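(* Let $\Omega\subset\mathbb{C}$ be a simply connected open domain, and let $u\in W^{1,1}(\Omega;\mathbb{C})$ be a homeomorphism (onto its image) with $\frac{\partial u}{\partial z}\in L^2_{loc}(\Omega)$. Let $v\in W^{1,2}(\Omega;\mathbb{C})$. Suppose that $u$ and $v$ both satisfy the Beltrami equation $$\frac{\partial u}{\partial\bar z}=\mu\frac{\partial u}{\partial z}\quad\text{and}\quad\frac{\partial v}{\partial\bar z}=\mu\frac{\partial v}{\partial z}\quad\text{for a.e. }z\in\Omega,$$ where $\mu:\Omega\to\mathbb{C}$ is a measurable function such that $|\mu(z)|<1$ a.e. and $$\int_\Omega\frac{1+|\mu(z)|}{1-|\mu(z)|}\,dz<\infty .$$ Then there exists a holomorphic function $\phi:u(\Omega)\to\mathbb{C}$ such that $v=\phi\circ u$.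
   Context: $\frac{\partial f}{\partial\bar z}=\frac12(\partial_x+i\partial_y)f$ and $\frac{\partial f}{\partial z}=\frac12(\partial_x-i\partial_y)f$ (weak derivatives), and $dz$ in the integral denotes two-dimensional Lebesgue measure. The equality $v=\phi\circ u$ is understood for Sobolev maps, i.e. up to the choice of representative of $v$. *)

theory Defs
  imports "HOL-Complex_Analysis.Complex_Analysis"
begin

text \<open>
  Elements of \<open>L\<^sup>p\<close> and Sobolev spaces are represented by functions on the whole plane; only the
  values on \<open>\<Omega>\<close> matter. All measures are the (completed) two-dimensional Lebesgue measure.
\<close>

definition Lp_space :: "real \<Rightarrow> complex set \<Rightarrow> (complex \<Rightarrow> complex) set" where
  "Lp_space p A = {f \<in> borel_measurable (lebesgue_on A).
     integrable (lebesgue_on A) (\<lambda>z. norm (f z) powr p)}"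

definition Lp_loc :: "real \<Rightarrow> complex set \<Rightarrow> (complex \<Rightarrow> complex) set" where
  "Lp_loc p \<Omega> = {f. \<forall>K. compact K \<and> K \<subseteq> \<Omega> \<longrightarrow> f \<in> Lp_space p K}"

text \<open>
  Smoothness is real smoothness on \<open>\<complex> = \<real>\<^sup>2\<close>: the directions \<open>1\<close> and \<open>\<i>\<close> give \<open>\<partial>\<^sub>x\<close> and \<open>\<partial>\<^sub>y\<close>.
\<close>

primrec times_cont_diff :: "nat \<Rightarrow> (complex \<Rightarrow> real) \<Rightarrow> bool" where
  "times_cont_diff 0 f \<longleftrightarrow> continuous_on UNIV f"
| "times_cont_diff (Suc k) f \<longleftrightarrow> (\<forall>z. f differentiable (at z)) \<and>
     (\<forall>e\<in>{1, \<i>}. times_cont_diff k (\<lambda>z. frechet_derivative f (at z) e))"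

definition test_functions :: "complex set \<Rightarrow> (complex \<Rightarrow> real) set" where
  "test_functions \<Omega> = {\<eta>. (\<forall>k. times_cont_diff k \<eta>) \<and>
     compact (closure {z. \<eta> z \<noteq> 0}) \<and> closure {z. \<eta> z \<noteq> 0} \<subseteq> \<Omega>}"

definition has_weak_partial ::
  "complex set \<Rightarrow> complex \<Rightarrow> (complex \<Rightarrow> complex) \<Rightarrow> (complex \<Rightarrow> complex) \<Rightarrow> bool" where
  "has_weak_partial \<Omega> e f g \<longleftrightarrow> f \<in> Lp_loc 1 \<Omega> \<and> g \<in> Lp_loc 1 \<Omega> \<and>
     (\<forall>\<eta>\<in>test_functions \<Omega>.
        (LINT z|lebesgue_on \<Omega>. frechet_derivative \<eta> (at z) e *\<^sub>R f z) =
        - (LINT z|lebesgue_on \<Omega>. \<eta> z *\<^sub>R g z))"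

text \<open>The space \<open>W\<^sup>1\<^sup>,\<^sup>p(\<Omega>; \<complex>)\<close>.\<close>

definition sobolev_W1 :: "real \<Rightarrow> complex set \<Rightarrow> (complex \<Rightarrow> complex) set" where
  "sobolev_W1 p \<Omega> = {f \<in> Lp_space p \<Omega>.
     \<forall>e\<in>{1, \<i>}. \<exists>g\<in>Lp_space p \<Omega>. has_weak_partial \<Omega> e f g}"

text \<open>
  On an open set a weak derivative is unique up to null sets, so the choice below fixes an arbitrary
  representative. It is meaningful whenever a weak derivative exists, in particular on \<open>sobolev_W1\<close>.
\<close>

definition weak_partial :: "complex set \<Rightarrow> complex \<Rightarrow> (complex \<Rightarrow> complex) \<Rightarrow> complex \<Rightarrow> complex" where
  "weak_partial \<Omega> e f = (SOME g. has_weak_partial \<Omega> e f g)"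

definition weak_dz :: "complex set \<Rightarrow> (complex \<Rightarrow> complex) \<Rightarrow> complex \<Rightarrow> complex" where
  "weak_dz \<Omega> f z = (weak_partial \<Omega> 1 f z - \<i> * weak_partial \<Omega> \<i> f z) / 2"

definition weak_dzbar :: "complex set \<Rightarrow> (complex \<Rightarrow> complex) \<Rightarrow> complex \<Rightarrow> complex" where
  "weak_dzbar \<Omega> f z = (weak_partial \<Omega> 1 f z + \<i> * weak_partial \<Omega> \<i> f z) / 2"

definition beltrami :: "complex set \<Rightarrow> (complex \<Rightarrow> complex) \<Rightarrow> (complex \<Rightarrow> complex) \<Rightarrow> bool" where
  "beltrami \<Omega> \<mu> f \<longleftrightarrow> (AE z in lebesgue_on \<Omega>. weak_dzbar \<Omega> f z = \<mu> z * weak_dz \<Omega> f z)"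

end

theory Submission
  imports Defs
begin

text \<open>
  Two solutions of the same Beltrami equation have parallel differentials:
  \<open>dv \<and> du = 0\<close> almost everywhere (\<open>beltrami_point_parallel\<close>). If the chain rule held for
  \<open>f = v \<circ> u\<inverse>\<close>, this would say that \<open>df \<and> d\<zeta> = 0\<close>, that is, that the derivative of \<open>f\<close> with respect
  to the conjugate variable vanishes. The difficulty is the chain rule: the Jacobian \<open>J\<close> of \<open>u\<close> is
  nonnegative, but it is not bounded away from zero, and \<open>v\<close> is only defined up to null sets. The
  integrability of the distortion \<open>(1 + |\<mu>|) / (1 - |\<mu>|)\<close> is what overcomes it.

  Since \<open>|\<mu>| < 1\<close>, the Beltrami equation bounds all of \<open>Du\<close> by \<open>\<partial>u/\<partial>z\<close>, so \<open>u\<close> is locally in \<open>W\<^sup>1\<^sup>,\<^sup>2\<close>,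
  with \<open>J \<ge> 0\<close>. Fix a closed rectangle in \<open>\<Omega>\<close>, with interior \<open>D\<close>.

  The area formula. Green's formula for mollifications of \<open>u\<close>, applied to a Cauchy kernel that is
  smoothed at scale \<open>r\<close>, expresses the integral of \<open>J\<close> against a bump around \<open>u z = c\<close> as the winding
  number of the image of the boundary about \<open>c\<close>, which is \<open>1\<close> up to sign by the Jordan curve theorem
  (\<open>degree_identity\<close>). Averaging over \<open>c\<close> and letting \<open>r\<close> tend to zero bounds the measure of an image
  by the integral of \<open>|J|\<close> (\<open>area_inequality\<close>), and shows for \<open>J \<ge> 0\<close> that \<open>u\<close> carries \<open>J dz\<close> on \<open>D\<close>
  to Lebesgue measure on \<open>u(D)\<close> (\<open>area_formula\<close>).

  The inverse. Green's formula for \<open>d(P \<cdot> (\<eta> \<circ> u)) \<and> du\<close>, with \<open>P\<close> smooth and \<open>\<eta>\<close> a test function on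
  \<open>u(D)\<close>, shows that the weak gradient of \<open>P \<circ> u\<inverse>\<close> is the one that the chain rule predicts
  (\<open>pullback_identity\<close>, \<open>weak_grad_compose_inverse\<close>). For \<open>P z = z\<close> the square integral is at most a multiple
  of the integral of the distortion, so \<open>u\<inverse>\<close> is again a homeomorphism in \<open>W\<^sup>1\<^sup>,\<^sup>2\<close> (\<open>weak_grad_inverse_L2\<close>). Its area
  inequality forces \<open>J > 0\<close> almost everywhere (\<open>jac_pos\<close>). Hence null sets correspond under \<open>u\<close>, and
  \<open>v \<circ> u\<inverse>\<close> is well defined up to null sets.

  The limit. For mollifications \<open>v\<^sub>n\<close> of \<open>v\<close>, the weak derivative of \<open>v\<^sub>n \<circ> u\<inverse>\<close> with respect to the
  conjugate variable is the transported form \<open>dv\<^sub>n \<and> du\<close> (\<open>integral_dbar_compose_inverse\<close>); as \<open>dv\<^sub>n\<close>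
  converges in \<open>L\<^sup>2\<close> and \<open>du\<close> lies in \<open>L\<^sup>2\<close>, it tends to \<open>dv \<and> du = 0\<close>. In the \<open>L\<^sup>1\<close> norm of the gradient of
  \<open>v\<^sub>n \<circ> u\<inverse>\<close> the Jacobian cancels (\<open>energy_inverse\<close>), so the Poincare inequality turns the convergence of
  \<open>dv\<^sub>n\<close> into \<open>L\<^sup>1\<close> convergence of \<open>v\<^sub>n \<circ> u\<inverse>\<close> to \<open>v \<circ> u\<inverse>\<close> up to constants. Weyl's lemma (\<open>weyl_dbar\<close>) then
  makes \<open>v \<circ> u\<inverse>\<close> holomorphic near each point of \<open>u(D)\<close> after a change on a null set
  (\<open>local_factorization\<close>), and the local factors fit together because two continuous functions that
  agree almost everywhere on an open set agree (\<open>patch_factorizations\<close>).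
\<close>

section \<open>Smooth functions\<close>

text \<open>
  Polynomials in \<open>1/t\<close> times \<open>exp (-1/t)\<close>: the smallest family that contains the classical flat function
  and is closed under the derivative.
\<close>
definition flat :: "real poly \<Rightarrow> real \<Rightarrow> real" where
  "flat p t = (if t > 0 then poly p (inverse t) * exp (- inverse t) else 0)"

text \<open>
  Smoothness is certified by construction. The class is closed under the derivative, so its members are
  infinitely differentiable. In the last clause the zeros of \<open>f\<close> to the left of \<open>1/4\<close> keep its support
  away from the pole of \<open>1/t\<close>.
\<close>
inductive smooth_line :: "(real \<Rightarrow> real) \<Rightarrow> bool" where
  const: "smooth_line (\<lambda>t. c)"
| ident: "smooth_line (\<lambda>t. t)"
| add: "smooth_line f \<Longrightarrow> smooth_line g \<Longrightarrow> smooth_line (\<lambda>t. f t + g t)"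
| mult: "smooth_line f \<Longrightarrow> smooth_line g \<Longrightarrow> smooth_line (\<lambda>t. f t * g t)"
| comp: "smooth_line f \<Longrightarrow> smooth_line g \<Longrightarrow> smooth_line (\<lambda>t. f (g t))"
| flat: "smooth_line (flat p)"
| divide: "smooth_line f \<Longrightarrow> (\<And>t. t < 1/4 \<Longrightarrow> f t = 0) \<Longrightarrow> smooth_line (\<lambda>t. f t / t)"

lemma poly_exp_tendsto_0: "((\<lambda>s::real. poly p s * exp (- s)) \<longlongrightarrow> 0) at_top"
proof -
  have "((\<lambda>s::real. (\<Sum>i\<le>degree p. coeff p i * (s ^ i / exp s))) \<longlongrightarrow> (\<Sum>i\<le>degree p. coeff p i * 0)) at_top"
    by (intro tendsto_sum tendsto_mult tendsto_const tendsto_power_div_exp_0)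
  moreover have "(\<Sum>i\<le>degree p. coeff p i * (s ^ i / exp s)) = poly p s * exp (- s)" for s :: real
    by (simp add: poly_altdef sum_distrib_right exp_minus divide_inverse mult.assoc)
  ultimately show ?thesis by simp
qed

text \<open>
  Away from \<open>0\<close> this is the product rule. At \<open>0\<close> the right difference quotient is again a polynomial in
  \<open>1/t\<close> times \<open>exp (-1/t)\<close>, and the exponential wins.
\<close>
lemma flat_DERIV: "(flat p has_real_derivative flat ([:0, 0, 1:] * (p - pderiv p)) t) (at t)"
proof (cases "t \<noteq> 0")
  case True
  consider "t > 0" | "t < 0" using True by linarith
  then show ?thesis
  proof cases
    case 1
    have "((\<lambda>t. poly p (inverse t) * exp (- inverse t)) has_real_derivative flat ([:0, 0, 1:] * (p - pderiv p)) t) (at t)"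
      using 1 by (auto intro!: derivative_eq_intros simp: flat_def power2_eq_square algebra_simps)
    then show ?thesis
      by (rule has_field_derivative_transform_within_open[where S="{0<..}"]) (use 1 in \<open>auto simp: flat_def\<close>)
  next
    case 2
    have "((\<lambda>t. 0) has_real_derivative flat ([:0, 0, 1:] * (p - pderiv p)) t) (at t)"
      using 2 by (auto simp: flat_def)
    then show ?thesis
      by (rule has_field_derivative_transform_within_open[where S="{..<0}"]) (use 2 in \<open>auto simp: flat_def\<close>)
  qed
next
  case False
  then have t: "t = 0" by simp
  have "((\<lambda>h. (flat p (0 + h) - flat p 0) / h) \<longlongrightarrow> 0) (at_right 0)"
  proof -
    have "((\<lambda>h. poly ([:0,1:] * p) (inverse h) * exp (- inverse h)) \<longlongrightarrow> 0) (at_right (0::real))"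
      using filterlim_compose[OF poly_exp_tendsto_0[of "[:0,1:] * p"] filterlim_inverse_at_top_right] by simp
    then show ?thesis
      by (rule Lim_transform_eventually) (auto simp: flat_def divide_inverse eventually_at_filter algebra_simps)
  qed
  moreover have "((\<lambda>h. (flat p (0 + h) - flat p 0) / h) \<longlongrightarrow> 0) (at_left 0)"
    by (rule Lim_transform_eventually[OF tendsto_const]) (auto simp: flat_def eventually_at_filter)
  ultimately have "((\<lambda>h. (flat p (0 + h) - flat p 0) / h) \<longlongrightarrow> 0) (at 0)"
    using filterlim_split_at by blast
  then show ?thesis by (simp add: t DERIV_def flat_def)
qed

lemma smooth_line_derivative:
  "smooth_line f \<Longrightarrow> \<exists>f'. smooth_line f' \<and> (\<forall>t. (f has_real_derivative f' t) (at t))"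
proof (induction rule: smooth_line.induct)
  case (const c)
  show ?case by (rule exI[of _ "\<lambda>_. 0"]) (auto intro: smooth_line.const)
next
  case ident
  show ?case by (rule exI[of _ "\<lambda>_. 1"]) (auto intro: smooth_line.const)
next
  case (add f g)
  then obtain f' g' where "smooth_line f'" "smooth_line g'"
    "\<forall>t. (f has_real_derivative f' t) (at t)" "\<forall>t. (g has_real_derivative g' t) (at t)" by blast
  then show ?case by (intro exI[of _ "\<lambda>t. f' t + g' t"]) (auto intro!: smooth_line.add derivative_intros)
next
  case (mult f g)
  then obtain f' g' where "smooth_line f'" "smooth_line g'"
    "\<forall>t. (f has_real_derivative f' t) (at t)" "\<forall>t. (g has_real_derivative g' t) (at t)" by blast
  then show ?case using mult by (intro exI[of _ "\<lambda>t. f t * g' t + f' t * g t"])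
     (auto intro!: smooth_line.add smooth_line.mult derivative_eq_intros)
next
  case (comp f g)
  then obtain f' g' where "smooth_line f'" "smooth_line g'"
    and *: "\<forall>t. (f has_real_derivative f' t) (at t)" "\<forall>t. (g has_real_derivative g' t) (at t)" by blast
  moreover have "((\<lambda>t. f (g t)) has_real_derivative f' (g t) * g' t) (at t)" for t
    using * DERIV_chain2 by blast
  ultimately show ?case using comp by (intro exI[of _ "\<lambda>t. f' (g t) * g' t"]) (auto intro!: smooth_line.mult smooth_line.comp[of f'])
next
  case (flat p)
  then show ?case using flat_DERIV smooth_line.flat by blast
next
  case (divide f)
  then obtain f' where f': "smooth_line f'" "\<And>t. (f has_real_derivative f' t) (at t)" by blast
  have f'0: "f' t = 0" if "t < 1/4" for t
  proof -
    have "((\<lambda>t. 0) has_real_derivative f' t) (at t)"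
      by (rule has_field_derivative_transform_within_open[OF f'(2), where S="{..<1/4}"])
         (use that divide in auto)
    from DERIV_unique[OF this DERIV_const] show ?thesis .
  qed
  have D: "((\<lambda>t. f t / t) has_real_derivative f' t / t + (-1) * (f t / t / t)) (at t)" for t
  proof (cases "t < 1/4")
    case True
    have "((\<lambda>t. 0) has_real_derivative f' t / t + (-1) * (f t / t / t)) (at t)"
      using True f'0 divide by simp
    then show ?thesis
      by (rule has_field_derivative_transform_within_open[where S="{..<1/4}"])
         (use True divide in auto)
  next
    case False
    then show ?thesis using f'(2)[of t]
      by (auto intro!: derivative_eq_intros simp: field_simps)
  qed
  have "smooth_line (\<lambda>t. f' t / t + (-1) * (f t / t / t))"
    using divide f'0 f' by (intro smooth_line.add smooth_line.mult smooth_line.divide smooth_line.const) auto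
  then show ?case using D by blast
qed

text \<open>
  The same certificate for real functions on the plane, with the two coordinates as generators.
\<close>
inductive smooth_plane :: "(complex \<Rightarrow> real) \<Rightarrow> bool" where
  const: "smooth_plane (\<lambda>z. c)"
| Re: "smooth_plane Re"
| Im: "smooth_plane Im"
| add: "smooth_plane f \<Longrightarrow> smooth_plane g \<Longrightarrow> smooth_plane (\<lambda>z. f z + g z)"
| mult: "smooth_plane f \<Longrightarrow> smooth_plane g \<Longrightarrow> smooth_plane (\<lambda>z. f z * g z)"
| comp: "smooth_line h \<Longrightarrow> smooth_plane f \<Longrightarrow> smooth_plane (\<lambda>z. h (f z))"

text \<open>
  The real-linear map with value \<open>p\<close> at \<open>1\<close> and \<open>q\<close> at \<open>\<i>\<close>: a Frechet derivative in terms of the two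
  partial derivatives.
\<close>
definition grad_map :: "'a::real_vector \<Rightarrow> 'a \<Rightarrow> complex \<Rightarrow> 'a" where
  "grad_map p q h = Re h *\<^sub>R p + Im h *\<^sub>R q"

lemma smooth_plane_derivative:
  "smooth_plane f \<Longrightarrow> \<exists>p q. smooth_plane p \<and> smooth_plane q \<and>
     (\<forall>z. (f has_derivative grad_map (p z) (q z)) (at z))"
proof (induction rule: smooth_plane.induct)
  case (const c)
  show ?case by (rule exI[of _ "\<lambda>_. 0"], rule exI[of _ "\<lambda>_. 0"])
    (auto intro!: smooth_plane.const derivative_eq_intros simp: grad_map_def fun_eq_iff)
next
  case Re
  show ?case by (rule exI[of _ "\<lambda>_. 1"], rule exI[of _ "\<lambda>_. 0"])
    (auto intro!: smooth_plane.const derivative_eq_intros simp: grad_map_def fun_eq_iff)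
next
  case Im
  show ?case by (rule exI[of _ "\<lambda>_. 0"], rule exI[of _ "\<lambda>_. 1"])
    (auto intro!: smooth_plane.const derivative_eq_intros simp: grad_map_def fun_eq_iff)
next
  case (add f g)
  then obtain p q p' q' where *: "smooth_plane p" "smooth_plane q" "smooth_plane p'" "smooth_plane q'"
    "\<And>z. (f has_derivative grad_map (p z) (q z)) (at z)"
    "\<And>z. (g has_derivative grad_map (p' z) (q' z)) (at z)" by blast
  have "((\<lambda>z. f z + g z) has_derivative grad_map (p z + p' z) (q z + q' z)) (at z)" for z
    by (rule has_derivative_eq_rhs[OF has_derivative_add[OF *(5,6)]])
      (simp add: grad_map_def fun_eq_iff algebra_simps)
  then show ?case using *
    by (intro exI[of _ "\<lambda>z. p z + p' z"] exI[of _ "\<lambda>z. q z + q' z"] conjI smooth_plane.add allI) auto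
next
  case (mult f g)
  then obtain p q p' q' where *: "smooth_plane p" "smooth_plane q" "smooth_plane p'" "smooth_plane q'"
    "\<And>z. (f has_derivative grad_map (p z) (q z)) (at z)"
    "\<And>z. (g has_derivative grad_map (p' z) (q' z)) (at z)" by blast
  have "((\<lambda>z. f z * g z) has_derivative grad_map (f z * p' z + p z * g z) (f z * q' z + q z * g z)) (at z)" for z
    by (rule has_derivative_eq_rhs[OF has_derivative_mult[OF *(5,6)]])
      (simp add: grad_map_def fun_eq_iff algebra_simps)
  then show ?case using * mult
    by (intro exI[of _ "\<lambda>z. f z * p' z + p z * g z"] exI[of _ "\<lambda>z. f z * q' z + q z * g z"]
        conjI smooth_plane.add smooth_plane.mult allI) auto
next
  case (comp h f)
  then obtain p q where *: "smooth_plane p" "smooth_plane q"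
    "\<And>z. (f has_derivative grad_map (p z) (q z)) (at z)" by blast
  obtain h' where h': "smooth_line h'" "\<And>t. (h has_real_derivative h' t) (at t)"
    using smooth_line_derivative[OF comp(1)] by blast
  have "((\<lambda>z. h (f z)) has_derivative grad_map (h' (f z) * p z) (h' (f z) * q z)) (at z)" for z
    using has_derivative_compose[OF *(3)[of z] h'(2)[of "f z", unfolded has_field_derivative_def]]
    by (rule has_derivative_eq_rhs) (auto simp: grad_map_def fun_eq_iff algebra_simps)
  then show ?case using * h' comp
    by (intro exI[of _ "\<lambda>z. h' (f z) * p z"] exI[of _ "\<lambda>z. h' (f z) * q z"]
        conjI smooth_plane.mult smooth_plane.comp[of h'] allI) auto
qed

lemma frechet_grad_map:
  fixes f :: "complex \<Rightarrow> real"
  assumes "(f has_derivative grad_map p q) (at z)"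
  shows "frechet_derivative f (at z) 1 = p" "frechet_derivative f (at z) \<i> = q"
  using frechet_derivative_at[OF assms] by (metis grad_map_def add.right_neutral add_0 imaginary_unit.sel one_complex.sel scale_one scale_zero_left)+

lemma smooth_plane_continuous: "smooth_plane f \<Longrightarrow> continuous_on S f"
  by (meson continuous_at_imp_continuous_on has_derivative_continuous smooth_plane_derivative)

lemma smooth_plane_times_cont_diff: "smooth_plane f \<Longrightarrow> times_cont_diff k f"
proof (induction k arbitrary: f)
  case 0
  then show ?case by (simp add: smooth_plane_continuous)
next
  case (Suc k)
  obtain p q where pq: "smooth_plane p" "smooth_plane q"
     "\<And>z. (f has_derivative grad_map (p z) (q z)) (at z)"
    using smooth_plane_derivative[OF Suc(2)] by blast
  then have "(\<lambda>z. frechet_derivative f (at z) 1) = p" "(\<lambda>z. frechet_derivative f (at z) \<i>) = q"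
    using frechet_grad_map by blast+
  moreover have "f differentiable (at z)" for z using pq(3) differentiable_def by blast
  ultimately show ?case using Suc pq by simp
qed

section \<open>A smooth radial kernel\<close>

text \<open>
  A smooth increasing step. For \<open>t \<le> 1/4\<close> the argument of the outer flat function is not positive; for
  \<open>t \<ge> 1\<close> the inner one vanishes, and the step has reached its final height. Starting at \<open>1/4\<close> rather than at
  \<open>0\<close> makes \<open>ramp t / t\<close> smooth.
\<close>
definition ramp :: "real \<Rightarrow> real" where
  "ramp t = flat 1 (flat 1 (3/4) - flat 1 (1 - t))"

lemma flat_1: "flat 1 t = (if t > 0 then exp (- inverse t) else 0)"
  by (simp add: flat_def)

lemma flat_1_mono: "s \<le> t \<Longrightarrow> flat 1 s \<le> flat 1 t"
  by (auto simp: flat_1 le_imp_inverse_le)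

lemma ramp_smooth: "smooth_line ramp"
proof -
  have "smooth_line (\<lambda>t. flat 1 (flat 1 (3/4) + (-1) * flat 1 (1 + (-1) * t)))"
    by (intro smooth_line.comp[OF smooth_line.flat] smooth_line.add smooth_line.mult smooth_line.const smooth_line.ident smooth_line.flat)
  then show ?thesis by (simp add: ramp_def[abs_def])
qed

lemma ramp_0: "t \<le> 1/4 \<Longrightarrow> ramp t = 0"
  using flat_1_mono[of "3/4" "1 - t"] by (simp add: ramp_def flat_def)

lemma ramp_const: "t \<ge> 1 \<Longrightarrow> ramp t = ramp 1"
  by (simp add: ramp_def flat_1)

lemma ramp_1_pos: "ramp 1 > 0"
  by (simp add: ramp_def flat_1)

lemma ramp_mono: "s \<le> t \<Longrightarrow> ramp s \<le> ramp t"
  unfolding ramp_def by (intro flat_1_mono diff_left_mono) simp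

definition ramp' :: "real \<Rightarrow> real" where "ramp' = (SOME f'. smooth_line f' \<and> (\<forall>t. (ramp has_real_derivative f' t) (at t)))"

lemma ramp'_smooth: "smooth_line ramp'" and ramp_DERIV: "(ramp has_real_derivative ramp' t) (at t)"
  using someI_ex[OF smooth_line_derivative[OF ramp_smooth]] unfolding ramp'_def by blast+

lemma ramp'_nonneg: "ramp' t \<ge> 0"
  using mono_on_imp_deriv_nonneg[of UNIV ramp "ramp' t" t] ramp_DERIV ramp_mono
  by (auto intro!: mono_onI)

definition has_grad :: "(complex \<Rightarrow> 'a::real_normed_vector) \<Rightarrow> (complex \<Rightarrow> 'a) \<Rightarrow> (complex \<Rightarrow> 'a) \<Rightarrow> bool" where
  "has_grad f p q \<longleftrightarrow> (\<forall>z. (f has_derivative grad_map (p z) (q z)) (at z)) \<and>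
     continuous_on UNIV p \<and> continuous_on UNIV q"

lemma has_gradI:
  assumes "\<And>z. (f has_derivative grad_map (p z) (q z)) (at z)" "continuous_on UNIV p" "continuous_on UNIV q"
  shows "has_grad f p q"
  using assms by (simp add: has_grad_def)

lemma has_gradD:
  assumes "has_grad f p q"
  shows "(f has_derivative grad_map (p z) (q z)) (at z within S)" "continuous_on S p" "continuous_on S q" "continuous_on S f"
proof -
  have *: "(f has_derivative grad_map (p z) (q z)) (at z within S)" for z S
    using assms unfolding has_grad_def by (auto intro: has_derivative_at_withinI)
  show "(f has_derivative grad_map (p z) (q z)) (at z within S)" "continuous_on S f"
    using * has_derivative_continuous_on[of S f "\<lambda>z. grad_map (p z) (q z)"] by blast+
  show "continuous_on S p" "continuous_on S q"
    using assms unfolding has_grad_def by (auto intro: continuous_on_subset)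
qed

lemma has_grad_cong:
  assumes "has_grad f p q" "\<And>z. f z = f' z" "\<And>z. p z = p' z" "\<And>z. q z = q' z"
  shows "has_grad f' p' q'"
  using assms by (metis ext)

lemma has_grad_const: "has_grad (\<lambda>z. c) (\<lambda>z. 0) (\<lambda>z. 0)"
  by (rule has_gradI) (auto intro!: derivative_eq_intros simp: grad_map_def fun_eq_iff)

lemma has_grad_id: "has_grad (\<lambda>z. z) (\<lambda>z. 1) (\<lambda>z. \<i>)"
  by (rule has_gradI) (auto intro!: derivative_eq_intros simp: grad_map_def fun_eq_iff complex_eq_iff)

lemma has_grad_add:
  assumes f: "has_grad f p q" and g: "has_grad g p' q'"
  shows "has_grad (\<lambda>z. f z + g z) (\<lambda>z. p z + p' z) (\<lambda>z. q z + q' z)"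
proof (rule has_gradI)
  show "((\<lambda>z. f z + g z) has_derivative grad_map (p z + p' z) (q z + q' z)) (at z)" for z
    by (rule has_derivative_eq_rhs[OF has_derivative_add[OF has_gradD(1)[OF f] has_gradD(1)[OF g]]])
      (simp add: grad_map_def fun_eq_iff algebra_simps)
qed (intro continuous_on_add has_gradD(2,3)[OF f] has_gradD(2,3)[OF g])+

lemma has_grad_mult:
  fixes f g :: "complex \<Rightarrow> 'a::real_normed_algebra"
  assumes f: "has_grad f p q" and g: "has_grad g p' q'"
  shows "has_grad (\<lambda>z. f z * g z) (\<lambda>z. f z * p' z + p z * g z) (\<lambda>z. f z * q' z + q z * g z)"
proof (rule has_gradI)
  show "((\<lambda>z. f z * g z) has_derivative grad_map (f z * p' z + p z * g z) (f z * q' z + q z * g z)) (at z)" for z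
    by (rule has_derivative_eq_rhs[OF has_derivative_mult[OF has_gradD(1)[OF f] has_gradD(1)[OF g]]])
      (simp add: grad_map_def fun_eq_iff algebra_simps)
qed (intro continuous_on_add continuous_on_mult has_gradD(2-4)[OF f] has_gradD(2-4)[OF g])+

lemma has_grad_linear:
  assumes f: "has_grad f p q" and T: "bounded_linear T"
  shows "has_grad (\<lambda>z. T (f z)) (\<lambda>z. T (p z)) (\<lambda>z. T (q z))"
proof -
  interpret T: bounded_linear T by fact
  show ?thesis
  proof (rule has_gradI)
    show "((\<lambda>z. T (f z)) has_derivative grad_map (T (p z)) (T (q z))) (at z)" for z
      by (rule has_derivative_eq_rhs[OF T.has_derivative[OF has_gradD(1)[OF f]]])
        (simp add: grad_map_def fun_eq_iff T.add T.scale)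
  qed (intro T.continuous_on has_gradD(2,3)[OF f])+
qed

lemma continuous_on_compose_UNIV:
  "continuous_on UNIV F \<Longrightarrow> continuous_on S f \<Longrightarrow> continuous_on S (\<lambda>z. F (f z))"
  by (rule continuous_on_compose2[of UNIV]) auto

lemma has_grad_compose:
  assumes F: "has_grad F Fx Fy" and f: "has_grad f p q"
  shows "has_grad (\<lambda>z. F (f z)) (\<lambda>z. grad_map (Fx (f z)) (Fy (f z)) (p z)) (\<lambda>z. grad_map (Fx (f z)) (Fy (f z)) (q z))"
proof (rule has_gradI)
  show "((\<lambda>z. F (f z)) has_derivative grad_map (grad_map (Fx (f z)) (Fy (f z)) (p z)) (grad_map (Fx (f z)) (Fy (f z)) (q z))) (at z)" for z
    by (rule has_derivative_eq_rhs[OF has_derivative_compose[OF has_gradD(1)[OF f] has_gradD(1)[OF F]]])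
      (simp add: grad_map_def fun_eq_iff algebra_simps)
  have c: "continuous_on UNIV (\<lambda>z. Fx (f z))" "continuous_on UNIV (\<lambda>z. Fy (f z))"
    by (rule continuous_on_compose_UNIV[OF _ has_gradD(4)[OF f]], rule has_gradD[OF F])+
  show "continuous_on UNIV (\<lambda>z. grad_map (Fx (f z)) (Fy (f z)) (p z))" "continuous_on UNIV (\<lambda>z. grad_map (Fx (f z)) (Fy (f z)) (q z))"
    unfolding grad_map_def
    by (intro continuous_on_add continuous_on_scaleR continuous_on_Re continuous_on_Im has_gradD(2,3)[OF f] c)+
qed

lemma smooth_plane_has_grad:
  "smooth_plane f \<Longrightarrow> \<exists>p q. smooth_plane p \<and> smooth_plane q \<and> has_grad f p q"
  using smooth_plane_derivative[of f] unfolding has_grad_def using smooth_plane_continuous by blast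

lemma ramp'_0: "t < 1/4 \<or> t > 1 \<Longrightarrow> ramp' t = 0"
proof (elim disjE)
  assume t: "t < 1/4"
  have "((\<lambda>t. 0) has_real_derivative ramp' t) (at t)"
    by (rule has_field_derivative_transform_within_open[OF ramp_DERIV, where S="{..<1/4}"])
       (use t ramp_0 in auto)
  from DERIV_unique[OF this DERIV_const] show ?thesis .
next
  assume t: "t > 1"
  have "((\<lambda>t. ramp 1) has_real_derivative ramp' t) (at t)"
    by (rule has_field_derivative_transform_within_open[OF ramp_DERIV, where S="{1<..}"])
       (use t in \<open>auto intro!: ramp_const\<close>)
  from DERIV_unique[OF this DERIV_const] show ?thesis .
qed

text \<open>
  A smooth probability density on the annulus \<open>r/2 \<le> |z| \<le> r\<close>. It is the derivative with respect to the
  conjugate variable of \<open>cauchy_kern r\<close>, a smooth function that agrees with the Cauchy kernel \<open>1/(\<pi> z)\<close>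
  for \<open>|z| \<ge> r\<close>. The factor \<open>stem r\<close> is real and radial; the quotient by \<open>|z|\<^sup>2\<close> in it causes no trouble
  at the origin, where \<open>ramp\<close> vanishes.
\<close>
definition kern :: "real \<Rightarrow> complex \<Rightarrow> real" where
  "kern r z = ramp' ((cmod z)\<^sup>2 / r\<^sup>2) / (pi * ramp 1 * r\<^sup>2)"

definition stem :: "real \<Rightarrow> complex \<Rightarrow> real" where
  "stem r z = ramp ((cmod z)\<^sup>2 / r\<^sup>2) / ((cmod z)\<^sup>2 / r\<^sup>2) / (pi * ramp 1 * r\<^sup>2)"

definition cauchy_kern :: "real \<Rightarrow> complex \<Rightarrow> complex" where
  "cauchy_kern r z = cnj z * of_real (stem r z)"

lemma kern_nonneg: "kern r z \<ge> 0"
  using ramp'_nonneg ramp_1_pos by (simp add: kern_def)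

lemma kern_support: "r > 0 \<Longrightarrow> kern r z \<noteq> 0 \<Longrightarrow> cmod z \<le> r"
  using ramp'_0[of "(cmod z)\<^sup>2 / r\<^sup>2"] power2_le_imp_le[of "cmod z" r]
  by (cases "(cmod z)\<^sup>2 / r\<^sup>2 > 1") (auto simp: kern_def not_less divide_le_eq)

lemma cauchy_kern_outside:
  fixes z :: complex
  assumes "r > 0" "cmod z \<ge> r"
  shows "cauchy_kern r z = 1 / (of_real pi * z)"
proof -
  have "ramp ((cmod z)\<^sup>2 / r\<^sup>2) = ramp 1" using assms power_mono[of r "cmod z" 2] by (intro ramp_const) simp
  then have "stem r z = 1 / (pi * (cmod z)\<^sup>2)" using ramp_1_pos assms by (simp add: stem_def)
  moreover have "of_real ((cmod z)\<^sup>2) = z * cnj z" using complex_norm_square[of z] by simp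
  moreover have "z \<noteq> 0" using assms by auto
  ultimately show ?thesis by (simp add: cauchy_kern_def)
qed

lemma cmod_sq: "(cmod z)\<^sup>2 = Re z * Re z + Im z * Im z"
  by (simp add: cmod_def power2_eq_square)

lemma smooth_plane_radial:
  assumes "smooth_line h" shows "smooth_plane (\<lambda>z. h ((cmod z)\<^sup>2))"
  unfolding cmod_sq
  by (rule smooth_plane.comp[OF assms]) (intro smooth_plane.add smooth_plane.mult smooth_plane.Re smooth_plane.Im)

text \<open>
  The derivative of the profile is returned as well, because second derivatives of radial functions are
  computed by a second application.
\<close>
lemma has_grad_radial:
  assumes "smooth_line h"
  shows "\<exists>h'. smooth_line h' \<and> (\<forall>t. (h has_real_derivative h' t) (at t)) \<and> has_grad (\<lambda>z. h ((cmod z)\<^sup>2)) (\<lambda>z. 2 * Re z * h' ((cmod z)\<^sup>2)) (\<lambda>z. 2 * Im z * h' ((cmod z)\<^sup>2))"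
proof -
  obtain h' where h': "smooth_line h'" "\<And>t. (h has_real_derivative h' t) (at t)"
    using smooth_line_derivative[OF assms] by blast
  have "((\<lambda>z. (cmod z)\<^sup>2) has_derivative grad_map (2 * Re z) (2 * Im z)) (at z)" for z
    unfolding cmod_sq by (auto intro!: derivative_eq_intros simp: grad_map_def fun_eq_iff)
  then have "((\<lambda>z. h ((cmod z)\<^sup>2)) has_derivative grad_map (2 * Re z * h' ((cmod z)\<^sup>2)) (2 * Im z * h' ((cmod z)\<^sup>2))) (at z)" for z
    by (rule has_derivative_eq_rhs[OF has_derivative_compose[OF _ h'(2)[unfolded has_field_derivative_def]]])
      (auto simp: grad_map_def fun_eq_iff algebra_simps)
  moreover have c: "continuous_on UNIV (\<lambda>z::complex. h' ((cmod z)\<^sup>2))"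
    using smooth_plane_continuous[OF smooth_plane_radial[OF h'(1)]] by simp
  ultimately have "has_grad (\<lambda>z. h ((cmod z)\<^sup>2)) (\<lambda>z. 2 * Re z * h' ((cmod z)\<^sup>2)) (\<lambda>z. 2 * Im z * h' ((cmod z)\<^sup>2))"
    by (intro has_gradI continuous_on_mult continuous_on_const continuous_on_Re continuous_on_Im continuous_on_id) auto
  then show ?thesis using h' by blast
qed

lemma smooth_plane_kern: "smooth_plane (kern r)"
proof -
  have "smooth_line (\<lambda>t. ramp' (inverse (r\<^sup>2) * t) * inverse (pi * ramp 1 * r\<^sup>2))"
    by (intro smooth_line.mult smooth_line.const smooth_line.comp[OF ramp'_smooth] smooth_line.ident)
  from smooth_plane_radial[OF this] show ?thesis by (simp add: kern_def[abs_def] field_simps)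
qed

lemma smooth_line_stem: "smooth_line (\<lambda>t. ramp (t / r\<^sup>2) / (t / r\<^sup>2) / (pi * ramp 1 * r\<^sup>2))"
proof -
  have 1: "smooth_line (\<lambda>t. ramp t / t)" by (rule smooth_line.divide[OF ramp_smooth]) (simp add: ramp_0)
  have "smooth_line (\<lambda>t. (\<lambda>t. ramp t / t) (inverse (r\<^sup>2) * t) * inverse (pi * ramp 1 * r\<^sup>2))"
    by (intro smooth_line.mult smooth_line.const smooth_line.comp[OF 1] smooth_line.ident)
  moreover have "(\<lambda>t. (\<lambda>t. ramp t / t) (inverse (r\<^sup>2) * t) * inverse (pi * ramp 1 * r\<^sup>2)) =
     (\<lambda>t. ramp (t / r\<^sup>2) / (t / r\<^sup>2) / (pi * ramp 1 * r\<^sup>2))"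
    by (simp add: divide_inverse mult.commute mult.assoc mult.left_commute)
  ultimately show ?thesis by simp
qed

lemma smooth_plane_stem: "smooth_plane (stem r)"
  using smooth_plane_radial[OF smooth_line_stem] by (simp add: stem_def[abs_def])

text \<open>
  Put \<open>t = |z|\<^sup>2\<close> and \<open>stem r z = S t\<close>. The derivative of \<open>cnj z \<cdot> S t\<close> with respect to the conjugate
  variable is \<open>S t + t S' t = (t S t)'\<close>, and \<open>t S t\<close> is a multiple of \<open>ramp (t / r\<^sup>2)\<close>. This is why the
  mollifier is built from the derivative of the step.
\<close>
lemma has_grad_cauchy_kern:
  assumes "r > 0"
  shows "\<exists>p q. has_grad (cauchy_kern r) p q \<and> (\<forall>z. p z + \<i> * q z = 2 * of_real (kern r z))"
proof -
  define S where "S = (\<lambda>t. ramp (t / r\<^sup>2) / (t / r\<^sup>2) / (pi * ramp 1 * r\<^sup>2))"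
  have stem_S: "stem r = (\<lambda>z. S ((cmod z)\<^sup>2))" by (simp only: stem_def[abs_def] S_def)
  have sS: "smooth_line S" using smooth_line_stem by (simp only: S_def)
  obtain S' where S': "smooth_line S'" and dS: "\<And>t. (S has_real_derivative S' t) (at t)"
    and gS: "has_grad (\<lambda>z. S ((cmod z)\<^sup>2)) (\<lambda>z. 2 * Re z * S' ((cmod z)\<^sup>2)) (\<lambda>z. 2 * Im z * S' ((cmod z)\<^sup>2))"
    using has_grad_radial[OF sS] by blast
  have tS: "S t + t * S' t = ramp' (t / r\<^sup>2) / (pi * ramp 1 * r\<^sup>2)" for t
  proof -
    have "((\<lambda>t. t * S t) has_real_derivative S t + t * S' t) (at t)"
      by (auto intro!: derivative_eq_intros dS)
    moreover have "(\<lambda>t. t * S t) = (\<lambda>t. ramp (t / r\<^sup>2) / (pi * ramp 1))"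
      using assms ramp_1_pos by (auto simp: S_def fun_eq_iff field_simps ramp_0)
    moreover have "((\<lambda>t. ramp (t / r\<^sup>2) / (pi * ramp 1)) has_real_derivative ramp' (t / r\<^sup>2) * (1 / r\<^sup>2) / (pi * ramp 1)) (at t)"
      by (intro DERIV_cdivide DERIV_chain2[OF ramp_DERIV]) (auto intro!: derivative_eq_intros)
    ultimately show ?thesis using DERIV_unique by fastforce
  qed
  from has_grad_mult[OF has_grad_linear[OF has_grad_id bounded_linear_cnj] has_grad_linear[OF gS[folded stem_S] bounded_linear_of_real]]
  have "has_grad (cauchy_kern r)
      (\<lambda>z. cnj z * complex_of_real (2 * Re z * S' ((cmod z)\<^sup>2)) + cnj 1 * complex_of_real (stem r z))
      (\<lambda>z. cnj z * complex_of_real (2 * Im z * S' ((cmod z)\<^sup>2)) + cnj \<i> * complex_of_real (stem r z))"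
    by (simp add: cauchy_kern_def[abs_def])
  moreover have "cnj z * complex_of_real (2 * Re z * S' ((cmod z)\<^sup>2)) + cnj 1 * complex_of_real (stem r z) +
     \<i> * (cnj z * complex_of_real (2 * Im z * S' ((cmod z)\<^sup>2)) + cnj \<i> * complex_of_real (stem r z)) = 2 * of_real (kern r z)" for z
  proof -
    have "kern r z = stem r z + (cmod z)\<^sup>2 * S' ((cmod z)\<^sup>2)"
      using tS[of "(cmod z)\<^sup>2"] by (simp add: kern_def stem_def S_def)
    then show ?thesis by (simp add: complex_eq_iff cmod_sq algebra_simps)
  qed
  ultimately show ?thesis by blast
qed

section \<open>Green's formula on rectangles\<close>

lemma measurable_Complex[measurable]: "(\<lambda>(x, y). Complex x y) \<in> borel_measurable (borel :: (real \<times> real) measure)"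
  unfolding Complex_eq case_prod_unfold by (intro borel_measurable_continuous_onI continuous_intros)

lemma lborel_complex: "(lborel :: complex measure) = distr (lborel :: (real \<times> real) measure) borel (\<lambda>(x, y). Complex x y)"
proof (rule lborel_eqI)
  fix l u :: complex assume "\<And>b. b \<in> Basis \<Longrightarrow> l \<bullet> b \<le> u \<bullet> b"
  from this[of 1] this[of \<i>] have le: "Re l \<le> Re u" "Im l \<le> Im u" by (simp_all add: Basis_complex_def inner_complex_def)
  have "(\<lambda>(x, y). Complex x y) -` box l u = box (Re l, Im l) (Re u, Im u)"
    by (auto simp: in_box_complex_iff mem_box Basis_prod_def)
  then have "emeasure (distr lborel borel (\<lambda>(x, y). Complex x y)) (box l u) = emeasure lborel (box (Re l, Im l) (Re u, Im u))"
    by (subst emeasure_distr) auto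
  also have "\<dots> = (Re u - Re l) * (Im u - Im l)"
    using le by (subst emeasure_lborel_box) (auto simp: Basis_prod_def Basis_complex_def inner_complex_def)
  finally show "emeasure (distr lborel borel (\<lambda>(x, y). Complex x y)) (box l u) = (\<Prod>b\<in>Basis. (u - l) \<bullet> b)"
    by (simp add: Basis_complex_def inner_complex_def)
qed simp

lemma integral_cbox_complex:
  fixes f :: "complex \<Rightarrow> complex"
  assumes f: "continuous_on UNIV f"
  shows "(LINT z:cbox a b|lborel. f z) = integral {Re a..Re b} (\<lambda>x. integral {Im a..Im b} (\<lambda>y. f (Complex x y)))"
    and "(LINT z:cbox a b|lborel. f z) = integral {Im a..Im b} (\<lambda>y. integral {Re a..Re b} (\<lambda>x. f (Complex x y)))"
proof -
  have [measurable]: "f \<in> borel_measurable borel" using f by (rule borel_measurable_continuous_onI)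
  let ?g = "\<lambda>(x, y). f (Complex x y)"
  have cg: "continuous_on S ?g" for S
    unfolding Complex_eq case_prod_unfold by (intro continuous_on_compose2[OF f] continuous_intros) auto
  have ind: "indicator (cbox a b) (case p of (x, y) \<Rightarrow> Complex x y) = (indicator (cbox (Re a, Im a) (Re b, Im b)) p :: real)" for p
    by (cases p) (simp add: in_cbox_complex_iff cbox_Pair_eq indicator_def)
  have "(LINT z:cbox a b|lborel. f z) = (LINT p|lborel. indicator (cbox a b) (case p of (x, y) \<Rightarrow> Complex x y) *\<^sub>R f (case p of (x, y) \<Rightarrow> Complex x y))"
    unfolding set_lebesgue_integral_def
    by (subst lborel_complex, subst integral_distr) auto
  also have "\<dots> = (LINT p:cbox (Re a, Im a) (Re b, Im b)|lborel. ?g p)"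
    unfolding set_lebesgue_integral_def ind by (simp add: case_prod_unfold)
  also have "\<dots> = integral (cbox (Re a, Im a) (Re b, Im b)) ?g"
    by (intro set_borel_integral_eq_integral(2)) (simp add: set_integrable_def borel_integrable_compact cg)
  finally have *: "(LINT z:cbox a b|lborel. f z) = integral (cbox (Re a, Im a) (Re b, Im b)) ?g" .
  show "(LINT z:cbox a b|lborel. f z) = integral {Re a..Re b} (\<lambda>x. integral {Im a..Im b} (\<lambda>y. f (Complex x y)))"
    unfolding * using integral_prod_continuous[OF cg, of "Re a" "Im a" "Re b" "Im b"] by simp
  also have "\<dots> = integral {Im a..Im b} (\<lambda>y. integral {Re a..Re b} (\<lambda>x. f (Complex x y)))"
    using integral_swap_continuous[of "Re a" "Im a" "Re b" "Im b" "\<lambda>x y. f (Complex x y)"] cg by simp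
  finally show "(LINT z:cbox a b|lborel. f z) = integral {Im a..Im b} (\<lambda>y. integral {Re a..Re b} (\<lambda>x. f (Complex x y)))" .
qed

lemma has_grad_along:
  assumes "has_grad f p q"
  shows "((\<lambda>x. f (Complex x y)) has_vector_derivative p (Complex x y)) (at x within S)"
    and "((\<lambda>y. f (Complex x y)) has_vector_derivative q (Complex x y)) (at y within S)"
proof -
  have 1: "((\<lambda>x. Complex x y) has_derivative (\<lambda>h. of_real h)) (at x within S)" 
    unfolding Complex_eq by (auto intro!: derivative_eq_intros)
  have 2: "((\<lambda>y. Complex x y) has_derivative (\<lambda>h. \<i> * of_real h)) (at y within S)"
    unfolding Complex_eq by (auto intro!: derivative_eq_intros)
  show "((\<lambda>x. f (Complex x y)) has_vector_derivative p (Complex x y)) (at x within S)"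
    unfolding has_vector_derivative_def
    by (rule has_derivative_eq_rhs[OF has_derivative_compose[OF 1 has_gradD(1)[OF assms]]]) (simp add: grad_map_def fun_eq_iff)
  show "((\<lambda>y. f (Complex x y)) has_vector_derivative q (Complex x y)) (at y within S)"
    unfolding has_vector_derivative_def
    by (rule has_derivative_eq_rhs[OF has_derivative_compose[OF 2 has_gradD(1)[OF assms]]]) (simp add: grad_map_def fun_eq_iff)
qed

lemma continuous_on_Complex:
  assumes "continuous_on UNIV f"
  shows "continuous_on S (\<lambda>x. f (Complex x y))" "continuous_on S (\<lambda>y. f (Complex x y))"
  unfolding Complex_eq by (intro continuous_on_compose2[OF assms] continuous_intros; simp)+

lemma integral_partial_rectangle:
  fixes f :: "complex \<Rightarrow> complex"
  assumes f: "has_grad f p q" and ab: "Re a \<le> Re b" "Im a \<le> Im b"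
  shows "(LINT z:cbox a b|lborel. p z) = integral {Im a..Im b} (\<lambda>y. f (Complex (Re b) y) - f (Complex (Re a) y))"
    and "(LINT z:cbox a b|lborel. q z) = integral {Re a..Re b} (\<lambda>x. f (Complex x (Im b)) - f (Complex x (Im a)))"
proof -
  have "integral {Re a..Re b} (\<lambda>x. p (Complex x y)) = f (Complex (Re b) y) - f (Complex (Re a) y)" for y
    by (intro integral_unique fundamental_theorem_of_calculus ab has_grad_along[OF f])
  then show "(LINT z:cbox a b|lborel. p z) = integral {Im a..Im b} (\<lambda>y. f (Complex (Re b) y) - f (Complex (Re a) y))"
    by (simp add: integral_cbox_complex(2) has_gradD[OF f])
  have "integral {Im a..Im b} (\<lambda>y. q (Complex x y)) = f (Complex x (Im b)) - f (Complex x (Im a))" for x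
    by (intro integral_unique fundamental_theorem_of_calculus ab has_grad_along[OF f])
  then show "(LINT z:cbox a b|lborel. q z) = integral {Re a..Re b} (\<lambda>x. f (Complex x (Im b)) - f (Complex x (Im a)))"
    by (simp add: integral_cbox_complex(1) has_gradD[OF f])
qed

text \<open>
  Twice continuously differentiable, with the symmetry of the mixed derivatives built in: one function
  \<open>m\<close> serves for both. This is the form in which Green's formula uses it.
\<close>
definition C2_map :: "(complex \<Rightarrow> complex) \<Rightarrow> (complex \<Rightarrow> complex) \<Rightarrow> (complex \<Rightarrow> complex) \<Rightarrow> bool" where
  "C2_map f p q \<longleftrightarrow> has_grad f p q \<and> (\<exists>pp m qq. has_grad p pp m \<and> has_grad q m qq)"

lemma set_integrable_continuous_cbox:
  fixes f :: "complex \<Rightarrow> 'a::{banach, second_countable_topology}"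
  assumes "continuous_on UNIV f" shows "set_integrable lborel (cbox a b) f"
  unfolding set_integrable_def using assms 
  by (intro borel_integrable_compact) (auto intro: continuous_on_subset)

text \<open>
  The form \<open>dP \<and> dq\<close> is the differential of \<open>P dq\<close>: in the curl of \<open>(P \<cdot> qx, P \<cdot> qy)\<close> the two terms
  with second derivatives of \<open>q\<close> cancel.
\<close>
theorem green_rectangle:
  assumes P: "has_grad P Px Py" and q: "C2_map q qx qy" and ab: "Re a \<le> Re b" "Im a \<le> Im b"
  shows "(LINT z:cbox a b|lborel. Px z * qy z - Py z * qx z) =
     integral {Im a..Im b} (\<lambda>y. P (Complex (Re b) y) * qy (Complex (Re b) y) - P (Complex (Re a) y) * qy (Complex (Re a) y))
   - integral {Re a..Re b} (\<lambda>x. P (Complex x (Im b)) * qx (Complex x (Im b)) - P (Complex x (Im a)) * qx (Complex x (Im a)))"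
proof -
  obtain pp m qq where m: "has_grad qx pp m" "has_grad qy m qq" using q by (auto simp: C2_map_def)
  have 1: "has_grad (\<lambda>z. P z * qy z) (\<lambda>z. P z * m z + Px z * qy z) (\<lambda>z. P z * qq z + Py z * qy z)"
    by (rule has_grad_mult[OF P m(2)])
  have 2: "has_grad (\<lambda>z. P z * qx z) (\<lambda>z. P z * pp z + Px z * qx z) (\<lambda>z. P z * m z + Py z * qx z)"
    by (rule has_grad_mult[OF P m(1)])
  have "(LINT z:cbox a b|lborel. Px z * qy z - Py z * qx z) = 
     (LINT z:cbox a b|lborel. (P z * m z + Px z * qy z) - (P z * m z + Py z * qx z))"
    by (rule arg_cong[where f="set_lebesgue_integral lborel (cbox a b)"]) (simp add: fun_eq_iff)
  also have "\<dots> = (LINT z:cbox a b|lborel. P z * m z + Px z * qy z) - (LINT z:cbox a b|lborel. P z * m z + Py z * qx z)"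
    by (intro set_integral_diff set_integrable_continuous_cbox has_gradD[OF 1] has_gradD[OF 2])
  finally show ?thesis
    by (simp only: integral_partial_rectangle(1)[OF 1 ab] integral_partial_rectangle(2)[OF 2 ab])
qed

lemma has_grad_along_linepath:
  assumes "has_grad q qx qy"
  shows "((q \<circ> linepath A B) has_vector_derivative grad_map (qx (linepath A B t)) (qy (linepath A B t)) (B - A)) (at t within S)"
  unfolding o_def has_vector_derivative_def
  by (rule has_derivative_eq_rhs[OF has_derivative_compose[OF
        has_vector_derivative_linepath_within[unfolded has_vector_derivative_def] has_gradD(1)[OF assms]]])
    (simp add: grad_map_def fun_eq_iff scaleR_add_right)

lemma valid_path_image_linepath:
  assumes "has_grad q qx qy"
  shows "valid_path (q \<circ> linepath A B)"
proof -
  have c: "continuous_on S (linepath A B)" for S by (rule continuous_on_linepath)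
  have "continuous_on {0..1} (\<lambda>t. grad_map (qx (linepath A B t)) (qy (linepath A B t)) (B - A))"
    unfolding grad_map_def
    by (intro continuous_on_add continuous_on_scaleR continuous_on_const
         continuous_on_compose_UNIV[OF has_gradD(2)[OF assms] c] continuous_on_compose_UNIV[OF has_gradD(3)[OF assms] c])
  then have "(q \<circ> linepath A B) C1_differentiable_on {0..1}"
    unfolding C1_differentiable_on_def
    by (intro exI[of _ "\<lambda>t. grad_map (qx (linepath A B t)) (qy (linepath A B t)) (B - A)"])
      (simp add: has_grad_along_linepath[OF assms])
  then show ?thesis by (simp add: valid_path_def C1_differentiable_imp_piecewise)
qed

text \<open>
  Substituting the affine parametrization of the side; \<open>P\<close> only has to be of the form \<open>G \<circ> q\<close> on the
  side itself.
\<close>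
lemma contour_integral_image_side:
  assumes q: "has_grad q qx qy" and P: "continuous_on UNIV P" and le: "x0 \<le> x1"
  shows "(\<And>x. x \<in> {x0..x1} \<Longrightarrow> G (q (Complex x y)) = P (Complex x y)) \<Longrightarrow>
     (G has_contour_integral integral {x0..x1} (\<lambda>x. P (Complex x y) * qx (Complex x y))) (q \<circ> linepath (Complex x0 y) (Complex x1 y))"
    and "(\<And>x. x \<in> {x0..x1} \<Longrightarrow> G (q (Complex y x)) = P (Complex y x)) \<Longrightarrow>
     (G has_contour_integral integral {x0..x1} (\<lambda>x. P (Complex y x) * qy (Complex y x))) (q \<circ> linepath (Complex y x0) (Complex y x1))"
proof -
  define g where "g t = x0 + t * (x1 - x0)" for t
  have gin: "g t \<in> {x0..x1}" if "t \<in> {0..1}" for t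
  proof -
    have "t * (x1 - x0) \<le> 1 * (x1 - x0)" using that le by (intro mult_right_mono) auto
    moreover have "0 \<le> t * (x1 - x0)" using that le by auto
    ultimately show ?thesis by (simp add: g_def)
  qed
  have sub: "((\<lambda>t. (x1 - x0) *\<^sub>R F (g t)) has_integral integral {g 0..g 1} F) {0..1}" if "continuous_on {x0..x1} F" for F :: "real \<Rightarrow> complex"
    by (rule has_integral_substitution[OF _ _ _ that]) (auto simp: g_def le intro!: derivative_eq_intros dest: gin[unfolded g_def])
  have vd: "vector_derivative (q \<circ> linepath A B) (at t within {0..1}) = grad_map (qx (linepath A B t)) (qy (linepath A B t)) (B - A)" 
    if "t \<in> {0..1}" for A B t
    using that by (intro vector_derivative_within_cbox[of 0 1, simplified] has_grad_along_linepath[OF q]) auto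
  {
    assume G: "\<And>x. x \<in> {x0..x1} \<Longrightarrow> G (q (Complex x y)) = P (Complex x y)"
    have G': "G (q (Complex (g t) y)) = P (Complex (g t) y)" if "t \<in> {0..1}" for t
      by (rule G[OF gin[OF that]])
    have lp: "linepath (Complex x0 y) (Complex x1 y) t = Complex (g t) y" for t
      by (simp add: linepath_def complex_eq_iff g_def algebra_simps)
    have "continuous_on {x0..x1} (\<lambda>x. P (Complex x y) * qx (Complex x y))"
      by (intro continuous_on_mult continuous_on_Complex P has_gradD[OF q])
    from sub[OF this] show "(G has_contour_integral integral {x0..x1} (\<lambda>x. P (Complex x y) * qx (Complex x y))) (q \<circ> linepath (Complex x0 y) (Complex x1 y))"
      unfolding has_contour_integral_def
      by (rule has_integral_eq_rhs[OF has_integral_eq[rotated]])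
        (auto simp: vd lp G' grad_map_def g_def[of 0] g_def[of 1] scaleR_conv_of_real)
  }
  {
    assume G: "\<And>x. x \<in> {x0..x1} \<Longrightarrow> G (q (Complex y x)) = P (Complex y x)"
    have G': "G (q (Complex y (g t))) = P (Complex y (g t))" if "t \<in> {0..1}" for t
      by (rule G[OF gin[OF that]])
    have lp: "linepath (Complex y x0) (Complex y x1) t = Complex y (g t)" for t
      by (simp add: linepath_def complex_eq_iff g_def algebra_simps)
    have "continuous_on {x0..x1} (\<lambda>x. P (Complex y x) * qy (Complex y x))"
      by (intro continuous_on_mult continuous_on_Complex P has_gradD[OF q])
    from sub[OF this] show "(G has_contour_integral integral {x0..x1} (\<lambda>x. P (Complex y x) * qy (Complex y x))) (q \<circ> linepath (Complex y x0) (Complex y x1))"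
      unfolding has_contour_integral_def
      by (rule has_integral_eq_rhs[OF has_integral_eq[rotated]])
        (auto simp: vd lp G' grad_map_def g_def[of 0] g_def[of 1] scaleR_conv_of_real)
  }
qed

lemma valid_path_image_rectpath:
  assumes q: "has_grad q qx qy"
  shows "valid_path (q \<circ> rectpath a b)"
  unfolding rectpath_def Let_def path_compose_join
  by (intro valid_path_join valid_path_image_linepath[OF q])
    (auto simp: pathstart_compose pathfinish_compose)

text \<open>
  The boundary term \<open>\<integral> P dq\<close> of Green's formula is a contour integral over the image of the boundary as soon as
  \<open>P\<close> factors through \<open>q\<close> there. Since nothing is asked of \<open>G\<close> inside, \<open>G\<close> may have a pole at a point
  that \<open>q\<close> takes in the interior.
\<close>
theorem green_contour:
  assumes P: "has_grad P Px Py" and q: "C2_map q qx qy" and ab: "Re a \<le> Re b" "Im a \<le> Im b"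
    and G: "\<And>z. z \<in> cbox a b - box a b \<Longrightarrow> G (q z) = P z"
  shows "(LINT z:cbox a b|lborel. Px z * qy z - Py z * qx z) = contour_integral (q \<circ> rectpath a b) G"
proof -
  have q': "has_grad q qx qy" using q by (simp add: C2_map_def)
  have P': "continuous_on UNIV P" by (rule has_gradD[OF P])
  define s where "s A B = q \<circ> linepath A B" for A B
  have v: "valid_path (s A B)" for A B unfolding s_def by (rule valid_path_image_linepath[OF q'])
  let ?b = "\<lambda>x. integral {Re a..Re b} (\<lambda>y. P (Complex y x) * qx (Complex y x))"
  let ?s = "\<lambda>x. integral {Im a..Im b} (\<lambda>y. P (Complex x y) * qy (Complex x y))"
  have 1: "(G has_contour_integral ?b (Im a)) (s a (Complex (Re b) (Im a)))"
    unfolding s_def using contour_integral_image_side(1)[OF q' P' ab(1), of G "Im a"] G ab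
    by (auto simp: in_cbox_complex_iff in_box_complex_iff)
  have 2: "(G has_contour_integral ?s (Re b)) (s (Complex (Re b) (Im a)) b)"
    unfolding s_def using contour_integral_image_side(2)[OF q' P' ab(2), of G "Re b"] G ab
    by (auto simp: in_cbox_complex_iff in_box_complex_iff)
  have "(G has_contour_integral ?b (Im b)) (s (Complex (Re a) (Im b)) b)"
    unfolding s_def using contour_integral_image_side(1)[OF q' P' ab(1), of G "Im b"] G ab
    by (auto simp: in_cbox_complex_iff in_box_complex_iff)
  from has_contour_integral_reversepath[OF v this]
  have 3: "(G has_contour_integral - ?b (Im b)) (s b (Complex (Re a) (Im b)))"
    by (simp add: s_def reversepath_o[symmetric] o_assoc[symmetric] reversepath_def o_def linepath_def algebra_simps)
  have "(G has_contour_integral ?s (Re a)) (s a (Complex (Re a) (Im b)))"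
    unfolding s_def using contour_integral_image_side(2)[OF q' P' ab(2), of G "Re a"] G ab
    by (auto simp: in_cbox_complex_iff in_box_complex_iff)
  from has_contour_integral_reversepath[OF v this]
  have 4: "(G has_contour_integral - ?s (Re a)) (s (Complex (Re a) (Im b)) a)"
    by (simp add: s_def reversepath_o[symmetric] o_assoc[symmetric] reversepath_def o_def linepath_def algebra_simps)
  have e: "pathstart (s A B) = q A" "pathfinish (s A B) = q B" for A B
    by (simp_all add: s_def pathstart_compose pathfinish_compose)
  have "(G has_contour_integral (?b (Im a) + (?s (Re b) + (- ?b (Im b) + - ?s (Re a))))) (q \<circ> rectpath a b)"
    unfolding rectpath_def Let_def path_compose_join s_def[symmetric]
    by (intro has_contour_integral_join 1 2 3 4 valid_path_join v) (simp_all add: e)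
  then have "contour_integral (q \<circ> rectpath a b) G = ?b (Im a) + (?s (Re b) + (- ?b (Im b) + - ?s (Re a)))"
    by (rule contour_integral_unique)
  also have "\<dots> = (LINT z:cbox a b|lborel. Px z * qy z - Py z * qx z)"
  proof -
    have i: "(\<lambda>y. P (Complex y x) * qx (Complex y x)) integrable_on {Re a..Re b}"
         "(\<lambda>y. P (Complex x y) * qy (Complex x y)) integrable_on {Im a..Im b}" for x
      by (intro integrable_continuous_real continuous_on_mult continuous_on_Complex P' has_gradD[OF q'])+
    show ?thesis unfolding green_rectangle[OF P q ab] by (simp add: integral_diff i)
  qed
  finally show ?thesis by simp
qed

text \<open>
  The degree formula for a smooth map. The integrand is the pullback under \<open>q\<close> of
  \<open>kern r (\<zeta> - c) d(cnj \<zeta>) \<and> d\<zeta>\<close>, which is the differential of \<open>cauchy_kern r (\<zeta> - c) d\<zeta>\<close>. On the image of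
  the boundary this is the Cauchy kernel, whose contour integral is the winding number.
\<close>
lemma integral_radial_kern_compose:
  assumes q: "C2_map q qx qy" and ab: "Re a \<le> Re b" "Im a \<le> Im b" and r: "r > 0"
    and far: "\<And>z. z \<in> cbox a b - box a b \<Longrightarrow> cmod (q z - c) \<ge> r"
  shows "(LINT z:cbox a b|lborel. of_real (kern r (q z - c)) * (cnj (qx z) * qy z - cnj (qy z) * qx z)) =
     2 * \<i> * winding_number (q \<circ> rectpath a b) c"
proof -
  have q': "has_grad q qx qy" using q by (simp add: C2_map_def)
  obtain Gx Gy where G: "has_grad (cauchy_kern r) Gx Gy" "\<And>z. Gx z + \<i> * Gy z = 2 * of_real (kern r z)"
    using has_grad_cauchy_kern[OF r] by blast
  have qc: "has_grad (\<lambda>z. q z - c) qx qy"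
    using has_grad_add[OF q' has_grad_const[of "-c"]] by simp
  define X where "X z = Gx (q z - c)" for z
  define Y where "Y z = Gy (q z - c)" for z
  have P: "has_grad (\<lambda>z. cauchy_kern r (q z - c)) (\<lambda>z. grad_map (X z) (Y z) (qx z)) (\<lambda>z. grad_map (X z) (Y z) (qy z))"
    unfolding X_def Y_def by (rule has_grad_compose[OF G(1) qc])
  have XY: "X z = 2 * of_real (kern r (q z - c)) - \<i> * Y z" for z
    using G(2)[of "q z - c"] by (simp add: X_def Y_def algebra_simps)
  have w: "grad_map (X z) (Y z) (qx z) * qy z - grad_map (X z) (Y z) (qy z) * qx z =
     of_real (kern r (q z - c)) * (cnj (qx z) * qy z - cnj (qy z) * qx z)" for z
    unfolding XY grad_map_def scaleR_conv_of_real by (simp add: complex_eq_iff algebra_simps)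
  have "(LINT z:cbox a b|lborel. of_real (kern r (q z - c)) * (cnj (qx z) * qy z - cnj (qy z) * qx z)) =
     contour_integral (q \<circ> rectpath a b) (\<lambda>\<zeta>. 1 / (of_real pi * (\<zeta> - c)))"
    using green_contour[OF P q ab, of "\<lambda>\<zeta>. 1 / (of_real pi * (\<zeta> - c))"] cauchy_kern_outside[OF r far]
    by (simp add: w)
  also have "\<dots> = contour_integral (q \<circ> rectpath a b) (\<lambda>\<zeta>. (1 / of_real pi) * (1 / (\<zeta> - c)))" by simp
  also have "\<dots> = (1 / of_real pi) * contour_integral (q \<circ> rectpath a b) (\<lambda>\<zeta>. 1 / (\<zeta> - c))"
    by (rule contour_integral_lmul)
      (use far r ab in \<open>force intro!: contour_integrable_inversediff valid_path_image_rectpath[OF q'] simp: path_image_compose path_image_rectpath_cbox_minus_box\<close>)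
  also have "contour_integral (q \<circ> rectpath a b) (\<lambda>\<zeta>. 1 / (\<zeta> - c)) = 2 * of_real pi * \<i> * winding_number (q \<circ> rectpath a b) c"
    using far r ab
    by (subst winding_number_valid_path[OF valid_path_image_rectpath[OF q']])
       (force simp: path_image_compose path_image_rectpath_cbox_minus_box)+
  finally show ?thesis by simp
qed

text \<open>
  The degree formula for the identity map determines the total mass of the kernel, because the boundary of a
  rectangle winds once around each interior point.
\<close>
lemma kern_unit_cbox:
  assumes r: "r > 0"
  shows "(LINT z:cbox (Complex (-2*r) (-2*r)) (Complex (2*r) (2*r))|lborel. kern r z) = 1"
proof -
  let ?a = "Complex (-2*r) (-2*r)" and ?b = "Complex (2*r) (2*r)"
  have id: "C2_map (\<lambda>z. z) (\<lambda>z. 1) (\<lambda>z. \<i>)"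
    unfolding C2_map_def using has_grad_id has_grad_const by blast
  have far: "r \<le> cmod (z - 0)" if "z \<in> cbox ?a ?b - box ?a ?b" for z
  proof -
    have "\<bar>Re z\<bar> \<ge> 2 * r \<or> \<bar>Im z\<bar> \<ge> 2 * r" using that r by (auto simp: in_cbox_complex_iff in_box_complex_iff)
    then show ?thesis using abs_Re_le_cmod[of z] abs_Im_le_cmod[of z] r by auto
  qed
  have "winding_number (rectpath ?a ?b) 0 = 1"
    by (rule winding_number_rectpath) (use r in \<open>auto simp: in_box_complex_iff\<close>)
  with integral_radial_kern_compose[OF id _ _ r far]
  have "(LINT z:cbox ?a ?b|lborel. of_real (kern r z) * (2 * \<i>)) = 2 * \<i>"
    using r by (simp add: o_def)
  then have "complex_of_real (LINT z:cbox ?a ?b|lborel. kern r z) = 1"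
    by (simp add: set_integral_complex_of_real[symmetric])
  then show ?thesis by simp
qed

section \<open>Convolution with smooth kernels\<close>

lemma lborel_reflect: "distr lborel borel (\<lambda>z. c - z) = (lborel :: complex measure)"
  using lborel_affine[of "-1" c] by (simp add: density_1)

lemma lborel_shift: "distr lborel borel (\<lambda>z. z - c) = (lborel :: complex measure)"
proof -
  have "(+) (- c) = (\<lambda>z. z - c)" by (simp add: fun_eq_iff)
  then show ?thesis using lborel_distr_plus[of "-c"] by simp
qed

lemma nn_integral_shift:
  fixes f :: "complex \<Rightarrow> ennreal"
  assumes "f \<in> borel_measurable borel" shows "(\<integral>\<^sup>+z. f (z - h) \<partial>lborel) = (\<integral>\<^sup>+z. f z \<partial>lborel)"
proof -
  have "(\<integral>\<^sup>+z. f z \<partial>lborel) = (\<integral>\<^sup>+z. f z \<partial>distr lborel borel (\<lambda>z. z - h))" unfolding lborel_shift ..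
  also have "\<dots> = (\<integral>\<^sup>+z. f (z - h) \<partial>lborel)" using assms by (subst nn_integral_distr) auto
  finally show ?thesis ..
qed

lemma nn_integral_reflect:
  fixes f :: "complex \<Rightarrow> ennreal"
  assumes "f \<in> borel_measurable borel" shows "(\<integral>\<^sup>+z. f (h - z) \<partial>lborel) = (\<integral>\<^sup>+z. f z \<partial>lborel)"
proof -
  have "(\<integral>\<^sup>+z. f z \<partial>lborel) = (\<integral>\<^sup>+z. f z \<partial>distr lborel borel (\<lambda>z. h - z))" unfolding lborel_reflect ..
  also have "\<dots> = (\<integral>\<^sup>+z. f (h - z) \<partial>lborel)" using assms by (subst nn_integral_distr) auto
  finally show ?thesis ..
qed

lemma integral_reflect:
  fixes f :: "complex \<Rightarrow> 'a::{banach, second_countable_topology}"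
  assumes "f \<in> borel_measurable borel" shows "(LINT z|lborel. f (h - z)) = (LINT z|lborel. f z)"
proof -
  have "(LINT z|lborel. f z) = (LINT z|distr lborel borel (\<lambda>z. h - z). f z)" unfolding lborel_reflect ..
  also have "\<dots> = (LINT z|lborel. f (h - z))" using assms by (subst integral_distr) auto
  finally show ?thesis ..
qed

definition bump :: "real \<Rightarrow> (complex \<Rightarrow> real) \<Rightarrow> bool" where
  "bump r k \<longleftrightarrow> smooth_plane k \<and> (\<forall>z. k z \<noteq> 0 \<longrightarrow> cmod z \<le> r)"

lemma bump_measurable[measurable_dest]: "bump r k \<Longrightarrow> k \<in> borel_measurable borel"
  unfolding bump_def by (auto intro: borel_measurable_continuous_onI smooth_plane_continuous)

lemma bump_bounded:
  assumes "bump r k" obtains B where "B \<ge> 0" "\<And>z. \<bar>k z\<bar> \<le> B"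
proof -
  have "bounded (k ` cball 0 r)"
    using assms unfolding bump_def
    by (intro compact_imp_bounded compact_continuous_image smooth_plane_continuous) auto
  then obtain B where B: "B > 0" "\<And>z. z \<in> cball 0 r \<Longrightarrow> \<bar>k z\<bar> \<le> B" unfolding bounded_pos by auto
  moreover have "\<bar>k z\<bar> \<le> B" for z
    using B assms unfolding bump_def by (cases "cmod z \<le> r") force+
  ultimately show thesis using that[of B] by auto
qed

lemma bump_gradient:
  assumes "bump r k" "has_grad k p q" "smooth_plane p" "smooth_plane q"
  shows "bump r p" "bump r q"
proof -
  have "p z = 0 \<and> q z = 0" if "cmod z > r" for z
  proof -
    have "((\<lambda>z. 0) has_derivative grad_map (p z) (q z)) (at z)"
      by (rule has_derivative_transform_within_open[OF has_gradD(1)[OF assms(2)], where s="- cball 0 r"])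
         (use that assms(1) in \<open>auto simp: bump_def\<close>)
    then have "grad_map (p z) (q z) = (\<lambda>h. 0)"
      using has_derivative_unique has_derivative_const by blast
    from fun_cong[OF this, of 1] fun_cong[OF this, of \<i>] show ?thesis by (simp add: grad_map_def)
  qed
  then show "bump r p" "bump r q" using assms unfolding bump_def by (meson not_le)+
qed

text \<open>
  Writing the kernel as \<open>h (|z|\<^sup>2)\<close> exhibits both mixed second derivatives as \<open>4 Re z Im z h''\<close>.
\<close>
lemma kern_derivatives:
  assumes "r > 0"
  obtains p q pp m qq where "bump r (kern r)" "bump r p" "bump r q" "bump r pp" "bump r m" "bump r qq"
    "has_grad (kern r) p q" "has_grad p pp m" "has_grad q m qq"
proof -
  have sm: "smooth_line (\<lambda>t. ramp' (inverse (r\<^sup>2) * t) * inverse (pi * ramp 1 * r\<^sup>2))"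
    by (intro smooth_line.mult smooth_line.const smooth_line.comp[OF ramp'_smooth] smooth_line.ident)
  define h where "h = (\<lambda>t. ramp' (inverse (r\<^sup>2) * t) * inverse (pi * ramp 1 * r\<^sup>2))"
  have k: "kern r = (\<lambda>z. h ((cmod z)\<^sup>2))" by (simp add: kern_def[abs_def] h_def divide_inverse mult.commute)
  obtain h1 where h1: "smooth_line h1" "has_grad (\<lambda>z. h ((cmod z)\<^sup>2)) (\<lambda>z. 2 * Re z * h1 ((cmod z)\<^sup>2)) (\<lambda>z. 2 * Im z * h1 ((cmod z)\<^sup>2))"
    using has_grad_radial[OF sm] unfolding h_def by blast
  obtain h2 where h2: "smooth_line h2" "has_grad (\<lambda>z. h1 ((cmod z)\<^sup>2)) (\<lambda>z. 2 * Re z * h2 ((cmod z)\<^sup>2)) (\<lambda>z. 2 * Im z * h2 ((cmod z)\<^sup>2))"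
    using has_grad_radial[OF h1(1)] by blast
  have RI: "has_grad Re (\<lambda>z. 1) (\<lambda>z. 0)" "has_grad Im (\<lambda>z. 0) (\<lambda>z. 1)"
    by (rule has_gradI; (auto intro!: derivative_eq_intros simp: grad_map_def fun_eq_iff)[1])+
  have m2: "has_grad f f1 f2 \<Longrightarrow> has_grad (\<lambda>z. 2 * f z) (\<lambda>z. 2 * f1 z) (\<lambda>z. 2 * f2 z)" for f f1 f2 :: "complex \<Rightarrow> real"
    by (rule has_grad_linear[where T="\<lambda>x. 2 * x"]) (auto intro: bounded_linear_mult_right)
  have p: "has_grad (\<lambda>z. 2 * Re z * h1 ((cmod z)\<^sup>2))
      (\<lambda>z. 2 * Re z * (2 * Re z * h2 ((cmod z)\<^sup>2)) + 2 * h1 ((cmod z)\<^sup>2))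
      (\<lambda>z. 2 * Re z * (2 * Im z * h2 ((cmod z)\<^sup>2)))"
    by (rule has_grad_cong[OF has_grad_mult[OF m2[OF RI(1)] h2(2)]]) auto
  have q: "has_grad (\<lambda>z. 2 * Im z * h1 ((cmod z)\<^sup>2))
      (\<lambda>z. 2 * Re z * (2 * Im z * h2 ((cmod z)\<^sup>2)))
      (\<lambda>z. 2 * Im z * (2 * Im z * h2 ((cmod z)\<^sup>2)) + 2 * h1 ((cmod z)\<^sup>2))"
    by (rule has_grad_cong[OF has_grad_mult[OF m2[OF RI(2)] h2(2)]]) auto
  note sp = smooth_plane.add smooth_plane.mult smooth_plane.const smooth_plane.Re smooth_plane.Im
    smooth_plane_radial[OF h1(1)] smooth_plane_radial[OF h2(1)]
  have b: "bump r (kern r)" unfolding bump_def using smooth_plane_kern kern_support[OF assms] by blast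
  have b1: "bump r (\<lambda>z. 2 * Re z * h1 ((cmod z)\<^sup>2))" "bump r (\<lambda>z. 2 * Im z * h1 ((cmod z)\<^sup>2))"
    by (rule bump_gradient[OF b h1(2)[folded k]]; intro sp)+
  have b2: "bump r (\<lambda>z. 2 * Re z * (2 * Re z * h2 ((cmod z)\<^sup>2)) + 2 * h1 ((cmod z)\<^sup>2))"
     "bump r (\<lambda>z. 2 * Re z * (2 * Im z * h2 ((cmod z)\<^sup>2)))"
    by (rule bump_gradient[OF b1(1) p]; intro sp)+
  have b3: "bump r (\<lambda>z. 2 * Im z * (2 * Im z * h2 ((cmod z)\<^sup>2)) + 2 * h1 ((cmod z)\<^sup>2))"
    by (rule bump_gradient[OF b1(2) q]; intro sp)+
  show thesis by (rule that[OF b b1 b2 b3 h1(2)[folded k] p q])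
qed

definition conv :: "(complex \<Rightarrow> real) \<Rightarrow> (complex \<Rightarrow> complex) \<Rightarrow> complex \<Rightarrow> complex" where
  "conv k f z = (LINT y|lborel. k (z - y) *\<^sub>R f y)"

lemma conv_integrable:
  fixes f :: "complex \<Rightarrow> complex"
  assumes k: "bump r k" and f: "integrable lborel f"
  shows "integrable lborel (\<lambda>y. k (z - y) *\<^sub>R f y)"
proof -
  obtain B where B: "B \<ge> 0" "\<And>z. \<bar>k z\<bar> \<le> B" using bump_bounded[OF k] by blast
  have [measurable]: "k \<in> borel_measurable borel" "f \<in> borel_measurable borel" using k f by auto
  show ?thesis
    by (rule Bochner_Integration.integrable_bound[of _ "\<lambda>y. B *\<^sub>R f y"])
       (use f B in \<open>auto intro!: AE_I2 mult_right_mono\<close>)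
qed

lemma conv_continuous:
  assumes k: "bump r k" and f: "integrable lborel f"
  shows "continuous_on UNIV (conv k f)"
proof -
  obtain B where B: "B \<ge> 0" "\<And>z. \<bar>k z\<bar> \<le> B" using bump_bounded[OF k] by blast
  have [measurable]: "k \<in> borel_measurable borel" "f \<in> borel_measurable borel" using k f by auto
  have ck: "isCont k z" for z using smooth_plane_continuous[of k UNIV] k
    by (auto simp: bump_def continuous_on_eq_continuous_at)
  have "(\<lambda>n. conv k f (X n)) \<longlonglongrightarrow> conv k f z" if X: "X \<longlonglongrightarrow> z" for X z
    unfolding conv_def
  proof (rule integral_dominated_convergence[where w="\<lambda>y. B * norm (f y)"])
    show "AE y in lborel. (\<lambda>n. k (X n - y) *\<^sub>R f y) \<longlonglongrightarrow> k (z - y) *\<^sub>R f y"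
      by (intro AE_I2 tendsto_intros isCont_tendsto_compose[OF ck] X)
    show "\<And>n. AE y in lborel. norm (k (X n - y) *\<^sub>R f y) \<le> B * norm (f y)"
      using B by (intro AE_I2) (auto intro!: mult_right_mono)
  qed (use f in auto)
  then show ?thesis by (simp add: continuous_on_sequentially o_def)
qed

text \<open>
  Differentiation under the integral sign. The kernel is Lipschitz, so the remainders of its difference
  quotients are bounded, and dominated convergence only needs \<open>f\<close> integrable.
\<close>
theorem conv_has_grad:
  assumes k: "bump r k" "has_grad k p q" and pq: "bump r p" "bump r q" and f: "integrable lborel f"
  shows "has_grad (conv k f) (conv p f) (conv q f)"
proof (rule has_gradI)
  obtain Bp where Bp: "Bp \<ge> 0" "\<And>z. \<bar>p z\<bar> \<le> Bp" using bump_bounded[OF pq(1)] by blast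
  obtain Bq where Bq: "Bq \<ge> 0" "\<And>z. \<bar>q z\<bar> \<le> Bq" using bump_bounded[OF pq(2)] by blast
  define L where "L = Bp + Bq"
  have [measurable]: "k \<in> borel_measurable borel" "p \<in> borel_measurable borel" "q \<in> borel_measurable borel" "f \<in> borel_measurable borel" using k pq f by auto
  have g: "\<bar>grad_map (p z) (q z) h\<bar> \<le> L * cmod h" for z h
  proof -
    have "\<bar>grad_map (p z) (q z) h\<bar> \<le> \<bar>Re h\<bar> * \<bar>p z\<bar> + \<bar>Im h\<bar> * \<bar>q z\<bar>"
      unfolding grad_map_def by (simp add: abs_mult[symmetric])
    also have "\<dots> \<le> cmod h * Bp + cmod h * Bq"
      using Bp Bq abs_Re_le_cmod[of h] abs_Im_le_cmod[of h] by (intro add_mono mult_mono) auto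
    finally show ?thesis by (simp add: L_def algebra_simps)
  qed
  have lip: "\<bar>k a - k b\<bar> \<le> L * cmod (a - b)" for a b
    using differentiable_bound[of UNIV k "\<lambda>z. grad_map (p z) (q z)" L a b] has_gradD(1)[OF k(2)] g
    by (simp add: onorm_le)
  show "((conv k f) has_derivative grad_map (conv p f z) (conv q f z)) (at z)" for z
    unfolding has_derivative_iff_norm
  proof
    have e: "grad_map (conv p f z) (conv q f z) h = (LINT y|lborel. grad_map (p (z - y)) (q (z - y)) h *\<^sub>R f y)" for h
      unfolding grad_map_def conv_def scaleR_add_left
      by (subst Bochner_Integration.integral_add)
        (auto intro!: integrable_scaleR_right conv_integrable pq f simp flip: scaleR_scaleR)
    show "bounded_linear (grad_map (conv p f z) (conv q f z))"
      unfolding grad_map_def by (intro bounded_linear_add bounded_linear_scaleR_left bounded_linear_compose[OF bounded_linear_scaleR_left] bounded_linear_Re bounded_linear_Im)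
    show "((\<lambda>w. norm (conv k f w - conv k f z - grad_map (conv p f z) (conv q f z) (w - z)) / norm (w - z)) \<longlongrightarrow> 0) (at z)"
      unfolding tendsto_at_iff_sequentially o_def
    proof (intro allI impI)
      fix X assume X: "\<forall>i. X i \<in> UNIV - {z}" "X \<longlonglongrightarrow> z"
      define R where "R n y = (k (X n - y) - k (z - y) - grad_map (p (z - y)) (q (z - y)) (X n - z)) / cmod (X n - z)" for n y
      have [measurable]: "R n \<in> borel_measurable borel" for n unfolding R_def grad_map_def by measurable
      have R: "\<bar>R n y\<bar> \<le> 2 * L" for n y
      proof -
        have pos: "cmod (X n - z) > 0" using X by auto
        have "\<bar>k (X n - y) - k (z - y) - grad_map (p (z - y)) (q (z - y)) (X n - z)\<bar> \<le> L * cmod (X n - z) + L * cmod (X n - z)"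
          using lip[of "X n - y" "z - y"] g[of "z - y" "X n - z"] by simp
        then show ?thesis using pos unfolding R_def by (simp add: abs_divide divide_le_eq algebra_simps)
      qed
      have "(\<lambda>n. LINT y|lborel. norm (R n y *\<^sub>R f y)) \<longlonglongrightarrow> (LINT y::complex|lborel. 0)"
      proof (rule integral_dominated_convergence[where w="\<lambda>y. 2 * L * norm (f y)"])
        show "AE y in lborel. (\<lambda>n. norm (R n y *\<^sub>R f y)) \<longlonglongrightarrow> 0"
        proof (rule AE_I2)
          fix y :: complex
          have "((\<lambda>w. norm (k w - k (z - y) - grad_map (p (z-y)) (q (z-y)) (w - (z - y))) / norm (w - (z - y))) \<longlongrightarrow> 0) (at (z - y))"
            using has_gradD(1)[OF k(2), of "z - y" UNIV] unfolding has_derivative_iff_norm by simp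
          then have "(\<lambda>n. norm (k (X n - y) - k (z - y) - grad_map (p (z-y)) (q (z-y)) ((X n - y) - (z - y))) / norm ((X n - y) - (z - y))) \<longlonglongrightarrow> 0"
            unfolding tendsto_at_iff_sequentially o_def using X
            by (elim allE[of _ "\<lambda>n. X n - y"]) (auto intro!: tendsto_intros)
          then have "(\<lambda>n. norm (R n y)) \<longlonglongrightarrow> 0" by (simp add: R_def abs_divide)
          then show "(\<lambda>n. norm (R n y *\<^sub>R f y)) \<longlonglongrightarrow> 0" using tendsto_mult_left_zero by auto
        qed
        show "\<And>n. AE y in lborel. norm (norm (R n y *\<^sub>R f y)) \<le> 2 * L * norm (f y)"
          using R by (intro AE_I2) (auto intro!: mult_right_mono)
      qed (use f in auto)
      then have lim: "(\<lambda>n. LINT y|lborel. norm (R n y *\<^sub>R f y)) \<longlonglongrightarrow> 0" by simp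
      show "(\<lambda>n. norm (conv k f (X n) - conv k f z - grad_map (conv p f z) (conv q f z) (X n - z)) / norm (X n - z)) \<longlonglongrightarrow> 0"
      proof (rule tendsto_sandwich[OF _ _ tendsto_const lim]; intro always_eventually allI)
        fix n
        have pos: "cmod (X n - z) > 0" using X by auto
        have ig: "integrable lborel (\<lambda>y. grad_map (p (z - y)) (q (z - y)) h *\<^sub>R f y)" for h
          unfolding grad_map_def scaleR_add_left
          by (auto intro!: integrable_scaleR_right conv_integrable pq f simp flip: scaleR_scaleR)
        have "conv k f (X n) - conv k f z - grad_map (conv p f z) (conv q f z) (X n - z) =
          (LINT y|lborel. k (X n - y) *\<^sub>R f y - k (z - y) *\<^sub>R f y - grad_map (p (z - y)) (q (z - y)) (X n - z) *\<^sub>R f y)"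
          unfolding e unfolding conv_def
          by (simp add: Bochner_Integration.integral_diff Bochner_Integration.integrable_diff conv_integrable[OF k(1) f] ig)
        also have "\<dots> = (LINT y|lborel. cmod (X n - z) *\<^sub>R (R n y *\<^sub>R f y))"
          using pos by (intro Bochner_Integration.integral_cong) (auto simp: R_def scaleR_diff_left)
        also have "\<dots> = cmod (X n - z) *\<^sub>R (LINT y|lborel. R n y *\<^sub>R f y)"
          by (rule integral_scaleR_right)
        finally have "norm (conv k f (X n) - conv k f z - grad_map (conv p f z) (conv q f z) (X n - z)) / norm (X n - z) = norm (LINT y|lborel. R n y *\<^sub>R f y)"
          using pos by simp
        also have "\<dots> \<le> (LINT y|lborel. norm (R n y *\<^sub>R f y))" by (rule integral_norm_bound)
        finally show "norm (conv k f (X n) - conv k f z - grad_map (conv p f z) (conv q f z) (X n - z)) / norm (X n - z) \<le> (LINT y|lborel. norm (R n y *\<^sub>R f y))" .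
      qed auto
    qed
  qed
qed (intro conv_continuous[OF pq(1) f] conv_continuous[OF pq(2) f])+

lemma conv_kern_C2:
  assumes r: "r > 0" and f: "integrable lborel f"
  obtains p q where "C2_map (conv (kern r) f) (conv p f) (conv q f)" "has_grad (kern r) p q" "bump r p" "bump r q"
proof -
  obtain p q pp m qq where *: "bump r (kern r)" "bump r p" "bump r q" "bump r pp" "bump r m" "bump r qq"
    "has_grad (kern r) p q" "has_grad p pp m" "has_grad q m qq" using kern_derivatives[OF r] by blast
  have "C2_map (conv (kern r) f) (conv p f) (conv q f)"
    unfolding C2_map_def using * by (blast intro: conv_has_grad f)
  then show thesis using that * by blast
qed

lemma bump_kern: "r > 0 \<Longrightarrow> bump r (kern r)"
  using smooth_plane_kern kern_support by (simp add: bump_def)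

lemma kern_integral:
  assumes r: "r > 0"
  shows "integrable lborel (kern r)" "(LINT z|lborel. kern r z) = 1" "(\<integral>\<^sup>+z. ennreal (kern r z) \<partial>lborel) = 1"
proof -
  let ?C = "cbox (Complex (-2*r) (-2*r)) (Complex (2*r) (2*r))"
  have k0: "z \<in> ?C" if "kern r z \<noteq> 0" for z
    using kern_support[OF r that] abs_Re_le_cmod[of z] abs_Im_le_cmod[of z] r by (auto simp: in_cbox_complex_iff)
  have e: "(\<lambda>z. indicator ?C z *\<^sub>R kern r z) = kern r" using k0 by (force simp: indicator_def fun_eq_iff)
  have "set_integrable lborel ?C (kern r)"
    by (intro set_integrable_continuous_cbox smooth_plane_continuous smooth_plane_kern)
  then show i: "integrable lborel (kern r)" unfolding set_integrable_def e .
  show "(LINT z|lborel. kern r z) = 1" using kern_unit_cbox[OF r] unfolding set_lebesgue_integral_def e .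
  then show "(\<integral>\<^sup>+z. ennreal (kern r z) \<partial>lborel) = 1"
    by (subst nn_integral_eq_integral[OF i]) (auto simp: kern_nonneg)
qed

text \<open>
  As the kernel has mass one, the error of mollification is an average of differences of \<open>f\<close>.
\<close>
lemma conv_kern_diff:
  assumes r: "r > 0" and f: "integrable lborel f"
  shows "conv (kern r) f z - f z = (LINT y|lborel. kern r y *\<^sub>R (f (z - y) - f z))"
    and "integrable lborel (\<lambda>y. kern r y *\<^sub>R (f (z - y) - f z))"
proof -
  have [measurable]: "kern r \<in> borel_measurable borel" "f \<in> borel_measurable borel" using f bump_kern[OF r] by auto
  have i: "integrable lborel (\<lambda>y. kern r (z - y) *\<^sub>R f y)" by (rule conv_integrable[OF bump_kern[OF r] f])
  have "integrable (distr lborel borel (\<lambda>y. z - y)) (\<lambda>y. kern r (z - y) *\<^sub>R f y)" unfolding lborel_reflect by (rule i)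
  then have i2: "integrable lborel (\<lambda>y. kern r y *\<^sub>R f (z - y))" by (subst (asm) integrable_distr_eq) auto
  have i3: "integrable lborel (\<lambda>y. kern r y *\<^sub>R f z)" using kern_integral(1)[OF r] by auto
  show "integrable lborel (\<lambda>y. kern r y *\<^sub>R (f (z - y) - f z))"
    unfolding scaleR_diff_right by (intro Bochner_Integration.integrable_diff i2 i3)
  have "conv (kern r) f z = (LINT y|lborel. kern r y *\<^sub>R f (z - y))"
    unfolding conv_def using integral_reflect[of "\<lambda>y. kern r y *\<^sub>R f (z - y)" z] by simp
  then show "conv (kern r) f z - f z = (LINT y|lborel. kern r y *\<^sub>R (f (z - y) - f z))"
    unfolding scaleR_diff_right
    by (subst Bochner_Integration.integral_diff[OF i2 i3]) (simp add: kern_integral[OF r])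
qed

lemma conv_kern_close:
  assumes r: "r > 0" and f: "integrable lborel f" and e: "\<And>y. cmod (y - z) \<le> r \<Longrightarrow> cmod (f y - f z) \<le> e"
  shows "cmod (conv (kern r) f z - f z) \<le> e"
proof -
  have "cmod (conv (kern r) f z - f z) \<le> (LINT y|lborel. kern r y * e)"
    unfolding conv_kern_diff(1)[OF r f]
  proof (rule Bochner_Integration.integral_norm_bound_integral[OF conv_kern_diff(2)[OF r f]])
    show "norm (kern r y *\<^sub>R (f (z - y) - f z)) \<le> kern r y * e" for y
      using e[of "z - y"] kern_support[OF r, of y] kern_nonneg[of r y]
      by (cases "kern r y = 0") (auto intro!: mult_left_mono)
  qed (use kern_integral(1)[OF r] in auto)
  then show ?thesis using kern_integral[OF r] by simp
qed

text \<open>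
  Closed sets approximate from inside; intersecting them with large discs loses little measure.
\<close>
lemma inner_compact_lborel:
  fixes A :: "complex set"
  assumes A: "A \<in> sets borel" "emeasure lborel A < \<infinity>" and e: "e > (0::real)"
  obtains C where "compact C" "C \<subseteq> A" "emeasure lborel (A - C) < ennreal e"
proof -
  have A': "A \<in> sets lebesgue" by (rule sets_completionI_sets) (simp add: A(1))
  have "e / 2 > 0" using e by simp
  from sets_lebesgue_inner_closed[OF A' this]
  obtain T where T: "closed T" "T \<subseteq> A" "emeasure lebesgue (A - T) < ennreal (e/2)" by metis
  have [measurable]: "T \<in> sets borel" "A \<in> sets borel" using T A by (auto simp: borel_closed)
  have T': "emeasure lborel (A - T) < ennreal (e/2)"
    using T(3) by (subst (asm) emeasure_completion) auto
  have "(\<lambda>n. emeasure lborel (T - cball 0 (real n))) \<longlonglongrightarrow> emeasure lborel (\<Inter>n. T - cball 0 (real n))"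
  proof (rule Lim_emeasure_decseq)
    show "decseq (\<lambda>n. T - cball 0 (real n))" by (force simp: decseq_def)
    show "emeasure lborel (T - cball 0 (real n)) \<noteq> \<infinity>" for n
    proof -
      have "emeasure lborel (T - cball 0 (real n)) \<le> emeasure lborel A" by (rule emeasure_mono) (use T A in auto)
      then show ?thesis using A(2) by (auto simp: top_unique)
    qed
  qed (use T in \<open>auto simp: borel_closed\<close>)
  moreover have "(\<Inter>n. T - cball 0 (real n)) = {}"
  proof -
    have "x \<notin> (\<Inter>n. T - cball 0 (real n))" for x
    proof -
      obtain n where "cmod x \<le> real n" using real_arch_simple by blast
      then have "x \<notin> T - cball 0 (real n)" by simp
      then show ?thesis by blast
    qed
    then show ?thesis by blast
  qed
  ultimately have "(\<lambda>n. emeasure lborel (T - cball 0 (real n))) \<longlonglongrightarrow> 0" by (simp only: emeasure_empty)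
  then have "\<forall>\<^sub>F n in sequentially. emeasure lborel (T - cball 0 (real n)) < ennreal (e/2)"
    using e by (auto intro: order_tendstoD)
  then obtain n where n: "emeasure lborel (T - cball 0 (real n)) < ennreal (e/2)"
    by (auto simp: eventually_sequentially)
  let ?C = "T \<inter> cball 0 (real n)"
  have "emeasure lborel (A - ?C) \<le> emeasure lborel ((A - T) \<union> (T - cball 0 (real n)))"
    using A T by (intro emeasure_mono) (auto simp: borel_closed)
  also have "\<dots> \<le> emeasure lborel (A - T) + emeasure lborel (T - cball 0 (real n))"
    using A T by (intro emeasure_subadditive) (auto simp: borel_closed)
  also have "\<dots> < ennreal (e/2) + ennreal (e/2)" by (intro add_strict_mono T' n)
  also have "\<dots> = ennreal e" using e by (subst ennreal_plus[symmetric]) auto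
  finally have "emeasure lborel (A - ?C) < ennreal e" .
  moreover have "compact ?C" by (rule closed_Int_compact[OF T(1) compact_cball])
  ultimately show thesis using that[of ?C] T(2) by blast
qed

definition translation_modulus :: "nat \<Rightarrow> (complex \<Rightarrow> complex) \<Rightarrow> complex \<Rightarrow> ennreal" where
  "translation_modulus p f h = (\<integral>\<^sup>+z. ennreal (cmod (f (z - h) - f z) ^ p) \<partial>lborel)"

text \<open>
  Squeeze \<open>A\<close> between a compact \<open>C\<close> and an open \<open>U\<close> of almost the same measure. For a shift shorter than
  the distance from \<open>C\<close> to the complement of \<open>U\<close>, the indicators of \<open>A\<close> and its translate differ only on
  \<open>U - C\<close> and on the translate of \<open>U - C\<close>.
\<close>
lemma translation_modulus_indicator:
  assumes A: "A \<in> sets borel" "emeasure lborel A < \<infinity>" and e: "e > (0::real)"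
  shows "\<exists>d>0. \<forall>h. cmod h < d \<longrightarrow> translation_modulus 1 (\<lambda>z. indicator A z *\<^sub>R c) h \<le> ennreal e"
proof -
  define X where "X = cmod c + 1"
  have X: "X > 0" "cmod c \<le> X" by (auto simp: X_def add_nonneg_pos)
  define e' where "e' = e / (4 * X)"
  have e': "e' > 0" using e X by (simp add: e'_def)
  obtain C where C: "compact C" "C \<subseteq> A" "emeasure lborel (A - C) < ennreal e'"
    using inner_compact_lborel[OF A e'] .
  obtain U where U: "open U" "A \<subseteq> U" "emeasure lborel (U - A) < ennreal e'"
    using outer_regular_lborel[OF A(1) e'] by blast
  obtain d where d: "d > 0" "(\<Union>x\<in>C. cball x d) \<subseteq> U"
    using compact_subset_open_imp_cball_epsilon_subset[OF C(1) U(1)] C U by blast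
  have [measurable]: "C \<in> sets borel" "U \<in> sets borel" "A \<in> sets borel"
    using A C U by (auto simp: borel_open borel_compact)
  have UC: "emeasure lborel (U - C) \<le> ennreal (2 * e')"
  proof -
    have "emeasure lborel (U - C) \<le> emeasure lborel ((U - A) \<union> (A - C))" by (intro emeasure_mono) auto
    also have "\<dots> \<le> emeasure lborel (U - A) + emeasure lborel (A - C)" by (intro emeasure_subadditive) auto
    also have "\<dots> \<le> ennreal e' + ennreal e'" using U C by (intro add_mono less_imp_le)
    also have "\<dots> = ennreal (2 * e')" using e' by (subst ennreal_plus[symmetric]) auto
    finally show ?thesis .
  qed
  show ?thesis
  proof (intro exI conjI allI impI)
    fix h assume h: "cmod h < d"
    have pt: "cmod (indicator A (z - h) *\<^sub>R c - indicator A z *\<^sub>R c) \<le> cmod c * (indicator (U - C) z + indicator (U - C) (z - h))" for z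
    proof -
      have 1: "z \<in> U" if "z - h \<in> C" using d(2) that h by (force simp: dist_norm norm_minus_commute)
      have 2: "z - h \<in> U" if "z \<in> C" using d(2) that h by (force simp: dist_norm)
      show ?thesis using 1 2 C(2) U(2) by (auto simp: indicator_def)
    qed
    have "translation_modulus 1 (\<lambda>z. indicator A z *\<^sub>R c) h \<le> (\<integral>\<^sup>+z. ennreal (cmod c) * (indicator (U - C) z + indicator (U - C) (z - h)) \<partial>lborel)"
      unfolding translation_modulus_def power_one_right
    proof (intro nn_integral_mono)
      fix z
      have "ennreal (cmod (indicator A (z - h) *\<^sub>R c - indicator A z *\<^sub>R c)) \<le> ennreal (cmod c * (indicator (U - C) z + indicator (U - C) (z - h)))"
        using pt by (intro ennreal_leI) simp
      also have "\<dots> = ennreal (cmod c) * (indicator (U - C) z + indicator (U - C) (z - h))"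
        by (simp add: ennreal_mult ennreal_plus ennreal_indicator)
      finally show "ennreal (cmod (indicator A (z - h) *\<^sub>R c - indicator A z *\<^sub>R c)) \<le> \<dots>" .
    qed
    also have "\<dots> = ennreal (cmod c) * (emeasure lborel (U - C) + emeasure lborel (U - C))"
      by (subst nn_integral_cmult) (auto simp: nn_integral_add nn_integral_shift[of "indicator (U - C)" h])
    also have "\<dots> \<le> ennreal (cmod c) * (ennreal (2 * e') + ennreal (2 * e'))"
      by (intro mult_left_mono add_mono UC) auto
    also have "ennreal (2 * e') + ennreal (2 * e') = ennreal (4 * e')"
      using e' by (subst ennreal_plus[symmetric]) auto
    also have "ennreal (cmod c) * \<dots> = ennreal (cmod c * (4 * e'))"
      using e' by (intro ennreal_mult[symmetric]) auto
    also have "\<dots> \<le> ennreal e"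
    proof (rule ennreal_leI)
      have "cmod c * (4 * e') = e * (cmod c / X)" using X by (simp add: e'_def)
      also have "\<dots> \<le> e * 1" using e X by (intro mult_left_mono) (auto simp: divide_le_eq)
      finally show "cmod c * (4 * e') \<le> e" by simp
    qed
    finally show "translation_modulus 1 (\<lambda>z. indicator A z *\<^sub>R c) h \<le> ennreal e" .
  qed (rule d)
qed

text \<open>
  Indicators have the property, and it survives sums and limits in \<open>L\<^sup>1\<close>.
\<close>
lemma translation_modulus_L1:
  assumes "integrable lborel f" "e > (0::real)"
  shows "\<exists>d>0. \<forall>h. cmod h < d \<longrightarrow> translation_modulus 1 f h \<le> ennreal e"
  using assms
proof (induction f arbitrary: e rule: integrable_induct)
  case (base A c)
  then show ?case using translation_modulus_indicator[of A e c] by simp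
next
  case (add f g)
  have [measurable]: "f \<in> borel_measurable borel" "g \<in> borel_measurable borel" using add by auto
  obtain d1 d2 where d: "d1 > 0" "d2 > 0"
     "\<And>h. cmod h < d1 \<Longrightarrow> translation_modulus 1 f h \<le> ennreal (e/2)"
     "\<And>h. cmod h < d2 \<Longrightarrow> translation_modulus 1 g h \<le> ennreal (e/2)"
    using add.IH(1)[of "e/2"] add.IH(2)[of "e/2"] add.prems by auto
  show ?case
  proof (intro exI[of _ "min d1 d2"] conjI allI impI)
    fix h assume h: "cmod h < min d1 d2"
    have "translation_modulus 1 (\<lambda>x. f x + g x) h \<le> (\<integral>\<^sup>+z. ennreal (cmod (f (z - h) - f z)) + ennreal (cmod (g (z - h) - g z)) \<partial>lborel)"
      unfolding translation_modulus_def power_one_right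
      by (intro nn_integral_mono) (auto simp flip: ennreal_plus intro!: ennreal_leI norm_diff_triangle_ineq)
    also have "\<dots> = translation_modulus 1 f h + translation_modulus 1 g h"
      unfolding translation_modulus_def power_one_right by (rule nn_integral_add) auto
    also have "\<dots> \<le> ennreal (e/2) + ennreal (e/2)" using d h by (intro add_mono) auto
    also have "\<dots> = ennreal e" using add.prems by (subst ennreal_plus[symmetric]) auto
    finally show "translation_modulus 1 (\<lambda>x. f x + g x) h \<le> ennreal e" .
  qed (use d in auto)
next
  case (lim f s)
  have [measurable]: "f \<in> borel_measurable borel" "s i \<in> borel_measurable borel" for i using lim by auto
  have "(\<lambda>i. \<integral>\<^sup>+x. norm (f x - s i x) \<partial>lborel) \<longlonglongrightarrow> 0"
    by (rule nn_integral_dominated_convergence_norm[where w="\<lambda>x. 2 * norm (f x)"])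
      (use lim in \<open>auto simp: integrable_iff_bounded ennreal_mult nn_integral_cmult ennreal_mult_less_top\<close>)
  then have "\<forall>\<^sub>F i in sequentially. (\<integral>\<^sup>+x. norm (f x - s i x) \<partial>lborel) < ennreal (e/4)"
    using lim.prems by (auto intro: order_tendstoD)
  then obtain i where i: "(\<integral>\<^sup>+x. norm (f x - s i x) \<partial>lborel) < ennreal (e/4)" by (auto simp: eventually_sequentially)
  obtain d where d: "d > 0" "\<And>h. cmod h < d \<Longrightarrow> translation_modulus 1 (s i) h \<le> ennreal (e/2)"
    using lim.IH[of "e/2" i] lim.prems by auto
  show ?case
  proof (intro exI[of _ d] conjI allI impI)
    fix h assume h: "cmod h < d"
    let ?D = "\<lambda>z. ennreal (cmod (f z - s i z))"
    have pt: "cmod (f (z - h) - f z) \<le> cmod (f (z - h) - s i (z - h)) + (cmod (s i (z - h) - s i z) + cmod (f z - s i z))" for z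
    proof -
      have "f (z - h) - f z = (f (z - h) - s i (z - h)) + ((s i (z - h) - s i z) - (f z - s i z))" by simp
      then show ?thesis by (metis norm_triangle_ineq norm_triangle_ineq4 add_left_mono order_trans)
    qed
    have "translation_modulus 1 f h \<le> (\<integral>\<^sup>+z. ?D (z - h) + (ennreal (cmod (s i (z - h) - s i z)) + ?D z) \<partial>lborel)"
      unfolding translation_modulus_def power_one_right
      by (intro nn_integral_mono) (auto simp flip: ennreal_plus intro!: ennreal_leI pt)
    also have "\<dots> = (\<integral>\<^sup>+z. ?D z \<partial>lborel) + (translation_modulus 1 (s i) h + (\<integral>\<^sup>+z. ?D z \<partial>lborel))"
      unfolding translation_modulus_def power_one_right by (simp add: nn_integral_add nn_integral_shift[of ?D h])
    also have "\<dots> \<le> ennreal (e/4) + (ennreal (e/2) + ennreal (e/4))"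
      using d h i by (intro add_mono) auto
    also have "\<dots> = ennreal e" using lim.prems by (simp add: ennreal_plus[symmetric] del: ennreal_plus)
    finally show "translation_modulus 1 f h \<le> ennreal e" .
  qed (use d in auto)
qed

lemma square_sum3: "(a + (b + c))\<^sup>2 \<le> 3 * a\<^sup>2 + (3 * b\<^sup>2 + 3 * c\<^sup>2)" for a b c :: real
proof -
  have "0 \<le> (a - b)\<^sup>2 + (a - c)\<^sup>2 + (b - c)\<^sup>2" by simp
  then show ?thesis by (simp add: power2_eq_square algebra_simps)
qed

text \<open>
  Truncate \<open>f\<close> at a height \<open>M\<close> beyond which little of its \<open>L\<^sup>2\<close> norm is left. Differences of the truncated
  function are at most \<open>2M\<close>, so their squares are controlled by the \<open>L\<^sup>1\<close> modulus.
\<close>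
lemma translation_modulus_L2:
  assumes f: "integrable lborel f" and f2: "(\<integral>\<^sup>+z. ennreal ((cmod (f z))\<^sup>2) \<partial>lborel) < \<infinity>" and e: "e > (0::real)"
  shows "\<exists>d>0. \<forall>h. cmod h < d \<longrightarrow> translation_modulus 2 f h \<le> ennreal e"
proof -
  have [measurable]: "f \<in> borel_measurable borel" using f by auto
  have lin: "3 * ennreal x + (ennreal m * ennreal y + 3 * ennreal x) = ennreal (3 * x + (m * y + 3 * x))"
    if "x \<ge> 0" "m \<ge> 0" "y \<ge> 0" for x m y
  proof -
    have "3 * ennreal x = ennreal (3 * x)" using that ennreal_mult[of 3 x] by simp
    moreover have "ennreal m * ennreal y = ennreal (m * y)" using that by (simp add: ennreal_mult)
    ultimately show ?thesis using that by (simp only: ennreal_plus add_nonneg_nonneg mult_nonneg_nonneg zero_le_numeral)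
  qed
  define t where "t M z = (if cmod (f z) \<le> real M then f z else 0)" for M z
  have [measurable]: "t M \<in> borel_measurable borel" for M unfolding t_def[abs_def] by measurable
  have ti: "integrable lborel (t M)" for M
    by (rule Bochner_Integration.integrable_bound[OF f]) (auto simp: t_def)
  have "(\<lambda>M. \<integral>\<^sup>+z. ennreal ((cmod (f z - t M z))\<^sup>2) \<partial>lborel) \<longlonglongrightarrow> nn_integral lborel (\<lambda>z::complex. 0)"
  proof (rule nn_integral_dominated_convergence[where w="\<lambda>z. ennreal ((cmod (f z))\<^sup>2)"])
    show "AE z in lborel. (\<lambda>M. ennreal ((cmod (f z - t M z))\<^sup>2)) \<longlonglongrightarrow> 0"
    proof (intro AE_I2 tendsto_eventually)
      fix z
      obtain N where "cmod (f z) \<le> real N" using real_arch_simple by blast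
      then show "\<forall>\<^sub>F M in sequentially. ennreal ((cmod (f z - t M z))\<^sup>2) = 0"
        unfolding eventually_sequentially t_def by (intro exI[of _ N]) (auto intro: order_trans)
    qed
  qed (use f2 in \<open>auto simp: t_def\<close>)
  then have "\<forall>\<^sub>F M in sequentially. (\<integral>\<^sup>+z. ennreal ((cmod (f z - t M z))\<^sup>2) \<partial>lborel) < ennreal (e/12)"
    using e by (auto intro: order_tendstoD)
  then obtain M where M: "(\<integral>\<^sup>+z. ennreal ((cmod (f z - t M z))\<^sup>2) \<partial>lborel) < ennreal (e/12)" by (auto simp: eventually_sequentially)
  obtain d where d: "d > 0" "\<And>h. cmod h < d \<Longrightarrow> translation_modulus 1 (t M) h \<le> ennreal (e / (12 * (real M + 1)))"
    using translation_modulus_L1[OF ti, of "e / (12 * (real M + 1))" M] e by (auto simp: add_nonneg_pos)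
  show ?thesis
  proof (intro exI[of _ d] conjI allI impI)
    fix h assume h: "cmod h < d"
    let ?D = "\<lambda>z. ennreal ((cmod (f z - t M z))\<^sup>2)"
    have tM: "cmod (t M z) \<le> real M" for z by (simp add: t_def)
    have pt: "(cmod (f (z - h) - f z))\<^sup>2 \<le> 3 * (cmod (f (z - h) - t M (z - h)))\<^sup>2 + ((6 * real M) * cmod (t M (z - h) - t M z) + 3 * (cmod (f z - t M z))\<^sup>2)" for z
    proof -
      have "f (z - h) - f z = (f (z - h) - t M (z - h)) + ((t M (z - h) - t M z) - (f z - t M z))" by simp
      then have "cmod (f (z - h) - f z) \<le> cmod (f (z - h) - t M (z - h)) + (cmod (t M (z - h) - t M z) + cmod (f z - t M z))"
        by (metis norm_triangle_ineq norm_triangle_ineq4 add_left_mono order_trans)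
      then have "(cmod (f (z - h) - f z))\<^sup>2 \<le> (cmod (f (z - h) - t M (z - h)) + (cmod (t M (z - h) - t M z) + cmod (f z - t M z)))\<^sup>2"
        by (intro power_mono) auto
      also have "\<dots> \<le> 3 * (cmod (f (z - h) - t M (z - h)))\<^sup>2 + (3 * (cmod (t M (z - h) - t M z))\<^sup>2 + 3 * (cmod (f z - t M z))\<^sup>2)"
        by (rule square_sum3)
      also have "(cmod (t M (z - h) - t M z))\<^sup>2 \<le> (2 * real M) * cmod (t M (z - h) - t M z)"
        unfolding power2_eq_square using tM[of "z - h"] tM[of z] norm_triangle_ineq4[of "t M (z - h)" "t M z"]
        by (intro mult_right_mono) auto
      finally show ?thesis by simp
    qed
    have "translation_modulus 2 f h \<le> (\<integral>\<^sup>+z. 3 * ?D (z - h) + (ennreal (6 * real M) * ennreal (cmod (t M (z - h) - t M z)) + 3 * ?D z) \<partial>lborel)"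
      unfolding translation_modulus_def
    proof (intro nn_integral_mono)
      fix z
      have "ennreal ((cmod (f (z - h) - f z))\<^sup>2) \<le> ennreal (3 * (cmod (f (z - h) - t M (z - h)))\<^sup>2 + ((6 * real M) * cmod (t M (z - h) - t M z) + 3 * (cmod (f z - t M z))\<^sup>2))"
        by (intro ennreal_leI pt)
      also have "\<dots> = 3 * ?D (z - h) + (ennreal (6 * real M) * ennreal (cmod (t M (z - h) - t M z)) + 3 * ?D z)"
        by (simp add: ennreal_mult ennreal_numeral)
      finally show "ennreal ((cmod (f (z - h) - f z))\<^sup>2) \<le> \<dots>" .
    qed
    also have "\<dots> = 3 * (\<integral>\<^sup>+z. ?D z \<partial>lborel) + (ennreal (6 * real M) * translation_modulus 1 (t M) h + 3 * (\<integral>\<^sup>+z. ?D z \<partial>lborel))"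
      unfolding translation_modulus_def power_one_right by (simp add: nn_integral_add nn_integral_cmult nn_integral_shift[of ?D h])
    also have "\<dots> \<le> 3 * ennreal (e/12) + (ennreal (6 * real M) * ennreal (e / (12 * (real M + 1))) + 3 * ennreal (e/12))"
      using d h M by (intro add_mono mult_left_mono) auto
    also have "\<dots> = ennreal (3 * (e/12) + ((6 * real M) * (e / (12 * (real M + 1))) + 3 * (e/12)))"
      by (rule lin) (use e in auto)
    also have "\<dots> \<le> ennreal e"
    proof (rule ennreal_leI)
      have "(6 * real M) * (e / (12 * (real M + 1))) = e/2 * (real M / (real M + 1))" by (simp add: field_simps)
      also have "\<dots> \<le> e/2 * 1" using e by (intro mult_left_mono) auto
      finally show "3 * (e/12) + ((6 * real M) * (e / (12 * (real M + 1))) + 3 * (e/12)) \<le> e" by simp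
    qed
    finally show "translation_modulus 2 f h \<le> ennreal e" .
  qed (use d in auto)
qed

text \<open>
  Jensen's inequality for the probability density \<open>kern r\<close>. For \<open>p = 2\<close> it comes from
  \<open>\<integral> kern r \<cdot> (g - m)\<^sup>2 \<ge> 0\<close>, where \<open>m\<close> is the mean of \<open>g\<close>.
\<close>
lemma conv_kern_jensen:
  assumes r: "r > 0" and f: "integrable lborel f" and p: "p = 1 \<or> p = (2::nat)"
  shows "ennreal (cmod (conv (kern r) f z - f z) ^ p) \<le> (\<integral>\<^sup>+y. ennreal (kern r y) * ennreal (cmod (f (z - y) - f z) ^ p) \<partial>lborel)"
proof -
  have [measurable]: "kern r \<in> borel_measurable borel" "f \<in> borel_measurable borel" using f bump_kern[OF r] by auto
  define g where "g y = cmod (f (z - y) - f z)" for y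
  have [measurable]: "g \<in> borel_measurable borel" unfolding g_def[abs_def] by measurable
  have gi: "integrable lborel (\<lambda>y. kern r y * g y)"
    using integrable_norm[OF conv_kern_diff(2)[OF r f, of z]] by (simp add: g_def kern_nonneg)
  define m where "m = (LINT y|lborel. kern r y * g y)"
  have "cmod (conv (kern r) f z - f z) \<le> m"
    unfolding conv_kern_diff(1)[OF r f] m_def
    by (rule order_trans[OF integral_norm_bound]) (simp add: g_def kern_nonneg)
  then have 1: "cmod (conv (kern r) f z - f z) ^ p \<le> m ^ p" by (intro power_mono) auto
  have "ennreal (m ^ p) \<le> (\<integral>\<^sup>+y. ennreal (kern r y * g y ^ p) \<partial>lborel)"
  proof (cases "p = 1")
    case True
    have "ennreal m = (\<integral>\<^sup>+y. ennreal (kern r y * g y) \<partial>lborel)"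
      unfolding m_def by (rule nn_integral_eq_integral[OF gi, symmetric]) (simp add: g_def kern_nonneg)
    then show ?thesis using True by simp
  next
    case False
    then have p: "p = 2" using p by simp
    show ?thesis
    proof (cases "(\<integral>\<^sup>+y. ennreal (kern r y * (g y)\<^sup>2) \<partial>lborel) = \<infinity>")
      case fin: False
      have gi2: "integrable lborel (\<lambda>y. kern r y * (g y)\<^sup>2)"
        using fin by (intro integrableI_bounded) (auto simp: kern_nonneg less_top g_def)
      have pt: "2 * m * (kern r y * g y) - m\<^sup>2 * kern r y \<le> kern r y * (g y)\<^sup>2" for y
      proof -
        have "0 \<le> kern r y * (g y - m)\<^sup>2" using kern_nonneg by simp
        then show ?thesis by (simp add: power2_eq_square algebra_simps)
      qed
      have "m\<^sup>2 = (LINT y|lborel. 2 * m * (kern r y * g y) - m\<^sup>2 * kern r y)"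
        using gi kern_integral[OF r] by (simp add: Bochner_Integration.integral_diff m_def[symmetric] power2_eq_square)
      also have "\<dots> \<le> (LINT y|lborel. kern r y * (g y)\<^sup>2)"
        by (intro integral_mono gi2 pt Bochner_Integration.integrable_diff integrable_mult_right gi kern_integral[OF r])
      finally have "ennreal (m\<^sup>2) \<le> ennreal (LINT y|lborel. kern r y * (g y)\<^sup>2)" by (rule ennreal_leI)
      also have "\<dots> = (\<integral>\<^sup>+y. ennreal (kern r y * (g y)\<^sup>2) \<partial>lborel)"
        by (rule nn_integral_eq_integral[OF gi2, symmetric]) (simp add: kern_nonneg)
      finally show ?thesis by (simp add: p)
    qed (simp add: p)
  qed
  with 1 show ?thesis by (simp add: g_def ennreal_mult kern_nonneg) (meson ennreal_leI order_trans)
qed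

text \<open>
  By Jensen's inequality and Fubini's theorem, the error is an average of the translation moduli of \<open>f\<close> over
  shifts of length at most \<open>r\<close>.
\<close>
theorem conv_kern_Lp:
  assumes f: "integrable lborel f" and fp: "(\<integral>\<^sup>+z. ennreal (cmod (f z) ^ p) \<partial>lborel) < \<infinity>" and p: "p = 1 \<or> p = (2::nat)"
  shows "((\<lambda>r. \<integral>\<^sup>+z. ennreal (cmod (conv (kern r) f z - f z) ^ p) \<partial>lborel) \<longlongrightarrow> 0) (at_right 0)"
proof (rule order_tendstoI)
  fix e :: ennreal assume "0 < e"
  then obtain x where x: "0 < x" "x < e" using dense by blast
  then obtain e' where "e' \<ge> 0" "x = ennreal e'" by (cases x) auto
  with x have e': "e' > 0" "ennreal e' < e" by auto
  obtain d where d: "d > 0" "\<And>h. cmod h < d \<Longrightarrow> translation_modulus p f h \<le> ennreal e'"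
    using translation_modulus_L1[OF f e'(1)] translation_modulus_L2[OF f _ e'(1)] fp p by auto
  have [measurable]: "f \<in> borel_measurable borel" using f by auto
  show "\<forall>\<^sub>F r in at_right 0. (\<integral>\<^sup>+z. ennreal (cmod (conv (kern r) f z - f z) ^ p) \<partial>lborel) < e"
    unfolding eventually_at_right_field
  proof (intro exI[of _ d] conjI allI impI d(1))
    fix r assume r: "0 < r" "r < d"
    have [measurable]: "kern r \<in> borel_measurable borel" using bump_kern[OF r(1)] by auto
    have "(\<integral>\<^sup>+z. ennreal (cmod (conv (kern r) f z - f z) ^ p) \<partial>lborel) \<le>
       (\<integral>\<^sup>+z. \<integral>\<^sup>+y. ennreal (kern r y) * ennreal (cmod (f (z - y) - f z) ^ p) \<partial>lborel \<partial>lborel)"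
      by (intro nn_integral_mono conv_kern_jensen r f p)
    also have "\<dots> = (\<integral>\<^sup>+y. \<integral>\<^sup>+z. ennreal (kern r y) * ennreal (cmod (f (z - y) - f z) ^ p) \<partial>lborel \<partial>lborel)"
      by (rule lborel_pair.Fubini') simp
    also have "\<dots> = (\<integral>\<^sup>+y. ennreal (kern r y) * translation_modulus p f y \<partial>lborel)"
      unfolding translation_modulus_def by (simp add: nn_integral_cmult)
    also have "\<dots> \<le> (\<integral>\<^sup>+y. ennreal (kern r y) * ennreal e' \<partial>lborel)"
    proof (intro nn_integral_mono)
      fix y
      show "ennreal (kern r y) * translation_modulus p f y \<le> ennreal (kern r y) * ennreal e'"
        using kern_support[OF r(1), of y] d(2)[of y] r by (cases "kern r y = 0") (auto intro!: mult_left_mono)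
    qed
    also have "\<dots> = ennreal e'" by (simp add: nn_integral_multc kern_integral[OF r(1)])
    finally show "(\<integral>\<^sup>+z. ennreal (cmod (conv (kern r) f z - f z) ^ p) \<partial>lborel) < e" using e' by simp
  qed
qed simp

section \<open>Convergence in mean\<close>

text \<open>
  A density instead of a restricted space: measurability then always refers to the whole plane, whatever the
  set, and functions can be composed and moved between sets freely.
\<close>
definition lborel_on :: "complex set \<Rightarrow> complex measure" where
  "lborel_on R = density lborel (\<lambda>z. ennreal (indicator R z))"

lemma sets_lborel_on[measurable_cong, simp]: "sets (lborel_on R) = sets borel"
  by (simp add: lborel_on_def)

lemma space_lborel_on[simp]: "space (lborel_on R) = UNIV"
  by (simp add: lborel_on_def)

lemma AE_lborel_on:
  assumes "R \<in> sets borel"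
  shows "(AE z in lborel_on R. P z) \<longleftrightarrow> (AE z in lborel. z \<in> R \<longrightarrow> P z)"
  using assms unfolding lborel_on_def by (subst AE_density) (auto simp: indicator_def)

lemma nn_integral_lborel_on:
  assumes "R \<in> sets borel" "f \<in> borel_measurable borel"
  shows "(\<integral>\<^sup>+z. f z \<partial>lborel_on R) = (\<integral>\<^sup>+z. indicator R z * f z \<partial>lborel)"
  using assms unfolding lborel_on_def by (subst nn_integral_density) (auto simp: ennreal_indicator)

lemma emeasure_lborel_on:
  assumes "R \<in> sets borel" "A \<in> sets borel"
  shows "emeasure (lborel_on R) A = emeasure lborel (R \<inter> A)"
  using assms unfolding lborel_on_def
  by (subst emeasure_density) (auto simp: ennreal_indicator indicator_inter_arith[symmetric])

lemma integral_lborel_on: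
  fixes f :: "complex \<Rightarrow> 'a::{banach, second_countable_topology}"
  assumes "R \<in> sets borel" "f \<in> borel_measurable borel"
  shows "integral\<^sup>L (lborel_on R) f = (LINT z:R|lborel. f z)"
  using assms unfolding lborel_on_def set_lebesgue_integral_def by (subst integral_density) auto

lemma integrable_lborel_on:
  fixes f :: "complex \<Rightarrow> 'a::{banach, second_countable_topology}"
  assumes "R \<in> sets borel" "f \<in> borel_measurable borel"
  shows "integrable (lborel_on R) f \<longleftrightarrow> integrable lborel (\<lambda>z. indicator R z *\<^sub>R f z)"
  using assms unfolding lborel_on_def by (subst integrable_density) auto

lemma integrable_lborel_on_continuous:
  fixes f :: "complex \<Rightarrow> 'a::{banach, second_countable_topology}"
  assumes "compact R" "continuous_on UNIV f"
  shows "integrable (lborel_on R) f"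
  using assms
  by (subst integrable_lborel_on)
     (auto intro!: borel_integrable_compact continuous_on_subset[OF assms(2)] borel_measurable_continuous_onI simp: borel_compact)

lemma lborel_on_mono:
  assumes "R \<subseteq> K" "R \<in> sets borel" "K \<in> sets borel" "f \<in> borel_measurable borel"
  shows "(\<integral>\<^sup>+z. f z \<partial>lborel_on R) \<le> (\<integral>\<^sup>+z. f z \<partial>lborel_on K)"
  using assms by (subst (1 2) nn_integral_lborel_on) (auto intro!: nn_integral_mono simp: indicator_def)

text \<open>
  Split \<open>g' h' - g h\<close> as \<open>g' (h' - h) + (g' - g) h\<close>: the first factor is bounded, and dominated convergence
  takes care of the second term.
\<close>
lemma L1_limit_mult:
  fixes g h :: "'a \<Rightarrow> complex"
  assumes [measurable]: "\<And>n. g' n \<in> borel_measurable M" "g \<in> borel_measurable M" "\<And>n. h' n \<in> borel_measurable M"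
    and g: "AE z in M. (\<lambda>n. g' n z) \<longlonglongrightarrow> g z" and B: "B \<ge> 0" "\<And>n. AE z in M. cmod (g' n z) \<le> B"
    and h: "(\<lambda>n. \<integral>\<^sup>+z. ennreal (cmod (h' n z - h z)) \<partial>M) \<longlonglongrightarrow> 0" and hi: "integrable M h"
  shows "(\<lambda>n. \<integral>\<^sup>+z. ennreal (cmod (g' n z * h' n z - g z * h z)) \<partial>M) \<longlonglongrightarrow> 0"
proof (rule tendsto_sandwich[OF _ _ tendsto_const])
  have [measurable]: "h \<in> borel_measurable M" using hi by auto
  have 1: "(\<lambda>n. \<integral>\<^sup>+z. ennreal (cmod (g z * h z - g' n z * h z)) \<partial>M) \<longlonglongrightarrow> 0"
  proof (rule nn_integral_dominated_convergence_norm[where w="\<lambda>z. B * cmod (h z)"])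
    show "AE z in M. cmod (g' n z * h z) \<le> B * cmod (h z)" for n
      using B(2)[of n] by eventually_elim (simp add: norm_mult mult_right_mono)
    show "AE z in M. (\<lambda>n. g' n z * h z) \<longlonglongrightarrow> g z * h z"
      using g by eventually_elim (intro tendsto_intros)
    have "integrable M (\<lambda>z. B * cmod (h z))" using hi by auto
    then show "(\<integral>\<^sup>+ z. ennreal (B * cmod (h z)) \<partial>M) < \<infinity>"
      using B by (subst nn_integral_eq_integral) auto
  qed auto
  show "(\<lambda>n. ennreal B * (\<integral>\<^sup>+z. ennreal (cmod (h' n z - h z)) \<partial>M) + (\<integral>\<^sup>+z. ennreal (cmod (g z * h z - g' n z * h z)) \<partial>M)) \<longlonglongrightarrow> 0"
    using tendsto_add[OF ennreal_tendsto_cmult[OF _ h, of "ennreal B"] 1] by simp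
  show "\<forall>\<^sub>F n in sequentially. (\<integral>\<^sup>+z. ennreal (cmod (g' n z * h' n z - g z * h z)) \<partial>M) \<le>
      ennreal B * (\<integral>\<^sup>+z. ennreal (cmod (h' n z - h z)) \<partial>M) + (\<integral>\<^sup>+z. ennreal (cmod (g z * h z - g' n z * h z)) \<partial>M)"
  proof (intro always_eventually allI)
    fix n
    have "(\<integral>\<^sup>+z. ennreal (cmod (g' n z * h' n z - g z * h z)) \<partial>M) \<le>
       (\<integral>\<^sup>+z. ennreal B * ennreal (cmod (h' n z - h z)) + ennreal (cmod (g z * h z - g' n z * h z)) \<partial>M)"
    proof (intro nn_integral_mono_AE, use B(2)[of n] in eventually_elim)
      fix z assume z: "cmod (g' n z) \<le> B"
      have "g' n z * h' n z - g z * h z = g' n z * (h' n z - h z) - (g z * h z - g' n z * h z)" by (simp add: algebra_simps)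
      then have "cmod (g' n z * h' n z - g z * h z) \<le> cmod (g' n z) * cmod (h' n z - h z) + cmod (g z * h z - g' n z * h z)"
        by (metis norm_triangle_ineq4 norm_mult)
      also have "\<dots> \<le> B * cmod (h' n z - h z) + cmod (g z * h z - g' n z * h z)"
        using z by (intro add_right_mono mult_right_mono) auto
      finally show "ennreal (cmod (g' n z * h' n z - g z * h z)) \<le> ennreal B * ennreal (cmod (h' n z - h z)) + ennreal (cmod (g z * h z - g' n z * h z))"
        using B by (simp flip: ennreal_mult ennreal_plus add: ennreal_leI)
    qed
    also have "\<dots> = ennreal B * (\<integral>\<^sup>+z. ennreal (cmod (h' n z - h z)) \<partial>M) + (\<integral>\<^sup>+z. ennreal (cmod (g z * h z - g' n z * h z)) \<partial>M)"
      by (simp add: nn_integral_add nn_integral_cmult)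
    finally show "(\<integral>\<^sup>+z. ennreal (cmod (g' n z * h' n z - g z * h z)) \<partial>M) \<le> \<dots>" .
  qed
qed auto

text \<open>
  Cauchy-Schwarz in the form \<open>A B \<le> A\<^sup>2 / t + t B\<^sup>2\<close>, where \<open>t\<close> is so small that the second term
  contributes at most half of the tolerance.
\<close>
lemma nn_integral_mult_tendsto_0:
  fixes A :: "nat \<Rightarrow> 'a \<Rightarrow> real"
  assumes [measurable]: "\<And>n. A n \<in> borel_measurable M" "B \<in> borel_measurable M"
    and nn: "\<And>n z. A n z \<ge> 0" "\<And>z. B z \<ge> 0"
    and A: "(\<lambda>n. \<integral>\<^sup>+z. ennreal ((A n z)\<^sup>2) \<partial>M) \<longlonglongrightarrow> 0" and B: "(\<integral>\<^sup>+z. ennreal ((B z)\<^sup>2) \<partial>M) < \<infinity>"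
  shows "(\<lambda>n. \<integral>\<^sup>+z. ennreal (A n z * B z) \<partial>M) \<longlonglongrightarrow> 0"
proof (rule order_tendstoI)
  fix e :: ennreal assume "0 < e"
  then obtain x where x: "0 < x" "x < e" using dense by blast
  then obtain e' where "e' \<ge> 0" "x = ennreal e'" by (cases x) auto
  with x have e': "e' > 0" "ennreal e' < e" by auto
  obtain I where I: "I \<ge> 0" "(\<integral>\<^sup>+z. ennreal ((B z)\<^sup>2) \<partial>M) = ennreal I"
    using B by (cases "\<integral>\<^sup>+z. ennreal ((B z)\<^sup>2) \<partial>M") auto
  define t where "t = e' / (2 * (I + 1))"
  have t: "t > 0" using e' I by (simp add: t_def)
  have "t * I = e' / 2 * (I / (I + 1))" using I by (simp add: t_def)
  also have "\<dots> \<le> e' / 2 * 1" using e' I by (intro mult_left_mono) auto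
  finally have tI: "t * I \<le> e' / 2" by simp
  have "\<forall>\<^sub>F n in sequentially. (\<integral>\<^sup>+z. ennreal ((A n z)\<^sup>2) \<partial>M) < ennreal (t * e' / 2)"
    using A t e' by (auto intro: order_tendstoD)
  then show "\<forall>\<^sub>F n in sequentially. (\<integral>\<^sup>+z. ennreal (A n z * B z) \<partial>M) < e"
  proof eventually_elim
    fix n assume n: "(\<integral>\<^sup>+z. ennreal ((A n z)\<^sup>2) \<partial>M) < ennreal (t * e' / 2)"
    have "(\<integral>\<^sup>+z. ennreal (A n z * B z) \<partial>M) \<le> (\<integral>\<^sup>+z. ennreal (1/t) * ennreal ((A n z)\<^sup>2) + ennreal t * ennreal ((B z)\<^sup>2) \<partial>M)"
    proof (intro nn_integral_mono)
      fix z
      have "0 \<le> (A n z / sqrt t - sqrt t * B z)\<^sup>2" by simp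
      also have "\<dots> = (1/t) * (A n z)\<^sup>2 + t * (B z)\<^sup>2 - 2 * (A n z * B z)"
        using t by (simp add: power2_diff power_divide power_mult_distrib)
      finally have "2 * (A n z * B z) \<le> (1/t) * (A n z)\<^sup>2 + t * (B z)\<^sup>2" by simp
      moreover have "A n z * B z \<le> 2 * (A n z * B z)" using nn by simp
      ultimately have "A n z * B z \<le> (1/t) * (A n z)\<^sup>2 + t * (B z)\<^sup>2" by linarith
      then have "ennreal (A n z * B z) \<le> ennreal ((1/t) * (A n z)\<^sup>2 + t * (B z)\<^sup>2)" by (rule ennreal_leI)
      also have "\<dots> = ennreal (1/t) * ennreal ((A n z)\<^sup>2) + ennreal t * ennreal ((B z)\<^sup>2)"
        using t by (simp only: ennreal_plus[symmetric] ennreal_mult[symmetric] mult_nonneg_nonneg zero_le_power2 less_imp_le divide_nonneg_pos zero_le_one)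
      finally show "ennreal (A n z * B z) \<le> \<dots>" .
    qed
    also have "\<dots> = ennreal (1/t) * (\<integral>\<^sup>+z. ennreal ((A n z)\<^sup>2) \<partial>M) + ennreal t * ennreal I"
      by (simp only: I(2)[symmetric]) (simp add: nn_integral_add nn_integral_cmult)
    also have "\<dots> \<le> ennreal (1/t) * ennreal (t * e' / 2) + ennreal t * ennreal I"
      using n by (intro add_right_mono mult_left_mono) auto
    also have "\<dots> = ennreal (e'/2 + t * I)"
    proof -
      have "ennreal (1/t) * ennreal (t * e' / 2) = ennreal ((1/t) * (t * e' / 2))"
        using t e' by (intro ennreal_mult[symmetric]) auto
      moreover have "ennreal t * ennreal I = ennreal (t * I)" using t I by (intro ennreal_mult[symmetric]) auto
      ultimately show ?thesis using t e' I by (simp add: ennreal_plus[symmetric] del: ennreal_plus)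
    qed
    also have "\<dots> \<le> ennreal e'" using tI by (intro ennreal_leI) simp
    finally show "(\<integral>\<^sup>+z. ennreal (A n z * B z) \<partial>M) < e" using e' by simp
  qed
qed simp

lemma mult_le_sum_squares: "x \<ge> 0 \<Longrightarrow> y \<ge> 0 \<Longrightarrow> x * y \<le> x\<^sup>2 + y\<^sup>2" for x y :: real
  using sum_squares_bound[of x y] mult_nonneg_nonneg[of x y] by linarith

lemma L2_limit_mult:
  fixes a b :: "'a \<Rightarrow> complex"
  assumes [measurable]: "\<And>n. a' n \<in> borel_measurable M" "a \<in> borel_measurable M" "\<And>n. b' n \<in> borel_measurable M" "b \<in> borel_measurable M"
    and a: "(\<lambda>n. \<integral>\<^sup>+z. ennreal ((cmod (a' n z - a z))\<^sup>2) \<partial>M) \<longlonglongrightarrow> 0" "(\<integral>\<^sup>+z. ennreal ((cmod (a z))\<^sup>2) \<partial>M) < \<infinity>"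
    and b: "(\<lambda>n. \<integral>\<^sup>+z. ennreal ((cmod (b' n z - b z))\<^sup>2) \<partial>M) \<longlonglongrightarrow> 0" "(\<integral>\<^sup>+z. ennreal ((cmod (b z))\<^sup>2) \<partial>M) < \<infinity>"
  shows "(\<lambda>n. \<integral>\<^sup>+z. ennreal (cmod (a' n z * b' n z - a z * b z)) \<partial>M) \<longlonglongrightarrow> 0"
proof (rule tendsto_sandwich[OF _ _ tendsto_const])
  define x where "x n z = cmod (a' n z - a z)" for n z
  define y where "y n z = cmod (b' n z - b z)" for n z
  have [measurable]: "x n \<in> borel_measurable M" "y n \<in> borel_measurable M" for n unfolding x_def[abs_def] y_def[abs_def] by measurable
  have nn: "x n z \<ge> 0" "y n z \<ge> 0" for n z by (auto simp: x_def y_def)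
  have 1: "(\<lambda>n. \<integral>\<^sup>+z. ennreal (x n z * cmod (b z)) \<partial>M) \<longlonglongrightarrow> 0"
    by (rule nn_integral_mult_tendsto_0) (use a b nn in \<open>auto simp: x_def\<close>)
  have 2: "(\<lambda>n. \<integral>\<^sup>+z. ennreal (y n z * cmod (a z)) \<partial>M) \<longlonglongrightarrow> 0"
    by (rule nn_integral_mult_tendsto_0) (use a b nn in \<open>auto simp: y_def\<close>)
  show "(\<lambda>n. (\<integral>\<^sup>+z. ennreal ((x n z)\<^sup>2) \<partial>M) + (\<integral>\<^sup>+z. ennreal ((y n z)\<^sup>2) \<partial>M) +
      ((\<integral>\<^sup>+z. ennreal (x n z * cmod (b z)) \<partial>M) + (\<integral>\<^sup>+z. ennreal (y n z * cmod (a z)) \<partial>M))) \<longlonglongrightarrow> 0"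
    using tendsto_add[OF tendsto_add[OF a(1) b(1)] tendsto_add[OF 1 2]] unfolding x_def y_def by simp
  show "\<forall>\<^sub>F n in sequentially. (\<integral>\<^sup>+z. ennreal (cmod (a' n z * b' n z - a z * b z)) \<partial>M) \<le>
     (\<integral>\<^sup>+z. ennreal ((x n z)\<^sup>2) \<partial>M) + (\<integral>\<^sup>+z. ennreal ((y n z)\<^sup>2) \<partial>M) +
      ((\<integral>\<^sup>+z. ennreal (x n z * cmod (b z)) \<partial>M) + (\<integral>\<^sup>+z. ennreal (y n z * cmod (a z)) \<partial>M))"
  proof (intro always_eventually allI)
    fix n
    have pt: "cmod (a' n z * b' n z - a z * b z) \<le> (x n z)\<^sup>2 + (y n z)\<^sup>2 + (x n z * cmod (b z) + y n z * cmod (a z))" for z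
    proof -
      have "a' n z * b' n z - a z * b z = (a' n z - a z) * (b' n z - b z) + ((a' n z - a z) * b z + a z * (b' n z - b z))"
        by (simp add: algebra_simps)
      then have "cmod (a' n z * b' n z - a z * b z) \<le> x n z * y n z + (x n z * cmod (b z) + y n z * cmod (a z))"
        using order_trans[OF norm_triangle_ineq add_left_mono[OF norm_triangle_ineq], of "(a' n z - a z) * (b' n z - b z)" "(a' n z - a z) * b z" "a z * (b' n z - b z)"]
        by (simp add: x_def y_def norm_mult mult.commute)
      moreover have "x n z * y n z \<le> (x n z)\<^sup>2 + (y n z)\<^sup>2"
        by (rule mult_le_sum_squares) (rule nn)+
      ultimately show ?thesis by linarith
    qed
    have "(\<integral>\<^sup>+z. ennreal (cmod (a' n z * b' n z - a z * b z)) \<partial>M) \<le>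
      (\<integral>\<^sup>+z. ennreal ((x n z)\<^sup>2) + ennreal ((y n z)\<^sup>2) + (ennreal (x n z * cmod (b z)) + ennreal (y n z * cmod (a z))) \<partial>M)"
      using nn by (intro nn_integral_mono) (simp flip: ennreal_plus add: ennreal_leI pt)
    also have "\<dots> = (\<integral>\<^sup>+z. ennreal ((x n z)\<^sup>2) \<partial>M) + (\<integral>\<^sup>+z. ennreal ((y n z)\<^sup>2) \<partial>M) +
      ((\<integral>\<^sup>+z. ennreal (x n z * cmod (b z)) \<partial>M) + (\<integral>\<^sup>+z. ennreal (y n z * cmod (a z)) \<partial>M))"
      by (simp add: nn_integral_add)
    finally show "(\<integral>\<^sup>+z. ennreal (cmod (a' n z * b' n z - a z * b z)) \<partial>M) \<le> \<dots>" .
  qed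
qed auto

text \<open>
  The coefficient of the wedge product of two one-forms depends continuously on them, from \<open>L\<^sup>2\<close> to \<open>L\<^sup>1\<close>.
\<close>
lemma L2_limit_wedge:
  fixes a b c d :: "'a \<Rightarrow> complex"
  assumes [measurable]: "\<And>n. a' n \<in> borel_measurable M" "a \<in> borel_measurable M" "\<And>n. b' n \<in> borel_measurable M" "b \<in> borel_measurable M"
      "\<And>n. c' n \<in> borel_measurable M" "c \<in> borel_measurable M" "\<And>n. d' n \<in> borel_measurable M" "d \<in> borel_measurable M"
    and a: "(\<lambda>n. \<integral>\<^sup>+z. ennreal ((cmod (a' n z - a z))\<^sup>2) \<partial>M) \<longlonglongrightarrow> 0" "(\<integral>\<^sup>+z. ennreal ((cmod (a z))\<^sup>2) \<partial>M) < \<infinity>"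
    and b: "(\<lambda>n. \<integral>\<^sup>+z. ennreal ((cmod (b' n z - b z))\<^sup>2) \<partial>M) \<longlonglongrightarrow> 0" "(\<integral>\<^sup>+z. ennreal ((cmod (b z))\<^sup>2) \<partial>M) < \<infinity>"
    and c: "(\<lambda>n. \<integral>\<^sup>+z. ennreal ((cmod (c' n z - c z))\<^sup>2) \<partial>M) \<longlonglongrightarrow> 0" "(\<integral>\<^sup>+z. ennreal ((cmod (c z))\<^sup>2) \<partial>M) < \<infinity>"
    and d: "(\<lambda>n. \<integral>\<^sup>+z. ennreal ((cmod (d' n z - d z))\<^sup>2) \<partial>M) \<longlonglongrightarrow> 0" "(\<integral>\<^sup>+z. ennreal ((cmod (d z))\<^sup>2) \<partial>M) < \<infinity>"
  shows "(\<lambda>n. \<integral>\<^sup>+z. ennreal (cmod ((a' n z * b' n z - c' n z * d' n z) - (a z * b z - c z * d z))) \<partial>M) \<longlonglongrightarrow> 0"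
proof (rule tendsto_sandwich[OF _ _ tendsto_const])
  have 1: "(\<lambda>n. \<integral>\<^sup>+z. ennreal (cmod (a' n z * b' n z - a z * b z)) \<partial>M) \<longlonglongrightarrow> 0"
    by (rule L2_limit_mult) (use a b in auto)
  have 2: "(\<lambda>n. \<integral>\<^sup>+z. ennreal (cmod (c' n z * d' n z - c z * d z)) \<partial>M) \<longlonglongrightarrow> 0"
    by (rule L2_limit_mult) (use c d in auto)
  show "(\<lambda>n. (\<integral>\<^sup>+z. ennreal (cmod (a' n z * b' n z - a z * b z)) \<partial>M) + (\<integral>\<^sup>+z. ennreal (cmod (c' n z * d' n z - c z * d z)) \<partial>M)) \<longlonglongrightarrow> 0"
    using tendsto_add[OF 1 2] by simp
  show "\<forall>\<^sub>F n in sequentially. (\<integral>\<^sup>+z. ennreal (cmod ((a' n z * b' n z - c' n z * d' n z) - (a z * b z - c z * d z))) \<partial>M) \<le>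
      (\<integral>\<^sup>+z. ennreal (cmod (a' n z * b' n z - a z * b z)) \<partial>M) + (\<integral>\<^sup>+z. ennreal (cmod (c' n z * d' n z - c z * d z)) \<partial>M)"
  proof (intro always_eventually allI)
    fix n
    have "cmod ((a' n z * b' n z - c' n z * d' n z) - (a z * b z - c z * d z)) \<le> cmod (a' n z * b' n z - a z * b z) + cmod (c' n z * d' n z - c z * d z)" for z
      using norm_triangle_ineq4[of "a' n z * b' n z - a z * b z" "c' n z * d' n z - c z * d z"] by (simp add: algebra_simps)
    then show "(\<integral>\<^sup>+z. ennreal (cmod ((a' n z * b' n z - c' n z * d' n z) - (a z * b z - c z * d z))) \<partial>M) \<le>
        (\<integral>\<^sup>+z. ennreal (cmod (a' n z * b' n z - a z * b z)) \<partial>M) + (\<integral>\<^sup>+z. ennreal (cmod (c' n z * d' n z - c z * d z)) \<partial>M)"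
      by (subst nn_integral_add[symmetric]) (auto intro!: nn_integral_mono simp flip: ennreal_plus simp: ennreal_leI)
  qed
qed auto

lemma integrable_mult_L2:
  fixes a b :: "'a \<Rightarrow> complex"
  assumes [measurable]: "a \<in> borel_measurable M" "b \<in> borel_measurable M"
    and "(\<integral>\<^sup>+z. ennreal ((cmod (a z))\<^sup>2) \<partial>M) < \<infinity>" "(\<integral>\<^sup>+z. ennreal ((cmod (b z))\<^sup>2) \<partial>M) < \<infinity>"
  shows "integrable M (\<lambda>z. a z * b z)"
proof (rule integrableI_bounded)
  have "(\<integral>\<^sup>+z. ennreal (cmod (a z * b z)) \<partial>M) \<le> (\<integral>\<^sup>+z. ennreal ((cmod (a z))\<^sup>2) + ennreal ((cmod (b z))\<^sup>2) \<partial>M)"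
  proof (intro nn_integral_mono)
    fix z
    have "cmod (a z * b z) \<le> (cmod (a z))\<^sup>2 + (cmod (b z))\<^sup>2"
      unfolding norm_mult by (rule mult_le_sum_squares) auto
    then show "ennreal (cmod (a z * b z)) \<le> ennreal ((cmod (a z))\<^sup>2) + ennreal ((cmod (b z))\<^sup>2)"
      by (simp flip: ennreal_plus add: ennreal_leI)
  qed
  also have "\<dots> < \<infinity>" using assms(3,4) by (simp add: nn_integral_add)
  finally show "(\<integral>\<^sup>+z. ennreal (cmod (a z * b z)) \<partial>M) < \<infinity>" .
qed simp

section \<open>Weak gradients\<close>

text \<open>
  Local integrability for an everywhere defined Borel function. Lebesgue measurability would be too weak: it
  is lost under composition with a homeomorphism.
\<close>
definition loc_Lp :: "nat \<Rightarrow> complex set \<Rightarrow> (complex \<Rightarrow> complex) \<Rightarrow> bool" where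
  "loc_Lp s \<Omega> f \<longleftrightarrow> f \<in> borel_measurable borel \<and>
     (\<forall>K. compact K \<and> K \<subseteq> \<Omega> \<longrightarrow> (\<integral>\<^sup>+z. ennreal (cmod (f z) ^ s) \<partial>lborel_on K) < \<infinity>)"

lemma loc_Lp_measurable[measurable_dest]: "loc_Lp s \<Omega> f \<Longrightarrow> f \<in> borel_measurable borel"
  by (simp add: loc_Lp_def)

lemma loc_Lp_finite: "loc_Lp s \<Omega> f \<Longrightarrow> compact K \<Longrightarrow> K \<subseteq> \<Omega> \<Longrightarrow> (\<integral>\<^sup>+z. ennreal (cmod (f z) ^ s) \<partial>lborel_on K) < \<infinity>"
  by (simp add: loc_Lp_def)

lemma emeasure_lborel_on_compact: "compact K \<Longrightarrow> emeasure (lborel_on K) UNIV < \<infinity>"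
  using emeasure_compact_finite[of K] by (simp add: emeasure_lborel_on borel_compact)

lemma loc_L2_imp_L1:
  assumes "loc_Lp 2 \<Omega> f" shows "loc_Lp 1 \<Omega> f"
  unfolding loc_Lp_def
proof (intro conjI allI impI)
  show [measurable]: "f \<in> borel_measurable borel" using assms by auto
  fix K assume K: "compact K \<and> K \<subseteq> \<Omega>"
  have "(\<integral>\<^sup>+z. ennreal (cmod (f z) ^ 1) \<partial>lborel_on K) \<le> (\<integral>\<^sup>+z. 1 + ennreal ((cmod (f z))\<^sup>2) \<partial>lborel_on K)"
  proof (intro nn_integral_mono)
    fix z
    have "cmod (f z) ^ 1 \<le> 1 + (cmod (f z))\<^sup>2" using mult_le_sum_squares[of "cmod (f z)" 1] by simp
    then have "ennreal (cmod (f z) ^ 1) \<le> ennreal (1 + (cmod (f z))\<^sup>2)" by (rule ennreal_leI)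
    also have "\<dots> = 1 + ennreal ((cmod (f z))\<^sup>2)" by simp
    finally show "ennreal (cmod (f z) ^ 1) \<le> \<dots>" .
  qed
  also have "\<dots> = emeasure (lborel_on K) UNIV + (\<integral>\<^sup>+z. ennreal ((cmod (f z))\<^sup>2) \<partial>lborel_on K)"
    by (simp add: nn_integral_add)
  also have "\<dots> < \<infinity>" using emeasure_lborel_on_compact[of K] loc_Lp_finite[OF assms, of K] K by simp
  finally show "(\<integral>\<^sup>+z. ennreal (cmod (f z) ^ 1) \<partial>lborel_on K) < \<infinity>" .
qed

lemma loc_Lp_continuous:
  assumes [measurable]: "f \<in> borel_measurable borel" and f: "continuous_on \<Omega> f"
  shows "loc_Lp s \<Omega> f"
  unfolding loc_Lp_def
proof (intro conjI allI impI)
  fix K assume K: "compact K \<and> K \<subseteq> \<Omega>"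
  have "compact (f ` K)" using K continuous_on_subset[OF f] compact_continuous_image by blast
  then obtain B where B: "B > 0" "\<And>z. z \<in> K \<Longrightarrow> cmod (f z) \<le> B" using compact_imp_bounded bounded_pos by (metis imageI)
  have [measurable]: "K \<in> sets borel" using K by (auto simp: borel_compact)
  have "(\<integral>\<^sup>+z. ennreal (cmod (f z) ^ s) \<partial>lborel_on K) \<le> (\<integral>\<^sup>+z. ennreal (B ^ s) \<partial>lborel_on K)"
    by (intro nn_integral_mono_AE) (auto simp: AE_lborel_on intro!: AE_I2 ennreal_leI power_mono B)
  also have "\<dots> = ennreal (B ^ s) * emeasure (lborel_on K) UNIV" by simp
  also have "\<dots> < \<infinity>" using emeasure_lborel_on_compact[of K] K by (simp add: ennreal_mult_less_top)
  finally show "(\<integral>\<^sup>+z. ennreal (cmod (f z) ^ s) \<partial>lborel_on K) < \<infinity>" .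
qed simp

definition cut :: "complex set \<Rightarrow> (complex \<Rightarrow> complex) \<Rightarrow> complex \<Rightarrow> complex" where
  "cut K f z = indicator K z *\<^sub>R f z"

lemma cut_in[simp]: "z \<in> K \<Longrightarrow> cut K f z = f z" by (simp add: cut_def)

lemma cut_finite:
  assumes "loc_Lp s \<Omega> f" "compact K" "K \<subseteq> \<Omega>" "s \<noteq> 0"
  shows "(\<integral>\<^sup>+z. ennreal (cmod (cut K f z) ^ s) \<partial>lborel) < \<infinity>"
proof -
  have [measurable]: "f \<in> borel_measurable borel" "K \<in> sets borel" using assms by (auto simp: borel_compact)
  have "(\<integral>\<^sup>+z. ennreal (cmod (cut K f z) ^ s) \<partial>lborel) = (\<integral>\<^sup>+z. ennreal (cmod (f z) ^ s) \<partial>lborel_on K)"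
    using assms(4) by (subst nn_integral_lborel_on) (auto intro!: nn_integral_cong simp: cut_def indicator_def)
  then show ?thesis using loc_Lp_finite[OF assms(1-3)] by simp
qed

lemma cut_integrable:
  assumes "loc_Lp 1 \<Omega> f" "compact K" "K \<subseteq> \<Omega>"
  shows "integrable lborel (cut K f)"
proof (rule integrableI_bounded)
  have [measurable]: "f \<in> borel_measurable borel" "K \<in> sets borel" using assms by (auto simp: borel_compact)
  show "cut K f \<in> borel_measurable lborel" unfolding cut_def[abs_def] by measurable
  show "(\<integral>\<^sup>+z. ennreal (cmod (cut K f z)) \<partial>lborel) < \<infinity>" using cut_finite[OF assms] by simp
qed

text \<open>
  Test functions come with their partial derivatives as arguments and are taken from the certified class,
  which contains the translated and reflected kernels.
\<close>
definition test_in :: "complex set \<Rightarrow> (complex \<Rightarrow> real) \<Rightarrow> (complex \<Rightarrow> real) \<Rightarrow> (complex \<Rightarrow> real) \<Rightarrow> bool" where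
  "test_in \<Omega> \<eta> \<eta>x \<eta>y \<longleftrightarrow> smooth_plane \<eta> \<and> has_grad \<eta> \<eta>x \<eta>y \<and>
     (\<exists>K. compact K \<and> K \<subseteq> \<Omega> \<and> (\<forall>z. z \<notin> K \<longrightarrow> \<eta> z = 0 \<and> \<eta>x z = 0 \<and> \<eta>y z = 0))"

definition weak_grad :: "complex set \<Rightarrow> (complex \<Rightarrow> complex) \<Rightarrow> (complex \<Rightarrow> complex) \<Rightarrow> (complex \<Rightarrow> complex) \<Rightarrow> bool" where
  "weak_grad \<Omega> f p q \<longleftrightarrow> (\<forall>\<eta> \<eta>x \<eta>y. test_in \<Omega> \<eta> \<eta>x \<eta>y \<longrightarrow>
      (LINT z|lborel. \<eta>x z *\<^sub>R f z) = - (LINT z|lborel. \<eta> z *\<^sub>R p z) \<and>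
      (LINT z|lborel. \<eta>y z *\<^sub>R f z) = - (LINT z|lborel. \<eta> z *\<^sub>R q z))"

lemma smooth_plane_reflect:
  assumes "smooth_plane f" shows "smooth_plane (\<lambda>z. f (a - z))"
  using assms
proof (induction rule: smooth_plane.induct)
  case Re
  have "smooth_plane (\<lambda>z. Re a + (-1) * Re z)"
    by (intro smooth_plane.add smooth_plane.mult smooth_plane.const smooth_plane.Re)
  then show ?case by simp
next
  case Im
  have "smooth_plane (\<lambda>z. Im a + (-1) * Im z)"
    by (intro smooth_plane.add smooth_plane.mult smooth_plane.const smooth_plane.Im)
  then show ?case by simp
next
  case (comp h f)
  then show ?case using smooth_plane.comp[of h "\<lambda>z. f (a - z)"] by simp
qed (auto intro: smooth_plane.const smooth_plane.add smooth_plane.mult)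

lemma has_grad_reflect:
  assumes "has_grad f p q"
  shows "has_grad (\<lambda>z. f (a - z)) (\<lambda>z. - p (a - z)) (\<lambda>z. - q (a - z))"
proof (rule has_gradI)
  have c: "continuous_on UNIV (\<lambda>z. a - z)" by (intro continuous_intros)
  have "((\<lambda>z. a - z) has_derivative (\<lambda>h. - h)) (at z)" for z by (auto intro!: derivative_eq_intros)
  then show "((\<lambda>z. f (a - z)) has_derivative grad_map (- p (a - z)) (- q (a - z))) (at z)" for z
    by (rule has_derivative_eq_rhs[OF has_derivative_compose[OF _ has_gradD(1)[OF assms]]])
       (simp add: grad_map_def fun_eq_iff)
  show "continuous_on UNIV (\<lambda>z. - p (a - z))" "continuous_on UNIV (\<lambda>z. - q (a - z))"
    by (intro continuous_on_minus continuous_on_compose_UNIV[OF _ c] has_gradD[OF assms])+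
qed

lemma test_in_bump:
  assumes "bump r k" "has_grad k p q" "bump r p" "bump r q" "cball a r \<subseteq> \<Omega>"
  shows "test_in \<Omega> (\<lambda>z. k (a - z)) (\<lambda>z. - p (a - z)) (\<lambda>z. - q (a - z))"
  unfolding test_in_def
proof (intro conjI exI[of _ "cball a r"] allI impI)
  fix z assume "z \<notin> cball a r"
  then show "k (a - z) = 0" "- p (a - z) = 0" "- q (a - z) = 0"
    using assms unfolding bump_def by (auto simp: dist_norm not_le)
qed (use assms in \<open>auto simp: bump_def intro: smooth_plane_reflect has_grad_reflect\<close>)

text \<open>
  The reflected kernel around \<open>z\<close> is itself a test function, so differentiating the mollification is the
  same as mollifying the weak derivative.
\<close>
lemma conv_weak_grad:
  assumes w: "weak_grad \<Omega> f p q" and k: "bump r k" "has_grad k kx ky" "bump r kx" "bump r ky"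
    and z: "cball z r \<subseteq> K" "K \<subseteq> \<Omega>"
  shows "conv kx (cut K f) z = conv k (cut K p) z" "conv ky (cut K f) z = conv k (cut K q) z"
proof -
  have b: "b (z - y) *\<^sub>R cut K g y = b (z - y) *\<^sub>R g y" if "bump r b" for b g y
  proof (cases "b (z - y) = 0")
    case False
    then have "y \<in> cball z r" using that by (auto simp: bump_def dist_norm)
    then show ?thesis using z by auto
  qed simp
  have t: "test_in \<Omega> (\<lambda>y. k (z - y)) (\<lambda>y. - kx (z - y)) (\<lambda>y. - ky (z - y))"
    using test_in_bump[OF k] z by blast
  have "(LINT y|lborel. - kx (z - y) *\<^sub>R f y) = - (LINT y|lborel. k (z - y) *\<^sub>R p y) \<and>
      (LINT y|lborel. - ky (z - y) *\<^sub>R f y) = - (LINT y|lborel. k (z - y) *\<^sub>R q y)"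
    using w t unfolding weak_grad_def by blast
  then show "conv kx (cut K f) z = conv k (cut K p) z" "conv ky (cut K f) z = conv k (cut K q) z"
    unfolding conv_def b[OF k(1)] b[OF k(3)] b[OF k(4)] by simp_all
qed

lemma compact_tube:
  fixes R :: "complex set"
  assumes "compact R" shows "compact (\<Union>x\<in>R. cball x e)"
proof -
  have K: "(\<Union>x\<in>R. cball x e) = {x + y |x y. x \<in> R \<and> y \<in> cball 0 e}"
  proof (intro equalityI subsetI)
    fix z assume "z \<in> (\<Union>x\<in>R. cball x e)"
    then obtain x where "x \<in> R" "z \<in> cball x e" by blast
    then show "z \<in> {x + y |x y. x \<in> R \<and> y \<in> cball 0 e}"
      by (intro CollectI exI[of _ x] exI[of _ "z - x"]) (auto simp: dist_norm norm_minus_commute)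
  next
    fix z assume "z \<in> {x + y |x y. x \<in> R \<and> y \<in> cball 0 e}"
    then obtain x y where "z = x + y" "x \<in> R" "cmod y \<le> e" by auto
    then show "z \<in> (\<Union>x\<in>R. cball x e)" by (intro UN_I[of x]) (simp_all add: dist_norm)
  qed
  show ?thesis unfolding K by (rule compact_sums[OF assms compact_cball])
qed

lemma compact_neighbourhood:
  assumes "compact R" "R \<subseteq> \<Omega>" "open \<Omega>"
  obtains K e where "compact K" "K \<subseteq> (\<Omega> :: complex set)" "e > 0" "\<And>z. z \<in> R \<Longrightarrow> cball z e \<subseteq> K"
proof (cases "R = {}")
  case True
  then show thesis using that[of "{}" 1] by simp
next
  case False
  obtain e where e: "e > 0" "(\<Union>x\<in>R. cball x e) \<subseteq> \<Omega>"
    using compact_subset_open_imp_cball_epsilon_subset[OF assms(1,3,2)] by blast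
  then show thesis using that[OF compact_tube[OF assms(1)], of e e] by blast
qed

text \<open>
  Cut \<open>f\<close> off to a compact neighbourhood of \<open>R\<close> and mollify. For radii below the distance from \<open>R\<close> to the
  complement of the neighbourhood, the cut is not noticed at points of \<open>R\<close>.
\<close>
theorem smooth_approximation:
  assumes \<Omega>: "open \<Omega>" and R: "compact R" "R \<subseteq> \<Omega>" and w: "weak_grad \<Omega> f p q"
    and f: "loc_Lp 1 \<Omega> f" and p: "loc_Lp 1 \<Omega> p" "loc_Lp s \<Omega> p" and q: "loc_Lp 1 \<Omega> q" "loc_Lp s \<Omega> q"
    and s: "s = 1 \<or> s = 2"
  obtains F P Q where "\<And>n::nat. C2_map (F n) (P n) (Q n)"
    "(\<lambda>n. \<integral>\<^sup>+z. ennreal (cmod (P n z - p z) ^ s) \<partial>lborel_on R) \<longlonglongrightarrow> 0"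
    "(\<lambda>n. \<integral>\<^sup>+z. ennreal (cmod (Q n z - q z) ^ s) \<partial>lborel_on R) \<longlonglongrightarrow> 0"
    "(\<lambda>n. \<integral>\<^sup>+z. ennreal (cmod (F n z - f z)) \<partial>lborel_on R) \<longlonglongrightarrow> 0"
    "continuous_on \<Omega> f \<Longrightarrow> uniform_limit R F f sequentially"
proof -
  obtain K e where K: "compact K" "K \<subseteq> \<Omega>" "e > 0" "\<And>z. z \<in> R \<Longrightarrow> cball z e \<subseteq> K"
    using compact_neighbourhood[OF R \<Omega>] by blast
  have RK: "R \<subseteq> K" using K(3,4) by force
  define r where "r n = e / (real n + 1)" for n
  have r: "r n > 0" "r n \<le> e" for n using K(3) by (auto simp: r_def divide_le_eq mult_left_mono[of 1] algebra_simps)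
  have r0: "filterlim r (at_right 0) sequentially"
  proof -
    have "r \<longlonglongrightarrow> 0" unfolding r_def[abs_def] using LIMSEQ_inverse_real_of_nat[THEN tendsto_mult_left, of e]
      by (simp add: divide_inverse add.commute)
    moreover have "r n \<noteq> 0" for n using r(1)[of n] by simp
    ultimately show ?thesis using r(1) by (simp add: filterlim_at)
  qed
  have ci: "integrable lborel (cut K f)" "integrable lborel (cut K p)" "integrable lborel (cut K q)"
    using cut_integrable f p q K by blast+
  have [measurable]: "R \<in> sets borel" "K \<in> sets borel" "f \<in> borel_measurable borel" "p \<in> borel_measurable borel" "q \<in> borel_measurable borel"
    using R K f p q by (auto simp: borel_compact)
  have "\<forall>n. \<exists>p' q'. C2_map (conv (kern (r n)) (cut K f)) (conv p' (cut K f)) (conv q' (cut K f)) \<and>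
      has_grad (kern (r n)) p' q' \<and> bump (r n) p' \<and> bump (r n) q'"
    using conv_kern_C2[OF r(1) ci(1)] by metis
  then obtain kx ky where k: "\<And>n. C2_map (conv (kern (r n)) (cut K f)) (conv (kx n) (cut K f)) (conv (ky n) (cut K f))"
      "\<And>n. has_grad (kern (r n)) (kx n) (ky n)" "\<And>n. bump (r n) (kx n)" "\<And>n. bump (r n) (ky n)"
    by metis
  have on_R: "conv (kx n) (cut K f) z = conv (kern (r n)) (cut K p) z"
       "conv (ky n) (cut K f) z = conv (kern (r n)) (cut K q) z" if "z \<in> R" for n z
    using that K(2) r(2)[of n] K(4)[OF that] by (intro conv_weak_grad[OF w bump_kern[OF r(1)] k(2-4)]; force)+
  have cm: "conv (kern (r n)) (cut K g) \<in> borel_measurable borel" if "integrable lborel (cut K g)" for n g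
    by (rule borel_measurable_continuous_onI[OF conv_continuous[OF bump_kern[OF r(1)] that]])
  have lim: "(\<lambda>n. \<integral>\<^sup>+z. ennreal (cmod (G n z - g z) ^ t) \<partial>lborel_on R) \<longlonglongrightarrow> 0"
    if g: "loc_Lp 1 \<Omega> g" "loc_Lp t \<Omega> g" and t: "t = 1 \<or> t = 2" and G: "\<And>n z. z \<in> R \<Longrightarrow> G n z = conv (kern (r n)) (cut K g) z"
      "\<And>n. G n \<in> borel_measurable borel" for g G t
  proof (rule tendsto_sandwich[OF _ _ tendsto_const])
    have [measurable]: "g \<in> borel_measurable borel" "G n \<in> borel_measurable borel" for n using g G by auto
    have gi: "integrable lborel (cut K g)" using cut_integrable g K by blast
    note [measurable] = cm[OF gi]
    have gf: "(\<integral>\<^sup>+z. ennreal (cmod (cut K g z) ^ t) \<partial>lborel) < \<infinity>"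
      using cut_finite[OF g(2) K(1,2)] t by auto
    show "(\<lambda>n. \<integral>\<^sup>+z. ennreal (cmod (conv (kern (r n)) (cut K g) z - cut K g z) ^ t) \<partial>lborel) \<longlonglongrightarrow> 0"
      by (rule filterlim_compose[OF conv_kern_Lp[OF gi gf t] r0])
    show "\<forall>\<^sub>F n in sequentially. (\<integral>\<^sup>+z. ennreal (cmod (G n z - g z) ^ t) \<partial>lborel_on R) \<le>
        (\<integral>\<^sup>+z. ennreal (cmod (conv (kern (r n)) (cut K g) z - cut K g z) ^ t) \<partial>lborel)"
      by (intro always_eventually allI, subst nn_integral_lborel_on)
        (auto intro!: nn_integral_mono simp: G(1) cut_def subsetD[OF RK] indicator_def)
  qed auto
  show thesis
  proof (rule that[of "\<lambda>n. conv (kern (r n)) (cut K f)" "\<lambda>n. conv (kx n) (cut K f)" "\<lambda>n. conv (ky n) (cut K f)"])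
    show "(\<lambda>n. \<integral>\<^sup>+z. ennreal (cmod (conv (kern (r n)) (cut K f) z - f z)) \<partial>lborel_on R) \<longlonglongrightarrow> 0"
      using lim[OF f f, of "\<lambda>n. conv (kern (r n)) (cut K f)"] cm[OF ci(1)] by simp
    show "(\<lambda>n. \<integral>\<^sup>+z. ennreal (cmod (conv (kx n) (cut K f) z - p z) ^ s) \<partial>lborel_on R) \<longlonglongrightarrow> 0"
      by (rule lim[OF p s on_R(1)]) (auto intro: borel_measurable_continuous_onI conv_continuous[OF k(3) ci(1)])
    show "(\<lambda>n. \<integral>\<^sup>+z. ennreal (cmod (conv (ky n) (cut K f) z - q z) ^ s) \<partial>lborel_on R) \<longlonglongrightarrow> 0"
      by (rule lim[OF q s on_R(2)]) (auto intro: borel_measurable_continuous_onI conv_continuous[OF k(4) ci(1)])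
    assume cf: "continuous_on \<Omega> f"
    show "uniform_limit R (\<lambda>n. conv (kern (r n)) (cut K f)) f sequentially"
      unfolding uniform_limit_iff
    proof (intro allI impI)
      fix d :: real assume d: "d > 0"
      have "uniformly_continuous_on K f"
        using compact_uniformly_continuous[OF continuous_on_subset[OF cf K(2)] K(1)] .
      then obtain d' where d': "d' > 0" "\<And>x y. x \<in> K \<Longrightarrow> y \<in> K \<Longrightarrow> dist y x < d' \<Longrightarrow> dist (f y) (f x) < d/2"
        unfolding uniformly_continuous_on_def using d half_gt_zero by metis
      have "\<forall>\<^sub>F n in sequentially. r n < d'"
        using r0 d'(1) by (auto simp: filterlim_at intro: order_tendstoD)
      then show "\<forall>\<^sub>F n in sequentially. \<forall>x\<in>R. dist (conv (kern (r n)) (cut K f) x) (f x) < d"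
      proof eventually_elim
        fix n assume n: "r n < d'"
        show "\<forall>x\<in>R. dist (conv (kern (r n)) (cut K f) x) (f x) < d"
        proof
          fix x assume x: "x \<in> R"
          then have xK: "x \<in> K" using RK by blast
          have "cmod (conv (kern (r n)) (cut K f) x - cut K f x) \<le> d/2"
          proof (rule conv_kern_close[OF r(1) ci(1)])
            fix y assume y: "cmod (y - x) \<le> r n"
            then have "y \<in> cball x e" using r(2)[of n] by (simp add: dist_norm norm_minus_commute)
            then have "y \<in> K" using K(4)[OF x] by blast
            then show "cmod (cut K f y - cut K f x) \<le> d/2"
              using d'(2)[OF xK, of y] xK y n by (simp add: dist_norm)
          qed
          then show "dist (conv (kern (r n)) (cut K f) x) (f x) < d" using xK d by (simp add: dist_norm)
        qed
      qed
    qed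
  qed (rule k)
qed

section \<open>The area formula for planar Sobolev homeomorphisms\<close>

text \<open>
  The determinant with columns \<open>p\<close> and \<open>q\<close>, that is, the Jacobian of a map with these partial derivatives.
\<close>
definition jac :: "(complex \<Rightarrow> complex) \<Rightarrow> (complex \<Rightarrow> complex) \<Rightarrow> complex \<Rightarrow> real" where
  "jac p q z = Im (cnj (p z) * q z)"

lemma jac_eq: "cnj (p z) * q z - cnj (q z) * p z = 2 * \<i> * of_real (jac p q z)"
  by (simp add: jac_def complex_eq_iff)

lemma borel_measurable_cnj[measurable]: "cnj \<in> borel_measurable borel"
  by (intro borel_measurable_continuous_onI continuous_intros)

lemma borel_measurable_jac[measurable]:
  "p \<in> borel_measurable M \<Longrightarrow> q \<in> borel_measurable M \<Longrightarrow> jac p q \<in> borel_measurable M"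
  unfolding jac_def[abs_def] by measurable

text \<open>
  By invariance of domain, \<open>u\<close> is a homeomorphism onto an open set.
\<close>
locale sobolev_homeo =
  fixes \<Omega> :: "complex set" and u p q :: "complex \<Rightarrow> complex"
  assumes open_dom: "open \<Omega>" and cont: "continuous_on \<Omega> u" and inj: "inj_on u \<Omega>"
    and measurable_u[measurable]: "u \<in> borel_measurable borel"
    and grad: "weak_grad \<Omega> u p q" and p_L2: "loc_Lp 2 \<Omega> p" and q_L2: "loc_Lp 2 \<Omega> q"
begin

lemma measurable_pq[measurable]: "p \<in> borel_measurable borel" "q \<in> borel_measurable borel"
  using p_L2 q_L2 by auto

lemma u_loc: "loc_Lp s \<Omega> u"
  using loc_Lp_continuous[OF measurable_u cont] .

lemma open_image: "open S \<Longrightarrow> S \<subseteq> \<Omega> \<Longrightarrow> open (u ` S)"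
  by (rule invariance_of_domain) (auto intro: continuous_on_subset[OF cont] inj_on_subset[OF inj])

lemma jac_integrable:
  assumes "cbox a b \<subseteq> \<Omega>" shows "integrable (lborel_on (cbox a b)) (jac p q)"
proof -
  have "integrable (lborel_on (cbox a b)) (\<lambda>z. cnj (p z) * q z)"
    by (rule integrable_mult_L2) (use loc_Lp_finite[OF p_L2 compact_cbox assms] loc_Lp_finite[OF q_L2 compact_cbox assms] in auto)
  then show ?thesis unfolding jac_def[abs_def] by (rule integrable_Im)
qed

text \<open>
  The image of the boundary is a Jordan curve. It separates the image of the open rectangle from the complement
  of the image of the closed one; both sets are open, so the component of \<open>c\<close> stays in the former and is
  bounded. Thus \<open>c\<close> lies inside the curve.
\<close>
lemma winding_number_image_rectpath:
  assumes R: "cbox a b \<subseteq> \<Omega>" and c: "c \<in> u ` box a b"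
  shows "cmod (winding_number (u \<circ> rectpath a b) c) = 1"
proof -
  let ?F = "cbox a b - box a b"
  have "box a b \<noteq> {}" using c by auto
  then have ab: "Re a < Re b" "Im a < Im b"
    by (auto simp: in_box_complex_iff)
  have pim: "path_image (rectpath a b) = ?F" using ab by (intro path_image_rectpath_cbox_minus_box) auto
  have sub: "box a b \<subseteq> cbox a b" by (rule box_subset_cbox)
  have simple: "simple_path (u \<circ> rectpath a b)"
    by (rule simple_path_continuous_image)
       (use ab R pim in \<open>auto intro!: simple_path_rectpath continuous_on_subset[OF cont] inj_on_subset[OF inj]\<close>)
  have pim': "path_image (u \<circ> rectpath a b) = u ` ?F" by (simp add: path_image_compose pim)
  have disj: "u ` box a b \<inter> u ` ?F = {}"
    using inj R sub by (subst inj_on_image_Int[OF inj, symmetric]) auto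
  have "c \<in> inside (u ` ?F)"
    unfolding inside_def
  proof (intro CollectI conjI)
    show "c \<notin> u ` ?F" using c disj by blast
    let ?W = "u ` box a b"
    have oW: "open ?W" using sub R by (intro open_image) auto
    have comp: "compact (u ` cbox a b)" using R by (intro compact_continuous_image continuous_on_subset[OF cont]) auto
    let ?C = "connected_component_set (- (u ` ?F)) c"
    have "?C \<subseteq> ?W"
    proof (rule ccontr)
      assume n: "\<not> ?C \<subseteq> ?W"
      have C1: "?C \<subseteq> ?W \<union> - (u ` cbox a b)"
        using connected_component_subset[of "- (u ` ?F)" c] by auto
      have "?W \<inter> - (u ` cbox a b) \<inter> ?C = {}" using sub by auto
      moreover have "connected ?C" by (rule connected_connected_component)
      moreover have "open (- (u ` cbox a b))" using comp by (simp add: compact_imp_closed open_Compl)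
      ultimately have "?W \<inter> ?C = {} \<or> - (u ` cbox a b) \<inter> ?C = {}"
        using oW C1 by (intro connectedD) 
      moreover have "c \<in> ?C" using c disj by (simp add: disjoint_iff)
      ultimately show False using c n C1 by blast
    qed
    moreover have "bounded ?W" using comp sub by (meson bounded_subset compact_imp_bounded image_mono)
    ultimately show "bounded ?C" using bounded_subset by blast
  qed
  then have "c \<in> inside (path_image (u \<circ> rectpath a b))" by (simp add: pim')
  then show ?thesis
    using simple_closed_path_norm_winding_number_inside[OF simple] by (simp add: pathstart_compose pathfinish_compose)
qed

text \<open>
  The smooth degree formula holds for the mollifications of \<open>u\<close>. In the limit the Jacobians converge in \<open>L\<^sup>1\<close>,
  the bounded factors converge pointwise, and the winding number is eventually constant because the boundary
  curves converge uniformly.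
\<close>
theorem degree_identity:
  assumes R: "cbox a b \<subseteq> \<Omega>" and r: "r > 0" and c: "cball c r \<subseteq> u ` box a b"
  shows "\<bar>LINT z|lborel_on (cbox a b). kern r (u z - c) * jac p q z\<bar> = 1"
proof -
  let ?R = "cbox a b" and ?F = "cbox a b - box a b"
  have cin: "c \<in> u ` box a b" using c r by (auto simp: subset_iff)
  then have "box a b \<noteq> {}" by auto
  then have ab: "Re a < Re b" "Im a < Im b" by (auto simp: in_box_complex_iff)
  have sub: "box a b \<subseteq> ?R" by (rule box_subset_cbox)
  have pim: "path_image (rectpath a b) = ?F" using ab by (intro path_image_rectpath_cbox_minus_box) auto
  obtain U P Q where U: "\<And>n::nat. C2_map (U n) (P n) (Q n)"
    "(\<lambda>n. \<integral>\<^sup>+z. ennreal ((cmod (P n z - p z))\<^sup>2) \<partial>lborel_on ?R) \<longlonglongrightarrow> 0"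
    "(\<lambda>n. \<integral>\<^sup>+z. ennreal ((cmod (Q n z - q z))\<^sup>2) \<partial>lborel_on ?R) \<longlonglongrightarrow> 0"
    "(\<lambda>n. \<integral>\<^sup>+z. ennreal (cmod (U n z - u z)) \<partial>lborel_on ?R) \<longlonglongrightarrow> 0"
    "continuous_on \<Omega> u \<Longrightarrow> uniform_limit ?R U u sequentially"
    by (rule smooth_approximation[OF open_dom compact_cbox R grad u_loc loc_L2_imp_L1[OF p_L2] p_L2 loc_L2_imp_L1[OF q_L2] q_L2]) auto
  note Uu = U(5)[OF cont]
  have Ug: "has_grad (U n) (P n) (Q n)" for n using U(1) by (simp add: C2_map_def)
  have Uc: "continuous_on UNIV (U n)" "continuous_on UNIV (P n)" "continuous_on UNIV (Q n)" for n
    using has_gradD[OF Ug] by auto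
  have [measurable]: "U n \<in> borel_measurable borel" "P n \<in> borel_measurable borel" "Q n \<in> borel_measurable borel" for n
    using Uc by (auto intro: borel_measurable_continuous_onI)
  have [measurable]: "kern r \<in> borel_measurable borel" using bump_kern[OF r] by auto
  have far: "cmod (u z - c) > r" if "z \<in> ?F" for z
  proof (rule ccontr)
    assume "\<not> cmod (u z - c) > r"
    then have "u z \<in> cball c r" by (simp add: dist_norm norm_minus_commute)
    then have "u z \<in> u ` box a b" using c by blast
    then show False using that inj R sub by (auto dest!: inj_onD[OF inj])
  qed
  \<comment> \<open>By compactness the image of the boundary has a margin \<open>d\<close> to the disc, so a map closer than \<open>d\<close> to \<open>u\<close>
      still sends the boundary outside the disc.\<close>
  obtain d where d: "d > 0" "\<And>z. z \<in> ?F \<Longrightarrow> cmod (u z - c) \<ge> r + d"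
  proof -
    have cF: "compact ?F" by (intro compact_diff compact_cbox open_box)
    have neF: "a \<in> ?F" using ab by (simp add: in_cbox_complex_iff in_box_complex_iff)
    have "continuous_on ?F (\<lambda>z. cmod (u z - c))" using R by (intro continuous_intros continuous_on_subset[OF cont]) auto
    from continuous_attains_inf[OF cF _ this] neF obtain z0 where z0: "z0 \<in> ?F" "\<And>z. z \<in> ?F \<Longrightarrow> cmod (u z0 - c) \<le> cmod (u z - c)" by blast
    then show thesis using that[of "cmod (u z0 - c) - r"] far[OF z0(1)] by auto
  qed
  define h' where "h' n z = cnj (P n z) * Q n z - cnj (Q n z) * P n z" for n z
  define h where "h z = cnj (p z) * q z - cnj (q z) * p z" for z
  define g' where "g' n z = complex_of_real (kern r (U n z - c))" for n z
  define g where "g z = complex_of_real (kern r (u z - c))" for z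
  have [measurable]: "h' n \<in> borel_measurable borel" "h \<in> borel_measurable borel"
     "g' n \<in> borel_measurable borel" "g \<in> borel_measurable borel" for n
    unfolding h'_def[abs_def] h_def[abs_def] g'_def[abs_def] g_def[abs_def] by measurable
  have fp: "(\<integral>\<^sup>+z. ennreal ((cmod (p z))\<^sup>2) \<partial>lborel_on ?R) < \<infinity>" "(\<integral>\<^sup>+z. ennreal ((cmod (q z))\<^sup>2) \<partial>lborel_on ?R) < \<infinity>"
    using loc_Lp_finite[OF p_L2 compact_cbox R] loc_Lp_finite[OF q_L2 compact_cbox R] by auto
  have hi: "integrable (lborel_on ?R) h"
    unfolding h_def[abs_def]
    by (intro Bochner_Integration.integrable_diff integrable_mult_L2) (use fp in auto)
  have hl: "(\<lambda>n. \<integral>\<^sup>+z. ennreal (cmod (h' n z - h z)) \<partial>lborel_on ?R) \<longlonglongrightarrow> 0"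
  proof -
    have e: "cmod (cnj x - cnj y) = cmod (x - y)" for x y by (metis complex_cnj_diff complex_mod_cnj)
    show ?thesis unfolding h'_def h_def
      by (rule L2_limit_wedge) (use fp U(2,3) in \<open>auto simp: e\<close>)
  qed
  obtain B where B: "B \<ge> 0" "\<And>z. \<bar>kern r z\<bar> \<le> B" using bump_bounded[OF bump_kern[OF r]] by blast
  have kc: "isCont (kern r) z" for z using smooth_plane_continuous[OF smooth_plane_kern, of UNIV r] by (simp add: continuous_on_eq_continuous_at)
  have gl: "(\<lambda>n. g' n z) \<longlonglongrightarrow> g z" if "z \<in> ?R" for z
    unfolding g'_def g_def
    by (intro tendsto_intros isCont_tendsto_compose[OF kc] tendsto_uniform_limitI[OF Uu that])
  have conv: "(\<lambda>n. \<integral>\<^sup>+z. ennreal (cmod (g' n z * h' n z - g z * h z)) \<partial>lborel_on ?R) \<longlonglongrightarrow> 0"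
    by (rule L1_limit_mult[where B=B]) (use gl B hl hi in \<open>auto simp: AE_lborel_on g'_def\<close>)
  have "(\<lambda>n. LINT z|lborel_on ?R. g' n z * h' n z) \<longlonglongrightarrow> (LINT z|lborel_on ?R. g z * h z)"
  proof (rule tendsto_L1_int[OF _ _ conv])
    show "integrable (lborel_on ?R) (\<lambda>z. g' n z * h' n z)" for n
    proof (rule integrable_lborel_on_continuous[OF compact_cbox])
      have "continuous_on UNIV (\<lambda>z. U n z - c)" by (intro continuous_intros Uc)
      from continuous_on_compose_UNIV[OF smooth_plane_continuous[OF smooth_plane_kern] this]
      show "continuous_on UNIV (\<lambda>z. g' n z * h' n z)" unfolding g'_def h'_def
        by (intro continuous_on_mult continuous_on_diff continuous_on_cnj continuous_on_of_real Uc)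
    qed
    show "integrable (lborel_on ?R) (\<lambda>z. g z * h z)"
      by (rule Bochner_Integration.integrable_bound[of _ "\<lambda>z. B * cmod (h z)"])
         (use hi B in \<open>auto simp: norm_mult g_def intro!: AE_I2 mult_right_mono\<close>)
  qed
  then have lim1: "(\<lambda>n. cmod (LINT z|lborel_on ?R. g' n z * h' n z)) \<longlonglongrightarrow> cmod (LINT z|lborel_on ?R. g z * h z)" by (rule tendsto_norm)
  have ev: "\<forall>\<^sub>F n in sequentially. cmod (LINT z|lborel_on ?R. g' n z * h' n z) = 2"
  proof -
    have "\<forall>\<^sub>F n in sequentially. \<forall>z\<in>?R. dist (U n z) (u z) < d"
      using Uu d(1) unfolding uniform_limit_iff by blast
    then show ?thesis
    proof eventually_elim
      fix n assume n: "\<forall>z\<in>?R. dist (U n z) (u z) < d"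
      have farU: "cmod (U n z - c) \<ge> r" if "z \<in> ?F" for z
      proof -
        have "cmod (u z - c) \<le> cmod (U n z - c) + dist (U n z) (u z)"
          by (metis add.commute dist_norm norm_minus_commute norm_triangle_sub dist_triangle2 dist_commute)
        moreover have "z \<in> ?R" using that by blast
        ultimately show ?thesis using n d(2)[OF that] by fastforce
      qed
      have "(LINT z|lborel_on ?R. g' n z * h' n z) = 2 * \<i> * winding_number (U n \<circ> rectpath a b) c"
        using integral_radial_kern_compose[OF U(1) less_imp_le[OF ab(1)] less_imp_le[OF ab(2)] r farU]
        by (subst integral_lborel_on) (auto simp: g'_def h'_def)
      also have "winding_number (U n \<circ> rectpath a b) c = winding_number (u \<circ> rectpath a b) c"
      proof (rule winding_number_nearby_loops_eq)
        have "path_image (rectpath a b) \<subseteq> ?R" using pim by blast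
        then show "path (u \<circ> rectpath a b)" "path (U n \<circ> rectpath a b)"
          using R by (auto intro!: path_continuous_image continuous_on_subset[OF cont] continuous_on_subset[OF Uc(1)])
        fix t :: real assume "t \<in> {0..1}"
        then have t: "rectpath a b t \<in> ?F" using pim by (auto simp: path_image_def)
        then have "dist (U n (rectpath a b t)) (u (rectpath a b t)) < d" using n by blast
        then show "cmod ((U n \<circ> rectpath a b) t - (u \<circ> rectpath a b) t) < cmod ((u \<circ> rectpath a b) t - c)"
          using d(2)[OF t] r by (simp add: dist_norm)
      qed (auto simp: pathstart_compose pathfinish_compose)
      finally show "cmod (LINT z|lborel_on ?R. g' n z * h' n z) = 2"
        using winding_number_image_rectpath[OF R cin] by (simp add: norm_mult)
    qed
  qed
  have "cmod (LINT z|lborel_on ?R. g z * h z) = 2"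
    by (rule LIMSEQ_unique[OF lim1 tendsto_eventually[OF ev]])
  moreover have "(LINT z|lborel_on ?R. g z * h z) = (LINT z|lborel_on ?R. (2 * \<i>) * complex_of_real (kern r (u z - c) * jac p q z))"
    by (intro Bochner_Integration.integral_cong) (simp_all add: g_def h_def jac_eq)
  moreover have "\<dots> = (2 * \<i>) * (LINT z|lborel_on ?R. complex_of_real (kern r (u z - c) * jac p q z))"
    by (rule integral_mult_right_zero)
  ultimately show ?thesis by (simp add: norm_mult integral_complex_of_real del: of_real_mult)
qed

end

lemma lborel_on_box: "lborel_on (box a b) = lborel_on (cbox a b)"
  unfolding lborel_on_def
proof (rule density_cong)
  have "emeasure lborel (cbox a b - box a b) = emeasure lborel (cbox a b) - emeasure lborel (box a b)"
    using emeasure_lborel_box_finite[of a b] by (intro emeasure_Diff) (auto simp: box_subset_cbox)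
  then have "emeasure lborel (cbox a b - box a b) = 0"
    using emeasure_lborel_cbox_finite[of a b] by (simp add: emeasure_lborel_box_eq emeasure_lborel_cbox_eq)
  then have "AE z in lborel. z \<notin> cbox a b - box a b"
    by (intro AE_not_in null_setsI) auto
  then show "AE z in lborel. ennreal (indicator (box a b) z) = ennreal (indicator (cbox a b) z)"
    using box_subset_cbox[of a b] by (auto simp: indicator_def)
qed auto

context sobolev_homeo
begin

lemma degree_integrable:
  assumes R: "cbox a b \<subseteq> \<Omega>" and r: "r > 0"
  shows "integrable (lborel_on (cbox a b)) (\<lambda>z. kern r (u z - c) * jac p q z)"
proof -
  obtain B where B: "B \<ge> 0" "\<And>z. \<bar>kern r z\<bar> \<le> B" using bump_bounded[OF bump_kern[OF r]] by blast
  have [measurable]: "kern r \<in> borel_measurable borel" using bump_kern[OF r] by auto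
  show ?thesis
    by (rule Bochner_Integration.integrable_bound[of _ "\<lambda>z. B * jac p q z"])
       (use jac_integrable[OF R] B in \<open>auto simp: abs_mult intro!: AE_I2 mult_right_mono\<close>)
qed

text \<open>
  Integrate the degree identity over \<open>c \<in> A\<close> and exchange the integrals. Replacing \<open>J\<close> by its absolute value
  can only increase the integral, and changes nothing when \<open>J \<ge> 0\<close>.
\<close>
lemma degree_average:
  assumes R: "cbox a b \<subseteq> \<Omega>" and r: "r > 0" and A[measurable]: "A \<in> sets borel" and Ar: "\<And>c. c \<in> A \<Longrightarrow> cball c r \<subseteq> u ` box a b"
  defines "W \<equiv> (\<integral>\<^sup>+z. ennreal \<bar>jac p q z\<bar> * (\<integral>\<^sup>+c. indicator A c * ennreal (kern r (u z - c)) \<partial>lborel) \<partial>lborel_on (cbox a b))"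
  shows "emeasure lborel A \<le> W"
    and "(AE z in lborel_on (cbox a b). jac p q z \<ge> 0) \<Longrightarrow> emeasure lborel A = W"
proof -
  have [measurable]: "kern r \<in> borel_measurable borel" using bump_kern[OF r] by auto
  define I where "I c = (\<integral>\<^sup>+z. ennreal (\<bar>kern r (u z - c) * jac p q z\<bar>) \<partial>lborel_on (cbox a b))" for c
  have I: "I c = (\<integral>\<^sup>+z. indicator (cbox a b) z * (ennreal \<bar>jac p q z\<bar> * ennreal (kern r (u z - c))) \<partial>lborel)" for c
    unfolding I_def by (subst nn_integral_lborel_on) (auto simp: abs_mult kern_nonneg ennreal_mult mult.commute intro!: nn_integral_cong)
  have "W = (\<integral>\<^sup>+z. indicator (cbox a b) z * (ennreal \<bar>jac p q z\<bar> * (\<integral>\<^sup>+c. indicator A c * ennreal (kern r (u z - c)) \<partial>lborel)) \<partial>lborel)"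
    unfolding W_def by (subst nn_integral_lborel_on) auto
  also have "\<dots> = (\<integral>\<^sup>+z. \<integral>\<^sup>+c. indicator (cbox a b) z * (ennreal \<bar>jac p q z\<bar> * (indicator A c * ennreal (kern r (u z - c)))) \<partial>lborel \<partial>lborel)"
    by (simp add: nn_integral_cmult)
  also have "\<dots> = (\<integral>\<^sup>+c. \<integral>\<^sup>+z. indicator (cbox a b) z * (ennreal \<bar>jac p q z\<bar> * (indicator A c * ennreal (kern r (u z - c)))) \<partial>lborel \<partial>lborel)"
    by (rule lborel_pair.Fubini') simp
  also have "\<dots> = (\<integral>\<^sup>+c. \<integral>\<^sup>+z. indicator A c * (indicator (cbox a b) z * (ennreal \<bar>jac p q z\<bar> * ennreal (kern r (u z - c)))) \<partial>lborel \<partial>lborel)"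
    by (simp add: ac_simps)
  also have "\<dots> = (\<integral>\<^sup>+c. indicator A c * I c \<partial>lborel)"
    unfolding I by (simp add: nn_integral_cmult)
  finally have W: "W = (\<integral>\<^sup>+c. indicator A c * I c \<partial>lborel)" .
  have A1: "emeasure lborel A = (\<integral>\<^sup>+c. indicator A c * 1 \<partial>lborel)" by simp
  have I1: "1 \<le> I c" if "c \<in> A" for c
  proof -
    have "ennreal (norm (LINT z|lborel_on (cbox a b). kern r (u z - c) * jac p q z)) \<le> I c"
      unfolding I_def using integral_norm_bound_ennreal[OF degree_integrable[OF R r]] by simp
    then show ?thesis using degree_identity[OF R r Ar[OF that]] by simp
  qed
  show "emeasure lborel A \<le> W" unfolding W A1
    by (intro nn_integral_mono) (use I1 in \<open>auto simp: indicator_def\<close>)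
  assume nn: "AE z in lborel_on (cbox a b). jac p q z \<ge> 0"
  have "I c = 1" if "c \<in> A" for c
  proof -
    have nn': "AE z in lborel_on (cbox a b). 0 \<le> kern r (u z - c) * jac p q z"
      using nn by eventually_elim (simp add: kern_nonneg)
    have "I c = (\<integral>\<^sup>+z. ennreal (kern r (u z - c) * jac p q z) \<partial>lborel_on (cbox a b))"
      unfolding I_def by (rule nn_integral_cong_AE) (use nn' in eventually_elim, simp)
    also have "\<dots> = ennreal (LINT z|lborel_on (cbox a b). kern r (u z - c) * jac p q z)"
      by (rule nn_integral_eq_integral[OF degree_integrable[OF R r] nn'])
    also have "(LINT z|lborel_on (cbox a b). kern r (u z - c) * jac p q z) = 1"
      using degree_identity[OF R r Ar[OF that]] integral_nonneg_AE[OF nn'] by simp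
    finally show ?thesis by simp
  qed
  then show "emeasure lborel A = W" unfolding W A1
    by (intro nn_integral_cong) (auto simp: indicator_def)
qed

text \<open>
  Let the scale \<open>r\<close> of the averaged identity tend to zero. The kernels centred in \<open>C\<close> sum up to at most the
  indicator of the closed \<open>r\<close>-neighbourhood \<open>T\<close> of \<open>C\<close>, and those centred in \<open>T\<close> to at least the indicator
  of \<open>C\<close>; the neighbourhoods shrink to \<open>C\<close>.
\<close>
lemma area_compact:
  assumes R: "cbox a b \<subseteq> \<Omega>" and C: "compact C" "C \<subseteq> u ` box a b"
  defines "W \<equiv> (\<integral>\<^sup>+z. ennreal \<bar>jac p q z\<bar> * indicator C (u z) \<partial>lborel_on (cbox a b))"
  shows "emeasure lborel C \<le> W"
    and "(AE z in lborel_on (cbox a b). jac p q z \<ge> 0) \<Longrightarrow> emeasure lborel C = W"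
proof -
  have oV: "open (u ` box a b)" using R box_subset_cbox[of a b] by (intro open_image) auto
  obtain K e where K: "compact K" "K \<subseteq> u ` box a b" "e > 0" "\<And>c. c \<in> C \<Longrightarrow> cball c e \<subseteq> K"
    using compact_neighbourhood[OF C oV] by blast
  define r where "r n = e / (real n + 1) / 2" for n
  have r: "r n > 0" "r n + r n \<le> e" for n using K(3) mult_left_mono[of 1 "real n + 1" e] by (auto simp: r_def divide_le_eq)
  have r0: "r \<longlonglongrightarrow> 0"
  proof -
    have "(\<lambda>n. (e/2) * inverse (real (Suc n))) \<longlonglongrightarrow> (e/2) * 0" by (intro tendsto_mult_left LIMSEQ_inverse_real_of_nat)
    moreover have "r = (\<lambda>n. (e/2) * inverse (real (Suc n)))" by (intro ext) (simp add: r_def field_simps)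
    ultimately show ?thesis by simp
  qed
  have rdec: "r n \<le> r m" if "m \<le> n" for m n using that K(3) by (auto simp: r_def intro!: divide_left_mono divide_right_mono)
  define T where "T n = (\<Union>c\<in>C. cball c (r n))" for n
  have Tc: "compact (T n)" for n unfolding T_def by (rule compact_tube[OF C(1)])
  have CT: "C \<subseteq> T n" for n using r(1)[of n] by (force simp: T_def)
  have [measurable]: "T n \<in> sets borel" "C \<in> sets borel" for n using Tc C by (auto simp: borel_compact)
  have kern_meas[measurable]: "kern (r n) \<in> borel_measurable borel" for n using bump_kern[OF r(1)] by auto
  have notT: "\<forall>\<^sub>F n in sequentially. \<zeta> \<notin> T n" if "\<zeta> \<notin> C" for \<zeta>
  proof -
    have "open (- C)" using C(1) by (simp add: compact_imp_closed open_Compl)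
    moreover have "\<zeta> \<in> - C" using that by simp
    ultimately obtain d where "d > 0" "ball \<zeta> d \<subseteq> - C" using open_contains_ball by metis
    then have d: "d > 0" "ball \<zeta> d \<inter> C = {}" by auto
    have "\<forall>\<^sub>F n in sequentially. r n < d" using r0 d(1) by (auto intro: order_tendstoD)
    then show ?thesis by eventually_elim (use d in \<open>auto simp: T_def dist_commute disjoint_iff\<close>)
  qed
  have k1: "(\<integral>\<^sup>+c. ennreal (kern (r n) (\<zeta> - c)) \<partial>lborel) = 1" for n \<zeta>
    using nn_integral_reflect[of "\<lambda>c. ennreal (kern (r n) c)" \<zeta>] kern_integral(3)[OF r(1)[of n]] by simp
  have ks: "dist c \<zeta> \<le> r n" if "kern (r n) (\<zeta> - c) \<noteq> 0" for n \<zeta> c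
    using kern_support[OF r(1) that] by (simp add: dist_norm norm_minus_commute)
  have inner_le: "(\<integral>\<^sup>+c. indicator C c * ennreal (kern (r n) (\<zeta> - c)) \<partial>lborel) \<le> indicator (T n) \<zeta>" for n \<zeta>
  proof (cases "\<zeta> \<in> T n")
    case True
    have "(\<integral>\<^sup>+c. indicator C c * ennreal (kern (r n) (\<zeta> - c)) \<partial>lborel) \<le> (\<integral>\<^sup>+c. ennreal (kern (r n) (\<zeta> - c)) \<partial>lborel)"
      by (intro nn_integral_mono) (auto simp: indicator_def)
    then show ?thesis using True k1 by simp
  next
    case False
    have "indicator C c * ennreal (kern (r n) (\<zeta> - c)) = 0" for c
      using ks[of n \<zeta> c] False by (cases "kern (r n) (\<zeta> - c) = 0") (auto simp: T_def)
    then have "(\<integral>\<^sup>+c. indicator C c * ennreal (kern (r n) (\<zeta> - c)) \<partial>lborel) = 0" by (simp only: nn_integral_const mult_zero_left)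
    then show ?thesis by simp
  qed
  have inner_ge: "indicator C \<zeta> \<le> (\<integral>\<^sup>+c. indicator (T n) c * ennreal (kern (r n) (\<zeta> - c)) \<partial>lborel)" for n \<zeta>
  proof (cases "\<zeta> \<in> C")
    case True
    have "indicator (T n) c * ennreal (kern (r n) (\<zeta> - c)) = ennreal (kern (r n) (\<zeta> - c))" for c
    proof (cases "kern (r n) (\<zeta> - c) = 0")
      case False
      then have "c \<in> T n" unfolding T_def using ks[of n \<zeta> c] True by (intro UN_I[of \<zeta>]) (auto simp: dist_commute)
      then show ?thesis by simp
    qed simp
    then show ?thesis using True k1 by simp
  qed simp
  have subK: "cball c (r n) \<subseteq> u ` box a b" if cT: "c \<in> T n" for c n
  proof -
    obtain c0 where c0: "c0 \<in> C" "dist c0 c \<le> r n" using cT by (auto simp: T_def)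
    have "cball c (r n) \<subseteq> cball c0 e"
    proof
      fix x assume "x \<in> cball c (r n)"
      then show "x \<in> cball c0 e" using c0(2) r(2)[of n] dist_triangle[of c0 x c] by simp
    qed
    then show ?thesis using K(2) K(4)[OF c0(1)] by blast
  qed
  show "emeasure lborel C \<le> W"
  proof (rule LIMSEQ_le_const)
    show "(\<lambda>n. \<integral>\<^sup>+z. ennreal \<bar>jac p q z\<bar> * indicator (T n) (u z) \<partial>lborel_on (cbox a b)) \<longlonglongrightarrow> W"
      unfolding W_def
    proof (rule nn_integral_dominated_convergence[where w="\<lambda>z. ennreal \<bar>jac p q z\<bar>"])
      show "(\<integral>\<^sup>+z. ennreal \<bar>jac p q z\<bar> \<partial>lborel_on (cbox a b)) < \<infinity>"
        using jac_integrable[OF R] by (simp add: integrable_iff_bounded)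
      show "AE z in lborel_on (cbox a b). (\<lambda>n. ennreal \<bar>jac p q z\<bar> * indicator (T n) (u z)) \<longlonglongrightarrow> ennreal \<bar>jac p q z\<bar> * indicator C (u z)"
      proof (intro AE_I2 tendsto_eventually)
        fix z
        show "\<forall>\<^sub>F n in sequentially. ennreal \<bar>jac p q z\<bar> * indicator (T n) (u z) = ennreal \<bar>jac p q z\<bar> * indicator C (u z)"
        proof (cases "u z \<in> C")
          case True
          then show ?thesis using CT by (intro always_eventually) (auto simp: subset_iff)
        next
          case False
          from notT[OF this] show ?thesis by eventually_elim (use False in simp)
        qed
      qed
    qed (auto simp: indicator_def)
    show "\<exists>N. \<forall>n\<ge>N. emeasure lborel C \<le> (\<integral>\<^sup>+z. ennreal \<bar>jac p q z\<bar> * indicator (T n) (u z) \<partial>lborel_on (cbox a b))"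
    proof (intro exI[of _ 0] allI impI)
      fix n
      have "emeasure lborel C \<le> (\<integral>\<^sup>+z. ennreal \<bar>jac p q z\<bar> * (\<integral>\<^sup>+c. indicator C c * ennreal (kern (r n) (u z - c)) \<partial>lborel) \<partial>lborel_on (cbox a b))"
        by (rule degree_average(1)[OF R r(1) \<open>C \<in> sets borel\<close> subK[OF subsetD[OF CT]]])
      also have "\<dots> \<le> (\<integral>\<^sup>+z. ennreal \<bar>jac p q z\<bar> * indicator (T n) (u z) \<partial>lborel_on (cbox a b))"
        by (intro nn_integral_mono mult_left_mono inner_le) auto
      finally show "emeasure lborel C \<le> \<dots>" .
    qed
  qed
  moreover assume nn: "AE z in lborel_on (cbox a b). jac p q z \<ge> 0"
  have "W \<le> emeasure lborel C"
  proof (rule LIMSEQ_le_const)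
    have "(\<lambda>n. emeasure lborel (T n)) \<longlonglongrightarrow> emeasure lborel (\<Inter>n. T n)"
    proof (rule Lim_emeasure_decseq)
      show "decseq T"
        unfolding decseq_def
      proof (intro allI impI)
        fix m n :: nat assume "m \<le> n"
        from rdec[OF this] show "T n \<subseteq> T m" unfolding T_def by (intro UN_mono subset_cball) auto
      qed
      show "emeasure lborel (T n) \<noteq> \<infinity>" for n using emeasure_compact_finite[OF Tc] by (simp add: less_top)
    qed auto
    moreover have "(\<Inter>n. T n) = C"
    proof (intro equalityI subsetI)
      fix \<zeta> assume z: "\<zeta> \<in> (\<Inter>n. T n)"
      show "\<zeta> \<in> C"
      proof (rule ccontr)
        assume "\<zeta> \<notin> C"
        from notT[OF this] z show False by (auto simp: eventually_sequentially)
      qed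
    qed (use CT in blast)
    ultimately show "(\<lambda>n. emeasure lborel (T n)) \<longlonglongrightarrow> emeasure lborel C" by (simp only:)
    show "\<exists>N. \<forall>n\<ge>N. W \<le> emeasure lborel (T n)"
    proof (intro exI[of _ 0] allI impI)
      fix n
      have "W \<le> (\<integral>\<^sup>+z. ennreal \<bar>jac p q z\<bar> * (\<integral>\<^sup>+c. indicator (T n) c * ennreal (kern (r n) (u z - c)) \<partial>lborel) \<partial>lborel_on (cbox a b))"
        unfolding W_def by (intro nn_integral_mono mult_left_mono inner_ge) auto
      also have "\<dots> = emeasure lborel (T n)"
        by (rule degree_average(2)[OF R r(1) \<open>T n \<in> sets borel\<close> subK nn, symmetric])
      finally show "W \<le> emeasure lborel (T n)" .
    qed
  qed
  ultimately show "emeasure lborel C = W" by (rule antisym)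
qed

lemma image_box_finite:
  assumes R: "cbox a b \<subseteq> \<Omega>"
  shows "emeasure lborel (u ` box a b) < \<infinity>"
proof -
  have c: "compact (u ` cbox a b)" using R by (intro compact_continuous_image continuous_on_subset[OF cont]) auto
  have "emeasure lborel (u ` box a b) \<le> emeasure lborel (u ` cbox a b)"
    using c box_subset_cbox[of a b] by (intro emeasure_mono) (auto simp: borel_compact)
  then show ?thesis using emeasure_compact_finite[OF c] by (rule order_le_less_trans)
qed

theorem area_inequality:
  assumes R: "cbox a b \<subseteq> \<Omega>" and A[measurable]: "A \<in> sets borel" and AV: "A \<subseteq> u ` box a b"
  shows "emeasure lborel A \<le> (\<integral>\<^sup>+z. ennreal \<bar>jac p q z\<bar> * indicator A (u z) \<partial>lborel_on (cbox a b))"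
proof (rule ennreal_le_epsilon)
  fix e :: real assume e: "e > 0"
  have oV: "open (u ` box a b)" using R box_subset_cbox[of a b] by (intro open_image) auto
  have "emeasure lborel A \<le> emeasure lborel (u ` box a b)" using AV oV by (intro emeasure_mono) (auto simp: borel_open)
  then have "emeasure lborel A < \<infinity>" using image_box_finite[OF R] by (rule order_le_less_trans)
  then obtain C where C: "compact C" "C \<subseteq> A" "emeasure lborel (A - C) < ennreal e"
    using inner_compact_lborel[OF A _ e] by blast
  have [measurable]: "C \<in> sets borel" using C by (simp add: borel_compact)
  have "emeasure lborel A = emeasure lborel (C \<union> (A - C))" using C by (simp add: Un_absorb1)
  also have "\<dots> \<le> emeasure lborel C + emeasure lborel (A - C)" by (intro emeasure_subadditive) auto
  also have "\<dots> \<le> (\<integral>\<^sup>+z. ennreal \<bar>jac p q z\<bar> * indicator C (u z) \<partial>lborel_on (cbox a b)) + ennreal e"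
    using C AV by (intro add_mono area_compact(1)[OF R]) auto
  also have "\<dots> \<le> (\<integral>\<^sup>+z. ennreal \<bar>jac p q z\<bar> * indicator A (u z) \<partial>lborel_on (cbox a b)) + ennreal e"
    using C by (intro add_right_mono nn_integral_mono mult_left_mono) (auto simp: indicator_def)
  finally show "emeasure lborel A \<le> (\<integral>\<^sup>+z. ennreal \<bar>jac p q z\<bar> * indicator A (u z) \<partial>lborel_on (cbox a b)) + ennreal e" .
qed

text \<open>
  One inequality holds on every Borel set. Both measures are finite and have the same total mass, by exhaustion
  with compact sets; passing to complements gives the other inequality.
\<close>
theorem area_formula:
  assumes R: "cbox a b \<subseteq> \<Omega>" and nn: "AE z in lborel_on (box a b). jac p q z \<ge> 0"
  shows "distr (density (lborel_on (box a b)) (\<lambda>z. ennreal (jac p q z))) borel u = lborel_on (u ` box a b)"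
proof (rule measure_eqI)
  let ?V = "u ` box a b" and ?N = "distr (density (lborel_on (box a b)) (\<lambda>z. ennreal (jac p q z))) borel u"
  have oV: "open ?V" using R box_subset_cbox[of a b] by (intro open_image) auto
  then have [measurable]: "?V \<in> sets borel" by (simp add: borel_open)
  show "sets ?N = sets (lborel_on ?V)" by simp
  have nn': "AE z in lborel_on (cbox a b). jac p q z \<ge> 0" by (rule nn[unfolded lborel_on_box])
  have N: "emeasure ?N A = (\<integral>\<^sup>+z. ennreal \<bar>jac p q z\<bar> * indicator A (u z) \<partial>lborel_on (cbox a b))"
    if [measurable]: "A \<in> sets borel" for A
  proof -
    have "emeasure ?N A = (\<integral>\<^sup>+z. ennreal (jac p q z) * indicator (u -` A) z \<partial>lborel_on (box a b))"
    proof -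
      have [measurable]: "u -` A \<in> sets borel" using measurable_sets_borel[OF measurable_u that] .
      show ?thesis by (subst emeasure_distr) (auto simp: emeasure_density)
    qed
    also have "\<dots> = (\<integral>\<^sup>+z. ennreal \<bar>jac p q z\<bar> * indicator A (u z) \<partial>lborel_on (cbox a b))"
      unfolding lborel_on_box by (intro nn_integral_cong_AE) (use nn' in eventually_elim, simp add: indicator_vimage)
    finally show ?thesis .
  qed
  have le: "emeasure lborel (?V \<inter> A) \<le> emeasure ?N A" if [measurable]: "A \<in> sets borel" for A
  proof -
    have "emeasure lborel (?V \<inter> A) \<le> emeasure ?N (?V \<inter> A)" using N area_inequality[OF R, of "?V \<inter> A"] by simp
    also have "\<dots> \<le> emeasure ?N A" by (intro emeasure_mono) auto
    finally show ?thesis .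
  qed
  obtain C where C: "\<And>n. compact (C n)" "\<And>n. C n \<subseteq> ?V" "\<And>n. C n \<subseteq> interior (C (Suc n))" "\<Union>(range C) = ?V"
    using open_Union_compact_subsets[OF oV] by metis
  have [measurable]: "C n \<in> sets borel" for n using C by (simp add: borel_compact)
  have inc: "incseq C" using C(3) interior_subset by (intro incseq_SucI) blast
  have "emeasure ?N ?V = (SUP n. emeasure ?N (C n))" using C(4) inc by (subst SUP_emeasure_incseq) auto
  also have "\<dots> = (SUP n. emeasure lborel (C n))" using N area_compact(2)[OF R C(1,2) nn'] by simp
  also have "\<dots> = emeasure lborel ?V" using C(4) inc by (subst SUP_emeasure_incseq) auto
  finally have NV: "emeasure ?N ?V = emeasure lborel ?V" .
  have NU: "emeasure ?N UNIV = emeasure lborel ?V"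
  proof -
    have U: "UNIV \<in> sets (borel :: complex measure)" by simp
    have "emeasure ?N UNIV = emeasure ?N ?V"
      unfolding N[OF U] N[OF \<open>?V \<in> sets borel\<close>] lborel_on_box[symmetric]
      by (intro nn_integral_cong_AE) (auto simp: AE_lborel_on)
    then show ?thesis using NV by simp
  qed
  have fin: "emeasure lborel ?V < \<infinity>" by (rule image_box_finite[OF R])
  show "emeasure ?N A = emeasure (lborel_on ?V) A" if "A \<in> sets ?N" for A
  proof -
    have A[measurable]: "A \<in> sets borel" using that by simp
    have Ac[measurable]: "- A \<in> sets borel" using A by auto
    have fA: "emeasure ?N (- A) \<noteq> \<infinity>" using NU fin emeasure_mono[of "- A" UNIV ?N] by (auto simp: top_unique)
    have fB: "emeasure lborel (?V \<inter> - A) \<noteq> \<infinity>" using fin emeasure_mono[of "?V \<inter> - A" ?V lborel] by (auto simp: top_unique)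
    have "emeasure ?N A = emeasure ?N (UNIV - (- A))" by (simp add: Compl_eq_Diff_UNIV[symmetric])
    also have "\<dots> = emeasure ?N UNIV - emeasure ?N (- A)" using fA by (intro emeasure_Diff) auto
    also have "\<dots> \<le> emeasure lborel ?V - emeasure lborel (?V \<inter> - A)"
      unfolding NU by (intro ennreal_minus_mono le Ac) auto
    also have "\<dots> = emeasure lborel (?V - (?V \<inter> - A))" using fB by (intro emeasure_Diff[symmetric]) auto
    also have "?V - (?V \<inter> - A) = ?V \<inter> A" by blast
    finally have "emeasure ?N A = emeasure lborel (?V \<inter> A)" using le[OF A] by (rule antisym)
    then show ?thesis by (simp add: emeasure_lborel_on)
  qed
qed

end

section \<open>Pulling back test forms\<close>

lemma L2_limit_linear:
  fixes T :: "complex \<Rightarrow> complex" and a' :: "nat \<Rightarrow> 'a \<Rightarrow> complex"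
  assumes T: "bounded_linear T" "\<And>x. cmod (T x) \<le> cmod x"
    and a: "(\<lambda>n. \<integral>\<^sup>+z. ennreal ((cmod (a' n z - a z))\<^sup>2) \<partial>M) \<longlonglongrightarrow> 0"
  shows "(\<lambda>n. \<integral>\<^sup>+z. ennreal ((cmod (T (a' n z) - T (a z)))\<^sup>2) \<partial>M) \<longlonglongrightarrow> 0"
proof (rule tendsto_sandwich[OF _ _ tendsto_const a])
  interpret T: bounded_linear T by fact
  show "\<forall>\<^sub>F n in sequentially. (\<integral>\<^sup>+z. ennreal ((cmod (T (a' n z) - T (a z)))\<^sup>2) \<partial>M) \<le> (\<integral>\<^sup>+z. ennreal ((cmod (a' n z - a z))\<^sup>2) \<partial>M)"
    by (intro always_eventually allI nn_integral_mono ennreal_leI power_mono) (simp_all flip: T.diff add: T(2))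
qed auto

lemma finite_linear:
  fixes T :: "complex \<Rightarrow> complex"
  assumes "\<And>x. cmod (T x) \<le> cmod x" "(\<integral>\<^sup>+z. ennreal ((cmod (a z))\<^sup>2) \<partial>M) < \<infinity>"
  shows "(\<integral>\<^sup>+z. ennreal ((cmod (T (a z)))\<^sup>2) \<partial>M) < \<infinity>"
  by (rule order_le_less_trans[OF nn_integral_mono assms(2)]) (intro ennreal_leI power_mono assms; simp)

lemma C2_map_linear:
  assumes "C2_map f p q" "bounded_linear T"
  shows "C2_map (\<lambda>z. T (f z)) (\<lambda>z. T (p z)) (\<lambda>z. T (q z))"
proof -
  obtain pp m qq where "has_grad f p q" "has_grad p pp m" "has_grad q m qq" using assms(1) unfolding C2_map_def by blast
  then show ?thesis unfolding C2_map_def using has_grad_linear[OF _ assms(2)] by blast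
qed

lemma green_compact:
  assumes P: "has_grad P Px Py" and q: "C2_map q qx qy" and ab: "Re a \<le> Re b" "Im a \<le> Im b"
    and 0: "\<And>z. z \<in> cbox a b - box a b \<Longrightarrow> P z = 0"
  shows "(LINT z|lborel_on (cbox a b). Px z * qy z - Py z * qx z) = 0"
proof -
  have q': "has_grad q qx qy" using q by (simp add: C2_map_def)
  have "continuous_on UNIV (\<lambda>z. Px z * qy z - Py z * qx z)"
    by (intro continuous_intros has_gradD[OF P] has_gradD[OF q'])
  then have "(LINT z|lborel_on (cbox a b). Px z * qy z - Py z * qx z) = (LINT z:cbox a b|lborel. Px z * qy z - Py z * qx z)"
    by (intro integral_lborel_on borel_measurable_continuous_onI) auto
  also have "\<dots> = contour_integral (q \<circ> rectpath a b) (\<lambda>_. 0)"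
    by (rule green_contour[OF P q ab]) (simp add: 0)
  finally show ?thesis by simp
qed

lemma test_in_bounded:
  assumes "test_in \<Omega> \<eta> \<eta>x \<eta>y"
  obtains B where "B \<ge> 0" "\<And>z. \<bar>\<eta> z\<bar> \<le> B" "\<And>z. \<bar>\<eta>x z\<bar> \<le> B" "\<And>z. \<bar>\<eta>y z\<bar> \<le> B"
proof -
  obtain K where K: "compact K" "\<And>z. z \<notin> K \<Longrightarrow> \<eta> z = 0 \<and> \<eta>x z = 0 \<and> \<eta>y z = 0" and g: "has_grad \<eta> \<eta>x \<eta>y"
    using assms unfolding test_in_def by blast
  have "\<exists>B\<ge>0. \<forall>z. \<bar>f z\<bar> \<le> B" if "continuous_on UNIV f" "\<And>z. z \<notin> K \<Longrightarrow> f z = 0" for f :: "complex \<Rightarrow> real"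
  proof -
    have "bounded (f ` K)" using K(1) that(1)
      by (intro compact_imp_bounded compact_continuous_image) (auto intro: continuous_on_subset)
    then obtain B where B: "B > 0" "\<And>z. z \<in> K \<Longrightarrow> \<bar>f z\<bar> \<le> B" unfolding bounded_pos by auto
    then show ?thesis using that(2) by (intro exI[of _ B]) (metis abs_zero less_imp_le)
  qed
  from this[OF has_gradD(4)[OF g]] this[OF has_gradD(2)[OF g]] this[OF has_gradD(3)[OF g]] K(2)
  obtain B1 B2 B3 where "B1 \<ge> 0" "\<And>z. \<bar>\<eta> z\<bar> \<le> B1" "B2 \<ge> 0" "\<And>z. \<bar>\<eta>x z\<bar> \<le> B2" "B3 \<ge> 0" "\<And>z. \<bar>\<eta>y z\<bar> \<le> B3" by metis
  then show thesis using that[of "B1 + B2 + B3"] by (smt (verit))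
qed

lemma test_in_measurable:
  assumes "test_in \<Omega> \<eta> \<eta>x \<eta>y"
  shows "\<eta> \<in> borel_measurable borel" "\<eta>x \<in> borel_measurable borel" "\<eta>y \<in> borel_measurable borel"
  using assms has_gradD(2-4)[of \<eta> \<eta>x \<eta>y UNIV] unfolding test_in_def by (auto intro: borel_measurable_continuous_onI)

lemma finite_lborel_on_continuous:
  fixes f :: "complex \<Rightarrow> complex"
  assumes "continuous_on UNIV f" "compact R"
  shows "(\<integral>\<^sup>+z. ennreal ((cmod (f z))\<^sup>2) \<partial>lborel_on R) < \<infinity>"
proof -
  have "integrable (lborel_on R) (\<lambda>z. (cmod (f z))\<^sup>2)"
    by (intro integrable_lborel_on_continuous assms continuous_intros)
  then show ?thesis by (simp add: integrable_iff_bounded)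
qed

context sobolev_homeo
begin

text \<open>
  The integral of \<open>d(P \<cdot> (\<eta> \<circ> u)) \<and> d(T u)\<close> vanishes, written out by the product rule; \<open>T\<close> will be the real
  or the imaginary part. For a mollification of \<open>u\<close> that is uniformly close, \<open>\<eta>\<close> still vanishes on the image
  of the boundary, so this is Green's formula. The three terms converge separately.
\<close>
lemma pullback_form:
  assumes R: "cbox a b \<subseteq> \<Omega>" and t: "test_in (u ` box a b) \<eta> \<eta>x \<eta>y" and P: "has_grad P Px Py"
    and T: "bounded_linear T" "\<And>x. cmod (T x) \<le> cmod x"
  shows "(LINT z|lborel_on (cbox a b). of_real (\<eta> (u z)) * (Px z * T (q z) - Py z * T (p z))) +
     (LINT z|lborel_on (cbox a b). (P z * of_real (\<eta>x (u z))) * (of_real (Re (p z)) * T (q z) - of_real (Re (q z)) * T (p z))) +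
     (LINT z|lborel_on (cbox a b). (P z * of_real (\<eta>y (u z))) * (of_real (Im (p z)) * T (q z) - of_real (Im (q z)) * T (p z))) = 0"
proof (cases "box a b = {}")
  case True
  then have "lborel_on (cbox a b) = lborel_on {}" using lborel_on_box[of a b] by simp
  then show ?thesis by (simp add: lborel_on_def integral_eq_zero_AE AE_density)
next
  case False
  then have ab: "Re a < Re b" "Im a < Im b" by (auto simp: in_box_complex_iff)
  let ?R = "cbox a b" and ?F = "cbox a b - box a b"
  have sub: "box a b \<subseteq> ?R" by (rule box_subset_cbox)
  have g: "has_grad \<eta> \<eta>x \<eta>y" using t by (simp add: test_in_def)
  obtain K where K: "compact K" "K \<subseteq> u ` box a b" "\<And>z. z \<notin> K \<Longrightarrow> \<eta> z = 0"
    using t unfolding test_in_def by blast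
  obtain B where B: "B \<ge> 0" "\<And>z. \<bar>\<eta> z\<bar> \<le> B" "\<And>z. \<bar>\<eta>x z\<bar> \<le> B" "\<And>z. \<bar>\<eta>y z\<bar> \<le> B" using test_in_bounded[OF t] by blast
  note [measurable] = test_in_measurable[OF t]
  obtain U P' Q where U: "\<And>n::nat. C2_map (U n) (P' n) (Q n)"
    "(\<lambda>n. \<integral>\<^sup>+z. ennreal ((cmod (P' n z - p z))\<^sup>2) \<partial>lborel_on ?R) \<longlonglongrightarrow> 0"
    "(\<lambda>n. \<integral>\<^sup>+z. ennreal ((cmod (Q n z - q z))\<^sup>2) \<partial>lborel_on ?R) \<longlonglongrightarrow> 0"
    "(\<lambda>n. \<integral>\<^sup>+z. ennreal (cmod (U n z - u z)) \<partial>lborel_on ?R) \<longlonglongrightarrow> 0"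
    "continuous_on \<Omega> u \<Longrightarrow> uniform_limit ?R U u sequentially"
    by (rule smooth_approximation[OF open_dom compact_cbox R grad u_loc loc_L2_imp_L1[OF p_L2] p_L2 loc_L2_imp_L1[OF q_L2] q_L2]) auto
  note Uu = U(5)[OF cont]
  have Ug: "has_grad (U n) (P' n) (Q n)" for n using U(1) by (simp add: C2_map_def)
  have Uc: "continuous_on UNIV (U n)" "continuous_on UNIV (P' n)" "continuous_on UNIV (Q n)" for n
    using has_gradD[OF Ug] by auto
  have [measurable]: "U n \<in> borel_measurable borel" "P' n \<in> borel_measurable borel" "Q n \<in> borel_measurable borel" for n
    using Uc by (auto intro: borel_measurable_continuous_onI)
  have [measurable]: "P \<in> borel_measurable borel" "Px \<in> borel_measurable borel" "Py \<in> borel_measurable borel"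
    using has_gradD[OF P] by (auto intro: borel_measurable_continuous_onI)
  have cT: "continuous_on UNIV T" using T(1) by (rule linear_continuous_on)
  have [measurable]: "T \<in> borel_measurable borel" by (rule borel_measurable_continuous_onI[OF cT])
  have fp: "(\<integral>\<^sup>+z. ennreal ((cmod (p z))\<^sup>2) \<partial>lborel_on ?R) < \<infinity>" "(\<integral>\<^sup>+z. ennreal ((cmod (q z))\<^sup>2) \<partial>lborel_on ?R) < \<infinity>"
    using loc_Lp_finite[OF p_L2 compact_cbox R] loc_Lp_finite[OF q_L2 compact_cbox R] by auto
  have RI: "bounded_linear (\<lambda>x. complex_of_real (Re x))" "bounded_linear (\<lambda>x. complex_of_real (Im x))"
    by (intro bounded_linear_compose[OF bounded_linear_of_real] bounded_linear_Re bounded_linear_Im)+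
  have RIb: "cmod (complex_of_real (Re x)) \<le> cmod x" "cmod (complex_of_real (Im x)) \<le> cmod x" for x
    using abs_Re_le_cmod abs_Im_le_cmod by auto
  note lp = L2_limit_linear[OF T U(2)] and lq = L2_limit_linear[OF T U(3)]
  note fT = finite_linear[of T, OF T(2) fp(1)] finite_linear[of T, OF T(2) fp(2)]
  have fP: "(\<integral>\<^sup>+z. ennreal ((cmod (Px z))\<^sup>2) \<partial>lborel_on ?R) < \<infinity>" "(\<integral>\<^sup>+z. ennreal ((cmod (Py z))\<^sup>2) \<partial>lborel_on ?R) < \<infinity>"
    by (intro finite_lborel_on_continuous has_gradD[OF P] compact_cbox)+
  \<comment> \<open>The forms \<open>dP \<and> T du\<close>, \<open>d(Re u) \<and> T du\<close> and \<open>d(Im u) \<and> T du\<close>, which converge in \<open>L\<^sup>1\<close>; the bounded factors in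
      front of them follow as \<open>g1\<close>, \<open>g2\<close> and \<open>g3\<close>.\<close>
  define h1 where "h1 x y z = Px z * T y - Py z * T x" for x y z
  define h2 where "h2 x y = complex_of_real (Re x) * T y - of_real (Re y) * T x" for x y
  define h3 where "h3 x y = complex_of_real (Im x) * T y - of_real (Im y) * T x" for x y
  have l1: "(\<lambda>n. \<integral>\<^sup>+z. ennreal (cmod (h1 (P' n z) (Q n z) z - h1 (p z) (q z) z)) \<partial>lborel_on ?R) \<longlonglongrightarrow> 0"
    unfolding h1_def by (rule L2_limit_wedge) (use lp lq fT fP in auto)
  have l2: "(\<lambda>n. \<integral>\<^sup>+z. ennreal (cmod (h2 (P' n z) (Q n z) - h2 (p z) (q z))) \<partial>lborel_on ?R) \<longlonglongrightarrow> 0"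
    unfolding h2_def
    by (rule L2_limit_wedge) (use lp lq fT L2_limit_linear[OF RI(1) RIb(1) U(2)] L2_limit_linear[OF RI(1) RIb(1) U(3)]
        finite_linear[of "\<lambda>x. of_real (Re x)", OF RIb(1) fp(1)] finite_linear[of "\<lambda>x. of_real (Re x)", OF RIb(1) fp(2)] in auto)
  have l3: "(\<lambda>n. \<integral>\<^sup>+z. ennreal (cmod (h3 (P' n z) (Q n z) - h3 (p z) (q z))) \<partial>lborel_on ?R) \<longlonglongrightarrow> 0"
    unfolding h3_def
    by (rule L2_limit_wedge) (use lp lq fT L2_limit_linear[OF RI(2) RIb(2) U(2)] L2_limit_linear[OF RI(2) RIb(2) U(3)]
        finite_linear[of "\<lambda>x. of_real (Im x)", OF RIb(2) fp(1)] finite_linear[of "\<lambda>x. of_real (Im x)", OF RIb(2) fp(2)] in auto)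
  have i1: "integrable (lborel_on ?R) (\<lambda>z. h1 (p z) (q z) z)" unfolding h1_def
    by (intro Bochner_Integration.integrable_diff integrable_mult_L2) (use fT fP in auto)
  have i2: "integrable (lborel_on ?R) (\<lambda>z. h2 (p z) (q z))" unfolding h2_def
    by (intro Bochner_Integration.integrable_diff integrable_mult_L2)
       (use fT finite_linear[of "\<lambda>x. of_real (Re x)", OF RIb(1) fp(1)] finite_linear[of "\<lambda>x. of_real (Re x)", OF RIb(1) fp(2)] in auto)
  have i3: "integrable (lborel_on ?R) (\<lambda>z. h3 (p z) (q z))" unfolding h3_def
    by (intro Bochner_Integration.integrable_diff integrable_mult_L2)
       (use fT finite_linear[of "\<lambda>x. of_real (Im x)", OF RIb(2) fp(1)] finite_linear[of "\<lambda>x. of_real (Im x)", OF RIb(2) fp(2)] in auto)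
  have "bounded (P ` ?R)" by (intro compact_imp_bounded compact_continuous_image has_gradD[OF P] compact_cbox)
  then obtain B' where B': "B' > 0" "\<And>z. z \<in> ?R \<Longrightarrow> cmod (P z) \<le> B'" unfolding bounded_pos by auto
  define g1 where "g1 \<zeta> z = complex_of_real (\<eta> \<zeta>)" for \<zeta> z :: complex
  define g2 where "g2 \<zeta> z = P z * of_real (\<eta>x \<zeta>)" for \<zeta> z
  define g3 where "g3 \<zeta> z = P z * of_real (\<eta>y \<zeta>)" for \<zeta> z
  have lim: "(\<lambda>n. LINT z|lborel_on ?R. G (U n z) z * H' n z) \<longlonglongrightarrow> (LINT z|lborel_on ?R. G (u z) z * H z)"
    and int: "integrable (lborel_on ?R) (\<lambda>z. G (U n z) z * H' n z)"
    if G: "\<And>z. continuous_on UNIV (\<lambda>\<zeta>. G \<zeta> z)" "\<And>\<zeta> z. z \<in> ?R \<Longrightarrow> cmod (G \<zeta> z) \<le> C" "C \<ge> 0"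
       "(\<lambda>(\<zeta>, z). G \<zeta> z) \<in> borel_measurable borel"
       "\<And>n. continuous_on UNIV (\<lambda>z. G (U n z) z)" "\<And>n. continuous_on UNIV (H' n)"
       "(\<lambda>n. \<integral>\<^sup>+z. ennreal (cmod (H' n z - H z)) \<partial>lborel_on ?R) \<longlonglongrightarrow> 0" "integrable (lborel_on ?R) H"
    for G :: "complex \<Rightarrow> complex \<Rightarrow> complex" and H' H C n
  proof -
    have [measurable]: "(\<lambda>z. G (f z) z) \<in> borel_measurable borel" if "f \<in> borel_measurable borel" for f
      using measurable_compose[OF borel_measurable_Pair[OF that measurable_ident, unfolded id_def] G(4)] by simp
    have [measurable]: "H' n \<in> borel_measurable borel" "H \<in> borel_measurable borel" for n
      using G(6,8) by (auto intro: borel_measurable_continuous_onI)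
    show int: "integrable (lborel_on ?R) (\<lambda>z. G (U n z) z * H' n z)" for n
      by (intro integrable_lborel_on_continuous compact_cbox continuous_on_mult G(5,6))
    have iG: "integrable (lborel_on ?R) (\<lambda>z. G (u z) z * H z)"
      by (rule Bochner_Integration.integrable_bound[of _ "\<lambda>z. C * cmod (H z)"])
         (use G(2,3,8) in \<open>auto simp: norm_mult AE_lborel_on intro!: AE_I2 mult_right_mono\<close>)
    have gl: "(\<lambda>n. G (U n z) z) \<longlonglongrightarrow> G (u z) z" if "z \<in> ?R" for z
      using G(1)[of z] tendsto_uniform_limitI[OF Uu that]
      by (intro isCont_tendsto_compose[of "u z" "\<lambda>\<zeta>. G \<zeta> z"]) (auto simp: continuous_on_eq_continuous_at)
    have "(\<lambda>n. \<integral>\<^sup>+z. ennreal (cmod (G (U n z) z * H' n z - G (u z) z * H z)) \<partial>lborel_on ?R) \<longlonglongrightarrow> 0"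
      by (rule L1_limit_mult[where B=C]) (use G gl in \<open>auto simp: AE_lborel_on\<close>)
    from tendsto_L1_int[OF int iG this]
    show "(\<lambda>n. LINT z|lborel_on ?R. G (U n z) z * H' n z) \<longlonglongrightarrow> (LINT z|lborel_on ?R. G (u z) z * H z)" .
  qed
  have TU: "continuous_on UNIV (\<lambda>z. T (P' n z))" "continuous_on UNIV (\<lambda>z. T (Q n z))" for n
    using continuous_on_compose_UNIV[OF cT Uc(2)] continuous_on_compose_UNIV[OF cT Uc(3)] by auto
  note eU = continuous_on_compose_UNIV[OF has_gradD(4)[OF g] Uc(1)] continuous_on_compose_UNIV[OF has_gradD(2)[OF g] Uc(1)] continuous_on_compose_UNIV[OF has_gradD(3)[OF g] Uc(1)]
  have cH: "continuous_on UNIV (\<lambda>z. h1 (P' n z) (Q n z) z)" "continuous_on UNIV (\<lambda>z. h2 (P' n z) (Q n z))" "continuous_on UNIV (\<lambda>z. h3 (P' n z) (Q n z))" for n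
    unfolding h1_def h2_def h3_def
    by (intro continuous_on_diff continuous_on_mult continuous_on_of_real continuous_on_Re continuous_on_Im TU Uc has_gradD[OF P])+
  have cG: "continuous_on UNIV (\<lambda>z. g1 (U n z) z)" "continuous_on UNIV (\<lambda>z. g2 (U n z) z)" "continuous_on UNIV (\<lambda>z. g3 (U n z) z)" for n
    unfolding g1_def g2_def g3_def
    by (intro continuous_on_mult continuous_on_of_real eU has_gradD[OF P])+
  have cG': "continuous_on UNIV (\<lambda>\<zeta>. g1 \<zeta> z)" "continuous_on UNIV (\<lambda>\<zeta>. g2 \<zeta> z)" "continuous_on UNIV (\<lambda>\<zeta>. g3 \<zeta> z)" for z
    unfolding g1_def g2_def g3_def
    by (intro continuous_on_mult continuous_on_of_real continuous_on_const has_gradD[OF g])+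
  have bG: "cmod (g1 \<zeta> z) \<le> B' * B + B" "cmod (g2 \<zeta> z) \<le> B' * B + B" "cmod (g3 \<zeta> z) \<le> B' * B + B" if "z \<in> ?R" for \<zeta> z
  proof -
    have "cmod (P z) * \<bar>\<eta>x \<zeta>\<bar> \<le> B' * B" "cmod (P z) * \<bar>\<eta>y \<zeta>\<bar> \<le> B' * B"
      using B B' that by (auto intro!: mult_mono)
    then show "cmod (g1 \<zeta> z) \<le> B' * B + B" "cmod (g2 \<zeta> z) \<le> B' * B + B" "cmod (g3 \<zeta> z) \<le> B' * B + B"
      using B B' by (auto simp: g1_def g2_def g3_def norm_mult intro: order_trans add_increasing)
  qed
  have mG: "(\<lambda>(\<zeta>, z). g1 \<zeta> z) \<in> borel_measurable borel" "(\<lambda>(\<zeta>, z). g2 \<zeta> z) \<in> borel_measurable borel" "(\<lambda>(\<zeta>, z). g3 \<zeta> z) \<in> borel_measurable borel"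
    unfolding g1_def g2_def g3_def borel_prod[symmetric] by measurable
  have BB: "B' * B + B \<ge> 0" using B B' by auto
  note L1 = lim[of g1, OF cG'(1) bG(1) BB mG(1) cG(1) cH(1) l1 i1] and I1 = int[of g1, OF cG'(1) bG(1) BB mG(1) cG(1) cH(1) l1 i1]
  note L2 = lim[of g2, OF cG'(2) bG(2) BB mG(2) cG(2) cH(2) l2 i2] and I2 = int[of g2, OF cG'(2) bG(2) BB mG(2) cG(2) cH(2) l2 i2]
  note L3 = lim[of g3, OF cG'(3) bG(3) BB mG(3) cG(3) cH(3) l3 i3] and I3 = int[of g3, OF cG'(3) bG(3) BB mG(3) cG(3) cH(3) l3 i3]
  have L: "(\<lambda>n. (LINT z|lborel_on ?R. g1 (U n z) z * h1 (P' n z) (Q n z) z) + (LINT z|lborel_on ?R. g2 (U n z) z * h2 (P' n z) (Q n z)) + (LINT z|lborel_on ?R. g3 (U n z) z * h3 (P' n z) (Q n z)))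
     \<longlonglongrightarrow> (LINT z|lborel_on ?R. g1 (u z) z * h1 (p z) (q z) z) + (LINT z|lborel_on ?R. g2 (u z) z * h2 (p z) (q z)) + (LINT z|lborel_on ?R. g3 (u z) z * h3 (p z) (q z))"
    by (intro tendsto_add L1 L2 L3)
  have "\<forall>\<^sub>F n in sequentially. (LINT z|lborel_on ?R. g1 (U n z) z * h1 (P' n z) (Q n z) z) + (LINT z|lborel_on ?R. g2 (U n z) z * h2 (P' n z) (Q n z)) + (LINT z|lborel_on ?R. g3 (U n z) z * h3 (P' n z) (Q n z)) = 0"
  proof -
    obtain d where d: "d > 0" "\<And>z \<zeta>. z \<in> ?F \<Longrightarrow> \<zeta> \<in> K \<Longrightarrow> d \<le> dist (u z) \<zeta>"
    proof -
      have "compact (u ` ?F)" using R by (intro compact_continuous_image continuous_on_subset[OF cont] compact_diff compact_cbox open_box) auto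
      moreover have "u ` ?F \<inter> K = {}"
      proof -
        have "u ` box a b \<inter> u ` ?F = {}" using inj R sub by (subst inj_on_image_Int[OF inj, symmetric]) auto
        then show ?thesis using K(2) by blast
      qed
      ultimately show thesis using separate_compact_closed[of "u ` ?F" K] compact_imp_closed[OF K(1)] that by (metis imageI)
    qed
    have "\<forall>\<^sub>F n in sequentially. \<forall>z\<in>?R. dist (U n z) (u z) < d" using Uu d(1) unfolding uniform_limit_iff by blast
    then show ?thesis
    proof eventually_elim
      fix n assume n: "\<forall>z\<in>?R. dist (U n z) (u z) < d"
      have z0: "complex_of_real (\<eta> (U n z)) = 0" if "z \<in> ?F" for z
      proof -
        have "dist (u z) (U n z) < d" using n that by (auto simp: dist_commute)
        then have "U n z \<notin> K" using d(2)[OF that] by force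
        then show ?thesis using K(3) by simp
      qed
      have e1: "has_grad (\<lambda>z. complex_of_real (\<eta> (U n z))) (\<lambda>z. of_real (grad_map (\<eta>x (U n z)) (\<eta>y (U n z)) (P' n z))) (\<lambda>z. of_real (grad_map (\<eta>x (U n z)) (\<eta>y (U n z)) (Q n z)))"
        by (rule has_grad_linear[OF has_grad_compose[OF g Ug] bounded_linear_of_real])
      have "0 = (LINT z|lborel_on ?R. (P z * of_real (grad_map (\<eta>x (U n z)) (\<eta>y (U n z)) (P' n z)) + Px z * of_real (\<eta> (U n z))) * T (Q n z)
          - (P z * of_real (grad_map (\<eta>x (U n z)) (\<eta>y (U n z)) (Q n z)) + Py z * of_real (\<eta> (U n z))) * T (P' n z))"
        by (rule green_compact[OF has_grad_mult[OF P e1] C2_map_linear[OF U(1) T(1)], symmetric]) (use ab z0 in auto)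
      also have "\<dots> = (LINT z|lborel_on ?R. g1 (U n z) z * h1 (P' n z) (Q n z) z + g2 (U n z) z * h2 (P' n z) (Q n z) + g3 (U n z) z * h3 (P' n z) (Q n z))"
        by (rule arg_cong[where f="integral\<^sup>L (lborel_on ?R)"])
          (auto simp: fun_eq_iff g1_def g2_def g3_def h1_def h2_def h3_def grad_map_def algebra_simps)
      also have "\<dots> = (LINT z|lborel_on ?R. g1 (U n z) z * h1 (P' n z) (Q n z) z) + (LINT z|lborel_on ?R. g2 (U n z) z * h2 (P' n z) (Q n z)) + (LINT z|lborel_on ?R. g3 (U n z) z * h3 (P' n z) (Q n z))"
        by (simp add: I1 I2 I3)
      finally show "(LINT z|lborel_on ?R. g1 (U n z) z * h1 (P' n z) (Q n z) z) + (LINT z|lborel_on ?R. g2 (U n z) z * h2 (P' n z) (Q n z)) + (LINT z|lborel_on ?R. g3 (U n z) z * h3 (P' n z) (Q n z)) = 0" by simp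
    qed
  qed
  from LIMSEQ_unique[OF L tendsto_eventually[OF this]] show ?thesis
    unfolding g1_def g2_def g3_def h1_def h2_def h3_def .
qed

text \<open>
  For \<open>T = Im\<close> the term with \<open>\<eta>y\<close> drops out, since a form wedged with itself is zero, and the form left in
  front of \<open>\<eta>x\<close> is the Jacobian. The roles are exchanged for \<open>T = Re\<close>.
\<close>
lemma pullback_identity:
  fixes P Px Py :: "complex \<Rightarrow> complex"
  assumes R: "cbox a b \<subseteq> \<Omega>" and t: "test_in (u ` box a b) \<eta> \<eta>x \<eta>y" and P: "has_grad P Px Py"
  shows "(LINT z|lborel_on (box a b). jac p q z *\<^sub>R (\<eta>x (u z) *\<^sub>R P z)) =
       - (LINT z|lborel_on (box a b). \<eta> (u z) *\<^sub>R (Im (q z) *\<^sub>R Px z - Im (p z) *\<^sub>R Py z))"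
    and "(LINT z|lborel_on (box a b). jac p q z *\<^sub>R (\<eta>y (u z) *\<^sub>R P z)) =
       - (LINT z|lborel_on (box a b). \<eta> (u z) *\<^sub>R (Re (p z) *\<^sub>R Py z - Re (q z) *\<^sub>R Px z))"
proof -
  have RI: "bounded_linear (\<lambda>x. complex_of_real (Re x))" "bounded_linear (\<lambda>x. complex_of_real (Im x))"
    by (intro bounded_linear_compose[OF bounded_linear_of_real] bounded_linear_Re bounded_linear_Im)+
  have RIb: "cmod (complex_of_real (Re x)) \<le> cmod x" "cmod (complex_of_real (Im x)) \<le> cmod x" for x
    using abs_Re_le_cmod abs_Im_le_cmod by auto
  have zero: "(\<lambda>z. x z * (complex_of_real (Re (p z)) * of_real (Re (q z)) - of_real (Re (q z)) * of_real (Re (p z)))) = (\<lambda>z. 0)"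
      "(\<lambda>z. x z * (complex_of_real (Im (p z)) * of_real (Im (q z)) - of_real (Im (q z)) * of_real (Im (p z)))) = (\<lambda>z. 0)" for x :: "complex \<Rightarrow> complex"
    by auto
  from pullback_form[where T="\<lambda>x. complex_of_real (Im x)", OF R t P RI(2) RIb(2)]
  have "(LINT z|lborel_on (cbox a b). of_real (\<eta> (u z)) * (Px z * of_real (Im (q z)) - Py z * of_real (Im (p z)))) +
     (LINT z|lborel_on (cbox a b). (P z * of_real (\<eta>x (u z))) * (of_real (Re (p z)) * of_real (Im (q z)) - of_real (Re (q z)) * of_real (Im (p z)))) = 0"
    unfolding zero by simp
  moreover have "(\<lambda>z. of_real (\<eta> (u z)) * (Px z * of_real (Im (q z)) - Py z * of_real (Im (p z)))) = (\<lambda>z. \<eta> (u z) *\<^sub>R (Im (q z) *\<^sub>R Px z - Im (p z) *\<^sub>R Py z))"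
     "(\<lambda>z. (P z * of_real (\<eta>x (u z))) * (of_real (Re (p z)) * of_real (Im (q z)) - of_real (Re (q z)) * of_real (Im (p z)))) = (\<lambda>z. jac p q z *\<^sub>R (\<eta>x (u z) *\<^sub>R P z))"
    by (auto simp: fun_eq_iff jac_def scaleR_conv_of_real algebra_simps)
  ultimately show "(LINT z|lborel_on (box a b). jac p q z *\<^sub>R (\<eta>x (u z) *\<^sub>R P z)) =
       - (LINT z|lborel_on (box a b). \<eta> (u z) *\<^sub>R (Im (q z) *\<^sub>R Px z - Im (p z) *\<^sub>R Py z))"
    by (simp add: lborel_on_box eq_neg_iff_add_eq_0 add.commute)
  from pullback_form[where T="\<lambda>x. complex_of_real (Re x)", OF R t P RI(1) RIb(1)]
  have "(LINT z|lborel_on (cbox a b). of_real (\<eta> (u z)) * (Px z * of_real (Re (q z)) - Py z * of_real (Re (p z)))) +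
     (LINT z|lborel_on (cbox a b). (P z * of_real (\<eta>y (u z))) * (of_real (Im (p z)) * of_real (Re (q z)) - of_real (Im (q z)) * of_real (Re (p z)))) = 0"
    unfolding zero by simp
  moreover have "(\<lambda>z. of_real (\<eta> (u z)) * (Px z * of_real (Re (q z)) - Py z * of_real (Re (p z)))) = (\<lambda>z. - (\<eta> (u z) *\<^sub>R (Re (p z) *\<^sub>R Py z - Re (q z) *\<^sub>R Px z)))"
     "(\<lambda>z. (P z * of_real (\<eta>y (u z))) * (of_real (Im (p z)) * of_real (Re (q z)) - of_real (Im (q z)) * of_real (Re (p z)))) = (\<lambda>z. - (jac p q z *\<^sub>R (\<eta>y (u z) *\<^sub>R P z)))"
    by (auto simp: fun_eq_iff jac_def scaleR_conv_of_real algebra_simps)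
  ultimately show "(LINT z|lborel_on (box a b). jac p q z *\<^sub>R (\<eta>y (u z) *\<^sub>R P z)) =
       - (LINT z|lborel_on (box a b). \<eta> (u z) *\<^sub>R (Re (p z) *\<^sub>R Py z - Re (q z) *\<^sub>R Px z))"
    by (simp add: lborel_on_box eq_neg_iff_add_eq_0 add_eq_0_iff)
qed

end

section \<open>The inverse of a homeomorphism of integrable distortion\<close>

text \<open>
  By Lindelof's theorem countably many of the open sets suffice.
\<close>
lemma AE_locally:
  fixes \<Omega> :: "complex set"
  assumes "\<And>z. z \<in> \<Omega> \<Longrightarrow> \<exists>S. open S \<and> z \<in> S \<and> (AE x in lborel. x \<in> S \<longrightarrow> Q x)"
  shows "AE x in lborel. x \<in> \<Omega> \<longrightarrow> Q x"
proof -
  define F where "F = {S. open S \<and> (AE x in lborel. x \<in> S \<longrightarrow> Q x)}"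
  have "\<And>S. S \<in> F \<Longrightarrow> open S" by (simp add: F_def)
  then obtain F' where F': "F' \<subseteq> F" "countable F'" "\<Union>F' = \<Union>F" using Lindelof by metis
  have "AE x in lborel. \<forall>S\<in>F'. x \<in> S \<longrightarrow> Q x"
    using F'(1,2) by (subst AE_ball_countable) (auto simp: F_def)
  then show ?thesis
  proof eventually_elim
    fix x assume x: "\<forall>S\<in>F'. x \<in> S \<longrightarrow> Q x"
    show "x \<in> \<Omega> \<longrightarrow> Q x"
    proof
      assume "x \<in> \<Omega>"
      then have "x \<in> \<Union>F" using assms unfolding F_def by blast
      then show "Q x" using x F'(3) by blast
    qed
  qed
qed

lemma open_contains_cbox_around:
  assumes "open V" "\<zeta> \<in> (V :: complex set)"
  obtains c d where "\<zeta> \<in> box c d" "cbox c d \<subseteq> V"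
  using open_contains_cbox[of V] assms by metis

text \<open>
  The last integrand is \<open>|Du|\<^sup>2 / J\<close>, a multiple of the distortion. Where \<open>J = 0\<close> the quotient has the
  conventional value \<open>0\<close>, which agrees with the vanishing of its numerator there.
\<close>
locale distortion_homeo = sobolev_homeo +
  fixes a b :: complex
  assumes rect: "cbox a b \<subseteq> \<Omega>"
    and sense: "AE z in lborel_on (box a b). jac p q z \<ge> 0 \<and> (jac p q z = 0 \<longrightarrow> p z = 0 \<and> q z = 0)"
    and distortion: "(\<integral>\<^sup>+z. ennreal (((cmod (p z))\<^sup>2 + (cmod (q z))\<^sup>2) / jac p q z) \<partial>lborel_on (box a b)) < \<infinity>"
begin

definition "D = box a b"
definition "V = u ` D"
text \<open>
  The inverse homeomorphism, with the value \<open>0\<close> outside \<open>V\<close> to make it Borel on the plane.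
\<close>
definition w :: "complex \<Rightarrow> complex" where "w \<zeta> = (if \<zeta> \<in> V then the_inv_into D u \<zeta> else 0)"

lemma D_sub: "D \<subseteq> \<Omega>" and D_sub_R: "D \<subseteq> cbox a b"
  using rect box_subset_cbox[of a b] by (auto simp: D_def)

lemma open_D: "open D" by (simp add: D_def open_box)
lemma open_V: "open V" unfolding V_def by (rule open_image[OF open_D D_sub])
lemma borel_DV[measurable]: "D \<in> sets borel" "V \<in> sets borel" using open_D open_V by (auto simp: borel_open)

lemma inj_D: "inj_on u D" using inj D_sub by (rule inj_on_subset)

lemma w_u: "z \<in> D \<Longrightarrow> w (u z) = z"
  by (simp add: w_def V_def the_inv_into_f_f[OF inj_D])

lemma u_V: "z \<in> D \<Longrightarrow> u z \<in> V" by (simp add: V_def)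

lemma w_D: "\<zeta> \<in> V \<Longrightarrow> w \<zeta> \<in> D" and u_w: "\<zeta> \<in> V \<Longrightarrow> u (w \<zeta>) = \<zeta>"
  using w_u by (auto simp: V_def)

lemma cont_w: "continuous_on V w"
proof -
  obtain g where "homeomorphism D (u ` D) u g"
    using invariance_of_domain_homeomorphism[OF open_D continuous_on_subset[OF cont D_sub] _ inj_D] by auto
  then have g: "continuous_on V g" "\<And>z. z \<in> D \<Longrightarrow> g (u z) = z" by (auto simp: homeomorphism_def V_def)
  then show ?thesis using w_u by (subst continuous_on_cong[of V V w g]) (auto simp: V_def)
qed

lemma measurable_w[measurable]: "w \<in> borel_measurable borel"
proof -
  have "(\<lambda>\<zeta>. indicator V \<zeta> *\<^sub>R w \<zeta>) \<in> borel_measurable borel"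
    by (rule borel_measurable_continuous_on_indicator[OF borel_DV(2) cont_w])
  moreover have "(\<lambda>\<zeta>. indicator V \<zeta> *\<^sub>R w \<zeta>) = w" by (auto simp: w_def indicator_def)
  ultimately show ?thesis by simp
qed

lemma jac_nonneg: "AE z in lborel_on D. jac p q z \<ge> 0"
  using sense unfolding D_def by eventually_elim simp

lemma AE_D: "AE z in lborel_on D. z \<in> D" by (simp add: AE_lborel_on)

lemma distr_eq: "distr (density (lborel_on D) (\<lambda>z. ennreal (jac p q z))) borel u = lborel_on V"
  using area_formula[OF rect] jac_nonneg unfolding D_def V_def by blast

lemma nn_transfer:
  assumes [measurable]: "g \<in> borel_measurable borel"
  shows "(\<integral>\<^sup>+\<zeta>. g \<zeta> \<partial>lborel_on V) = (\<integral>\<^sup>+z. ennreal (jac p q z) * g (u z) \<partial>lborel_on D)"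
  unfolding distr_eq[symmetric] by (subst nn_integral_distr) (auto simp: nn_integral_density)

lemma integral_transfer:
  fixes g :: "complex \<Rightarrow> complex"
  assumes [measurable]: "g \<in> borel_measurable borel"
  shows "(LINT \<zeta>|lborel_on V. g \<zeta>) = (LINT z|lborel_on D. jac p q z *\<^sub>R g (u z))"
  unfolding distr_eq[symmetric] using jac_nonneg
  by (subst integral_distr) (auto simp: integral_density)

text \<open>
  The area formula only controls preimages of null sets where the Jacobian is positive.
\<close>
lemma AE_V_imp_D:
  assumes "AE \<zeta> in lborel_on V. Q \<zeta>"
  shows "AE z in lborel_on D. jac p q z > 0 \<longrightarrow> Q (u z)"
proof -
  have "AE \<zeta> in distr (density (lborel_on D) (\<lambda>z. ennreal (jac p q z))) borel u. Q \<zeta>" using assms by (simp only: distr_eq)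
  then have "AE z in density (lborel_on D) (\<lambda>z. ennreal (jac p q z)). Q (u z)" by (rule AE_distrD[rotated]) simp
  then show ?thesis by (subst (asm) AE_density) auto
qed

text \<open>
  The image of a null set \<open>N\<close> has measure \<open>\<integral>\<^sub>N J = 0\<close>.
\<close>
lemma AE_D_imp_V:
  assumes "AE z in lborel_on D. Q z"
  shows "AE \<zeta> in lborel_on V. Q (w \<zeta>)"
proof -
  obtain N where N: "{z \<in> space (lborel_on D). \<not> Q z} \<subseteq> N" "emeasure (lborel_on D) N = 0" "N \<in> sets (lborel_on D)"
    using AE_E[OF assms] by metis
  then have [measurable]: "N \<in> sets borel" by simp
  have wN[measurable]: "w -` N \<in> sets borel" using measurable_sets_borel[OF measurable_w \<open>N \<in> sets borel\<close>] .
  have nN: "AE z in lborel_on D. z \<notin> N" using N by (intro AE_not_in null_setsI) auto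
  have "emeasure (lborel_on V) (w -` N) = (\<integral>\<^sup>+\<zeta>. indicator (w -` N) \<zeta> \<partial>lborel_on V)" by simp
  also have "\<dots> = (\<integral>\<^sup>+z. ennreal (jac p q z) * indicator (w -` N) (u z) \<partial>lborel_on D)" by (rule nn_transfer) simp
  also have "\<dots> = (\<integral>\<^sup>+z. 0 \<partial>lborel_on D)"
    by (rule nn_integral_cong_AE) (use nN AE_D in eventually_elim, simp add: w_u)
  finally have "AE \<zeta> in lborel_on V. \<zeta> \<notin> w -` N" by (intro AE_not_in null_setsI) auto
  then show ?thesis by eventually_elim (use N(1) in auto)
qed

text \<open>
  The partial derivatives of \<open>P \<circ> w\<close> according to the chain rule, at the point \<open>u z\<close>: the row \<open>(Px, Py)\<close>
  times the inverse of the Jacobian matrix of \<open>u\<close>, by Cramer's rule.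
\<close>
definition pull_x :: "(complex \<Rightarrow> complex) \<Rightarrow> (complex \<Rightarrow> complex) \<Rightarrow> complex \<Rightarrow> complex" where
  "pull_x Px Py z = (1 / jac p q z) *\<^sub>R (Im (q z) *\<^sub>R Px z - Im (p z) *\<^sub>R Py z)"
definition pull_y :: "(complex \<Rightarrow> complex) \<Rightarrow> (complex \<Rightarrow> complex) \<Rightarrow> complex \<Rightarrow> complex" where
  "pull_y Px Py z = (1 / jac p q z) *\<^sub>R (Re (p z) *\<^sub>R Py z - Re (q z) *\<^sub>R Px z)"

lemma measurable_pull[measurable]:
  assumes [measurable]: "Px \<in> borel_measurable borel" "Py \<in> borel_measurable borel"
  shows "pull_x Px Py \<in> borel_measurable borel" "pull_y Px Py \<in> borel_measurable borel"
  unfolding pull_x_def[abs_def] pull_y_def[abs_def] by measurable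

lemma integral_test_V:
  fixes g :: "complex \<Rightarrow> complex"
  assumes "\<And>\<zeta>. \<zeta> \<notin> V \<Longrightarrow> g \<zeta> = 0" "g \<in> borel_measurable borel"
  shows "(LINT \<zeta>|lborel. g \<zeta>) = (LINT \<zeta>|lborel_on V. g \<zeta>)"
  using assms by (subst integral_lborel_on) (auto simp: set_lebesgue_integral_def indicator_def intro!: Bochner_Integration.integral_cong)

text \<open>
  Changing variables by the area formula turns both sides into the two sides of the pullback identity: the
  Jacobian cancels the denominator of \<open>pull_x\<close> and \<open>pull_y\<close>. At points where it is zero the numerators vanish
  too.
\<close>
theorem weak_grad_compose_inverse:
  assumes P: "has_grad P Px Py"
  shows "weak_grad V (\<lambda>\<zeta>. P (w \<zeta>)) (\<lambda>\<zeta>. pull_x Px Py (w \<zeta>)) (\<lambda>\<zeta>. pull_y Px Py (w \<zeta>))"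
  unfolding weak_grad_def
proof (intro allI impI)
  fix \<eta> \<eta>x \<eta>y assume t: "test_in V \<eta> \<eta>x \<eta>y"
  note [measurable] = test_in_measurable[OF t]
  have [measurable]: "P \<in> borel_measurable borel" "Px \<in> borel_measurable borel" "Py \<in> borel_measurable borel"
    using has_gradD[OF P] by (auto intro: borel_measurable_continuous_onI)
  have t0: "\<eta> \<zeta> = 0" "\<eta>x \<zeta> = 0" "\<eta>y \<zeta> = 0" if "\<zeta> \<notin> V" for \<zeta> using t that unfolding test_in_def by blast+
  have tr: "(LINT \<zeta>|lborel. e \<zeta> *\<^sub>R f (w \<zeta>)) = (LINT z|lborel_on D. jac p q z *\<^sub>R (e (u z) *\<^sub>R f z))"
    if [measurable]: "e \<in> borel_measurable borel" "f \<in> borel_measurable borel" and e: "\<And>\<zeta>. \<zeta> \<notin> V \<Longrightarrow> e \<zeta> = 0"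
    for e :: "complex \<Rightarrow> real" and f :: "complex \<Rightarrow> complex"
  proof -
    have "(LINT \<zeta>|lborel. e \<zeta> *\<^sub>R f (w \<zeta>)) = (LINT \<zeta>|lborel_on V. e \<zeta> *\<^sub>R f (w \<zeta>))"
      by (rule integral_test_V) (simp_all add: e)
    also have "\<dots> = (LINT z|lborel_on D. jac p q z *\<^sub>R (e (u z) *\<^sub>R f (w (u z))))"
      by (rule integral_transfer) simp
    also have "\<dots> = (LINT z|lborel_on D. jac p q z *\<^sub>R (e (u z) *\<^sub>R f z))"
      by (rule integral_cong_AE) (simp_all, use AE_D in eventually_elim, simp add: w_u)
    finally show ?thesis .
  qed
  have s: "AE z in lborel_on D. jac p q z = 0 \<longrightarrow> p z = 0 \<and> q z = 0"
    using sense unfolding D_def by eventually_elim simp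
  have ex: "(LINT z|lborel_on D. jac p q z *\<^sub>R (\<eta> (u z) *\<^sub>R pull_x Px Py z)) = (LINT z|lborel_on D. \<eta> (u z) *\<^sub>R (Im (q z) *\<^sub>R Px z - Im (p z) *\<^sub>R Py z))"
    by (rule integral_cong_AE) (simp_all, use s in eventually_elim, auto simp: pull_x_def)
  have ey: "(LINT z|lborel_on D. jac p q z *\<^sub>R (\<eta> (u z) *\<^sub>R pull_y Px Py z)) = (LINT z|lborel_on D. \<eta> (u z) *\<^sub>R (Re (p z) *\<^sub>R Py z - Re (q z) *\<^sub>R Px z))"
    by (rule integral_cong_AE) (simp_all, use s in eventually_elim, auto simp: pull_y_def)
  have t': "test_in (u ` box a b) \<eta> \<eta>x \<eta>y" using t by (simp add: V_def D_def)
  show "(LINT z|lborel. \<eta>x z *\<^sub>R P (w z)) = - (LINT z|lborel. \<eta> z *\<^sub>R pull_x Px Py (w z)) \<and>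
       (LINT z|lborel. \<eta>y z *\<^sub>R P (w z)) = - (LINT z|lborel. \<eta> z *\<^sub>R pull_y Px Py (w z))"
  proof -
    have "(LINT z|lborel. \<eta>x z *\<^sub>R P (w z)) = (LINT z|lborel_on D. jac p q z *\<^sub>R (\<eta>x (u z) *\<^sub>R P z))"
      "(LINT z|lborel. \<eta>y z *\<^sub>R P (w z)) = (LINT z|lborel_on D. jac p q z *\<^sub>R (\<eta>y (u z) *\<^sub>R P z))"
      "(LINT z|lborel. \<eta> z *\<^sub>R pull_x Px Py (w z)) = (LINT z|lborel_on D. jac p q z *\<^sub>R (\<eta> (u z) *\<^sub>R pull_x Px Py z))"
      "(LINT z|lborel. \<eta> z *\<^sub>R pull_y Px Py (w z)) = (LINT z|lborel_on D. jac p q z *\<^sub>R (\<eta> (u z) *\<^sub>R pull_y Px Py z))"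
      by (rule tr; simp add: t0)+
    then show ?thesis
      using pullback_identity[OF rect t' P, folded D_def] by (simp only: ex ey)
  qed
qed

text \<open>
  In the \<open>L\<^sup>1\<close> norm of the gradient, the Jacobian from the change of variables cancels the denominator, so
  the bound is free of the distortion.
\<close>
lemma energy_inverse:
  fixes P :: "complex \<Rightarrow> complex"
  assumes [measurable]: "Px \<in> borel_measurable borel" "Py \<in> borel_measurable borel"
  shows "(\<integral>\<^sup>+\<zeta>. ennreal (cmod (pull_x Px Py (w \<zeta>)) + cmod (pull_y Px Py (w \<zeta>))) \<partial>lborel_on V) \<le>
     (\<integral>\<^sup>+z. ennreal (2 * ((cmod (Px z) + cmod (Py z)) * (cmod (p z) + cmod (q z)))) \<partial>lborel_on D)"
proof -
  have "(\<integral>\<^sup>+\<zeta>. ennreal (cmod (pull_x Px Py (w \<zeta>)) + cmod (pull_y Px Py (w \<zeta>))) \<partial>lborel_on V)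
     = (\<integral>\<^sup>+z. ennreal (jac p q z) * ennreal (cmod (pull_x Px Py (w (u z))) + cmod (pull_y Px Py (w (u z)))) \<partial>lborel_on D)"
    by (rule nn_transfer) measurable
  also have "\<dots> \<le> (\<integral>\<^sup>+z. ennreal (2 * ((cmod (Px z) + cmod (Py z)) * (cmod (p z) + cmod (q z)))) \<partial>lborel_on D)"
  proof (rule nn_integral_mono_AE, use AE_D jac_nonneg in eventually_elim)
    fix z assume z: "z \<in> D" "jac p q z \<ge> 0"
    have b: "cmod (s *\<^sub>R A - t *\<^sub>R B) \<le> (cmod A + cmod B) * (cmod (p z) + cmod (q z))"
      if "\<bar>s\<bar> \<le> cmod (p z) + cmod (q z)" "\<bar>t\<bar> \<le> cmod (p z) + cmod (q z)" for s t A B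
    proof -
      have "cmod (s *\<^sub>R A - t *\<^sub>R B) \<le> \<bar>s\<bar> * cmod A + \<bar>t\<bar> * cmod B" using norm_triangle_ineq4[of "s *\<^sub>R A" "t *\<^sub>R B"] by simp
      also have "\<dots> \<le> (cmod (p z) + cmod (q z)) * cmod A + (cmod (p z) + cmod (q z)) * cmod B"
        using that by (intro add_mono mult_right_mono) auto
      finally show ?thesis by (simp add: algebra_simps)
    qed
    have c: "\<bar>Im (q z)\<bar> \<le> cmod (p z) + cmod (q z)" "\<bar>Im (p z)\<bar> \<le> cmod (p z) + cmod (q z)"
        "\<bar>Re (q z)\<bar> \<le> cmod (p z) + cmod (q z)" "\<bar>Re (p z)\<bar> \<le> cmod (p z) + cmod (q z)"
      using abs_Re_le_cmod[of "p z"] abs_Im_le_cmod[of "p z"] abs_Re_le_cmod[of "q z"] abs_Im_le_cmod[of "q z"] norm_ge_zero[of "p z"] norm_ge_zero[of "q z"] by linarith+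
    have j: "jac p q z * cmod ((1 / jac p q z) *\<^sub>R x) \<le> cmod x" for x using z by simp
    have "jac p q z * (cmod (pull_x Px Py z) + cmod (pull_y Px Py z)) \<le> 2 * ((cmod (Px z) + cmod (Py z)) * (cmod (p z) + cmod (q z)))"
      using order_trans[OF j b[OF c(1,2)], of "Px z" "Py z"] order_trans[OF j b[OF c(4,3)], of "Py z" "Px z"]
      unfolding pull_x_def pull_y_def by (simp only: distrib_left add.commute)
    then show "ennreal (jac p q z) * ennreal (cmod (pull_x Px Py (w (u z))) + cmod (pull_y Px Py (w (u z)))) \<le> ennreal (2 * ((cmod (Px z) + cmod (Py z)) * (cmod (p z) + cmod (q z))))"
      using z by (simp add: w_u ennreal_mult[symmetric] ennreal_leI del: ennreal_plus)
  qed
  finally show ?thesis .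
qed

text \<open>
  In the \<open>L\<^sup>2\<close> norm one denominator survives the change of variables, and what remains is \<open>|Du|\<^sup>2 / J\<close>. This
  is where the integrability of the distortion is used.
\<close>
lemma weak_grad_inverse_L2:
  shows "loc_Lp 2 V (\<lambda>\<zeta>. pull_x (\<lambda>_. 1) (\<lambda>_. \<i>) (w \<zeta>))" "loc_Lp 2 V (\<lambda>\<zeta>. pull_y (\<lambda>_. 1) (\<lambda>_. \<i>) (w \<zeta>))"
proof -
  have main: "loc_Lp 2 V (\<lambda>\<zeta>. f (w \<zeta>))" if [measurable]: "f \<in> borel_measurable borel" and
     f: "\<And>z. jac p q z \<ge> 0 \<Longrightarrow> jac p q z * (cmod (f z))\<^sup>2 \<le> ((cmod (p z))\<^sup>2 + (cmod (q z))\<^sup>2) / jac p q z" for f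
    unfolding loc_Lp_def
  proof (intro conjI allI impI)
    fix K assume K: "compact K \<and> K \<subseteq> V"
    have "(\<integral>\<^sup>+\<zeta>. ennreal ((cmod (f (w \<zeta>)))\<^sup>2) \<partial>lborel_on K) \<le> (\<integral>\<^sup>+\<zeta>. ennreal ((cmod (f (w \<zeta>)))\<^sup>2) \<partial>lborel_on V)"
      using K by (intro lborel_on_mono) (auto simp: borel_compact)
    also have "\<dots> = (\<integral>\<^sup>+z. ennreal (jac p q z) * ennreal ((cmod (f (w (u z))))\<^sup>2) \<partial>lborel_on D)"
      by (rule nn_transfer) simp
    also have "\<dots> \<le> (\<integral>\<^sup>+z. ennreal (((cmod (p z))\<^sup>2 + (cmod (q z))\<^sup>2) / jac p q z) \<partial>lborel_on D)"
      by (rule nn_integral_mono_AE, use AE_D jac_nonneg in eventually_elim) (simp add: w_u ennreal_mult[symmetric] ennreal_leI f)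
    also have "\<dots> < \<infinity>" using distortion by (simp add: D_def)
    finally show "(\<integral>\<^sup>+\<zeta>. ennreal ((cmod (f (w \<zeta>)))\<^sup>2) \<partial>lborel_on K) < \<infinity>" .
  qed simp
  have e: "cmod ((1 / j) *\<^sub>R x) ^ 2 * j = (cmod x)\<^sup>2 / j" for x j by (cases "j = 0") (simp_all add: power2_eq_square power_divide)
  have le: "j * (cmod ((1 / j) *\<^sub>R (s *\<^sub>R 1 - t *\<^sub>R \<i>)))\<^sup>2 \<le> A / j" if "s\<^sup>2 + t\<^sup>2 \<le> A" "j \<ge> 0" for s t A j
  proof -
    have "(cmod (s *\<^sub>R 1 - t *\<^sub>R \<i>))\<^sup>2 = s\<^sup>2 + t\<^sup>2" unfolding cmod_sq by (simp add: power2_eq_square)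
    then show ?thesis using e[of j "s *\<^sub>R 1 - t *\<^sub>R \<i>"] that by (simp add: mult.commute divide_right_mono)
  qed
  have sq: "(Re x)\<^sup>2 \<le> (cmod x)\<^sup>2" "(Im x)\<^sup>2 \<le> (cmod x)\<^sup>2" for x unfolding cmod_sq by (simp_all add: power2_eq_square)
  show "loc_Lp 2 V (\<lambda>\<zeta>. pull_x (\<lambda>_. 1) (\<lambda>_. \<i>) (w \<zeta>))"
  proof (rule main)
    show "jac p q z * (cmod (pull_x (\<lambda>_. 1) (\<lambda>_. \<i>) z))\<^sup>2 \<le> ((cmod (p z))\<^sup>2 + (cmod (q z))\<^sup>2) / jac p q z" if "jac p q z \<ge> 0" for z
      unfolding pull_x_def using that sq[of "q z"] sq[of "p z"] by (intro le) auto
  qed measurable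
  show "loc_Lp 2 V (\<lambda>\<zeta>. pull_y (\<lambda>_. 1) (\<lambda>_. \<i>) (w \<zeta>))"
  proof (rule main)
    show "jac p q z * (cmod (pull_y (\<lambda>_. 1) (\<lambda>_. \<i>) z))\<^sup>2 \<le> ((cmod (p z))\<^sup>2 + (cmod (q z))\<^sup>2) / jac p q z" if "jac p q z \<ge> 0" for z
    proof -
      have "Re (p z) *\<^sub>R \<i> - Re (q z) *\<^sub>R 1 = - (Re (q z) *\<^sub>R 1 - Re (p z) *\<^sub>R \<i>)" by simp
      then have "cmod (pull_y (\<lambda>_. 1) (\<lambda>_. \<i>) z) = cmod ((1 / jac p q z) *\<^sub>R (Re (q z) *\<^sub>R 1 - Re (p z) *\<^sub>R \<i>))"
        unfolding pull_y_def by (simp only: norm_scaleR norm_minus_cancel)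
      then show ?thesis using that sq[of "q z"] sq[of "p z"] by (simp only:) (intro le, auto)
    qed
  qed measurable
qed

lemma sobolev_homeo_inverse: "sobolev_homeo V w (\<lambda>\<zeta>. pull_x (\<lambda>_. 1) (\<lambda>_. \<i>) (w \<zeta>)) (\<lambda>\<zeta>. pull_y (\<lambda>_. 1) (\<lambda>_. \<i>) (w \<zeta>))"
proof (unfold_locales)
  show "inj_on w V" by (metis inj_onI u_w)
  show "weak_grad V w (\<lambda>\<zeta>. pull_x (\<lambda>_. 1) (\<lambda>_. \<i>) (w \<zeta>)) (\<lambda>\<zeta>. pull_y (\<lambda>_. 1) (\<lambda>_. \<i>) (w \<zeta>))"
    using weak_grad_compose_inverse[OF has_grad_id] .
qed (simp_all add: open_V cont_w weak_grad_inverse_L2)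

text \<open>
  Let \<open>E\<close> be the set where \<open>J \<le> 0\<close>. By the area formula for \<open>u\<close>, the image \<open>u(E)\<close> is a null set. The area
  inequality for \<open>w\<close> bounds the measure of \<open>E = w(u(E))\<close> by an integral over \<open>u(E)\<close>, which is zero.
\<close>
theorem jac_pos: "AE z in lborel_on D. jac p q z > 0"
proof -
  interpret W: sobolev_homeo V w "\<lambda>\<zeta>. pull_x (\<lambda>_. 1) (\<lambda>_. \<i>) (w \<zeta>)" "\<lambda>\<zeta>. pull_y (\<lambda>_. 1) (\<lambda>_. \<i>) (w \<zeta>)"
    by (rule sobolev_homeo_inverse)
  let ?J = "jac (\<lambda>\<zeta>. pull_x (\<lambda>_. 1) (\<lambda>_. \<i>) (w \<zeta>)) (\<lambda>\<zeta>. pull_y (\<lambda>_. 1) (\<lambda>_. \<i>) (w \<zeta>))"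
  have [measurable]: "?J \<in> borel_measurable borel" by measurable
  define E where "E = {z \<in> D. jac p q z \<le> 0}"
  have E[measurable]: "E \<in> sets borel" unfolding E_def by measurable
  have wE[measurable]: "w -` E \<in> sets borel" using measurable_sets_borel[OF measurable_w E] .
  have "emeasure (lborel_on V) (w -` E) = (\<integral>\<^sup>+\<zeta>. indicator (w -` E) \<zeta> \<partial>lborel_on V)" by simp
  also have "\<dots> = (\<integral>\<^sup>+z. ennreal (jac p q z) * indicator (w -` E) (u z) \<partial>lborel_on D)" by (rule nn_transfer) simp
  also have "\<dots> = (\<integral>\<^sup>+z. 0 \<partial>lborel_on D)"
    by (rule nn_integral_cong_AE) (use AE_D in eventually_elim, auto simp: w_u E_def indicator_def ennreal_eq_0_iff)
  finally have "AE \<zeta> in lborel_on V. \<zeta> \<notin> w -` E" by (intro AE_not_in null_setsI) auto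
  then have nE: "AE \<zeta> in lborel. \<zeta> \<in> V \<longrightarrow> w \<zeta> \<notin> E" by (simp add: AE_lborel_on)
  have "AE z in lborel. z \<in> D \<longrightarrow> z \<notin> E"
  proof (rule AE_locally)
    fix z assume z: "z \<in> D"
    obtain c d where cd: "u z \<in> box c d" "cbox c d \<subseteq> V"
      using open_contains_cbox_around[OF open_V u_V[OF z]] by blast
    have bV: "box c d \<subseteq> V" using cd(2) box_subset_cbox[of c d] by blast
    have oS: "open (w ` box c d)" by (rule W.open_image[OF open_box bV])
    then have [measurable]: "w ` box c d \<in> sets borel" by (simp add: borel_open)
    let ?A = "E \<inter> w ` box c d"
    have "emeasure lborel ?A \<le> (\<integral>\<^sup>+\<zeta>. ennreal \<bar>?J \<zeta>\<bar> * indicator ?A (w \<zeta>) \<partial>lborel_on (cbox c d))"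
      by (rule W.area_inequality[OF cd(2)]) auto
    also have "\<dots> = (\<integral>\<^sup>+\<zeta>. 0 \<partial>lborel_on (cbox c d))"
    proof (rule nn_integral_cong_AE)
      have "AE \<zeta> in lborel_on (cbox c d). w \<zeta> \<notin> E"
        unfolding AE_lborel_on[OF borel_closed[OF closed_cbox]] using nE by eventually_elim (use cd(2) in blast)
      then show "AE \<zeta> in lborel_on (cbox c d). ennreal \<bar>?J \<zeta>\<bar> * indicator ?A (w \<zeta>) = 0"
        by eventually_elim simp
    qed
    finally have "AE x in lborel. x \<notin> ?A" by (intro AE_not_in null_setsI) auto
    then have "AE x in lborel. x \<in> w ` box c d \<longrightarrow> x \<notin> E" by eventually_elim blast
    moreover have "z \<in> w ` box c d" using cd(1) w_u[OF z] by (metis imageI)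
    ultimately show "\<exists>S. open S \<and> z \<in> S \<and> (AE x in lborel. x \<in> S \<longrightarrow> x \<notin> E)" using oS by blast
  qed
  then have "AE z in lborel. z \<in> D \<longrightarrow> jac p q z > 0" by eventually_elim (auto simp: E_def)
  then show ?thesis by (simp add: AE_lborel_on)
qed

corollary AE_compose_u:
  assumes "AE \<zeta> in lborel_on V. Q \<zeta>" shows "AE z in lborel_on D. Q (u z)"
  using AE_V_imp_D[OF assms] jac_pos by eventually_elim simp

end

section \<open>The Poincare inequality on rectangles\<close>

lemma borel_measurable_Complex[measurable]:
  assumes [measurable]: "f \<in> borel_measurable M" "g \<in> borel_measurable M"
  shows "(\<lambda>x. Complex (f x) (g x)) \<in> borel_measurable M"
proof -
  have c: "complex_of_real \<in> borel_measurable borel" by (intro borel_measurable_continuous_onI continuous_intros)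
  have "(\<lambda>x. complex_of_real (f x) + \<i> * complex_of_real (g x)) \<in> borel_measurable M"
    by (intro borel_measurable_add borel_measurable_times borel_measurable_const measurable_compose[OF _ c] assms)
  then show ?thesis by (simp add: Complex_eq)
qed

lemma nn_integral_complex:
  assumes [measurable]: "f \<in> borel_measurable borel"
  shows "(\<integral>\<^sup>+z. f z \<partial>lborel) = (\<integral>\<^sup>+x. \<integral>\<^sup>+y. f (Complex x y) \<partial>lborel \<partial>lborel)" (is "_ = ?A")
    and "(\<integral>\<^sup>+z. f z \<partial>lborel) = (\<integral>\<^sup>+y. \<integral>\<^sup>+x. f (Complex x y) \<partial>lborel \<partial>lborel)"
proof -
  have "(\<integral>\<^sup>+z. f z \<partial>lborel) = (\<integral>\<^sup>+z. f z \<partial>distr (lborel :: (real \<times> real) measure) borel (\<lambda>(x, y). Complex x y))"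
    by (simp only: lborel_complex)
  also have "\<dots> = (\<integral>\<^sup>+p. f (case p of (x, y) \<Rightarrow> Complex x y) \<partial>lborel)"
    by (rule nn_integral_distr) auto
  also have "\<dots> = (\<integral>\<^sup>+p. f (Complex (fst p) (snd p)) \<partial>(lborel \<Otimes>\<^sub>M lborel))"
    by (simp only: lborel_prod case_prod_unfold)
  also have "\<dots> = (\<integral>\<^sup>+x. \<integral>\<^sup>+y. f (Complex (fst (x, y)) (snd (x, y))) \<partial>lborel \<partial>lborel)"
    by (rule lborel.nn_integral_fst[symmetric]) measurable
  also have "\<dots> = ?A" by simp
  finally show "(\<integral>\<^sup>+z. f z \<partial>lborel) = ?A" .
  also have "?A = (\<integral>\<^sup>+y. \<integral>\<^sup>+x. f (Complex x y) \<partial>lborel \<partial>lborel)"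
    by (rule lborel_pair.Fubini'[symmetric]) measurable
  finally show "(\<integral>\<^sup>+z. f z \<partial>lborel) = (\<integral>\<^sup>+y. \<integral>\<^sup>+x. f (Complex x y) \<partial>lborel \<partial>lborel)" .
qed

lemma finite_measure_lborel_on: "compact Q \<Longrightarrow> finite_measure (lborel_on Q)"
  using emeasure_lborel_on_compact[of Q] by (intro finite_measureI) auto

text \<open>
  All pairs of values are compared, instead of each value with the mean, so that a bound makes sense before \<open>f\<close>
  is known to be integrable.
\<close>
definition oscillation :: "complex set \<Rightarrow> (complex \<Rightarrow> complex) \<Rightarrow> ennreal" where
  "oscillation Q f = (\<integral>\<^sup>+x. \<integral>\<^sup>+y. ennreal (cmod (f x - f y)) \<partial>lborel_on Q \<partial>lborel_on Q)"

lemma oscillation_fatou: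
  assumes Q: "compact Q" and [measurable]: "\<And>n. f' n \<in> borel_measurable borel" "f \<in> borel_measurable borel"
    and lim: "AE x in lborel_on Q. (\<lambda>n. f' n x) \<longlonglongrightarrow> f x"
  shows "oscillation Q f \<le> liminf (\<lambda>n. oscillation Q (f' n))"
proof -
  interpret finite_measure "lborel_on Q" by (rule finite_measure_lborel_on[OF Q])
  have "oscillation Q f \<le> (\<integral>\<^sup>+x. liminf (\<lambda>n. \<integral>\<^sup>+y. ennreal (cmod (f' n x - f' n y)) \<partial>lborel_on Q) \<partial>lborel_on Q)"
    unfolding oscillation_def
  proof (rule nn_integral_mono_AE, use lim in eventually_elim)
    fix x assume x: "(\<lambda>n. f' n x) \<longlonglongrightarrow> f x"
    have "(\<integral>\<^sup>+y. ennreal (cmod (f x - f y)) \<partial>lborel_on Q) = (\<integral>\<^sup>+y. liminf (\<lambda>n. ennreal (cmod (f' n x - f' n y))) \<partial>lborel_on Q)"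
      by (rule nn_integral_cong_AE, use lim in eventually_elim)
         (intro lim_imp_Liminf[symmetric] tendsto_intros x; simp)
    also have "\<dots> \<le> liminf (\<lambda>n. \<integral>\<^sup>+y. ennreal (cmod (f' n x - f' n y)) \<partial>lborel_on Q)"
      by (rule nn_integral_liminf) simp
    finally show "(\<integral>\<^sup>+y. ennreal (cmod (f x - f y)) \<partial>lborel_on Q) \<le> \<dots>" .
  qed
  also have "\<dots> \<le> liminf (\<lambda>n. oscillation Q (f' n))"
    unfolding oscillation_def by (rule nn_integral_liminf) simp
  finally show ?thesis .
qed

definition poincare_const :: "complex \<Rightarrow> complex \<Rightarrow> ennreal" where
  "poincare_const c d = emeasure lborel (cbox c d) * (ennreal (Re d - Re c) + ennreal (Im d - Im c))"

text \<open>
  Join \<open>z\<close> to \<open>z'\<close> by a horizontal and a vertical segment. The change of \<open>F\<close> along each is at most the integral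
  of the corresponding derivative over a full chord of the rectangle; the first integral depends only on
  \<open>Im z\<close>, the second only on \<open>Re z'\<close>.
\<close>
lemma poincare_smooth:
  assumes F: "has_grad F Fx Fy" and cd: "Re c \<le> Re d" "Im c \<le> Im d"
  shows "oscillation (cbox c d) F \<le> poincare_const c d * (\<integral>\<^sup>+z. ennreal (cmod (Fx z) + cmod (Fy z)) \<partial>lborel_on (cbox c d))"
proof -
  let ?Q = "cbox c d"
  interpret finite_measure "lborel_on ?Q" by (rule finite_measure_lborel_on[OF compact_cbox])
  have [measurable]: "F \<in> borel_measurable borel" "Fx \<in> borel_measurable borel" "Fy \<in> borel_measurable borel"
    using has_gradD[OF F] by (auto intro: borel_measurable_continuous_onI)
  define A where "A y = (\<integral>\<^sup>+s. ennreal (cmod (Fx (Complex s y))) * indicator {Re c..Re d} s \<partial>lborel)" for y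
  define B where "B x = (\<integral>\<^sup>+t. ennreal (cmod (Fy (Complex x t))) * indicator {Im c..Im d} t \<partial>lborel)" for x
  have [measurable]: "A \<in> borel_measurable borel" "B \<in> borel_measurable borel"
    unfolding A_def[abs_def] B_def[abs_def] by measurable
  have line: "ennreal (cmod (G x - G y)) \<le> (\<integral>\<^sup>+s. ennreal (cmod (G' s)) * indicator {l..r} s \<partial>lborel)"
    if G: "\<And>s. (G has_vector_derivative G' s) (at s within {min x y..max x y})" "continuous_on UNIV G'" and xy: "x \<in> {l..r}" "y \<in> {l..r}"
    for G G' :: "real \<Rightarrow> complex" and x y l r
  proof -
    let ?a = "min x y" and ?b = "max x y"
    have "(G' has_integral (G ?b - G ?a)) {?a..?b}"
      by (rule fundamental_theorem_of_calculus) (use G in auto)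
    then have i: "integral {?a..?b} G' = G ?b - G ?a" by (rule integral_unique)
    have "cmod (G x - G y) = cmod (G ?b - G ?a)" by (simp add: min_def max_def norm_minus_commute)
    also have "\<dots> \<le> integral {?a..?b} (\<lambda>s. cmod (G' s))"
      unfolding i[symmetric] by (intro integral_norm_bound_integral integrable_continuous_real continuous_on_norm continuous_on_subset[OF G(2)]) auto
    also have "\<dots> \<le> integral {l..r} (\<lambda>s. cmod (G' s))"
      using xy by (intro integral_subset_le integrable_continuous_real continuous_on_norm continuous_on_subset[OF G(2)]) auto
    finally have "ennreal (cmod (G x - G y)) \<le> ennreal (integral {l..r} (\<lambda>s. cmod (G' s)))" by (rule ennreal_leI)
    also have "\<dots> = (\<integral>\<^sup>+s. ennreal (cmod (G' s)) * indicator {l..r} s \<partial>lborel)"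
      by (rule nn_integral_has_integral_lebesgue'[symmetric])
         (auto intro!: integrable_integral integrable_continuous_real continuous_on_norm continuous_on_subset[OF G(2)])
    finally show ?thesis .
  qed
  have pt: "ennreal (cmod (F z - F z')) \<le> A (Im z) + B (Re z')" if "z \<in> ?Q" "z' \<in> ?Q" for z z'
  proof -
    have r: "Re z \<in> {Re c..Re d}" "Re z' \<in> {Re c..Re d}" "Im z \<in> {Im c..Im d}" "Im z' \<in> {Im c..Im d}"
      using that by (auto simp: in_cbox_complex_iff)
    let ?m = "Complex (Re z') (Im z)"
    have "ennreal (cmod (F (Complex (Re z) (Im z)) - F ?m)) \<le> A (Im z)"
      unfolding A_def by (rule line[OF has_grad_along(1)[OF F] continuous_on_Complex(1)[OF has_gradD(2)[OF F]] r(1,2)])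
    moreover have "ennreal (cmod (F ?m - F (Complex (Re z') (Im z')))) \<le> B (Re z')"
      unfolding B_def by (rule line[OF has_grad_along(2)[OF F] continuous_on_Complex(2)[OF has_gradD(3)[OF F]] r(3,4)])
    moreover have "ennreal (cmod (F z - F z')) \<le> ennreal (cmod (F z - F ?m)) + ennreal (cmod (F ?m - F z'))"
      using norm_triangle_ineq[of "F z - F ?m" "F ?m - F z'"] by (simp flip: ennreal_plus add: ennreal_leI)
    ultimately show ?thesis by (simp add: add_mono order_trans)
  qed
  have ind: "indicator ?Q (Complex x y) = (indicator {Re c..Re d} x * indicator {Im c..Im d} y :: ennreal)" for x y
    by (simp add: indicator_def in_cbox_complex_iff)
  have IA: "(\<integral>\<^sup>+z. A (Im z) \<partial>lborel_on ?Q) = ennreal (Re d - Re c) * (\<integral>\<^sup>+z. ennreal (cmod (Fx z)) \<partial>lborel_on ?Q)"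
  proof -
    have "(\<integral>\<^sup>+z. A (Im z) \<partial>lborel_on ?Q) = (\<integral>\<^sup>+y. \<integral>\<^sup>+x. indicator {Re c..Re d} x * (indicator {Im c..Im d} y * A y) \<partial>lborel \<partial>lborel)"
      by (subst nn_integral_lborel_on) (simp_all add: nn_integral_complex(2) ind mult.assoc)
    also have "\<dots> = (\<integral>\<^sup>+y. ennreal (Re d - Re c) * (indicator {Im c..Im d} y * A y) \<partial>lborel)"
      using cd by (subst nn_integral_multc) auto
    also have "\<dots> = ennreal (Re d - Re c) * (\<integral>\<^sup>+y. indicator {Im c..Im d} y * A y \<partial>lborel)"
      by (rule nn_integral_cmult) simp
    also have "(\<integral>\<^sup>+y. indicator {Im c..Im d} y * A y \<partial>lborel) = (\<integral>\<^sup>+y. \<integral>\<^sup>+s. indicator {Im c..Im d} y * (ennreal (cmod (Fx (Complex s y))) * indicator {Re c..Re d} s) \<partial>lborel \<partial>lborel)"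
      unfolding A_def by (subst nn_integral_cmult[symmetric]) auto
    also have "\<dots> = (\<integral>\<^sup>+z. ennreal (cmod (Fx z)) \<partial>lborel_on ?Q)"
      by (subst nn_integral_lborel_on) (simp_all add: nn_integral_complex(2) ind ac_simps)
    finally show ?thesis .
  qed
  have IB: "(\<integral>\<^sup>+z. B (Re z) \<partial>lborel_on ?Q) = ennreal (Im d - Im c) * (\<integral>\<^sup>+z. ennreal (cmod (Fy z)) \<partial>lborel_on ?Q)"
  proof -
    have "(\<integral>\<^sup>+z. B (Re z) \<partial>lborel_on ?Q) = (\<integral>\<^sup>+x. \<integral>\<^sup>+y. indicator {Im c..Im d} y * (indicator {Re c..Re d} x * B x) \<partial>lborel \<partial>lborel)"
      by (subst nn_integral_lborel_on) (simp_all add: nn_integral_complex(1) ind ac_simps)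
    also have "\<dots> = (\<integral>\<^sup>+x. ennreal (Im d - Im c) * (indicator {Re c..Re d} x * B x) \<partial>lborel)"
      using cd by (subst nn_integral_multc) auto
    also have "\<dots> = ennreal (Im d - Im c) * (\<integral>\<^sup>+x. indicator {Re c..Re d} x * B x \<partial>lborel)"
      by (rule nn_integral_cmult) simp
    also have "(\<integral>\<^sup>+x. indicator {Re c..Re d} x * B x \<partial>lborel) = (\<integral>\<^sup>+x. \<integral>\<^sup>+t. indicator {Re c..Re d} x * (ennreal (cmod (Fy (Complex x t))) * indicator {Im c..Im d} t) \<partial>lborel \<partial>lborel)"
      unfolding B_def by (subst nn_integral_cmult[symmetric]) auto
    also have "\<dots> = (\<integral>\<^sup>+z. ennreal (cmod (Fy z)) \<partial>lborel_on ?Q)"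
      by (subst nn_integral_lborel_on) (simp_all add: nn_integral_complex(1) ind ac_simps)
    finally show ?thesis .
  qed
  let ?m = "emeasure lborel ?Q"
  have U: "emeasure (lborel_on ?Q) UNIV = ?m" by (simp add: emeasure_lborel_on)
  have inQ: "AE z in lborel_on ?Q. z \<in> ?Q" by (simp add: AE_lborel_on)
  have "oscillation ?Q F \<le> (\<integral>\<^sup>+z. \<integral>\<^sup>+z'. A (Im z) + B (Re z') \<partial>lborel_on ?Q \<partial>lborel_on ?Q)"
    unfolding oscillation_def
  proof (rule nn_integral_mono_AE, use inQ in eventually_elim)
    fix z assume z: "z \<in> ?Q"
    show "(\<integral>\<^sup>+z'. ennreal (cmod (F z - F z')) \<partial>lborel_on ?Q) \<le> (\<integral>\<^sup>+z'. A (Im z) + B (Re z') \<partial>lborel_on ?Q)"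
      by (rule nn_integral_mono_AE, use inQ in eventually_elim) (rule pt[OF z])
  qed
  also have "\<dots> = ?m * (ennreal (Re d - Re c) * (\<integral>\<^sup>+z. ennreal (cmod (Fx z)) \<partial>lborel_on ?Q) + ennreal (Im d - Im c) * (\<integral>\<^sup>+z. ennreal (cmod (Fy z)) \<partial>lborel_on ?Q))"
    by (simp add: nn_integral_add nn_integral_multc IA IB U distrib_left mult.commute)
  also have "\<dots> \<le> ?m * ((ennreal (Re d - Re c) + ennreal (Im d - Im c)) * ((\<integral>\<^sup>+z. ennreal (cmod (Fx z)) \<partial>lborel_on ?Q) + (\<integral>\<^sup>+z. ennreal (cmod (Fy z)) \<partial>lborel_on ?Q)))"
    by (intro mult_left_mono) (auto simp: distrib_left distrib_right add_increasing add_increasing2 intro!: add_mono)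
  also have "\<dots> = poincare_const c d * (\<integral>\<^sup>+z. ennreal (cmod (Fx z) + cmod (Fy z)) \<partial>lborel_on ?Q)"
    by (simp add: poincare_const_def nn_integral_add mult.assoc)
  finally show ?thesis .
qed

lemma poincare_const_finite: "poincare_const c d < \<infinity>"
  using emeasure_lborel_cbox_finite[of c d] by (simp add: poincare_const_def ennreal_mult_less_top)

text \<open>
  The inequality for mollifications; the left-hand side passes to the limit by Fatou's lemma.
\<close>
theorem poincare:
  assumes V: "open V" and Q: "cbox c d \<subseteq> V" and cd: "Re c \<le> Re d" "Im c \<le> Im d"
    and f: "loc_Lp 1 V f" "continuous_on V f" and w: "weak_grad V f g h" and g: "loc_Lp 1 V g" and h: "loc_Lp 1 V h"
  shows "oscillation (cbox c d) f \<le> poincare_const c d * (\<integral>\<^sup>+z. ennreal (cmod (g z) + cmod (h z)) \<partial>lborel_on (cbox c d))"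
proof -
  let ?Q = "cbox c d"
  obtain F G H where F: "\<And>n::nat. C2_map (F n) (G n) (H n)"
    "(\<lambda>n. \<integral>\<^sup>+z. ennreal (cmod (G n z - g z) ^ 1) \<partial>lborel_on ?Q) \<longlonglongrightarrow> 0"
    "(\<lambda>n. \<integral>\<^sup>+z. ennreal (cmod (H n z - h z) ^ 1) \<partial>lborel_on ?Q) \<longlonglongrightarrow> 0"
    "(\<lambda>n. \<integral>\<^sup>+z. ennreal (cmod (F n z - f z)) \<partial>lborel_on ?Q) \<longlonglongrightarrow> 0"
    "continuous_on V f \<Longrightarrow> uniform_limit ?Q F f sequentially"
    by (rule smooth_approximation[OF V compact_cbox Q w f(1) g g h h]) auto
  have Fg: "has_grad (F n) (G n) (H n)" for n using F(1) by (simp add: C2_map_def)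
  have [measurable]: "F n \<in> borel_measurable borel" "G n \<in> borel_measurable borel" "H n \<in> borel_measurable borel" for n
    using has_gradD[OF Fg] by (auto intro: borel_measurable_continuous_onI)
  have [measurable]: "f \<in> borel_measurable borel" "g \<in> borel_measurable borel" "h \<in> borel_measurable borel" using f g h by auto
  let ?I = "\<integral>\<^sup>+z. ennreal (cmod (g z) + cmod (h z)) \<partial>lborel_on ?Q"
  let ?e = "\<lambda>n. (\<integral>\<^sup>+z. ennreal (cmod (G n z - g z)) \<partial>lborel_on ?Q) + (\<integral>\<^sup>+z. ennreal (cmod (H n z - h z)) \<partial>lborel_on ?Q)"
  have "oscillation ?Q f \<le> liminf (\<lambda>n. oscillation ?Q (F n))"
    by (rule oscillation_fatou[OF compact_cbox]) (auto simp: AE_lborel_on intro!: AE_I2 tendsto_uniform_limitI[OF F(5)[OF f(2)]])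
  also have "\<dots> \<le> liminf (\<lambda>n. poincare_const c d * (?I + ?e n))"
  proof (intro Liminf_mono always_eventually allI)
    fix n
    have "(\<integral>\<^sup>+z. ennreal (cmod (G n z) + cmod (H n z)) \<partial>lborel_on ?Q) \<le> (\<integral>\<^sup>+z. ennreal (cmod (g z) + cmod (h z)) + (ennreal (cmod (G n z - g z)) + ennreal (cmod (H n z - h z))) \<partial>lborel_on ?Q)"
    proof (intro nn_integral_mono)
      fix z
      have "cmod (G n z) + cmod (H n z) \<le> cmod (g z) + cmod (h z) + (cmod (G n z - g z) + cmod (H n z - h z))"
        using norm_triangle_sub[of "G n z" "g z"] norm_triangle_sub[of "H n z" "h z"] by simp
      then show "ennreal (cmod (G n z) + cmod (H n z)) \<le> ennreal (cmod (g z) + cmod (h z)) + (ennreal (cmod (G n z - g z)) + ennreal (cmod (H n z - h z)))"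
        by (simp only: ennreal_plus[symmetric] norm_ge_zero add_nonneg_nonneg ennreal_leI)
    qed
    also have "\<dots> = ?I + ?e n" by (simp add: nn_integral_add)
    finally show "oscillation ?Q (F n) \<le> poincare_const c d * (?I + ?e n)"
      by (intro order_trans[OF poincare_smooth[OF Fg cd]] mult_left_mono) auto
  qed
  also have "\<dots> = poincare_const c d * (?I + 0)"
  proof (rule lim_imp_Liminf)
    have "?e \<longlonglongrightarrow> 0 + 0" using F(2,3) by (intro tendsto_add) simp_all
    then have "(\<lambda>n. ?I + ?e n) \<longlonglongrightarrow> ?I + 0" by (intro tendsto_add tendsto_const) simp
    then show "(\<lambda>n. poincare_const c d * (?I + ?e n)) \<longlonglongrightarrow> poincare_const c d * (?I + 0)"
      by (intro ennreal_tendsto_cmult poincare_const_finite[unfolded infinity_ennreal_def])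
  qed simp
  finally show ?thesis by simp
qed

section \<open>Weyl's lemma for the Cauchy-Riemann operator\<close>

lemma has_grad_unique:
  fixes f :: "complex \<Rightarrow> complex"
  assumes "has_grad f p q" "has_grad f p' q'"
  shows "p z = p' z" "q z = q' z"
proof -
  have "grad_map (p z) (q z) = grad_map (p' z) (q' z)"
    using has_derivative_unique[OF has_gradD(1)[OF assms(1), of z UNIV] has_gradD(1)[OF assms(2), of z UNIV]] .
  from fun_cong[OF this, of 1] fun_cong[OF this, of \<i>] show "p z = p' z" "q z = q' z" by (simp_all add: grad_map_def)
qed

text \<open>
  The kernels \<open>cauchy_kern r\<close> and \<open>cauchy_kern s\<close> agree outside the disc of radius \<open>s\<close>. Hence their difference
  \<open>H1 + \<i> H2\<close> is a test function, and its derivative with respect to the conjugate variable is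
  \<open>kern r - kern s\<close>. The last two clauses are the real and imaginary part of this equation.
\<close>
lemma kern_difference_dbar:
  assumes r: "r > 0" "r \<le> s"
  obtains H1 H2 a1 b1 a2 b2 where "bump s H1" "bump s H2" "has_grad H1 a1 b1" "has_grad H2 a2 b2"
    "bump s a1" "bump s b1" "bump s a2" "bump s b2"
    "\<And>z. a1 z - b2 z = 2 * (kern r z - kern s z)" "\<And>z. b1 z + a2 z = 0"
proof -
  have s: "s > 0" using r by simp
  define M where "M z = stem r z - stem s z" for z
  define H1 where "H1 z = Re z * M z" for z
  define H2 where "H2 z = (-1) * Im z * M z" for z
  have M0: "M z = 0" if "cmod z > s" for z
  proof -
    have "cauchy_kern r z = cauchy_kern s z" using that r s by (simp add: cauchy_kern_outside)
    moreover have "z \<noteq> 0" using that s by auto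
    ultimately show ?thesis by (simp add: cauchy_kern_def M_def)
  qed
  have "smooth_plane (\<lambda>z. stem r z + (-1) * stem s z)"
    by (intro smooth_plane.add smooth_plane.mult smooth_plane.const smooth_plane_stem)
  then have sM: "smooth_plane M" by (simp add: M_def[abs_def])
  have sH: "smooth_plane H1" "smooth_plane H2" unfolding H1_def[abs_def] H2_def[abs_def]
    by (intro smooth_plane.mult smooth_plane.const smooth_plane.Re smooth_plane.Im sM)+
  have bH: "bump s H1" "bump s H2" using sH M0 unfolding bump_def H1_def H2_def by (metis mult_zero_right not_le)+
  obtain a1 b1 where 1: "smooth_plane a1" "smooth_plane b1" "has_grad H1 a1 b1" using smooth_plane_has_grad[OF sH(1)] by blast
  obtain a2 b2 where 2: "smooth_plane a2" "smooth_plane b2" "has_grad H2 a2 b2" using smooth_plane_has_grad[OF sH(2)] by blast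
  obtain p q where pq: "has_grad (cauchy_kern r) p q" "\<And>z. p z + \<i> * q z = 2 * of_real (kern r z)" using has_grad_cauchy_kern[OF r(1)] by blast
  obtain p' q' where pq': "has_grad (cauchy_kern s) p' q'" "\<And>z. p' z + \<i> * q' z = 2 * of_real (kern s z)" using has_grad_cauchy_kern[OF s] by blast
  have g1: "has_grad (\<lambda>z. cauchy_kern r z + (- cauchy_kern s z)) (\<lambda>z. p z + - p' z) (\<lambda>z. q z + - q' z)"
    by (intro has_grad_add pq has_grad_linear[OF pq'(1)] bounded_linear_minus bounded_linear_ident)
  have g2: "has_grad (\<lambda>z. of_real (H1 z) + \<i> * of_real (H2 z)) (\<lambda>z. of_real (a1 z) + \<i> * of_real (a2 z)) (\<lambda>z. of_real (b1 z) + \<i> * of_real (b2 z))"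
    by (intro has_grad_add has_grad_linear[OF 1(3) bounded_linear_of_real]
          has_grad_linear[OF has_grad_linear[OF 2(3) bounded_linear_of_real] bounded_linear_mult_right])
  have g12: "(\<lambda>z. of_real (H1 z) + \<i> * of_real (H2 z)) = (\<lambda>z. cauchy_kern r z + (- cauchy_kern s z))"
    by (auto simp: fun_eq_iff H1_def H2_def M_def cauchy_kern_def complex_eq_iff algebra_simps)
  have e: "of_real (a1 z) + \<i> * of_real (a2 z) = p z + - p' z" "of_real (b1 z) + \<i> * of_real (b2 z) = q z + - q' z" for z
    by (rule has_grad_unique[OF g2[unfolded g12] g1])+
  have k: "(of_real (a1 z) + \<i> * of_real (a2 z)) + \<i> * (of_real (b1 z) + \<i> * of_real (b2 z)) = complex_of_real (2 * (kern r z - kern s z))" for z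
    unfolding e using pq(2)[of z] pq'(2)[of z] by (simp add: algebra_simps)
  have "a1 z - b2 z = 2 * (kern r z - kern s z)" "b1 z + a2 z = 0" for z
    using k[of z] by (simp_all add: complex_eq_iff)
  then show thesis
    using that[OF bH 1(3) 2(3) bump_gradient[OF bH(1) 1(3) 1(1,2)] bump_gradient[OF bH(2) 2(3) 2(1,2)]] by blast
qed

text \<open>
  The mollifications \<open>conv (kern r) f\<close> do not depend on \<open>r\<close> near \<open>z0\<close>: their differences pair \<open>f\<close> with
  a derivative of a test function with respect to the conjugate variable. On the other hand they converge to
  \<open>f\<close> in \<open>L\<^sup>1\<close>. So \<open>f\<close> is almost everywhere equal to one mollification, which is continuously differentiable and
  satisfies the Cauchy-Riemann equation.
\<close>
theorem weyl_dbar: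
  assumes f: "integrable (lborel_on (cbox c d)) f" "f \<in> borel_measurable borel" and z0: "z0 \<in> box c d"
    and hol: "\<And>\<eta> \<eta>x \<eta>y. test_in (box c d) \<eta> \<eta>x \<eta>y \<Longrightarrow>
       (LINT z|lborel_on (cbox c d). (of_real (\<eta>x z) + \<i> * of_real (\<eta>y z)) * f z) = 0"
  shows "\<exists>\<rho>>0. ball z0 \<rho> \<subseteq> box c d \<and> (\<exists>\<phi>. \<phi> holomorphic_on ball z0 \<rho> \<and> (AE z in lborel_on (ball z0 \<rho>). f z = \<phi> z))"
proof -
  let ?Q = "cbox c d"
  note [measurable] = f(2)
  define F where "F = cut ?Q f"
  have Fi: "integrable lborel F" using f unfolding F_def cut_def[abs_def] by (subst (asm) integrable_lborel_on) auto
  have sub: "box c d \<subseteq> ?Q" by (rule box_subset_cbox)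
  obtain e where e: "e > 0" "cball z0 e \<subseteq> box c d" using open_contains_cball[of "box c d"] z0 open_box by blast
  define \<rho> where "\<rho> = e / 2"
  have \<rho>: "\<rho> > 0" using e by (simp add: \<rho>_def)
  have cb: "cball z r \<subseteq> box c d" if "z \<in> ball z0 \<rho>" "r \<le> \<rho>" for z r
  proof
    fix x assume "x \<in> cball z r"
    then have "x \<in> cball z0 e" using that dist_triangle[of z0 x z] by (simp add: \<rho>_def)
    then show "x \<in> box c d" using e by blast
  qed
  have T: "conv kx F z + \<i> * conv ky F z = 0"
    if k: "bump r k" "has_grad k kx ky" "bump r kx" "bump r ky" and z: "z \<in> ball z0 \<rho>" "r \<le> \<rho>" for k kx ky r z
  proof -
    have t: "test_in (box c d) (\<lambda>y. k (z - y)) (\<lambda>y. - kx (z - y)) (\<lambda>y. - ky (z - y))"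
      using test_in_bump[OF k cb[OF z]] .
    have [measurable]: "kx \<in> borel_measurable borel" "ky \<in> borel_measurable borel" using k by auto
    have "conv kx F z + \<i> * conv ky F z = (LINT y|lborel. kx (z - y) *\<^sub>R F y) + (LINT y|lborel. \<i> * (ky (z - y) *\<^sub>R F y))"
      unfolding conv_def by (simp only: integral_mult_right_zero)
    also have "\<dots> = (LINT y|lborel. kx (z - y) *\<^sub>R F y + \<i> * (ky (z - y) *\<^sub>R F y))"
      by (intro Bochner_Integration.integral_add[symmetric] integrable_mult_right conv_integrable[OF k(3) Fi] conv_integrable[OF k(4) Fi])
    also have "\<dots> = - (LINT y|lborel. indicator ?Q y *\<^sub>R ((of_real (- kx (z - y)) + \<i> * of_real (- ky (z - y))) * f y))"
      by (subst integral_minus[symmetric], rule Bochner_Integration.integral_cong)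
         (auto simp: F_def cut_def indicator_def scaleR_conv_of_real algebra_simps)
    also have "\<dots> = - (LINT y|lborel_on ?Q. (of_real (- kx (z - y)) + \<i> * of_real (- ky (z - y))) * f y)"
      by (subst integral_lborel_on) (auto simp: set_lebesgue_integral_def)
    also have "\<dots> = 0" using hol[OF t] by simp
    finally show ?thesis .
  qed
  have same: "conv (kern r) F z = conv (kern \<rho>) F z" if z: "z \<in> ball z0 \<rho>" and r: "0 < r" "r \<le> \<rho>" for r z
  proof -
    obtain H1 H2 a1 b1 a2 b2 where H: "bump \<rho> H1" "bump \<rho> H2" "has_grad H1 a1 b1" "has_grad H2 a2 b2"
      "bump \<rho> a1" "bump \<rho> b1" "bump \<rho> a2" "bump \<rho> b2"
      "\<And>z. a1 z - b2 z = 2 * (kern r z - kern \<rho> z)" "\<And>z. b1 z + a2 z = 0"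
      using kern_difference_dbar[OF r] by blast
    note i = conv_integrable[OF H(5) Fi, of z] conv_integrable[OF H(6) Fi, of z] conv_integrable[OF H(7) Fi, of z] conv_integrable[OF H(8) Fi, of z]
      conv_integrable[OF bump_kern[OF r(1)] Fi, of z] conv_integrable[OF bump_kern[OF \<rho>] Fi, of z]
    have "conv a1 F z + \<i> * conv b1 F z = 0" "conv a2 F z + \<i> * conv b2 F z = 0"
      using T[OF H(1,3,5,6) z] T[OF H(2,4,7,8) z] by auto
    then have "(conv a1 F z + \<i> * conv b1 F z) + \<i> * (conv a2 F z + \<i> * conv b2 F z) = 0" by simp
    then have 0: "(conv a1 F z - conv b2 F z) + \<i> * (conv b1 F z + conv a2 F z) = 0" by (simp add: algebra_simps)
    have "conv b1 F z + conv a2 F z = (LINT y|lborel. (b1 (z - y) + a2 (z - y)) *\<^sub>R F y)"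
      unfolding conv_def scaleR_add_left using i by (subst Bochner_Integration.integral_add) auto
    then have 1: "conv b1 F z + conv a2 F z = 0" by (simp add: H(10))
    have "conv a1 F z - conv b2 F z = (LINT y|lborel. (a1 (z - y) - b2 (z - y)) *\<^sub>R F y)"
      unfolding conv_def scaleR_diff_left using i by (subst Bochner_Integration.integral_diff) auto
    also have "\<dots> = (LINT y|lborel. 2 *\<^sub>R (kern r (z - y) *\<^sub>R F y - kern \<rho> (z - y) *\<^sub>R F y))"
      unfolding H(9) by (simp add: scaleR_diff_left scaleR_diff_right right_diff_distrib)
    also have "\<dots> = 2 *\<^sub>R (conv (kern r) F z - conv (kern \<rho>) F z)"
      unfolding conv_def using i by (subst integral_scaleR_right, subst Bochner_Integration.integral_diff) auto
    finally show ?thesis using 0 1 by simp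
  qed
  define \<phi> where "\<phi> = conv (kern \<rho>) F"
  obtain kx ky where k: "C2_map \<phi> (conv kx F) (conv ky F)" "has_grad (kern \<rho>) kx ky" "bump \<rho> kx" "bump \<rho> ky"
    using conv_kern_C2[OF \<rho> Fi] unfolding \<phi>_def by blast
  have \<phi>g: "has_grad \<phi> (conv kx F) (conv ky F)" using k(1) by (simp add: C2_map_def)
  have "\<phi> holomorphic_on ball z0 \<rho>"
    unfolding holomorphic_on_def field_differentiable_def
  proof (intro ballI exI)
    fix z assume z: "z \<in> ball z0 \<rho>"
    have cr: "conv ky F z = \<i> * conv kx F z"
    proof -
      have "\<i> * (conv kx F z + \<i> * conv ky F z) = 0" using T[OF bump_kern[OF \<rho>] k(2-4) z] by simp
      then show ?thesis by (simp add: algebra_simps)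
    qed
    have "grad_map (conv kx F z) (conv ky F z) = (*) (conv kx F z)"
      unfolding cr grad_map_def by (auto simp: fun_eq_iff complex_eq_iff algebra_simps)
    then show "(\<phi> has_field_derivative conv kx F z) (at z within ball z0 \<rho>)"
      unfolding has_field_derivative_def using has_gradD(1)[OF \<phi>g, of z] by simp
  qed
  moreover have "AE z in lborel_on (ball z0 \<rho>). f z = \<phi> z"
  proof -
    have [measurable]: "\<phi> \<in> borel_measurable borel" "F \<in> borel_measurable borel"
      using has_gradD(4)[OF \<phi>g] Fi by (auto intro: borel_measurable_continuous_onI)
    note [measurable] = this(1)[unfolded \<phi>_def]
    let ?I = "\<integral>\<^sup>+z. ennreal (cmod (\<phi> z - F z)) \<partial>lborel_on (ball z0 \<rho>)"
    have "?I \<le> 0"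
    proof (rule tendsto_lowerbound)
      have "(\<integral>\<^sup>+z. ennreal (cmod (F z) ^ 1) \<partial>lborel) < \<infinity>" using Fi by (simp add: integrable_iff_bounded)
      from conv_kern_Lp[OF Fi this] show "((\<lambda>r. \<integral>\<^sup>+z. ennreal (cmod (conv (kern r) F z - F z)) \<partial>lborel) \<longlongrightarrow> 0) (at_right 0)" by simp
      show "\<forall>\<^sub>F r in at_right 0. ?I \<le> (\<integral>\<^sup>+z. ennreal (cmod (conv (kern r) F z - F z)) \<partial>lborel)"
        unfolding eventually_at_right_field
      proof (intro exI[of _ \<rho>] conjI allI impI \<rho>)
        fix r assume r: "0 < r" "r < \<rho>"
        show "?I \<le> (\<integral>\<^sup>+z. ennreal (cmod (conv (kern r) F z - F z)) \<partial>lborel)"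
          by (subst nn_integral_lborel_on) (auto intro!: nn_integral_mono simp: indicator_def same r less_imp_le \<phi>_def)
      qed
    qed simp
    then have "?I = 0" by simp
    then have "AE z in lborel_on (ball z0 \<rho>). ennreal (cmod (\<phi> z - F z)) = 0" by (subst (asm) nn_integral_0_iff_AE) auto
    moreover have "AE z in lborel_on (ball z0 \<rho>). z \<in> ball z0 \<rho>" by (simp add: AE_lborel_on)
    ultimately show ?thesis
    proof eventually_elim
      fix z assume z: "ennreal (cmod (\<phi> z - F z)) = 0" "z \<in> ball z0 \<rho>"
      have "z \<in> ?Q" using cb[OF z(2), of 0] \<rho> sub by auto
      then show "f z = \<phi> z" using z by (simp add: F_def)
    qed
  qed
  moreover have "ball z0 \<rho> \<subseteq> box c d" using cb[of _ 0] \<rho> by auto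
  ultimately show ?thesis using \<rho> by blast
qed

section \<open>The factor is holomorphic\<close>

lemma norm_integral_le_nn_integral:
  fixes f :: "'a \<Rightarrow> complex"
  shows "ennreal (cmod (integral\<^sup>L M f)) \<le> (\<integral>\<^sup>+x. ennreal (cmod (f x)) \<partial>M)"
  using integral_norm_bound_ennreal[of M f] by (cases "integrable M f") (auto simp: not_integrable_integral_eq)

text \<open>
  Derivatives of test functions have mean zero. Hence pairing with them ignores additive constants, which the
  Poincare inequality leaves undetermined.
\<close>
lemma integral_test_gradient:
  assumes t: "test_in (box c d) \<eta> \<eta>x \<eta>y" and cd: "Re c \<le> Re d" "Im c \<le> Im d"
  shows "(LINT z|lborel_on (cbox c d). complex_of_real (\<eta>x z) + \<i> * of_real (\<eta>y z)) = 0"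
proof -
  have g: "has_grad \<eta> \<eta>x \<eta>y" using t by (simp add: test_in_def)
  have g': "has_grad (\<lambda>z. complex_of_real (\<eta> z)) (\<lambda>z. of_real (\<eta>x z)) (\<lambda>z. of_real (\<eta>y z))"
    by (rule has_grad_linear[OF g bounded_linear_of_real])
  have 0: "\<eta> z = 0" if "z \<notin> box c d" for z using t that unfolding test_in_def by blast
  have x: "(LINT z|lborel_on (cbox c d). complex_of_real (\<eta>x z)) = 0"
    using integral_partial_rectangle(1)[OF g' cd] by (subst integral_lborel_on)
      (auto simp: 0 in_box_complex_iff intro!: borel_measurable_continuous_onI has_gradD[OF g'])
  have y: "(LINT z|lborel_on (cbox c d). complex_of_real (\<eta>y z)) = 0"
    using integral_partial_rectangle(2)[OF g' cd] by (subst integral_lborel_on)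
      (auto simp: 0 in_box_complex_iff intro!: borel_measurable_continuous_onI has_gradD[OF g'])
  have "(LINT z|lborel_on (cbox c d). complex_of_real (\<eta>x z) + \<i> * of_real (\<eta>y z)) =
      (LINT z|lborel_on (cbox c d). complex_of_real (\<eta>x z)) + (LINT z|lborel_on (cbox c d). \<i> * of_real (\<eta>y z))"
    by (intro Bochner_Integration.integral_add integrable_mult_right integrable_lborel_on_continuous compact_cbox has_gradD[OF g'])
  also have "\<dots> = 0" using x y by (simp only: integral_mult_right_zero) simp
  finally show ?thesis .
qed

text \<open>
  As \<open>\<theta>\<close> has mean zero, \<open>F\<close> may be replaced by \<open>F - F x\<close> for every \<open>x\<close>; then average over \<open>x\<close>.
\<close>
lemma integral_test_oscillation:
  assumes Q: "compact Q" and [measurable]: "F \<in> borel_measurable borel" "\<theta> \<in> borel_measurable borel"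
    and Fi: "integrable (lborel_on Q) F" and B: "B \<ge> 0" "\<And>z. cmod (\<theta> z) \<le> B" and 0: "(LINT z|lborel_on Q. \<theta> z) = 0"
  shows "emeasure lborel Q * ennreal (cmod (LINT z|lborel_on Q. \<theta> z * F z)) \<le> ennreal B * oscillation Q F"
proof -
  interpret finite_measure "lborel_on Q" by (rule finite_measure_lborel_on[OF Q])
  have [measurable]: "Q \<in> sets borel" using Q by (simp add: borel_compact)
  have i1: "integrable (lborel_on Q) (\<lambda>z. \<theta> z * F z)"
    by (rule Bochner_Integration.integrable_bound[of _ "\<lambda>z. B * cmod (F z)"])
       (use Fi B in \<open>auto simp: norm_mult intro!: AE_I2 mult_right_mono\<close>)
  have i2: "integrable (lborel_on Q) \<theta>"
    by (rule integrable_const_bound[of _ B]) (use B in auto)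
  let ?I = "LINT z|lborel_on Q. \<theta> z * F z"
  have pt: "ennreal (cmod ?I) \<le> ennreal B * (\<integral>\<^sup>+y. ennreal (cmod (F x - F y)) \<partial>lborel_on Q)" for x
  proof -
    have "(LINT y|lborel_on Q. \<theta> y * F y - \<theta> y * F x) = ?I - (LINT y|lborel_on Q. \<theta> y * F x)"
      by (intro Bochner_Integration.integral_diff i1 integrable_mult_left i2)
    also have "\<dots> = ?I" using 0 by simp
    finally have "ennreal (cmod ?I) = ennreal (cmod (LINT y|lborel_on Q. \<theta> y * F y - \<theta> y * F x))" by simp
    also have "\<dots> \<le> (\<integral>\<^sup>+y. ennreal (cmod (\<theta> y * F y - \<theta> y * F x)) \<partial>lborel_on Q)" by (rule norm_integral_le_nn_integral)
    also have "\<dots> \<le> (\<integral>\<^sup>+y. ennreal B * ennreal (cmod (F x - F y)) \<partial>lborel_on Q)"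
    proof (intro nn_integral_mono)
      fix y
      have "cmod (\<theta> y * F y - \<theta> y * F x) = cmod (\<theta> y) * cmod (F x - F y)"
        by (simp add: norm_mult[symmetric] right_diff_distrib[symmetric] norm_minus_commute) (simp add: norm_mult norm_minus_commute)
      also have "\<dots> \<le> B * cmod (F x - F y)" by (intro mult_right_mono B) auto
      finally show "ennreal (cmod (\<theta> y * F y - \<theta> y * F x)) \<le> ennreal B * ennreal (cmod (F x - F y))"
        using B by (simp add: ennreal_mult[symmetric] ennreal_leI)
    qed
    also have "\<dots> = ennreal B * (\<integral>\<^sup>+y. ennreal (cmod (F x - F y)) \<partial>lborel_on Q)" by (rule nn_integral_cmult) simp
    finally show ?thesis .
  qed
  have "emeasure lborel Q * ennreal (cmod ?I) = (\<integral>\<^sup>+x. ennreal (cmod ?I) \<partial>lborel_on Q)"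
    by (simp add: emeasure_lborel_on mult.commute)
  also have "\<dots> \<le> (\<integral>\<^sup>+x. ennreal B * (\<integral>\<^sup>+y. ennreal (cmod (F x - F y)) \<partial>lborel_on Q) \<partial>lborel_on Q)"
    by (intro nn_integral_mono pt)
  also have "\<dots> = ennreal B * oscillation Q F" unfolding oscillation_def by (rule nn_integral_cmult) simp
  finally show ?thesis .
qed

text \<open>
  For almost every \<open>x\<close> the function \<open>F - F x\<close> is integrable; one such \<open>x\<close> is enough.
\<close>
lemma integrable_of_oscillation:
  assumes Q: "compact Q" "emeasure lborel Q \<noteq> 0" and [measurable]: "F \<in> borel_measurable borel" and o: "oscillation Q F < \<infinity>"
  shows "integrable (lborel_on Q) F"
proof (rule integrableI_bounded)
  interpret finite_measure "lborel_on Q" by (rule finite_measure_lborel_on[OF Q(1)])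
  have [measurable]: "Q \<in> sets borel" using Q by (simp add: borel_compact)
  have "AE x in lborel_on Q. (\<integral>\<^sup>+y. ennreal (cmod (F x - F y)) \<partial>lborel_on Q) \<noteq> \<infinity>"
    by (rule nn_integral_PInf_AE) (use o in \<open>auto simp: oscillation_def\<close>)
  moreover have "ae_filter (lborel_on Q) \<noteq> bot" using Q(2) by (simp add: ae_filter_eq_bot_iff emeasure_lborel_on)
  ultimately obtain x where x: "(\<integral>\<^sup>+y. ennreal (cmod (F x - F y)) \<partial>lborel_on Q) \<noteq> \<infinity>"
    using eventually_happens' by blast
  have "(\<integral>\<^sup>+y. ennreal (cmod (F y)) \<partial>lborel_on Q) \<le> (\<integral>\<^sup>+y. ennreal (cmod (F x)) + ennreal (cmod (F x - F y)) \<partial>lborel_on Q)"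
  proof (intro nn_integral_mono)
    fix y
    have "cmod (F y) \<le> cmod (F x) + cmod (F x - F y)"
      by (metis norm_minus_commute norm_triangle_sub)
    then show "ennreal (cmod (F y)) \<le> ennreal (cmod (F x)) + ennreal (cmod (F x - F y))" by (simp flip: ennreal_plus add: ennreal_leI)
  qed
  also have "\<dots> = ennreal (cmod (F x)) * emeasure (lborel_on Q) UNIV + (\<integral>\<^sup>+y. ennreal (cmod (F x - F y)) \<partial>lborel_on Q)"
    by (simp add: nn_integral_add)
  also have "\<dots> < \<infinity>" using x emeasure_lborel_on_compact[OF Q(1)] by (simp add: ennreal_mult_less_top less_top)
  finally show "(\<integral>\<^sup>+y. ennreal (cmod (F y)) \<partial>lborel_on Q) < \<infinity>" .
qed simp

context distortion_homeo
begin

lemma lborel_on_D: "lborel_on D = lborel_on (cbox a b)"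
  by (simp add: D_def lborel_on_box)

lemma energy_finite:
  assumes P: "has_grad P Px (Py :: complex \<Rightarrow> complex)"
  shows "(\<integral>\<^sup>+z. ennreal (2 * ((cmod (Px z) + cmod (Py z)) * (cmod (p z) + cmod (q z)))) \<partial>lborel_on D) < \<infinity>"
proof -
  have "bounded (Px ` cbox a b)" "bounded (Py ` cbox a b)"
    by (intro compact_imp_bounded compact_continuous_image has_gradD[OF P] compact_cbox)+
  then obtain B1 B2 where B1: "B1 > 0" "\<And>z. z \<in> cbox a b \<Longrightarrow> cmod (Px z) \<le> B1" and B2: "B2 > 0" "\<And>z. z \<in> cbox a b \<Longrightarrow> cmod (Py z) \<le> B2"
    unfolding bounded_pos by (metis imageI)
  define B where "B = 2 * (B1 + B2)"
  have "(\<integral>\<^sup>+z. ennreal (2 * ((cmod (Px z) + cmod (Py z)) * (cmod (p z) + cmod (q z)))) \<partial>lborel_on D) \<le>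
      (\<integral>\<^sup>+z. ennreal B * (ennreal (cmod (p z)) + ennreal (cmod (q z))) \<partial>lborel_on D)"
  proof (rule nn_integral_mono_AE, use AE_D in eventually_elim)
    fix z assume "z \<in> D"
    then have z: "z \<in> cbox a b" using D_sub_R by blast
    have "2 * ((cmod (Px z) + cmod (Py z)) * (cmod (p z) + cmod (q z))) \<le> B * (cmod (p z) + cmod (q z))"
      unfolding B_def mult.assoc using B1(2)[OF z] B2(2)[OF z] by (intro mult_left_mono mult_right_mono add_mono) auto
    then show "ennreal (2 * ((cmod (Px z) + cmod (Py z)) * (cmod (p z) + cmod (q z)))) \<le> ennreal B * (ennreal (cmod (p z)) + ennreal (cmod (q z)))"
      using B1 B2 by (simp add: ennreal_leI B_def flip: ennreal_plus ennreal_mult)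
  qed
  also have "\<dots> = ennreal B * ((\<integral>\<^sup>+z. ennreal (cmod (p z)) \<partial>lborel_on D) + (\<integral>\<^sup>+z. ennreal (cmod (q z)) \<partial>lborel_on D))"
    by (simp add: nn_integral_cmult nn_integral_add)
  also have "\<dots> < \<infinity>"
    using loc_Lp_finite[OF loc_L2_imp_L1[OF p_L2] compact_cbox rect] loc_Lp_finite[OF loc_L2_imp_L1[OF q_L2] compact_cbox rect]
    by (simp add: lborel_on_D ennreal_mult_less_top)
  finally show ?thesis .
qed

text \<open>
  The oscillation on the image side is controlled by an energy on the domain side, where mollifications are known
  to converge.
\<close>
lemma oscillation_compose_inverse:
  assumes P: "has_grad P Px (Py :: complex \<Rightarrow> complex)" and Q: "cbox c d \<subseteq> V" "Re c \<le> Re d" "Im c \<le> Im d"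
  shows "oscillation (cbox c d) (\<lambda>\<zeta>. P (w \<zeta>)) \<le> poincare_const c d *
    (\<integral>\<^sup>+z. ennreal (2 * ((cmod (Px z) + cmod (Py z)) * (cmod (p z) + cmod (q z)))) \<partial>lborel_on D)"
proof -
  have [measurable]: "P \<in> borel_measurable borel" "Px \<in> borel_measurable borel" "Py \<in> borel_measurable borel"
    using has_gradD[OF P] by (auto intro: borel_measurable_continuous_onI)
  let ?E = "\<integral>\<^sup>+z. ennreal (2 * ((cmod (Px z) + cmod (Py z)) * (cmod (p z) + cmod (q z)))) \<partial>lborel_on D"
  have E: "(\<integral>\<^sup>+\<zeta>. ennreal (cmod (pull_x Px Py (w \<zeta>)) + cmod (pull_y Px Py (w \<zeta>))) \<partial>lborel_on K) \<le> ?E"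
    if "compact K" "K \<subseteq> V" for K
    using that by (intro order_trans[OF lborel_on_mono energy_inverse]) (auto simp: borel_compact)
  have l: "loc_Lp 1 V (\<lambda>\<zeta>. f (w \<zeta>))" if [measurable]: "f \<in> borel_measurable borel"
     and f: "\<And>z. cmod (f z) \<le> cmod (pull_x Px Py z) + cmod (pull_y Px Py z)" for f
    unfolding loc_Lp_def
  proof (intro conjI allI impI)
    fix K assume K: "compact K \<and> K \<subseteq> V"
    have "(\<integral>\<^sup>+\<zeta>. ennreal (cmod (f (w \<zeta>)) ^ 1) \<partial>lborel_on K) \<le> (\<integral>\<^sup>+\<zeta>. ennreal (cmod (pull_x Px Py (w \<zeta>)) + cmod (pull_y Px Py (w \<zeta>))) \<partial>lborel_on K)"
      by (intro nn_integral_mono ennreal_leI) (simp add: f)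
    also have "\<dots> \<le> ?E" using E K by blast
    also have "\<dots> < \<infinity>" by (rule energy_finite[OF P])
    finally show "(\<integral>\<^sup>+\<zeta>. ennreal (cmod (f (w \<zeta>)) ^ 1) \<partial>lborel_on K) < \<infinity>" .
  qed simp
  have c: "continuous_on V (\<lambda>\<zeta>. P (w \<zeta>))" by (rule continuous_on_compose_UNIV[OF has_gradD(4)[OF P] cont_w])
  have "oscillation (cbox c d) (\<lambda>\<zeta>. P (w \<zeta>)) \<le> poincare_const c d * (\<integral>\<^sup>+\<zeta>. ennreal (cmod (pull_x Px Py (w \<zeta>)) + cmod (pull_y Px Py (w \<zeta>))) \<partial>lborel_on (cbox c d))"
    by (rule poincare[OF open_V Q loc_Lp_continuous[OF _ c] c weak_grad_compose_inverse[OF P] l l]) auto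
  also have "\<dots> \<le> poincare_const c d * ?E" by (intro mult_left_mono E Q) auto
  finally show ?thesis .
qed

text \<open>
  The derivative of \<open>P \<circ> w\<close> with respect to the conjugate variable is the coefficient of \<open>d(P \<circ> w) \<and> d\<zeta>\<close> up
  to a constant, and the pullback of this form under \<open>u\<close> is \<open>dP \<and> du\<close>.
\<close>
lemma integral_dbar_compose_inverse:
  assumes P: "has_grad P Px (Py :: complex \<Rightarrow> complex)" and Q: "cbox c d \<subseteq> V" and t: "test_in (box c d) \<eta> \<eta>x \<eta>y"
  shows "(LINT \<zeta>|lborel_on (cbox c d). (of_real (\<eta>x \<zeta>) + \<i> * of_real (\<eta>y \<zeta>)) * P (w \<zeta>)) =
    \<i> * (LINT z|lborel_on D. of_real (\<eta> (u z)) * (Px z * q z - Py z * p z))"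
proof -
  note [measurable] = test_in_measurable[OF t]
  have [measurable]: "P \<in> borel_measurable borel" "Px \<in> borel_measurable borel" "Py \<in> borel_measurable borel"
    using has_gradD[OF P] by (auto intro: borel_measurable_continuous_onI)
  have [measurable]: "complex_of_real \<in> borel_measurable borel" by (intro borel_measurable_continuous_onI continuous_intros)
  have sub: "box c d \<subseteq> cbox c d" by (rule box_subset_cbox)
  have 0: "\<eta>x \<zeta> = 0" "\<eta>y \<zeta> = 0" if "\<zeta> \<notin> box c d" for \<zeta> using t that unfolding test_in_def by blast+
  obtain K where "compact K" "K \<subseteq> box c d" "\<forall>z. z \<notin> K \<longrightarrow> \<eta> z = 0 \<and> \<eta>x z = 0 \<and> \<eta>y z = 0" using t unfolding test_in_def by blast
  then have t': "test_in (u ` box a b) \<eta> \<eta>x \<eta>y"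
    using t Q sub unfolding test_in_def V_def[symmetric] D_def[symmetric] by blast
  obtain B where B: "B \<ge> 0" "\<And>z. \<bar>\<eta> z\<bar> \<le> B" "\<And>z. \<bar>\<eta>x z\<bar> \<le> B" "\<And>z. \<bar>\<eta>y z\<bar> \<le> B" using test_in_bounded[OF t] by blast
  have "bounded (P ` cbox a b)" "bounded (Px ` cbox a b)" "bounded (Py ` cbox a b)"
    by (intro compact_imp_bounded compact_continuous_image has_gradD[OF P] compact_cbox)+
  then obtain BP B1 B2 where BP: "BP > 0" "\<And>z. z \<in> cbox a b \<Longrightarrow> cmod (P z) \<le> BP"
    and B1: "B1 > 0" "\<And>z. z \<in> cbox a b \<Longrightarrow> cmod (Px z) \<le> B1" and B2: "B2 > 0" "\<And>z. z \<in> cbox a b \<Longrightarrow> cmod (Py z) \<le> B2"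
    unfolding bounded_pos by (metis imageI)
  have ji: "integrable (lborel_on D) (jac p q)" using jac_integrable[OF rect] by (simp add: lborel_on_D)
  have i1: "integrable (lborel_on D) (\<lambda>z. jac p q z *\<^sub>R (e (u z) *\<^sub>R P z))"
    if [measurable]: "e \<in> borel_measurable borel" and e: "\<And>z. \<bar>e z\<bar> \<le> B" for e :: "complex \<Rightarrow> real"
  proof (rule Bochner_Integration.integrable_bound[of _ "\<lambda>z. (B * BP) *\<^sub>R jac p q z"])
    show "AE z in lborel_on D. norm (jac p q z *\<^sub>R (e (u z) *\<^sub>R P z)) \<le> norm ((B * BP) *\<^sub>R jac p q z)"
      using AE_D
    proof eventually_elim
      fix z assume "z \<in> D"
      then have "z \<in> cbox a b" using D_sub_R by blast
      then have "\<bar>e (u z)\<bar> * cmod (P z) \<le> B * BP" using e[of "u z"] BP B by (intro mult_mono) auto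
      then have "\<bar>e (u z)\<bar> * cmod (P z) * \<bar>jac p q z\<bar> \<le> B * BP * \<bar>jac p q z\<bar>" by (rule mult_right_mono) simp
      then show "norm (jac p q z *\<^sub>R (e (u z) *\<^sub>R P z)) \<le> norm ((B * BP) *\<^sub>R jac p q z)"
        using B BP by (simp add: abs_mult ac_simps)
    qed
  qed (use ji in auto)
  have pL: "integrable (lborel_on D) p" "integrable (lborel_on D) q"
    using loc_Lp_finite[OF loc_L2_imp_L1[OF p_L2] compact_cbox rect] loc_Lp_finite[OF loc_L2_imp_L1[OF q_L2] compact_cbox rect]
    by (auto simp: lborel_on_D integrable_iff_bounded)
  have i2: "integrable (lborel_on D) (\<lambda>z. \<eta> (u z) *\<^sub>R (g (q z) *\<^sub>R X z - g (p z) *\<^sub>R Y z))"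
    if [measurable]: "g \<in> borel_measurable borel" "X \<in> borel_measurable borel" "Y \<in> borel_measurable borel" and g: "\<And>x. \<bar>g x\<bar> \<le> cmod x"
      and XY: "\<And>z. z \<in> cbox a b \<Longrightarrow> cmod (X z) \<le> B1 + B2" "\<And>z. z \<in> cbox a b \<Longrightarrow> cmod (Y z) \<le> B1 + B2"
      for g :: "complex \<Rightarrow> real" and X Y :: "complex \<Rightarrow> complex"
  proof (rule Bochner_Integration.integrable_bound[of _ "\<lambda>z. (B * (B1 + B2)) *\<^sub>R (cmod (q z) + cmod (p z))"])
    show "AE z in lborel_on D. norm (\<eta> (u z) *\<^sub>R (g (q z) *\<^sub>R X z - g (p z) *\<^sub>R Y z)) \<le> norm ((B * (B1 + B2)) *\<^sub>R (cmod (q z) + cmod (p z)))"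
      using AE_D
    proof eventually_elim
      fix z assume "z \<in> D"
      then have z: "z \<in> cbox a b" using D_sub_R by blast
      have "cmod (g (q z) *\<^sub>R X z - g (p z) *\<^sub>R Y z) \<le> \<bar>g (q z)\<bar> * cmod (X z) + \<bar>g (p z)\<bar> * cmod (Y z)"
        using norm_triangle_ineq4[of "g (q z) *\<^sub>R X z" "g (p z) *\<^sub>R Y z"] by simp
      also have "\<dots> \<le> cmod (q z) * (B1 + B2) + cmod (p z) * (B1 + B2)"
        using g[of "q z"] g[of "p z"] XY[OF z] by (intro add_mono mult_mono) auto
      finally have "\<bar>\<eta> (u z)\<bar> * cmod (g (q z) *\<^sub>R X z - g (p z) *\<^sub>R Y z) \<le> B * (cmod (q z) * (B1 + B2) + cmod (p z) * (B1 + B2))"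
        using B by (intro mult_mono) auto
      moreover have "norm ((B * (B1 + B2)) *\<^sub>R (cmod (q z) + cmod (p z))) = B * (cmod (q z) * (B1 + B2) + cmod (p z) * (B1 + B2))"
        using B B1 B2 by (simp add: abs_mult algebra_simps)
      ultimately show "norm (\<eta> (u z) *\<^sub>R (g (q z) *\<^sub>R X z - g (p z) *\<^sub>R Y z)) \<le> norm ((B * (B1 + B2)) *\<^sub>R (cmod (q z) + cmod (p z)))"
        by (simp only: norm_scaleR)
    qed
  qed (use pL in auto)
  have XY: "cmod (Px z) \<le> B1 + B2" "cmod (Py z) \<le> B1 + B2" if "z \<in> cbox a b" for z
    using B1 B2 that by (auto intro: order_trans[OF B1(2)] order_trans[OF B2(2)])
  have "(LINT \<zeta>|lborel_on (cbox c d). (of_real (\<eta>x \<zeta>) + \<i> * of_real (\<eta>y \<zeta>)) * P (w \<zeta>)) =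
     (LINT \<zeta>|lborel_on V. (of_real (\<eta>x \<zeta>) + \<i> * of_real (\<eta>y \<zeta>)) * P (w \<zeta>))"
  proof -
    have "\<eta>x \<zeta> = 0" "\<eta>y \<zeta> = 0" if "\<zeta> \<notin> cbox c d" for \<zeta> using 0 that sub by blast+
    then show ?thesis using subsetD[OF Q]
      by (subst (1 2) integral_lborel_on)
        (auto simp: set_lebesgue_integral_def indicator_def intro!: Bochner_Integration.integral_cong)
  qed
  also have "\<dots> = (LINT z|lborel_on D. jac p q z *\<^sub>R ((of_real (\<eta>x (u z)) + \<i> * of_real (\<eta>y (u z))) * P (w (u z))))"
    by (rule integral_transfer) measurable
  also have "\<dots> = (LINT z|lborel_on D. jac p q z *\<^sub>R (\<eta>x (u z) *\<^sub>R P z) + \<i> * (jac p q z *\<^sub>R (\<eta>y (u z) *\<^sub>R P z)))"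
    by (rule integral_cong_AE, measurable) (use AE_D in eventually_elim, simp add: w_u scaleR_conv_of_real algebra_simps)
  also have "\<dots> = (LINT z|lborel_on D. jac p q z *\<^sub>R (\<eta>x (u z) *\<^sub>R P z)) + (LINT z|lborel_on D. \<i> * (jac p q z *\<^sub>R (\<eta>y (u z) *\<^sub>R P z)))"
    by (intro Bochner_Integration.integral_add integrable_mult_right i1 B) auto
  also have "\<dots> = - (LINT z|lborel_on D. \<eta> (u z) *\<^sub>R (Im (q z) *\<^sub>R Px z - Im (p z) *\<^sub>R Py z)) + \<i> * - (LINT z|lborel_on D. \<eta> (u z) *\<^sub>R (Re (p z) *\<^sub>R Py z - Re (q z) *\<^sub>R Px z))"
    using pullback_identity[OF rect t' P, folded D_def] by (simp only: integral_mult_right_zero)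
  also have "\<dots> = \<i> * (\<i> * (LINT z|lborel_on D. \<eta> (u z) *\<^sub>R (Im (q z) *\<^sub>R Px z - Im (p z) *\<^sub>R Py z)) + (LINT z|lborel_on D. \<eta> (u z) *\<^sub>R (Re (q z) *\<^sub>R Px z - Re (p z) *\<^sub>R Py z)))"
  proof -
    have "(LINT z|lborel_on D. \<eta> (u z) *\<^sub>R (Re (q z) *\<^sub>R Px z - Re (p z) *\<^sub>R Py z)) = - (LINT z|lborel_on D. \<eta> (u z) *\<^sub>R (Re (p z) *\<^sub>R Py z - Re (q z) *\<^sub>R Px z))"
      by (subst integral_minus[symmetric], rule arg_cong[where f="integral\<^sup>L (lborel_on D)"]) (simp add: fun_eq_iff scaleR_diff_right)
    moreover have "- A + \<i> * - B = \<i> * (\<i> * A + - B)" for A B :: complex by (simp add: algebra_simps)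
    ultimately show ?thesis by (simp only:)
  qed
  also have "\<i> * (LINT z|lborel_on D. \<eta> (u z) *\<^sub>R (Im (q z) *\<^sub>R Px z - Im (p z) *\<^sub>R Py z)) + (LINT z|lborel_on D. \<eta> (u z) *\<^sub>R (Re (q z) *\<^sub>R Px z - Re (p z) *\<^sub>R Py z)) =
    (LINT z|lborel_on D. \<i> * (\<eta> (u z) *\<^sub>R (Im (q z) *\<^sub>R Px z - Im (p z) *\<^sub>R Py z)) + \<eta> (u z) *\<^sub>R (Re (q z) *\<^sub>R Px z - Re (p z) *\<^sub>R Py z))"
  proof -
    have "integrable (lborel_on D) (\<lambda>z. \<eta> (u z) *\<^sub>R (Im (q z) *\<^sub>R Px z - Im (p z) *\<^sub>R Py z))"
      by (rule i2) (auto simp: abs_Im_le_cmod XY)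
    moreover have "integrable (lborel_on D) (\<lambda>z. \<eta> (u z) *\<^sub>R (Re (q z) *\<^sub>R Px z - Re (p z) *\<^sub>R Py z))"
      by (rule i2) (auto simp: abs_Re_le_cmod XY)
    ultimately show ?thesis
      by (subst Bochner_Integration.integral_add) (auto simp only: integral_mult_right_zero intro: integrable_mult_right)
  qed
  also have "\<dots> = (LINT z|lborel_on D. of_real (\<eta> (u z)) * (Px z * q z - Py z * p z))"
    by (rule arg_cong[where f="integral\<^sup>L (lborel_on D)"]) (auto simp: fun_eq_iff complex_eq_iff algebra_simps)
  finally show ?thesis .
qed

text \<open>
  Let \<open>G n\<close> be mollifications of \<open>v\<close>, converging almost everywhere. Both the oscillation of \<open>G n \<circ> w - v \<circ> w\<close>
  and the failure of \<open>G n \<circ> w\<close> to be weakly holomorphic are bounded by multiples of the same error \<open>e n\<close>, which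
  tends to zero. So \<open>v \<circ> w\<close> is weakly holomorphic, and Weyl's lemma applies.
\<close>
theorem local_factorization:
  assumes v: "weak_grad \<Omega> v vx vy" and vL: "loc_Lp 1 \<Omega> v" "loc_Lp 2 \<Omega> vx" "loc_Lp 2 \<Omega> vy"
    and par: "AE z in lborel_on D. vx z * q z - vy z * p z = 0" and z0: "z0 \<in> D"
  shows "\<exists>S \<phi>. open S \<and> z0 \<in> S \<and> S \<subseteq> D \<and> \<phi> holomorphic_on u ` S \<and> (AE z in lborel_on S. v z = \<phi> (u z))"
proof -
  let ?R = "cbox a b"
  have [measurable]: "v \<in> borel_measurable borel" "vx \<in> borel_measurable borel" "vy \<in> borel_measurable borel" using vL by auto
  have two: "(2::nat) = 1 \<or> (2::nat) = 2" by simp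
  obtain F Fx Fy where F: "\<And>n::nat. C2_map (F n) (Fx n) (Fy n)"
    "(\<lambda>n. \<integral>\<^sup>+z. ennreal ((cmod (Fx n z - vx z))\<^sup>2) \<partial>lborel_on ?R) \<longlonglongrightarrow> 0"
    "(\<lambda>n. \<integral>\<^sup>+z. ennreal ((cmod (Fy n z - vy z))\<^sup>2) \<partial>lborel_on ?R) \<longlonglongrightarrow> 0"
    "(\<lambda>n. \<integral>\<^sup>+z. ennreal (cmod (F n z - v z)) \<partial>lborel_on ?R) \<longlonglongrightarrow> 0"
    "continuous_on \<Omega> v \<Longrightarrow> uniform_limit ?R F v sequentially"
    by (rule smooth_approximation[OF open_dom compact_cbox rect v vL(1) loc_L2_imp_L1[OF vL(2)] vL(2) loc_L2_imp_L1[OF vL(3)] vL(3) two]) auto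
  have Fg0: "has_grad (F n) (Fx n) (Fy n)" for n using F(1) by (simp add: C2_map_def)
  have [measurable]: "F n \<in> borel_measurable borel" "Fx n \<in> borel_measurable borel" "Fy n \<in> borel_measurable borel" for n
    using has_gradD[OF Fg0] by (auto intro: borel_measurable_continuous_onI)
  \<comment> \<open>Convergence in \<open>L\<^sup>1\<close> yields almost everywhere convergence, which Fatou's lemma needs, along a subsequence.\<close>
  obtain r :: "nat \<Rightarrow> nat" where r: "strict_mono r" "AE z in lborel_on ?R. (\<lambda>n. F (r n) z - v z) \<longlonglongrightarrow> 0"
  proof -
    have vi: "integrable (lborel_on ?R) v"
      using loc_Lp_finite[OF vL(1) compact_cbox rect] by (simp add: integrable_iff_bounded)
    have i: "integrable (lborel_on ?R) (\<lambda>z. F n z - v z)" for n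
      by (intro Bochner_Integration.integrable_diff vi integrable_lborel_on_continuous compact_cbox has_gradD[OF Fg0])
    have "(\<lambda>n. LINT z|lborel_on ?R. cmod (F n z - v z)) \<longlonglongrightarrow> (LINT z|lborel_on ?R. (0::real))"
      by (rule tendsto_L1_int) (use i F(4) in auto)
    then show thesis using tendsto_L1_AE_subseq[of "lborel_on ?R" "\<lambda>n z. F n z - v z", OF i] that by auto
  qed
  define G where "G n = F (r n)" for n
  define Gx where "Gx n = Fx (r n)" for n
  define Gy where "Gy n = Fy (r n)" for n
  have Gg: "has_grad (G n) (Gx n) (Gy n)" for n unfolding G_def Gx_def Gy_def by (rule Fg0)
  have [measurable]: "G n \<in> borel_measurable borel" "Gx n \<in> borel_measurable borel" "Gy n \<in> borel_measurable borel" for n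
    unfolding G_def Gx_def Gy_def by measurable
  have Gl: "(\<lambda>n. \<integral>\<^sup>+z. ennreal ((cmod (Gx n z - vx z))\<^sup>2) \<partial>lborel_on D) \<longlonglongrightarrow> 0"
     "(\<lambda>n. \<integral>\<^sup>+z. ennreal ((cmod (Gy n z - vy z))\<^sup>2) \<partial>lborel_on D) \<longlonglongrightarrow> 0"
    unfolding Gx_def Gy_def lborel_on_D using LIMSEQ_subseq_LIMSEQ[OF F(2) r(1)] LIMSEQ_subseq_LIMSEQ[OF F(3) r(1)] by (simp_all add: o_def)
  have Gae: "AE z in lborel_on D. (\<lambda>n. G n z) \<longlonglongrightarrow> v z"
    using r(2) unfolding lborel_on_D G_def by eventually_elim (simp add: LIM_zero_iff)
  define \<delta> where "\<delta> n z = cmod (Gx n z - vx z) + cmod (Gy n z - vy z)" for n z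
  define pq where "pq z = cmod (p z) + cmod (q z)" for z
  have [measurable]: "\<delta> n \<in> borel_measurable borel" "pq \<in> borel_measurable borel" for n
    unfolding \<delta>_def[abs_def] pq_def[abs_def] by measurable
  \<comment> \<open>The error to which all later estimates reduce: the distance of \<open>dG n\<close> from \<open>dv\<close>, weighted by \<open>|du|\<close>.\<close>
  define e where "e n = (\<integral>\<^sup>+z. ennreal (\<delta> n z * pq z) \<partial>lborel_on D)" for n
  have e0: "e \<longlonglongrightarrow> 0"
  proof -
    have fp: "(\<integral>\<^sup>+z. ennreal ((cmod (p z))\<^sup>2) \<partial>lborel_on D) < \<infinity>" "(\<integral>\<^sup>+z. ennreal ((cmod (q z))\<^sup>2) \<partial>lborel_on D) < \<infinity>"
      using loc_Lp_finite[OF p_L2 compact_cbox rect] loc_Lp_finite[OF q_L2 compact_cbox rect] by (auto simp: lborel_on_D)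
    have t: "(\<lambda>n. \<integral>\<^sup>+z. ennreal (cmod (X n z - x z) * cmod (y z)) \<partial>lborel_on D) \<longlonglongrightarrow> 0"
      if [measurable]: "\<And>n. X n \<in> borel_measurable borel" "x \<in> borel_measurable borel" "y \<in> borel_measurable borel"
        and "(\<lambda>n. \<integral>\<^sup>+z. ennreal ((cmod (X n z - x z))\<^sup>2) \<partial>lborel_on D) \<longlonglongrightarrow> 0" "(\<integral>\<^sup>+z. ennreal ((cmod (y z))\<^sup>2) \<partial>lborel_on D) < \<infinity>"
      for X x y by (rule nn_integral_mult_tendsto_0) (use that in auto)
    have "(\<lambda>n. ((\<integral>\<^sup>+z. ennreal (cmod (Gx n z - vx z) * cmod (p z)) \<partial>lborel_on D) + (\<integral>\<^sup>+z. ennreal (cmod (Gx n z - vx z) * cmod (q z)) \<partial>lborel_on D))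
        + ((\<integral>\<^sup>+z. ennreal (cmod (Gy n z - vy z) * cmod (p z)) \<partial>lborel_on D) + (\<integral>\<^sup>+z. ennreal (cmod (Gy n z - vy z) * cmod (q z)) \<partial>lborel_on D))) \<longlonglongrightarrow> (0 + 0) + (0 + 0)"
      by (intro tendsto_add t Gl fp) measurable
    moreover have "e = (\<lambda>n. ((\<integral>\<^sup>+z. ennreal (cmod (Gx n z - vx z) * cmod (p z)) \<partial>lborel_on D) + (\<integral>\<^sup>+z. ennreal (cmod (Gx n z - vx z) * cmod (q z)) \<partial>lborel_on D))
        + ((\<integral>\<^sup>+z. ennreal (cmod (Gy n z - vy z) * cmod (p z)) \<partial>lborel_on D) + (\<integral>\<^sup>+z. ennreal (cmod (Gy n z - vy z) * cmod (q z)) \<partial>lborel_on D)))"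
      unfolding e_def[abs_def] \<delta>_def pq_def by (rule ext) (simp add: distrib_left distrib_right nn_integral_add)
    ultimately show ?thesis by simp
  qed
  have uz0: "u z0 \<in> V" by (rule u_V[OF z0])
  obtain c d where cd: "u z0 \<in> box c d" "cbox c d \<subseteq> V" using open_contains_cbox_around[OF open_V uz0] by blast
  let ?Q = "cbox c d"
  have sub: "box c d \<subseteq> ?Q" by (rule box_subset_cbox)
  have lt: "Re c < Re d" "Im c < Im d" using cd(1) by (auto simp: in_box_complex_iff)
  have mQ: "emeasure lborel ?Q \<noteq> 0"
    using lt by (simp add: emeasure_lborel_cbox_eq Basis_complex_def inner_complex_def)
  define f where "f \<zeta> = v (w \<zeta>)" for \<zeta>
  have [measurable]: "f \<in> borel_measurable borel" unfolding f_def[abs_def] by measurable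
  have Gw[measurable]: "(\<lambda>\<zeta>. G n (w \<zeta>)) \<in> borel_measurable borel" for n by measurable
  have fae: "AE \<zeta> in lborel_on ?Q. (\<lambda>n. G n (w \<zeta>)) \<longlonglongrightarrow> f \<zeta>"
    using AE_D_imp_V[OF Gae] cd(2) unfolding f_def by (auto simp: AE_lborel_on elim: eventually_mono)
  define C where "C = poincare_const c d * 2"
  have C: "C < \<infinity>" using poincare_const_finite[of c d] by (simp add: C_def ennreal_mult_less_top)
  have osc2: "oscillation ?Q (\<lambda>\<zeta>. G n (w \<zeta>) - G m (w \<zeta>)) \<le> C * (e n + e m)" for n m
  proof -
    have P: "has_grad (\<lambda>z. G n z + - G m z) (\<lambda>z. Gx n z + - Gx m z) (\<lambda>z. Gy n z + - Gy m z)"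
      by (intro has_grad_add Gg has_grad_linear[OF Gg] bounded_linear_minus bounded_linear_ident)
    have "oscillation ?Q (\<lambda>\<zeta>. G n (w \<zeta>) - G m (w \<zeta>)) \<le> poincare_const c d *
       (\<integral>\<^sup>+z. ennreal (2 * ((cmod (Gx n z + - Gx m z) + cmod (Gy n z + - Gy m z)) * (cmod (p z) + cmod (q z)))) \<partial>lborel_on D)"
      using oscillation_compose_inverse[OF P cd(2) less_imp_le[OF lt(1)] less_imp_le[OF lt(2)]] by simp
    also have "\<dots> \<le> poincare_const c d * (\<integral>\<^sup>+z. 2 * (ennreal (\<delta> n z * pq z) + ennreal (\<delta> m z * pq z)) \<partial>lborel_on D)"
    proof (intro mult_left_mono nn_integral_mono)
      fix z
      have "cmod (Gx n z + - Gx m z) + cmod (Gy n z + - Gy m z) \<le> \<delta> n z + \<delta> m z"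
        using norm_triangle_ineq4[of "Gx n z - vx z" "Gx m z - vx z"] norm_triangle_ineq4[of "Gy n z - vy z" "Gy m z - vy z"]
        by (simp add: \<delta>_def)
      then have "(cmod (Gx n z + - Gx m z) + cmod (Gy n z + - Gy m z)) * pq z \<le> (\<delta> n z + \<delta> m z) * pq z"
        by (rule mult_right_mono) (simp add: pq_def)
      then have "ennreal (2 * ((cmod (Gx n z + - Gx m z) + cmod (Gy n z + - Gy m z)) * pq z)) \<le> ennreal (2 * (\<delta> n z * pq z + \<delta> m z * pq z))"
        by (intro ennreal_leI) (simp add: algebra_simps)
      also have "\<dots> = 2 * (ennreal (\<delta> n z * pq z) + ennreal (\<delta> m z * pq z))"
        by (simp add: ennreal_mult \<delta>_def pq_def del: distrib_left distrib_right)
      finally show "ennreal (2 * ((cmod (Gx n z + - Gx m z) + cmod (Gy n z + - Gy m z)) * (cmod (p z) + cmod (q z)))) \<le> 2 * (ennreal (\<delta> n z * pq z) + ennreal (\<delta> m z * pq z))"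
        unfolding pq_def .
    qed simp
    also have "\<dots> = C * (e n + e m)"
      unfolding C_def e_def by (simp add: nn_integral_cmult nn_integral_add mult.assoc)
    finally show ?thesis .
  qed
  have osc: "oscillation ?Q (\<lambda>\<zeta>. G n (w \<zeta>) - f \<zeta>) \<le> C * e n" for n
  proof -
    have "oscillation ?Q (\<lambda>\<zeta>. G n (w \<zeta>) - f \<zeta>) \<le> liminf (\<lambda>m. oscillation ?Q (\<lambda>\<zeta>. G n (w \<zeta>) - G m (w \<zeta>)))"
      by (rule oscillation_fatou[OF compact_cbox]) (measurable, use fae in eventually_elim, intro tendsto_intros)
    also have "\<dots> \<le> liminf (\<lambda>m. C * (e n + e m))" by (intro Liminf_mono always_eventually allI osc2)
    also have "\<dots> = C * (e n + 0)"
      by (intro lim_imp_Liminf ennreal_tendsto_cmult C[unfolded infinity_ennreal_def] tendsto_add tendsto_const e0) simp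
    finally show ?thesis by simp
  qed
  have ediff: "integrable (lborel_on ?Q) (\<lambda>\<zeta>. G n (w \<zeta>) - f \<zeta>)" if "e n < \<infinity>" for n
  proof (rule integrable_of_oscillation[OF compact_cbox mQ])
    have "C * e n < \<infinity>" using C that by (simp add: ennreal_mult_less_top)
    with osc[of n] show "oscillation ?Q (\<lambda>\<zeta>. G n (w \<zeta>) - f \<zeta>) < \<infinity>" by (rule order_le_less_trans)
  qed measurable
  have Gi: "integrable (lborel_on ?Q) (\<lambda>\<zeta>. G n (w \<zeta>))" for n
    using loc_Lp_finite[OF loc_Lp_continuous[OF Gw continuous_on_compose_UNIV[OF has_gradD(4)[OF Gg] cont_w]] compact_cbox cd(2), of n 1]
    by (simp add: integrable_iff_bounded)
  have efin: "\<forall>\<^sub>F n in sequentially. e n < \<infinity>" using order_tendstoD(2)[OF e0, of \<infinity>] by simp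
  then obtain N where "e N < \<infinity>" by (auto simp: eventually_sequentially)
  from Bochner_Integration.integrable_diff[OF Gi[of N] ediff[OF this]] have fi: "integrable (lborel_on ?Q) f" by simp
  have hol: "(LINT \<zeta>|lborel_on ?Q. (of_real (\<eta>x \<zeta>) + \<i> * of_real (\<eta>y \<zeta>)) * f \<zeta>) = 0"
    if t: "test_in (box c d) \<eta> \<eta>x \<eta>y" for \<eta> \<eta>x \<eta>y
  proof -
    note [measurable] = test_in_measurable[OF t]
    have [measurable]: "complex_of_real \<in> borel_measurable borel" by (intro borel_measurable_continuous_onI continuous_intros)
    obtain B where B: "B \<ge> 0" "\<And>z. \<bar>\<eta> z\<bar> \<le> B" "\<And>z. \<bar>\<eta>x z\<bar> \<le> B" "\<And>z. \<bar>\<eta>y z\<bar> \<le> B" using test_in_bounded[OF t] by blast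
    define \<theta> where "\<theta> \<zeta> = complex_of_real (\<eta>x \<zeta>) + \<i> * of_real (\<eta>y \<zeta>)" for \<zeta>
    have [measurable]: "\<theta> \<in> borel_measurable borel" unfolding \<theta>_def[abs_def] by measurable
    have \<theta>B: "cmod (\<theta> \<zeta>) \<le> 2 * B" for \<zeta>
    proof -
      have "cmod (\<theta> \<zeta>) \<le> \<bar>\<eta>x \<zeta>\<bar> + \<bar>\<eta>y \<zeta>\<bar>" unfolding \<theta>_def by (rule order_trans[OF norm_triangle_ineq]) (simp add: norm_mult)
      then show ?thesis using B(3)[of \<zeta>] B(4)[of \<zeta>] by simp
    qed
    have \<theta>0: "(LINT \<zeta>|lborel_on ?Q. \<theta> \<zeta>) = 0" unfolding \<theta>_def by (rule integral_test_gradient[OF t]) (use lt in auto)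
    let ?I = "LINT \<zeta>|lborel_on ?Q. \<theta> \<zeta> * f \<zeta>"
    let ?m = "emeasure lborel ?Q"
    have mfin: "?m < \<infinity>" using emeasure_lborel_cbox_finite[of c d] by simp
    define K where "K = ?m * ennreal B + ennreal (2 * B) * C"
    have Kfin: "K < \<infinity>" using mfin C by (simp add: K_def ennreal_mult_less_top)
    have bound: "?m * ennreal (cmod ?I) \<le> K * e n" if n: "e n < \<infinity>" for n
    proof -
      have \<theta>i: "integrable (lborel_on ?Q) (\<lambda>\<zeta>. \<theta> \<zeta> * g \<zeta>)" if "integrable (lborel_on ?Q) g" for g
        by (rule Bochner_Integration.integrable_bound[of _ "\<lambda>\<zeta>. (2 * B) * cmod (g \<zeta>)"])
          (use that \<theta>B B(1) in \<open>auto simp: norm_mult intro!: AE_I2 mult_right_mono\<close>)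
      have "(LINT \<zeta>|lborel_on ?Q. \<theta> \<zeta> * (G n (w \<zeta>) - f \<zeta>)) = (LINT \<zeta>|lborel_on ?Q. \<theta> \<zeta> * G n (w \<zeta>) - \<theta> \<zeta> * f \<zeta>)"
        by (simp add: right_diff_distrib)
      also have "\<dots> = (LINT \<zeta>|lborel_on ?Q. \<theta> \<zeta> * G n (w \<zeta>)) - ?I"
        by (intro Bochner_Integration.integral_diff \<theta>i Gi fi)
      finally have "cmod ?I \<le> cmod (LINT \<zeta>|lborel_on ?Q. \<theta> \<zeta> * G n (w \<zeta>)) + cmod (LINT \<zeta>|lborel_on ?Q. \<theta> \<zeta> * (G n (w \<zeta>) - f \<zeta>))"
        using norm_triangle_ineq4[of "LINT \<zeta>|lborel_on ?Q. \<theta> \<zeta> * G n (w \<zeta>)" "(LINT \<zeta>|lborel_on ?Q. \<theta> \<zeta> * G n (w \<zeta>)) - ?I"] by simp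
      then have I: "ennreal (cmod ?I) \<le> ennreal (cmod (LINT \<zeta>|lborel_on ?Q. \<theta> \<zeta> * G n (w \<zeta>))) + ennreal (cmod (LINT \<zeta>|lborel_on ?Q. \<theta> \<zeta> * (G n (w \<zeta>) - f \<zeta>)))"
        by (simp flip: ennreal_plus add: ennreal_leI)
      have "(LINT \<zeta>|lborel_on ?Q. \<theta> \<zeta> * G n (w \<zeta>)) = \<i> * (LINT z|lborel_on D. of_real (\<eta> (u z)) * (Gx n z * q z - Gy n z * p z))"
        unfolding \<theta>_def by (rule integral_dbar_compose_inverse[OF Gg cd(2) t])
      then have "ennreal (cmod (LINT \<zeta>|lborel_on ?Q. \<theta> \<zeta> * G n (w \<zeta>))) = ennreal (cmod (LINT z|lborel_on D. of_real (\<eta> (u z)) * (Gx n z * q z - Gy n z * p z)))"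
        by (simp add: norm_mult)
      also have "\<dots> \<le> (\<integral>\<^sup>+z. ennreal (cmod (of_real (\<eta> (u z)) * (Gx n z * q z - Gy n z * p z))) \<partial>lborel_on D)"
        by (rule norm_integral_le_nn_integral)
      also have "\<dots> \<le> (\<integral>\<^sup>+z. ennreal B * ennreal (\<delta> n z * pq z) \<partial>lborel_on D)"
      proof (rule nn_integral_mono_AE, use par in eventually_elim)
        fix z assume z: "vx z * q z - vy z * p z = 0"
        have "Gx n z * q z - Gy n z * p z = (Gx n z - vx z) * q z - (Gy n z - vy z) * p z"
          using z by (simp add: algebra_simps)
        then have "cmod (Gx n z * q z - Gy n z * p z) \<le> cmod (Gx n z - vx z) * cmod (q z) + cmod (Gy n z - vy z) * cmod (p z)"
          using norm_triangle_ineq4[of "(Gx n z - vx z) * q z" "(Gy n z - vy z) * p z"] by (simp add: norm_mult)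
        also have "\<dots> \<le> \<delta> n z * pq z" by (simp add: \<delta>_def pq_def distrib_left distrib_right)
        finally have "\<bar>\<eta> (u z)\<bar> * cmod (Gx n z * q z - Gy n z * p z) \<le> B * (\<delta> n z * pq z)"
          using B by (intro mult_mono) auto
        then have "cmod (of_real (\<eta> (u z)) * (Gx n z * q z - Gy n z * p z)) \<le> B * (\<delta> n z * pq z)" by (simp add: norm_mult)
        then show "ennreal (cmod (of_real (\<eta> (u z)) * (Gx n z * q z - Gy n z * p z))) \<le> ennreal B * ennreal (\<delta> n z * pq z)"
          using B(1) by (subst ennreal_mult[symmetric]) (auto simp: \<delta>_def pq_def intro!: ennreal_leI)
      qed
      also have "\<dots> = ennreal B * e n" unfolding e_def by (rule nn_integral_cmult) measurable
      finally have 1: "ennreal (cmod (LINT \<zeta>|lborel_on ?Q. \<theta> \<zeta> * G n (w \<zeta>))) \<le> ennreal B * e n" .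
      have "?m * ennreal (cmod (LINT \<zeta>|lborel_on ?Q. \<theta> \<zeta> * (G n (w \<zeta>) - f \<zeta>))) \<le> ennreal (2 * B) * oscillation ?Q (\<lambda>\<zeta>. G n (w \<zeta>) - f \<zeta>)"
        by (rule integral_test_oscillation[OF compact_cbox]) (use ediff[OF n] B(1) \<theta>B \<theta>0 in auto)
      also have "\<dots> \<le> ennreal (2 * B) * (C * e n)" by (intro mult_left_mono osc) simp
      finally have 2: "?m * ennreal (cmod (LINT \<zeta>|lborel_on ?Q. \<theta> \<zeta> * (G n (w \<zeta>) - f \<zeta>))) \<le> ennreal (2 * B) * (C * e n)" .
      have "?m * ennreal (cmod ?I) \<le> ?m * (ennreal (cmod (LINT \<zeta>|lborel_on ?Q. \<theta> \<zeta> * G n (w \<zeta>))) + ennreal (cmod (LINT \<zeta>|lborel_on ?Q. \<theta> \<zeta> * (G n (w \<zeta>) - f \<zeta>))))"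
        by (intro mult_left_mono I) simp
      also have "\<dots> = ?m * ennreal (cmod (LINT \<zeta>|lborel_on ?Q. \<theta> \<zeta> * G n (w \<zeta>))) + ?m * ennreal (cmod (LINT \<zeta>|lborel_on ?Q. \<theta> \<zeta> * (G n (w \<zeta>) - f \<zeta>)))"
        by (rule distrib_left)
      also have "\<dots> \<le> ?m * (ennreal B * e n) + ennreal (2 * B) * (C * e n)"
        by (intro add_mono mult_left_mono 1 2) simp
      also have "\<dots> = K * e n" by (simp add: K_def distrib_right mult.assoc)
      finally show ?thesis .
    qed
    have "?m * ennreal (cmod ?I) \<le> 0"
    proof (rule tendsto_lowerbound)
      show "(\<lambda>n. K * e n) \<longlonglongrightarrow> 0" using ennreal_tendsto_cmult[OF Kfin[unfolded infinity_ennreal_def] e0] by simp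
      show "\<forall>\<^sub>F n in sequentially. ?m * ennreal (cmod ?I) \<le> K * e n" using efin by eventually_elim (rule bound)
    qed simp
    then show ?thesis using mQ by (simp add: \<theta>_def)
  qed
  obtain \<rho> \<phi> where \<rho>: "\<rho> > 0" "ball (u z0) \<rho> \<subseteq> box c d" "\<phi> holomorphic_on ball (u z0) \<rho>" "AE \<zeta> in lborel_on (ball (u z0) \<rho>). f \<zeta> = \<phi> \<zeta>"
    using weyl_dbar[OF fi \<open>f \<in> borel_measurable borel\<close> cd(1)] hol by metis
  let ?B = "ball (u z0) \<rho>"
  have BV: "?B \<subseteq> V" using \<rho>(2) sub cd(2) by blast
  define S where "S = D \<inter> u -` ?B"
  have oS: "open S" unfolding S_def using continuous_on_subset[OF cont D_sub] open_D by (intro continuous_open_preimage) auto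
  then have [measurable]: "S \<in> sets borel" by (simp add: borel_open)
  have uS: "u ` S = ?B" using BV unfolding S_def V_def by blast
  have "AE \<zeta> in lborel_on V. \<zeta> \<in> ?B \<longrightarrow> v (w \<zeta>) = \<phi> \<zeta>"
    using \<rho>(4) by (simp add: AE_lborel_on f_def) (auto elim: eventually_mono)
  from AE_compose_u[OF this] have "AE z in lborel_on D. u z \<in> ?B \<longrightarrow> v (w (u z)) = \<phi> (u z)" .
  then have "AE z in lborel_on S. v z = \<phi> (u z)"
    by (simp add: AE_lborel_on) (auto simp: S_def w_u elim: eventually_mono)
  moreover have "z0 \<in> S" using z0 \<rho>(1) by (simp add: S_def)
  moreover have "\<phi> holomorphic_on u ` S" using \<rho>(3) uS by simp
  moreover have "S \<subseteq> D" by (simp add: S_def)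
  ultimately show ?thesis using oS by blast
qed

end

text \<open>
  On an overlap both local factors composed with \<open>u\<close> are continuous and agree with \<open>v\<close> almost everywhere. The set
  where they differ is open and null, hence empty.
\<close>
theorem patch_factorizations:
  fixes u v :: "complex \<Rightarrow> complex"
  assumes \<Omega>: "open \<Omega>" and u: "continuous_on \<Omega> u" "inj_on u \<Omega>"
    and loc: "\<And>z. z \<in> \<Omega> \<Longrightarrow> \<exists>S \<phi>. open S \<and> z \<in> S \<and> S \<subseteq> \<Omega> \<and> \<phi> holomorphic_on u ` S \<and> (AE x in lborel_on S. v x = \<phi> (u x))"
  shows "\<exists>\<phi>. \<phi> holomorphic_on u ` \<Omega> \<and> (AE z in lborel. z \<in> \<Omega> \<longrightarrow> v z = \<phi> (u z))"
proof -
  obtain S \<phi> where S: "\<And>z. z \<in> \<Omega> \<Longrightarrow> open (S z) \<and> z \<in> S z \<and> S z \<subseteq> \<Omega> \<and> \<phi> z holomorphic_on u ` S z \<and> (AE x in lborel_on (S z). v x = \<phi> z (u x))"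
    using loc by metis
  have oI: "open (u ` T)" if "open T" "T \<subseteq> \<Omega>" for T
    using that by (intro invariance_of_domain) (auto intro: continuous_on_subset[OF u(1)] inj_on_subset[OF u(2)])
  have eq: "\<phi> x (u z) = \<phi> y (u z)" if x: "x \<in> \<Omega>" and y: "y \<in> \<Omega>" and z: "z \<in> S x" "z \<in> S y" for x y z
  proof (rule ccontr)
    assume ne: "\<phi> x (u z) \<noteq> \<phi> y (u z)"
    let ?O = "S x \<inter> S y"
    have oO: "open ?O" "?O \<subseteq> \<Omega>" using S[OF x] S[OF y] by auto
    have c: "continuous_on ?O (\<lambda>z. \<phi> x (u z) - \<phi> y (u z))"
    proof (rule continuous_on_diff)
      have cu: "continuous_on ?O u" by (rule continuous_on_subset[OF u(1) oO(2)])
      show "continuous_on ?O (\<lambda>z. \<phi> x (u z))"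
        by (rule continuous_on_compose2[OF holomorphic_on_imp_continuous_on cu]) (use S[OF x] in auto)
      show "continuous_on ?O (\<lambda>z. \<phi> y (u z))"
        by (rule continuous_on_compose2[OF holomorphic_on_imp_continuous_on cu]) (use S[OF y] in auto)
    qed
    let ?N = "?O \<inter> (\<lambda>z. \<phi> x (u z) - \<phi> y (u z)) -` (- {0})"
    have oN: "open ?N" by (rule continuous_open_preimage[OF c oO(1)]) (simp add: open_Compl)
    have "AE t in lborel. t \<notin> ?N"
    proof -
      have "AE t in lborel. t \<in> S x \<longrightarrow> v t = \<phi> x (u t)" "AE t in lborel. t \<in> S y \<longrightarrow> v t = \<phi> y (u t)"
        using S[OF x] S[OF y] AE_lborel_on[OF borel_open, of "S x" "\<lambda>t. v t = \<phi> x (u t)"]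
          AE_lborel_on[OF borel_open, of "S y" "\<lambda>t. v t = \<phi> y (u t)"] by blast+
      then show ?thesis by eventually_elim auto
    qed
    then have "?N \<in> null_sets lborel" using oN by (subst AE_iff_null_sets) (auto simp: borel_open)
    then have "negligible ?N" by (simp add: negligible_iff_null_sets null_sets_completionI)
    moreover have "z \<in> ?N" using z ne by simp
    ultimately show False using open_not_negligible[OF oN] by blast
  qed
  define \<Phi> where "\<Phi> \<zeta> = \<phi> (the_inv_into \<Omega> u \<zeta>) \<zeta>" for \<zeta>
  have \<Phi>: "\<Phi> (u t) = \<phi> z (u t)" if "z \<in> \<Omega>" "t \<in> S z" for z t
  proof -
    have t: "t \<in> \<Omega>" using S[OF that(1)] that(2) by blast
    have "\<Phi> (u t) = \<phi> t (u t)" by (simp add: \<Phi>_def the_inv_into_f_f[OF u(2) t])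
    also have "\<dots> = \<phi> z (u t)" using eq[OF t that(1), of t] S[OF t] that(2) by blast
    finally show ?thesis .
  qed
  have "\<Phi> holomorphic_on u ` \<Omega>"
  proof -
    have "\<Phi> field_differentiable (at (u z))" if z: "z \<in> \<Omega>" for z
    proof -
      have o: "open (u ` S z)" using S[OF z] oI by blast
      have "\<Phi> holomorphic_on u ` S z"
        using S[OF z] \<Phi>[OF z] by (subst holomorphic_cong[of _ "u ` S z" _ "\<phi> z"]) auto
      then show ?thesis using o S[OF z] by (intro holomorphic_on_imp_differentiable_at[of _ "u ` S z"]) auto
    qed
    then show ?thesis by (auto simp: holomorphic_on_def intro: field_differentiable_at_within)
  qed
  moreover have "AE z in lborel. z \<in> \<Omega> \<longrightarrow> v z = \<Phi> (u z)"
  proof (rule AE_locally)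
    fix z assume z: "z \<in> \<Omega>"
    have "AE x in lborel. x \<in> S z \<longrightarrow> v x = \<phi> z (u x)"
      using S[OF z] AE_lborel_on[OF borel_open, of "S z" "\<lambda>x. v x = \<phi> z (u x)"] by blast
    then have "AE x in lborel. x \<in> S z \<longrightarrow> v x = \<Phi> (u x)" by eventually_elim (use \<Phi>[OF z] in auto)
    then show "\<exists>T. open T \<and> z \<in> T \<and> (AE x in lborel. x \<in> T \<longrightarrow> v x = \<Phi> (u x))" using S[OF z] by blast
  qed
  ultimately show ?thesis by blast
qed

section \<open>Sobolev functions and their Borel representatives\<close>

text \<open>
  Exhaust \<open>\<Omega>\<close> by compact sets to get Lebesgue measurability on \<open>\<Omega>\<close>; a Lebesgue measurable function agrees
  almost everywhere with a Borel function.
\<close>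
lemma borel_representative:
  assumes \<Omega>: "open \<Omega>" and f: "\<And>K. compact K \<Longrightarrow> K \<subseteq> \<Omega> \<Longrightarrow> f \<in> borel_measurable (lebesgue_on K)"
  shows "(\<lambda>z. indicator \<Omega> z *\<^sub>R f z) \<in> borel_measurable lebesgue"
    and "\<exists>g. g \<in> borel_measurable borel \<and> (AE z in lborel. z \<in> \<Omega> \<longrightarrow> g z = (f z :: complex))"
proof -
  obtain C where C: "\<And>n. compact (C n)" "\<And>n. C n \<subseteq> \<Omega>" "\<And>n. C n \<subseteq> interior (C (Suc n))" "\<Union>(range C) = \<Omega>"
    using open_Union_compact_subsets[OF \<Omega>] by metis
  have inc: "incseq C" using C(3) interior_subset by (intro incseq_SucI) blast
  show m: "(\<lambda>z. indicator \<Omega> z *\<^sub>R f z) \<in> borel_measurable lebesgue"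
  proof (rule borel_measurable_LIMSEQ_metric)
    show "(\<lambda>z. indicator (C n) z *\<^sub>R f z) \<in> borel_measurable lebesgue" for n
    proof -
      have "C n \<inter> space lebesgue \<in> sets lebesgue" using C(1)[of n] by (simp add: borel_compact)
      from borel_measurable_restrict_space_iff[OF this, of f] show ?thesis using f[OF C(1,2)] by simp
    qed
    show "(\<lambda>n. indicator (C n) z *\<^sub>R f z) \<longlonglongrightarrow> indicator \<Omega> z *\<^sub>R f z" for z
    proof (rule tendsto_eventually)
      show "\<forall>\<^sub>F n in sequentially. indicator (C n) z *\<^sub>R f z = indicator \<Omega> z *\<^sub>R f z"
      proof (cases "z \<in> \<Omega>")
        case True
        then obtain N where "z \<in> C N" using C(4) by blast
        then have "z \<in> C n" if "n \<ge> N" for n using incseqD[OF inc that] by blast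
        then show ?thesis using True unfolding eventually_sequentially by (intro exI[of _ N]) simp
      next
        case False
        then have "z \<notin> C n" for n using C(2) by blast
        then show ?thesis using False by simp
      qed
    qed
  qed
  have "(\<lambda>z. Re (indicator \<Omega> z *\<^sub>R f z)) \<in> borel_measurable lebesgue" "(\<lambda>z. Im (indicator \<Omega> z *\<^sub>R f z)) \<in> borel_measurable lebesgue"
    using m by measurable
  then obtain x y where x: "x \<in> borel_measurable lborel" "AE z in lborel. Re (indicator \<Omega> z *\<^sub>R f z) = x z"
    and y: "y \<in> borel_measurable lborel" "AE z in lborel. Im (indicator \<Omega> z *\<^sub>R f z) = y z"
    by (auto dest!: completion_ex_borel_measurable_real)
  have "(\<lambda>z. Complex (x z) (y z)) \<in> borel_measurable borel" using x(1) y(1) by simp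
  moreover have "AE z in lborel. z \<in> \<Omega> \<longrightarrow> Complex (x z) (y z) = f z"
    using x(2) y(2) by eventually_elim (auto simp: complex_eq_iff)
  ultimately show "\<exists>g. g \<in> borel_measurable borel \<and> (AE z in lborel. z \<in> \<Omega> \<longrightarrow> g z = f z)" by blast
qed

lemma AE_lebesgue_on_open:
  assumes "open \<Omega>" shows "(AE z in lebesgue_on \<Omega>. P z) \<longleftrightarrow> (AE z in lborel. z \<in> \<Omega> \<longrightarrow> P z)"
proof -
  have "\<Omega> \<inter> space lebesgue \<in> sets lebesgue" using assms by (simp add: borel_open)
  then show ?thesis by (simp add: AE_restrict_space_iff AE_completion_iff)
qed

lemma Lp_space_measurable_subset:
  assumes "f \<in> Lp_loc s \<Omega>" "compact K" "K \<subseteq> \<Omega>" shows "f \<in> borel_measurable (lebesgue_on K)"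
  using assms by (auto simp: Lp_loc_def Lp_space_def)

lemma Lp_loc_imp_loc_Lp:
  assumes f: "f \<in> Lp_loc (real s) \<Omega>" and s: "s = 1 \<or> s = 2" and [measurable]: "g \<in> borel_measurable borel"
    and fg: "AE z in lborel. z \<in> \<Omega> \<longrightarrow> g z = f z"
  shows "loc_Lp s \<Omega> g"
  unfolding loc_Lp_def
proof (intro conjI allI impI)
  fix K assume K: "compact K \<and> K \<subseteq> \<Omega>"
  have [measurable]: "K \<in> sets borel" using K by (simp add: borel_compact)
  have Kl: "K \<inter> space lebesgue \<in> sets lebesgue" by simp
  have KO: "z \<in> \<Omega>" if "z \<in> K" for z using K that by blast
  have i: "integrable (lebesgue_on K) (\<lambda>z. norm (f z) powr real s)" using f K by (auto simp: Lp_loc_def Lp_space_def)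
  have "(\<integral>\<^sup>+z. ennreal (cmod (g z) ^ s) \<partial>lborel_on K) = (\<integral>\<^sup>+z. indicator K z * ennreal (cmod (g z) ^ s) \<partial>lborel)"
    by (subst nn_integral_lborel_on) auto
  also have "\<dots> = (\<integral>\<^sup>+z. indicator K z * ennreal (cmod (g z) ^ s) \<partial>lebesgue)"
    by (rule nn_integral_completion[symmetric]) 
  also have "\<dots> = (\<integral>\<^sup>+z. ennreal (norm (norm (f z) powr real s)) * indicator K z \<partial>lebesgue)"
  proof (rule nn_integral_cong_AE)
    have "AE z in lebesgue. z \<in> \<Omega> \<longrightarrow> g z = f z" using fg by (simp add: AE_completion_iff)
    moreover have "x powr real s = x ^ s" if "x \<ge> 0" for x :: real using s that by auto
    ultimately show "AE z in lebesgue. indicator K z * ennreal (cmod (g z) ^ s) = ennreal (norm (norm (f z) powr real s)) * indicator K z"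
      using KO by (auto elim!: eventually_mono simp: indicator_def)
  qed
  also have "\<dots> = (\<integral>\<^sup>+z. ennreal (norm (norm (f z) powr real s)) \<partial>lebesgue_on K)"
    by (rule nn_integral_restrict_space[OF Kl, symmetric])
  also have "\<dots> < \<infinity>" using i by (simp add: integrable_iff_bounded)
  finally show "(\<integral>\<^sup>+z. ennreal (cmod (g z) ^ s) \<partial>lborel_on K) < \<infinity>" .
qed simp

lemma Lp_space_imp_Lp_loc:
  assumes "f \<in> Lp_space s \<Omega>" "open \<Omega>" shows "f \<in> Lp_loc s \<Omega>"
  unfolding Lp_loc_def Lp_space_def
proof (intro CollectI allI impI conjI)
  fix K assume K: "compact K \<and> K \<subseteq> \<Omega>"
  have m: "K \<in> sets lebesgue" "\<Omega> \<in> sets lebesgue" using K assms(2) by (auto simp: borel_compact borel_open)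
  show "f \<in> borel_measurable (lebesgue_on K)"
    using assms(1) K m unfolding Lp_space_def by (auto intro: measurable_restrict_mono)
  have "set_integrable lebesgue \<Omega> (\<lambda>z. norm (f z) powr s)"
    using assms(1) m by (simp add: Lp_space_def set_integrable_def integrable_restrict_space)
  then have "set_integrable lebesgue K (\<lambda>z. norm (f z) powr s)"
    by (rule set_integrable_subset) (use K m in auto)
  then show "integrable (lebesgue_on K) (\<lambda>z. norm (f z) powr s)"
    using m by (simp add: set_integrable_def integrable_restrict_space)
qed

lemma test_in_test_functions:
  assumes "test_in \<Omega> \<eta> \<eta>x \<eta>y"
  shows "\<eta> \<in> test_functions \<Omega>" "frechet_derivative \<eta> (at z) 1 = \<eta>x z" "frechet_derivative \<eta> (at z) \<i> = \<eta>y z"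
proof -
  obtain K where K: "compact K" "K \<subseteq> \<Omega>" "\<And>z. z \<notin> K \<Longrightarrow> \<eta> z = 0" using assms unfolding test_in_def by blast
  have g: "smooth_plane \<eta>" "has_grad \<eta> \<eta>x \<eta>y" using assms by (auto simp: test_in_def)
  show "frechet_derivative \<eta> (at z) 1 = \<eta>x z" "frechet_derivative \<eta> (at z) \<i> = \<eta>y z"
    using frechet_grad_map[OF has_gradD(1)[OF g(2)]] by auto
  have "closure {z. \<eta> z \<noteq> 0} \<subseteq> K" by (rule closure_minimal) (use K compact_imp_closed in auto)
  moreover from this have "compact (closure {z. \<eta> z \<noteq> 0})" using K(1) by (metis closed_closure compact_Int_closed inf.absorb_iff2)
  ultimately show "\<eta> \<in> test_functions \<Omega>"
    using K(2) smooth_plane_times_cont_diff[OF g(1)] unfolding test_functions_def by blast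
qed

lemma integral_lebesgue_on_borel:
  fixes f g :: "complex \<Rightarrow> complex"
  assumes \<Omega>: "open \<Omega>" and f: "f \<in> Lp_loc 1 \<Omega>" and [measurable]: "g \<in> borel_measurable borel" and fg: "AE z in lborel. z \<in> \<Omega> \<longrightarrow> g z = f z"
    and e[measurable]: "e \<in> borel_measurable borel" "\<And>z. z \<notin> \<Omega> \<Longrightarrow> e z = 0"
  shows "(LINT z|lebesgue_on \<Omega>. e z *\<^sub>R f z) = (LINT z|lborel. e z *\<^sub>R g z)"
proof -
  have \<Omega>l: "\<Omega> \<inter> space lebesgue \<in> sets lebesgue" using \<Omega> by (simp add: borel_open)
  have m: "(\<lambda>z. indicator \<Omega> z *\<^sub>R f z) \<in> borel_measurable lebesgue"
    by (rule borel_representative(1)[OF \<Omega> Lp_space_measurable_subset[OF f]])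
  have "(LINT z|lebesgue_on \<Omega>. e z *\<^sub>R f z) = (LINT z|lebesgue. indicator \<Omega> z *\<^sub>R (e z *\<^sub>R f z))"
    by (rule integral_restrict_space[OF \<Omega>l])
  also have "\<dots> = (LINT z|lebesgue. e z *\<^sub>R (indicator \<Omega> z *\<^sub>R f z))" by (simp add: mult.commute)
  also have "\<dots> = (LINT z|lebesgue. e z *\<^sub>R g z)"
  proof (rule integral_cong_AE)
    have [measurable]: "e \<in> borel_measurable lebesgue" "g \<in> borel_measurable lebesgue"
      using e(1) \<open>g \<in> borel_measurable borel\<close> by (auto intro: measurable_completion)
    show "(\<lambda>z. e z *\<^sub>R (indicator \<Omega> z *\<^sub>R f z)) \<in> borel_measurable lebesgue" "(\<lambda>z. e z *\<^sub>R g z) \<in> borel_measurable lebesgue"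
      using m by measurable
    have "AE z in lebesgue. z \<in> \<Omega> \<longrightarrow> g z = f z" using fg by (simp add: AE_completion_iff)
    then show "AE z in lebesgue. e z *\<^sub>R (indicator \<Omega> z *\<^sub>R f z) = e z *\<^sub>R g z"
      by eventually_elim (use e(2) in \<open>auto simp: indicator_def\<close>)
  qed
  also have "\<dots> = (LINT z|lborel. e z *\<^sub>R g z)" by (rule integral_completion) simp
  finally show ?thesis .
qed

lemma weak_grad_of_weak_partials:
  assumes \<Omega>: "open \<Omega>" and x: "has_weak_partial \<Omega> 1 f p" and y: "has_weak_partial \<Omega> \<i> f q"
    and b: "f' \<in> borel_measurable borel" "p' \<in> borel_measurable borel" "q' \<in> borel_measurable borel"
    and e: "AE z in lborel. z \<in> \<Omega> \<longrightarrow> f' z = f z" "AE z in lborel. z \<in> \<Omega> \<longrightarrow> p' z = p z" "AE z in lborel. z \<in> \<Omega> \<longrightarrow> q' z = q z"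
  shows "weak_grad \<Omega> f' p' q'"
  unfolding weak_grad_def
proof (intro allI impI)
  fix \<eta> \<eta>x \<eta>y assume t: "test_in \<Omega> \<eta> \<eta>x \<eta>y"
  note tm = test_in_measurable[OF t]
  have t0: "\<eta> z = 0" "\<eta>x z = 0" "\<eta>y z = 0" if "z \<notin> \<Omega>" for z using t that unfolding test_in_def by blast+
  have L: "f \<in> Lp_loc 1 \<Omega>" "p \<in> Lp_loc 1 \<Omega>" "q \<in> Lp_loc 1 \<Omega>" using x y by (auto simp: has_weak_partial_def)
  note tt = test_in_test_functions[OF t]
  have 1: "(LINT z|lebesgue_on \<Omega>. \<eta>x z *\<^sub>R f z) = - (LINT z|lebesgue_on \<Omega>. \<eta> z *\<^sub>R p z)"
    using x tt(1) unfolding has_weak_partial_def tt(2,3)[abs_def, symmetric] by blast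
  have 2: "(LINT z|lebesgue_on \<Omega>. \<eta>y z *\<^sub>R f z) = - (LINT z|lebesgue_on \<Omega>. \<eta> z *\<^sub>R q z)"
    using y tt(1) unfolding has_weak_partial_def tt(2,3)[abs_def, symmetric] by blast
  have "(LINT z|lebesgue_on \<Omega>. \<eta>x z *\<^sub>R f z) = (LINT z|lborel. \<eta>x z *\<^sub>R f' z)"
       "(LINT z|lebesgue_on \<Omega>. \<eta>y z *\<^sub>R f z) = (LINT z|lborel. \<eta>y z *\<^sub>R f' z)"
       "(LINT z|lebesgue_on \<Omega>. \<eta> z *\<^sub>R p z) = (LINT z|lborel. \<eta> z *\<^sub>R p' z)"
       "(LINT z|lebesgue_on \<Omega>. \<eta> z *\<^sub>R q z) = (LINT z|lborel. \<eta> z *\<^sub>R q' z)"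
    by (rule integral_lebesgue_on_borel[OF \<Omega>]; (rule L b e tm t0; assumption?))+
  then show "(LINT z|lborel. \<eta>x z *\<^sub>R f' z) = - (LINT z|lborel. \<eta> z *\<^sub>R p' z) \<and> (LINT z|lborel. \<eta>y z *\<^sub>R f' z) = - (LINT z|lborel. \<eta> z *\<^sub>R q' z)"
    using 1 2 by simp
qed

text \<open>
  Two weak gradients of \<open>f\<close> have the same mollifications, namely the derivatives of the mollifications of \<open>f\<close>.
\<close>
lemma weak_grad_unique:
  assumes \<Omega>: "open \<Omega>" and w: "weak_grad \<Omega> f p q" "weak_grad \<Omega> f p' q'" and L: "loc_Lp 1 \<Omega> f" "loc_Lp 1 \<Omega> p" "loc_Lp 1 \<Omega> q" "loc_Lp 1 \<Omega> p'" "loc_Lp 1 \<Omega> q'"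
  shows "AE z in lborel. z \<in> \<Omega> \<longrightarrow> p z = p' z \<and> q z = q' z"
proof (rule AE_locally)
  fix z0 assume z0: "z0 \<in> \<Omega>"
  obtain e where e: "e > 0" "cball z0 e \<subseteq> \<Omega>" using \<Omega> z0 open_contains_cball by blast
  let ?K = "cball z0 e" and ?S = "ball z0 (e/2)"
  have ci: "integrable lborel (cut ?K g)" if "loc_Lp 1 \<Omega> g" for g using cut_integrable[OF that compact_cball e(2)] .
  have eq: "AE z in lborel_on ?S. g z = g' z"
    if g: "loc_Lp 1 \<Omega> g" "loc_Lp 1 \<Omega> g'" and same: "\<And>r z. 0 < r \<Longrightarrow> r < e/2 \<Longrightarrow> z \<in> ?S \<Longrightarrow> conv (kern r) (cut ?K g) z = conv (kern r) (cut ?K g') z" for g g'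
  proof -
    have [measurable]: "g \<in> borel_measurable borel" "g' \<in> borel_measurable borel" using g by auto
    have [measurable]: "cut ?K g \<in> borel_measurable borel" "cut ?K g' \<in> borel_measurable borel" using ci[OF g(1)] ci[OF g(2)] by auto
    have lim: "((\<lambda>r. \<integral>\<^sup>+z. ennreal (cmod (conv (kern r) (cut ?K h) z - cut ?K h z)) \<partial>lborel) \<longlongrightarrow> 0) (at_right 0)" if "loc_Lp 1 \<Omega> h" for h
      using conv_kern_Lp[OF ci[OF that] cut_finite[OF that compact_cball e(2)]] by simp
    let ?I = "\<integral>\<^sup>+z. ennreal (cmod (g z - g' z)) \<partial>lborel_on ?S"
    have "?I \<le> 0"
    proof (rule tendsto_lowerbound)
      show "((\<lambda>r. (\<integral>\<^sup>+z. ennreal (cmod (conv (kern r) (cut ?K g) z - cut ?K g z)) \<partial>lborel) + (\<integral>\<^sup>+z. ennreal (cmod (conv (kern r) (cut ?K g') z - cut ?K g' z)) \<partial>lborel)) \<longlongrightarrow> 0) (at_right 0)"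
        using tendsto_add[OF lim[OF g(1)] lim[OF g(2)]] by simp
      show "\<forall>\<^sub>F r in at_right 0. ?I \<le> (\<integral>\<^sup>+z. ennreal (cmod (conv (kern r) (cut ?K g) z - cut ?K g z)) \<partial>lborel) + (\<integral>\<^sup>+z. ennreal (cmod (conv (kern r) (cut ?K g') z - cut ?K g' z)) \<partial>lborel)"
        unfolding eventually_at_right_field
      proof (intro exI[of _ "e/2"] conjI allI impI)
        fix r assume r: "0 < r" "r < e/2"
        have cm[measurable]: "conv (kern r) (cut ?K h) \<in> borel_measurable borel" if "loc_Lp 1 \<Omega> h" for h
          by (rule borel_measurable_continuous_onI[OF conv_continuous[OF bump_kern[OF r(1)] ci[OF that]]])
        note [measurable] = cm[OF g(1)] cm[OF g(2)]
        have "?I = (\<integral>\<^sup>+z. indicator ?S z * ennreal (cmod (g z - g' z)) \<partial>lborel)" by (subst nn_integral_lborel_on) auto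
        also have "\<dots> \<le> (\<integral>\<^sup>+z. ennreal (cmod (conv (kern r) (cut ?K g) z - cut ?K g z)) + ennreal (cmod (conv (kern r) (cut ?K g') z - cut ?K g' z)) \<partial>lborel)"
        proof (intro nn_integral_mono)
          fix z
          show "indicator ?S z * ennreal (cmod (g z - g' z)) \<le> ennreal (cmod (conv (kern r) (cut ?K g) z - cut ?K g z)) + ennreal (cmod (conv (kern r) (cut ?K g') z - cut ?K g' z))"
          proof (cases "z \<in> ?S")
            case True
            then have "dist z0 z < e / 2" by simp
            then have zK: "z \<in> ?K" using zero_le_dist[of z0 z] unfolding mem_cball by linarith
            have "g z - g' z = (conv (kern r) (cut ?K g') z - cut ?K g' z) - (conv (kern r) (cut ?K g) z - cut ?K g z)"
              using same[OF r True] zK by simp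
            then have "cmod (g z - g' z) \<le> cmod (conv (kern r) (cut ?K g) z - cut ?K g z) + cmod (conv (kern r) (cut ?K g') z - cut ?K g' z)"
              by (metis add.commute norm_triangle_ineq4)
            then show ?thesis using True by (simp flip: ennreal_plus add: ennreal_leI)
          qed simp
        qed
        also have "\<dots> = (\<integral>\<^sup>+z. ennreal (cmod (conv (kern r) (cut ?K g) z - cut ?K g z)) \<partial>lborel) + (\<integral>\<^sup>+z. ennreal (cmod (conv (kern r) (cut ?K g') z - cut ?K g' z)) \<partial>lborel)"
          by (rule nn_integral_add) measurable
        finally show "?I \<le> \<dots>" .
      qed (use e in simp)
    qed simp
    then have "?I = 0" by simp
    then have "AE z in lborel_on ?S. ennreal (cmod (g z - g' z)) = 0" by (subst (asm) nn_integral_0_iff_AE) auto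
    then show ?thesis by eventually_elim simp
  qed
  have conv_eq: "conv (kern r) (cut ?K p) z = conv (kern r) (cut ?K p') z \<and> conv (kern r) (cut ?K q) z = conv (kern r) (cut ?K q') z"
    if r: "0 < r" "r < e/2" and z: "z \<in> ?S" for r z
  proof -
    obtain kx ky where k: "has_grad (kern r) kx ky" "bump r kx" "bump r ky" using conv_kern_C2[OF r(1) ci[OF L(1)]] by blast
    have "cball z r \<subseteq> ?K"
    proof
      fix x assume "x \<in> cball z r"
      then show "x \<in> ?K" using z r dist_triangle[of z0 x z] by simp
    qed
    then show ?thesis
      using conv_weak_grad[OF w(1) bump_kern[OF r(1)] k _ e(2), of z] conv_weak_grad[OF w(2) bump_kern[OF r(1)] k _ e(2), of z] by metis
  qed
  have "AE z in lborel_on ?S. p z = p' z" by (rule eq[OF L(2,4)]) (use conv_eq in blast)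
  moreover have "AE z in lborel_on ?S. q z = q' z" by (rule eq[OF L(3,5)]) (use conv_eq in blast)
  ultimately have "AE z in lborel. z \<in> ?S \<longrightarrow> p z = p' z \<and> q z = q' z"
    by (simp add: AE_lborel_on) (auto elim: eventually_elim2)
  then show "\<exists>S. open S \<and> z0 \<in> S \<and> (AE z in lborel. z \<in> S \<longrightarrow> p z = p' z \<and> q z = q' z)"
    using e(1) by (intro exI[of _ ?S]) auto
qed

section \<open>The factorization theorem\<close>

text \<open>
  In terms of \<open>A = \<partial>u/\<partial>z\<close> and \<open>B = m A\<close>, the Jacobian is \<open>|A|\<^sup>2 - |B|\<^sup>2\<close> and the squared norm of the
  differential is \<open>2 (|A|\<^sup>2 + |B|\<^sup>2)\<close>. With \<open>k = |m|\<close> their quotient is twice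
  \<open>(1 + k\<^sup>2) / (1 - k\<^sup>2) \<le> (1 + k)\<^sup>2 / (1 - k\<^sup>2) = (1 + k) / (1 - k)\<close>.
\<close>
lemma beltrami_point:
  fixes p q m :: complex
  assumes m: "cmod m < 1" and b: "(p + \<i> * q) / 2 = m * ((p - \<i> * q) / 2)"
  defines "A \<equiv> (p - \<i> * q) / 2" and "j \<equiv> Im (cnj p * q)"
  shows "j \<ge> 0" "j = 0 \<Longrightarrow> p = 0 \<and> q = 0" "cmod p \<le> 2 * cmod A" "cmod q \<le> 2 * cmod A"
    "((cmod p)\<^sup>2 + (cmod q)\<^sup>2) / j \<le> 2 * ((1 + cmod m) / (1 - cmod m))"
proof -
  define B where "B = (p + \<i> * q) / 2"
  have B: "B = m * A" using b by (simp add: A_def B_def)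
  have p: "p = A + B" by (simp add: A_def B_def field_simps)
  have q: "q = \<i> * (A - B)" by (simp add: A_def B_def field_simps)
  have j: "j = (cmod A)\<^sup>2 - (cmod B)\<^sup>2" unfolding j_def p q cmod_sq by (simp add: algebra_simps)
  have pq: "(cmod p)\<^sup>2 + (cmod q)\<^sup>2 = 2 * ((cmod A)\<^sup>2 + (cmod B)\<^sup>2)" unfolding p q cmod_sq by (simp add: algebra_simps)
  have B2: "(cmod B)\<^sup>2 = (cmod m)\<^sup>2 * (cmod A)\<^sup>2" by (simp add: B norm_mult power_mult_distrib)
  have m2: "(cmod m)\<^sup>2 < 1" using m by (simp add: abs_square_less_1)
  have j': "j = (1 - (cmod m)\<^sup>2) * (cmod A)\<^sup>2" unfolding j B2 by (simp add: algebra_simps)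
  show "j \<ge> 0" unfolding j' using m2 by simp
  show "p = 0 \<and> q = 0" if "j = 0"
    using that m2 unfolding j' by (auto simp: p q B)
  have BA: "cmod B \<le> cmod A" using m by (simp add: B norm_mult mult_left_le_one_le)
  show "cmod p \<le> 2 * cmod A" using norm_triangle_ineq[of A B] BA by (simp add: p)
  show "cmod q \<le> 2 * cmod A" using norm_triangle_ineq4[of A B] BA by (simp add: q norm_mult)
  show "((cmod p)\<^sup>2 + (cmod q)\<^sup>2) / j \<le> 2 * ((1 + cmod m) / (1 - cmod m))"
  proof (cases "A = 0")
    case True
    then show ?thesis using m by (simp add: j')
  next
    case False
    then have "((cmod p)\<^sup>2 + (cmod q)\<^sup>2) / j = 2 * ((1 + (cmod m)\<^sup>2) * (cmod A)\<^sup>2) / ((1 - (cmod m)\<^sup>2) * (cmod A)\<^sup>2)"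
      unfolding pq B2 j' by (simp add: algebra_simps)
    also have "\<dots> = 2 * ((1 + (cmod m)\<^sup>2) / (1 - (cmod m)\<^sup>2))" using False by simp
    also have "\<dots> \<le> 2 * ((1 + cmod m)\<^sup>2 / (1 - (cmod m)\<^sup>2))"
      using m2 by (intro mult_left_mono divide_right_mono) (auto simp: power2_sum)
    also have "(1 + cmod m)\<^sup>2 / (1 - (cmod m)\<^sup>2) = (1 + cmod m) / (1 - cmod m)"
    proof -
      have "1 - (cmod m)\<^sup>2 = (1 - cmod m) * (1 + cmod m)" by (simp add: power2_eq_square algebra_simps)
      moreover have "1 + cmod m \<noteq> 0" using norm_ge_zero[of m] by linarith
      ultimately show ?thesis by (simp add: power2_eq_square)
    qed
    finally show ?thesis .
  qed
qed

text \<open>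
  The coefficient of \<open>dv \<and> du\<close> is a multiple of \<open>b A - a B\<close>, where \<open>a, b\<close> and \<open>A, B\<close> are the derivatives of
  \<open>v\<close> and \<open>u\<close> with respect to \<open>z\<close> and its conjugate.
\<close>
lemma beltrami_point_parallel:
  fixes p q m x y :: complex
  assumes "(p + \<i> * q) / 2 = m * ((p - \<i> * q) / 2)" "(x + \<i> * y) / 2 = m * ((x - \<i> * y) / 2)"
  shows "x * q - y * p = 0"
proof -
  define A B a b where "A = (p - \<i> * q) / 2" and "B = (p + \<i> * q) / 2" and "a = (x - \<i> * y) / 2" and "b = (x + \<i> * y) / 2"
  have e: "p = A + B" "q = \<i> * (A - B)" "x = a + b" "y = \<i> * (a - b)"
    by (simp_all add: A_def B_def a_def b_def field_simps)
  have m: "B = m * A" "b = m * a" using assms by (simp_all add: A_def B_def a_def b_def)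
  show ?thesis unfolding e m by (simp add: algebra_simps)
qed

lemma loc_Lp_dominated:
  assumes A: "loc_Lp s \<Omega> A" and [measurable]: "g \<in> borel_measurable borel" and le: "AE z in lborel. z \<in> \<Omega> \<longrightarrow> cmod (g z) \<le> 2 * cmod (A z)"
  shows "loc_Lp s \<Omega> g"
  unfolding loc_Lp_def
proof (intro conjI allI impI)
  fix K assume K: "compact K \<and> K \<subseteq> \<Omega>"
  have [measurable]: "K \<in> sets borel" "A \<in> borel_measurable borel" using K A by (auto simp: borel_compact)
  have "AE z in lborel_on K. cmod (g z) \<le> 2 * cmod (A z)"
    unfolding AE_lborel_on[OF \<open>K \<in> sets borel\<close>] using le by eventually_elim (use K in blast)
  then have "(\<integral>\<^sup>+z. ennreal (cmod (g z) ^ s) \<partial>lborel_on K) \<le> (\<integral>\<^sup>+z. ennreal (2 ^ s) * ennreal (cmod (A z) ^ s) \<partial>lborel_on K)"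
  proof (intro nn_integral_mono_AE, eventually_elim)
    fix z assume "cmod (g z) \<le> 2 * cmod (A z)"
    then have "cmod (g z) ^ s \<le> 2 ^ s * cmod (A z) ^ s"
      using power_mono[of "cmod (g z)" "2 * cmod (A z)" s] by (simp add: power_mult_distrib)
    then have "ennreal (cmod (g z) ^ s) \<le> ennreal (2 ^ s * cmod (A z) ^ s)" by (rule ennreal_leI)
    also have "\<dots> = ennreal (2 ^ s) * ennreal (cmod (A z) ^ s)" by (rule ennreal_mult) auto
    finally show "ennreal (cmod (g z) ^ s) \<le> ennreal (2 ^ s) * ennreal (cmod (A z) ^ s)" .
  qed
  also have "\<dots> = ennreal (2 ^ s) * (\<integral>\<^sup>+z. ennreal (cmod (A z) ^ s) \<partial>lborel_on K)" by (rule nn_integral_cmult) simp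
  also have "\<dots> < \<infinity>" using loc_Lp_finite[OF A, of K] K by (simp add: ennreal_mult_less_top)
  finally show "(\<integral>\<^sup>+z. ennreal (cmod (g z) ^ s) \<partial>lborel_on K) < \<infinity>" .
qed simp

lemma has_weak_partial_weak_partial:
  assumes "f \<in> sobolev_W1 s \<Omega>" "e \<in> {1, \<i>}"
  shows "has_weak_partial \<Omega> e f (weak_partial \<Omega> e f)"
  using assms someI_ex[of "has_weak_partial \<Omega> e f"] unfolding sobolev_W1_def weak_partial_def by blast

lemma borel_representative_loc:
  assumes "open \<Omega>" "f \<in> Lp_loc s \<Omega>"
  shows "\<exists>g. g \<in> borel_measurable borel \<and> (AE z in lborel. z \<in> \<Omega> \<longrightarrow> g z = f z)"
  using borel_representative(2)[OF assms(1) Lp_space_measurable_subset[OF assms(2)]] .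

theorem corollary3:
  fixes \<Omega> :: "complex set" and u v \<mu> :: "complex \<Rightarrow> complex"
  assumes "open \<Omega>" and "simply_connected \<Omega>"
    and "u \<in> sobolev_W1 1 \<Omega>"
    and "\<exists>w. homeomorphism \<Omega> (u ` \<Omega>) u w"
    and "weak_dz \<Omega> u \<in> Lp_loc 2 \<Omega>"
    and "v \<in> sobolev_W1 2 \<Omega>"
    and "\<mu> \<in> borel_measurable (lebesgue_on \<Omega>)"
    and "AE z in lebesgue_on \<Omega>. norm (\<mu> z) < 1"
    and "(\<integral>\<^sup>+ z. ennreal ((1 + norm (\<mu> z)) / (1 - norm (\<mu> z))) \<partial>lebesgue_on \<Omega>) < \<infinity>"
    and "beltrami \<Omega> \<mu> u" and "beltrami \<Omega> \<mu> v"
  shows "\<exists>\<phi>. \<phi> holomorphic_on (u ` \<Omega>) \<and> (AE z in lebesgue_on \<Omega>. v z = \<phi> (u z))"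
proof -
  note \<Omega> = assms(1)
  have [measurable]: "\<Omega> \<in> sets borel" using \<Omega> by (simp add: borel_open)
  obtain w where "homeomorphism \<Omega> (u ` \<Omega>) u w" using assms(4) by blast
  then have cu: "continuous_on \<Omega> u" and iu: "inj_on u \<Omega>"
    by (auto simp: homeomorphism_def intro: inj_on_inverseI)
  \<comment> \<open>Extension by zero makes \<open>u\<close> a Borel function on the plane.\<close>
  define u' where "u' z = indicator \<Omega> z *\<^sub>R u z" for z
  have u'[measurable]: "u' \<in> borel_measurable borel"
    unfolding u'_def[abs_def] by (rule borel_measurable_continuous_on_indicator[OF _ cu]) simp
  have u'u: "u' z = u z" if "z \<in> \<Omega>" for z using that by (simp add: u'_def)
  have cu': "continuous_on \<Omega> u'" using cu u'u by (subst continuous_on_cong[OF refl, of \<Omega> u' u]) auto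
  have iu': "inj_on u' \<Omega>" using iu u'u by (subst inj_on_cong[of \<Omega> u' u]) auto
  \<comment> \<open>Weak derivatives and \<open>v\<close> are given only up to null sets; Borel representatives may be composed with \<open>u\<inverse>\<close>.\<close>
  note wu = has_weak_partial_weak_partial[OF assms(3)] and wv = has_weak_partial_weak_partial[OF assms(6)]
  have Lu: "weak_partial \<Omega> 1 u \<in> Lp_loc 1 \<Omega>" "weak_partial \<Omega> \<i> u \<in> Lp_loc 1 \<Omega>" "u \<in> Lp_loc 1 \<Omega>"
    using wu unfolding has_weak_partial_def by auto
  have Lv: "weak_partial \<Omega> 1 v \<in> Lp_loc 1 \<Omega>" "weak_partial \<Omega> \<i> v \<in> Lp_loc 1 \<Omega>" "v \<in> Lp_loc 1 \<Omega>"
    using wv unfolding has_weak_partial_def by auto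
  obtain p where p[measurable]: "p \<in> borel_measurable borel" and pe: "AE z in lborel. z \<in> \<Omega> \<longrightarrow> p z = weak_partial \<Omega> 1 u z"
    using borel_representative_loc[OF \<Omega> Lu(1)] by blast
  obtain q where q[measurable]: "q \<in> borel_measurable borel" and qe: "AE z in lborel. z \<in> \<Omega> \<longrightarrow> q z = weak_partial \<Omega> \<i> u z"
    using borel_representative_loc[OF \<Omega> Lu(2)] by blast
  obtain x where x[measurable]: "x \<in> borel_measurable borel" and xe: "AE z in lborel. z \<in> \<Omega> \<longrightarrow> x z = weak_partial \<Omega> 1 v z"
    using borel_representative_loc[OF \<Omega> Lv(1)] by blast
  obtain y where y[measurable]: "y \<in> borel_measurable borel" and ye: "AE z in lborel. z \<in> \<Omega> \<longrightarrow> y z = weak_partial \<Omega> \<i> v z"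
    using borel_representative_loc[OF \<Omega> Lv(2)] by blast
  obtain v' where v'[measurable]: "v' \<in> borel_measurable borel" and ve: "AE z in lborel. z \<in> \<Omega> \<longrightarrow> v' z = v z"
    using borel_representative_loc[OF \<Omega> Lv(3)] by blast
  have gu: "weak_grad \<Omega> u' p q"
    by (rule weak_grad_of_weak_partials[OF \<Omega> wu(1) wu(1) u' p q _ pe qe]) (auto simp: u'u)
  have gv: "weak_grad \<Omega> v' x y"
    by (rule weak_grad_of_weak_partials[OF \<Omega> wv(1) wv(1) v' x y ve xe ye]) auto
  have loc1: "loc_Lp 1 \<Omega> g" if "f \<in> Lp_loc 1 \<Omega>" "g \<in> borel_measurable borel" "AE z in lborel. z \<in> \<Omega> \<longrightarrow> g z = f z" for f g
    by (rule Lp_loc_imp_loc_Lp[of f]) (use that in auto)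
  have loc2: "loc_Lp 2 \<Omega> g" if "f \<in> Lp_loc 2 \<Omega>" "g \<in> borel_measurable borel" "AE z in lborel. z \<in> \<Omega> \<longrightarrow> g z = f z" for f g
    by (rule Lp_loc_imp_loc_Lp[of f]) (use that in auto)
  have m1: "AE z in lborel. z \<in> \<Omega> \<longrightarrow> cmod (\<mu> z) < 1"
    using assms(8) by (simp add: AE_lebesgue_on_open[OF \<Omega>])
  have bu: "AE z in lborel. z \<in> \<Omega> \<longrightarrow> (p z + \<i> * q z) / 2 = \<mu> z * ((p z - \<i> * q z) / 2)"
    using assms(10) pe qe unfolding beltrami_def AE_lebesgue_on_open[OF \<Omega>] weak_dz_def weak_dzbar_def
    by eventually_elim auto
  have bv: "AE z in lborel. z \<in> \<Omega> \<longrightarrow> (x z + \<i> * y z) / 2 = \<mu> z * ((x z - \<i> * y z) / 2)"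
    using assms(11) xe ye unfolding beltrami_def AE_lebesgue_on_open[OF \<Omega>] weak_dz_def weak_dzbar_def
    by eventually_elim auto
  \<comment> \<open>Both partial derivatives of \<open>u\<close> are dominated by \<open>2 |\<partial>u/\<partial>z|\<close>, hence locally square integrable.\<close>
  define A where "A z = (p z - \<i> * q z) / 2" for z
  have A[measurable]: "A \<in> borel_measurable borel" unfolding A_def[abs_def] by measurable
  have AL: "loc_Lp 2 \<Omega> A"
    by (rule loc2[OF assms(5)], simp) (use pe qe in eventually_elim, auto simp: A_def weak_dz_def)
  have pL: "loc_Lp 2 \<Omega> p"
    by (rule loc_Lp_dominated[OF AL p]) (use bu m1 in eventually_elim, auto simp: A_def dest: beltrami_point(3))
  have qL: "loc_Lp 2 \<Omega> q"
    by (rule loc_Lp_dominated[OF AL q]) (use bu m1 in eventually_elim, auto simp: A_def dest: beltrami_point(4))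
  \<comment> \<open>The derivatives \<open>weak_partial\<close> are arbitrary choices. They inherit square integrability from the ones in the
      definition of \<open>W\<^sup>1\<^sup>,\<^sup>2\<close>, with which they agree almost everywhere.\<close>
  have vL1: "loc_Lp 1 \<Omega> v'" by (rule loc1[OF Lv(3) v' ve])
  have xyL: "loc_Lp 2 \<Omega> x \<and> loc_Lp 2 \<Omega> y"
  proof -
    obtain gx gy where g: "gx \<in> Lp_space 2 \<Omega>" "has_weak_partial \<Omega> 1 v gx" "gy \<in> Lp_space 2 \<Omega>" "has_weak_partial \<Omega> \<i> v gy"
      using assms(6) unfolding sobolev_W1_def by blast
    have gL: "gx \<in> Lp_loc 2 \<Omega>" "gy \<in> Lp_loc 2 \<Omega>" "gx \<in> Lp_loc 1 \<Omega>" "gy \<in> Lp_loc 1 \<Omega>"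
      using g Lp_space_imp_Lp_loc[OF _ \<Omega>] by (auto simp: has_weak_partial_def)
    obtain x' where x'[measurable]: "x' \<in> borel_measurable borel" and x'e: "AE z in lborel. z \<in> \<Omega> \<longrightarrow> x' z = gx z"
      using borel_representative_loc[OF \<Omega> gL(1)] by blast
    obtain y' where y'[measurable]: "y' \<in> borel_measurable borel" and y'e: "AE z in lborel. z \<in> \<Omega> \<longrightarrow> y' z = gy z"
      using borel_representative_loc[OF \<Omega> gL(2)] by blast
    have gv': "weak_grad \<Omega> v' x' y'" by (rule weak_grad_of_weak_partials[OF \<Omega> g(2,4) v' x' y' ve x'e y'e])
    have un: "AE z in lborel. z \<in> \<Omega> \<longrightarrow> x z = x' z \<and> y z = y' z"
      by (rule weak_grad_unique[OF \<Omega> gv gv' vL1 loc1[OF Lv(1) x xe] loc1[OF Lv(2) y ye] loc1[OF gL(3) x' x'e] loc1[OF gL(4) y' y'e]])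
    have "loc_Lp 2 \<Omega> x" by (rule loc2[OF gL(1) x]) (use un x'e in eventually_elim, simp)
    moreover have "loc_Lp 2 \<Omega> y" by (rule loc2[OF gL(2) y]) (use un y'e in eventually_elim, simp)
    ultimately show ?thesis ..
  qed
  have loc: "\<exists>S \<phi>. open S \<and> z0 \<in> S \<and> S \<subseteq> \<Omega> \<and> \<phi> holomorphic_on u' ` S \<and> (AE z in lborel_on S. v' z = \<phi> (u' z))" if z0: "z0 \<in> \<Omega>" for z0
  proof -
    obtain a b where ab: "z0 \<in> box a b" "cbox a b \<subseteq> \<Omega>" using open_contains_cbox_around[OF \<Omega> z0] by blast
    have sub: "box a b \<subseteq> \<Omega>" using ab(2) box_subset_cbox[of a b] by blast
    interpret distortion_homeo \<Omega> u' p q a b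
    proof
      show "AE z in lborel_on (box a b). jac p q z \<ge> 0 \<and> (jac p q z = 0 \<longrightarrow> p z = 0 \<and> q z = 0)"
        unfolding AE_lborel_on[OF borel_open[OF open_box]] jac_def
        using bu m1 by eventually_elim (use sub in \<open>auto dest: beltrami_point(1,2)\<close>)
      let ?h = "\<lambda>z. ennreal (((cmod (p z))\<^sup>2 + (cmod (q z))\<^sup>2) / jac p q z)"
      let ?k = "\<lambda>z. ennreal ((1 + norm (\<mu> z)) / (1 - norm (\<mu> z)))"
      have \<Omega>l: "\<Omega> \<inter> space lebesgue \<in> sets lebesgue" by simp
      have [measurable]: "\<mu> \<in> borel_measurable (lebesgue_on \<Omega>)" by (rule assms(7))
      have "(\<integral>\<^sup>+z. ?h z \<partial>lborel_on (box a b)) = (\<integral>\<^sup>+z. indicator (box a b) z * ?h z \<partial>lborel)"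
        by (rule nn_integral_lborel_on) auto
      also have "\<dots> = (\<integral>\<^sup>+z. indicator (box a b) z * ?h z \<partial>lebesgue)"
        by (rule nn_integral_completion[symmetric])
      also have "\<dots> \<le> (\<integral>\<^sup>+z. (2 * ?k z) * indicator \<Omega> z \<partial>lebesgue)"
      proof (rule nn_integral_mono_AE)
        have "AE z in lebesgue. (z \<in> \<Omega> \<longrightarrow> (p z + \<i> * q z) / 2 = \<mu> z * ((p z - \<i> * q z) / 2)) \<and> (z \<in> \<Omega> \<longrightarrow> cmod (\<mu> z) < 1)"
          using bu m1 by (simp add: AE_completion_iff)
        then show "AE z in lebesgue. indicator (box a b) z * ?h z \<le> (2 * ?k z) * indicator \<Omega> z"
        proof eventually_elim
          fix z assume z: "(z \<in> \<Omega> \<longrightarrow> (p z + \<i> * q z) / 2 = \<mu> z * ((p z - \<i> * q z) / 2)) \<and> (z \<in> \<Omega> \<longrightarrow> cmod (\<mu> z) < 1)"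
          show "indicator (box a b) z * ?h z \<le> (2 * ?k z) * indicator \<Omega> z"
          proof (cases "z \<in> box a b")
            case True
            then have zO: "z \<in> \<Omega>" using sub by blast
            have "?h z \<le> ennreal (2 * ((1 + norm (\<mu> z)) / (1 - norm (\<mu> z))))"
              unfolding jac_def using z zO by (intro ennreal_leI beltrami_point(5)) auto
            also have "\<dots> = 2 * ?k z" using z zO by (subst ennreal_mult) auto
            finally show ?thesis using True zO by simp
          qed simp
        qed
      qed
      also have "\<dots> = (\<integral>\<^sup>+z. 2 * ?k z \<partial>lebesgue_on \<Omega>)" by (rule nn_integral_restrict_space[OF \<Omega>l, symmetric])
      also have "\<dots> = 2 * (\<integral>\<^sup>+z. ?k z \<partial>lebesgue_on \<Omega>)" by (rule nn_integral_cmult) measurable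
      also have "\<dots> < \<infinity>" using assms(9) by (simp add: ennreal_mult_less_top)
      finally show "(\<integral>\<^sup>+z. ?h z \<partial>lborel_on (box a b)) < \<infinity>" .
    qed (rule \<Omega> cu' iu' u' gu pL qL ab(2))+
    have par: "AE z in lborel_on D. x z * q z - y z * p z = 0"
      unfolding AE_lborel_on[OF borel_DV(1)] using bu bv
    proof eventually_elim
      case (elim z)
      then show ?case using D_sub beltrami_point_parallel[of "p z" "q z" "\<mu> z" "x z" "y z"] by blast
    qed
    have "z0 \<in> D" using ab(1) by (simp add: D_def)
    from local_factorization[OF gv vL1 conjunct1[OF xyL] conjunct2[OF xyL] par this]
    show ?thesis using D_sub by blast
  qed
  obtain \<phi> where \<phi>: "\<phi> holomorphic_on u' ` \<Omega>" "AE z in lborel. z \<in> \<Omega> \<longrightarrow> v' z = \<phi> (u' z)"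
    using patch_factorizations[OF \<Omega> cu' iu' loc] by blast
  have "u' ` \<Omega> = u ` \<Omega>" using u'u by (intro image_cong) auto
  moreover have "AE z in lebesgue_on \<Omega>. v z = \<phi> (u z)"
    unfolding AE_lebesgue_on_open[OF \<Omega>] using \<phi>(2) ve by eventually_elim (auto simp: u'u)
  ultimately show ?thesis using \<phi>(1) by auto
qed

end
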